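(* At density $p=1/4$, the asymptotically sharp minimum-codegree threshold for a tight Hamilton cycle is $1/3$. More precisely: for every $\alpha>1/3$, there exist $\mu>0$ and $n_0$ such that every $(1/4,\mu)$-dense $3$-graph $H$ on $n\ge n_0$ vertices with $\delta_2(H)\ge\alpha n$ contains a tight Hamilton cycle. Conversely, for every $\varepsilon,\mu>0$, there exist arbitrarily large $(1/4,\mu)$-dense $3$-graphs $H$ (with $n=|V(H)|$) with $\delta_2(H)\ge\left(\frac13-\varepsilon\right)n$ and no tight Hamilton cycle.
   Context: A $3$-graph is a pair $H=(V,E)$ with $E\subseteq\binom V3$. A $3$-graph $H$ on $n$ vertices is $(p,\mu)$-dense if for all $X,Y,Z\subseteq V(H)$ one has $e_H(X,Y,Z)\ge p|X||Y||Z|-\mu n^3$, where $e_H(X,Y,Z)$ is the number of ordered triples $(x,y,z)\in X\times Y\times Z$ with $\{x,y,z\}\in E(H)$. For a pair $xy\in\binom{V(H)}2$ let $d_H(x,y)=|\{z:xyz\in E(H)\}|$, and let $\delta_2(H)=\min_{xy}d_H(x,y)$ be the minimum codegree. A tight cycle is a cyclic ordering of distinct vertices whose edges are all the cyclically consecutive triples; a tight Hamilton cycle in $H$ is a tight cycle in $H$ containing every vertex of $H$. *)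

theory Defs
  imports Complex_Main
begin

type_synonym 'a graph3 = "'a set \<times> 'a set set"

abbreviation verts :: "'a graph3 \<Rightarrow> 'a set" where
  "verts H \<equiv> fst H"

abbreviation edges :: "'a graph3 \<Rightarrow> 'a set set" where
  "edges H \<equiv> snd H"

definition is_graph3 :: "'a graph3 \<Rightarrow> bool" where
  "is_graph3 H \<longleftrightarrow> finite (verts H) \<and> edges H \<subseteq> {e. e \<subseteq> verts H \<and> card e = 3}"

definition num_verts :: "'a graph3 \<Rightarrow> nat" where
  "num_verts H = card (verts H)"

definition edge_count :: "'a graph3 \<Rightarrow> 'a set \<Rightarrow> 'a set \<Rightarrow> 'a set \<Rightarrow> nat" where
  "edge_count H X Y Z = card {(x, y, z). x \<in> X \<and> y \<in> Y \<and> z \<in> Z \<and> {x, y, z} \<in> edges H}"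

definition pmu_dense :: "real \<Rightarrow> real \<Rightarrow> 'a graph3 \<Rightarrow> bool" where
  "pmu_dense p \<mu> H \<longleftrightarrow>
     (\<forall>X Y Z. X \<subseteq> verts H \<longrightarrow> Y \<subseteq> verts H \<longrightarrow> Z \<subseteq> verts H \<longrightarrow>
        real (edge_count H X Y Z)
          \<ge> p * real (card X) * real (card Y) * real (card Z) - \<mu> * real (num_verts H) ^ 3)"

definition codegree :: "'a graph3 \<Rightarrow> 'a \<Rightarrow> 'a \<Rightarrow> nat" where
  "codegree H x y = card {z \<in> verts H. {x, y, z} \<in> edges H}"

(* Meaningful only for graphs with at least two vertices: Min of the empty set is unspecified. *)
definition min_codegree :: "'a graph3 \<Rightarrow> nat" where
  "min_codegree H = Min {codegree H x y | x y. x \<in> verts H \<and> y \<in> verts H \<and> x \<noteq> y}"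

(* A cyclic ordering is represented by a list, read cyclically. *)
definition tight_cycle_edges :: "'a list \<Rightarrow> 'a set set" where
  "tight_cycle_edges c =
     {{c ! i, c ! ((i + 1) mod length c), c ! ((i + 2) mod length c)} | i. i < length c}"

(* Lists of length 1 or 2 are ruled out anyway, since edges have three elements;
   the length condition only excludes the empty list. *)
definition tight_cycle :: "'a graph3 \<Rightarrow> 'a list \<Rightarrow> bool" where
  "tight_cycle H c \<longleftrightarrow>
     length c \<ge> 3 \<and> distinct c \<and> set c \<subseteq> verts H \<and> tight_cycle_edges c \<subseteq> edges H"

definition tight_hamilton_cycle :: "'a graph3 \<Rightarrow> 'a list \<Rightarrow> bool" where
  "tight_hamilton_cycle H c \<longleftrightarrow> tight_cycle H c \<and> verts H \<subseteq> set c"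

end

(* For the upper bound, an inclusion-minimal set D of pairs that is large and almost closed under moving
   along edges of H is singled out; minimality comes from iterating through a quickly decreasing sequence
   of error parameters. Density 1/4 forces one part of every splitting of such a set to be large again.
   The triples T of H with all pairs in D have no fractional vertex cover of weight much less than n/3,
   hence an almost perfect tiling by complete tripartite graphs and no vertex set met exactly once by
   almost all triples; minimality and the latter fact make all pairs of D connectable by short tight paths
   of any length modulo 3. Absorption exchanges a leftover vertex v through slots a b u c d, in which u
   may be replaced by v whenever abcd is a path in both links, until three leftover vertices reach a
   complete tripartite gadget. For the lower bound, a complete set A of just under n/3 vertices is
   combined with a quasirandom graph of density 1/4 on the remaining vertices; every triple of the tight
   component meeting A has a vertex in A. *)
theory Submission
 imports Defs "HOL-Library.Multiset"
begin

section \<open>Normalised averages\<close>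

text \<open>The two constants are sharp in different places. Above 1/3, two of any three codegree
  sets meet, and a graph and its complement cannot both have degrees at least 1/3 almost everywhere:
  Goodman's count would leave no room for the edges of H. The value 1/4 is (1/2)^2: over the
  lightest popular weight class, which spans almost no pair of the component, a vertex joined by the
  component to more than half of the class has too few edges. Connecting and exchanging rest on one
  argument. A set of states that stops growing is almost closed; minimality of the component then
  makes a bounded statistic of pairs almost constant, and the unwanted values of it that are not
  ruled out by size describe a vertex set met exactly once by almost all triples. Modulo 3 this
  statistic counts states over an unordered pair. The tiling avoids a regularity partition: tiles of
  a much larger size serve as clusters, so coverage improves in small fixed steps. The depth at
  which the minimal component appears is unknown in advance, so all tolerances are functions of the
  error reached there.\<close>

definition avg :: "'a set => ('a => real) => real" where
 "avg V f = (\<Sum>x\<in>V. f x) / real (card V)"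

definition pr :: "'a set => ('a => bool) => real" where
 "pr V P = avg V (%x. of_bool (P x))"

definition pr2 :: "'a set => ('a => 'a => bool) => real" where
 "pr2 V P = avg V (%x. pr V (P x))"

definition pr3 :: "'a set => ('a => 'a => 'a => bool) => real" where
 "pr3 V P = avg V (%x. pr2 V (P x))"

lemma avg_mono: "(!!x. x \<in> V ==> f x <= g x) ==> avg V f <= avg V g"
 unfolding avg_def by (intro divide_right_mono sum_mono) auto

lemma avg_cong: "(!!x. x \<in> V ==> f x = g x) ==> avg V f = avg V g"
 unfolding avg_def by (metis sum.cong)

lemma avg_nonneg: "(!!x. x \<in> V ==> 0 <= f x) ==> 0 <= avg V f"
 unfolding avg_def by (intro divide_nonneg_nonneg sum_nonneg) auto

lemma avg_add: "avg V (%x. f x + g x) = avg V f + avg V g"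
 unfolding avg_def by (simp add: sum.distrib add_divide_distrib)

lemma avg_diff: "avg V (%x. f x - g x) = avg V f - avg V g"
 unfolding avg_def by (simp add: sum_subtractf diff_divide_distrib)

lemma avg_cmult: "avg V (%x. c * f x) = c * avg V f"
 unfolding avg_def by (simp add: sum_distrib_left)

lemma avg_multc: "avg V (%x. f x * c) = avg V f * c"
 unfolding avg_def by (simp add: sum_distrib_right)

lemma avg_swap: "avg V (%x. avg V (f x)) = avg V (%y. avg V (%x. f x y))"
proof -
 have "(\<Sum>x\<in>V. \<Sum>y\<in>V. f x y) = (\<Sum>y\<in>V. \<Sum>x\<in>V. f x y)"
  by (rule sum.swap)
 then show ?thesis unfolding avg_def by (simp flip: sum_divide_distrib)
qed

lemma pr_eq_card: "finite V ==> pr V P = real (card {x\<in>V. P x}) / real (card V)"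
 unfolding pr_def avg_def by (simp add: of_bool_def sum.If_cases Int_def)

lemma pr_nonneg [simp]: "0 <= pr V P"
 unfolding pr_def by (rule avg_nonneg) auto

lemma pr_mono: "(!!x. x \<in> V ==> P x ==> Q x) ==> pr V P <= pr V Q"
 unfolding pr_def by (rule avg_mono) auto

lemma pr_cong: "(!!x. x \<in> V ==> P x = Q x) ==> pr V P = pr V Q"
 unfolding pr_def by (rule avg_cong) auto

lemma pr_disj: "pr V (%x. P x | Q x) <= pr V P + pr V Q"
 unfolding pr_def avg_add[symmetric] by (rule avg_mono) auto

lemma pr_split: "pr V P = pr V (%x. P x & Q x) + pr V (%x. P x & ~ Q x)"
 unfolding pr_def avg_add[symmetric] by (rule avg_cong) auto

lemma pr_False [simp]: "pr V (%x. False) = 0"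
 unfolding pr_def avg_def by simp

lemma pr_union:
 assumes "!!x. x \<in> V ==> P x ==> Q x | R x" shows "pr V P <= pr V Q + pr V R"
 using order_trans[OF pr_mono pr_disj, of V P Q R] assms by blast

lemma pr_diff_ge:
 assumes "!!x. x \<in> V ==> P x ==> ~ Q x ==> R x" shows "pr V P - pr V Q <= pr V R"
 using pr_union[of V P Q R] assms by fastforce

lemma ex_of_pr: "pr V Q < pr V P ==> \<exists>x\<in>V. P x & ~ Q x"
 using pr_mono[of V P Q] by (meson leD)

lemma ex_of_pr0: "0 < pr V P ==> \<exists>x\<in>V. P x"
 using ex_of_pr[of V "%_. False" P] by auto

lemma markov:
 assumes "avg V f <= b" "!!x. x \<in> V ==> 0 <= f x" "0 < t" "!!x. x \<in> V ==> P x ==> t <= f x"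
 shows "pr V P <= b / t"
proof -
 have "t * pr V P <= avg V f"
  unfolding pr_def avg_cmult[symmetric] using assms by (intro avg_mono) auto
 then show ?thesis using assms(1,3) by (simp add: field_simps)
qed

lemma avg_swap_pr: "avg V (%x. pr V (P x)) = avg V (%y. pr V (%x. P x y))"
 unfolding pr_def by (rule avg_swap)

lemma pr2_nonneg [simp]: "0 <= pr2 V P"
 unfolding pr2_def by (rule avg_nonneg) auto

lemma pr2_mono: "(!!x y. x \<in> V ==> y \<in> V ==> P x y ==> Q x y) ==> pr2 V P <= pr2 V Q"
 unfolding pr2_def by (intro avg_mono pr_mono) auto

lemma pr2_cong: "(!!x y. x \<in> V ==> y \<in> V ==> P x y = Q x y) ==> pr2 V P = pr2 V Q"
 unfolding pr2_def by (intro avg_cong pr_cong) auto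

lemma pr2_disj: "pr2 V (%x y. P x y | Q x y) <= pr2 V P + pr2 V Q"
 unfolding pr2_def avg_add[symmetric] by (intro avg_mono pr_disj)

lemma pr2_union:
 assumes "!!x y. x \<in> V ==> y \<in> V ==> P x y ==> Q x y | R x y" shows "pr2 V P <= pr2 V Q + pr2 V R"
 using order_trans[OF pr2_mono pr2_disj, of V P Q R] assms by blast

lemma pr2_split: "pr2 V P = pr2 V (%x y. P x y & Q x y) + pr2 V (%x y. P x y & ~ Q x y)"
 unfolding pr2_def avg_add[symmetric] by (intro avg_cong pr_split)

lemma pr2_swap: "pr2 V (%x y. P y x) = pr2 V P"
 unfolding pr2_def by (rule avg_swap_pr)

lemma ex_of_pr2: "pr2 V Q < pr2 V P ==> \<exists>x\<in>V. \<exists>y\<in>V. P x y & ~ Q x y"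
 using pr2_mono[of V P Q] by (meson leD)

lemma pr3_nonneg [simp]: "0 <= pr3 V P"
 unfolding pr3_def by (rule avg_nonneg) auto

lemma pr3_mono:
 "(!!x y z. x \<in> V ==> y \<in> V ==> z \<in> V ==> P x y z ==> Q x y z) ==> pr3 V P <= pr3 V Q"
 unfolding pr3_def by (intro avg_mono pr2_mono) auto

lemma pr3_cong:
 "(!!x y z. x \<in> V ==> y \<in> V ==> z \<in> V ==> P x y z = Q x y z) ==> pr3 V P = pr3 V Q"
 unfolding pr3_def by (intro avg_cong pr2_cong) auto

lemma pr3_disj: "pr3 V (%x y z. P x y z | Q x y z) <= pr3 V P + pr3 V Q"
 unfolding pr3_def avg_add[symmetric] by (intro avg_mono pr2_disj)

lemma pr3_union:
 assumes "!!x y z. x \<in> V ==> y \<in> V ==> z \<in> V ==> P x y z ==> Q x y z | R x y z"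
 shows "pr3 V P <= pr3 V Q + pr3 V R"
 using order_trans[OF pr3_mono pr3_disj, of V P Q R] assms by blast

lemma pr3_split:
 "pr3 V P = pr3 V (%x y z. P x y z & Q x y z) + pr3 V (%x y z. P x y z & ~ Q x y z)"
 unfolding pr3_def avg_add[symmetric] by (intro avg_cong pr2_split)

lemma pr3_swap12: "pr3 V (%x y z. P y x z) = pr3 V P"
 unfolding pr3_def pr2_def by (rule avg_swap)

lemma pr3_swap23: "pr3 V (%x y z. P x z y) = pr3 V P"
 unfolding pr3_def by (intro avg_cong) (rule pr2_swap)

lemma pr3_swap13: "pr3 V (%x y z. P z y x) = pr3 V P"
 using pr3_swap12[of V P] pr3_swap23[of V "%x y z. P y x z"] pr3_swap12[of V "%x y z. P z x y"] by simp

lemma pr3_rot: "pr3 V (%x y z. P y z x) = pr3 V P" "pr3 V (%x y z. P z x y) = pr3 V P"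
 using pr3_swap12[of V P] pr3_swap23[of V P] pr3_swap23[of V "%x y z. P y x z"]
  pr3_swap12[of V "%x y z. P x z y"] by simp_all

lemma pr3_pr2: "pr3 V P = avg V (%x. avg V (%y. pr V (P x y)))"
 unfolding pr3_def pr2_def ..

lemma pr2_conj: "pr2 V (%x y. P x & Q x y) = avg V (%x. of_bool (P x) * pr V (Q x))"
 unfolding pr2_def by (intro avg_cong) (auto simp: of_bool_def)

lemma pr3_conj: "pr3 V (%x y z. P x & Q x y z) = avg V (%x. of_bool (P x) * pr2 V (Q x))"
 unfolding pr3_def by (intro avg_cong) (auto simp: of_bool_def pr2_def avg_def)

lemma pr2_conj_le:
 assumes "!!x. x \<in> V ==> P x ==> pr V (Q x) <= e"
 shows "pr2 V (%x y. P x & Q x y) <= e * pr V P"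
 unfolding pr2_conj pr_def[of V P] avg_cmult[symmetric] using assms
 by (intro avg_mono) auto

lemma pr2_conj_ge:
 assumes "!!x. x \<in> V ==> P x ==> e <= pr V (Q x)"
 shows "e * pr V P <= pr2 V (%x y. P x & Q x y)"
 unfolding pr2_conj pr_def[of V P] avg_cmult[symmetric] using assms
 by (intro avg_mono) auto

lemma pr3_conj_le:
 assumes "!!x. x \<in> V ==> P x ==> pr2 V (Q x) <= e"
 shows "pr3 V (%x y z. P x & Q x y z) <= e * pr V P"
 unfolding pr3_conj pr_def[of V P] avg_cmult[symmetric] using assms
 by (intro avg_mono) auto

lemma pr3_conj_ge:
 assumes "!!x. x \<in> V ==> P x ==> e <= pr2 V (Q x)"
 shows "e * pr V P <= pr3 V (%x y z. P x & Q x y z)"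
 unfolding pr3_conj pr_def[of V P] avg_cmult[symmetric] using assms
 by (intro avg_mono) auto

lemma pr_conj_const: "pr V (%y. P & Q y) = of_bool P * pr V Q"
 by (cases P) auto

lemma pr2_conj2: "pr3 V (%x y z. P x y & Q x y z) = avg V (%x. avg V (%y. of_bool (P x y) * pr V (Q x y)))"
 unfolding pr3_pr2 by (simp add: pr_conj_const)

lemma pr3_conj2_le:
 assumes "!!x y. x \<in> V ==> y \<in> V ==> P x y ==> pr V (Q x y) <= e"
 shows "pr3 V (%x y z. P x y & Q x y z) <= e * pr2 V P"
 unfolding pr2_conj2 pr2_def pr_def[of V "P _"] avg_cmult[symmetric] using assms
 by (intro avg_mono) auto

lemma pr3_conj2_ge:
 assumes "!!x y. x \<in> V ==> y \<in> V ==> P x y ==> e <= pr V (Q x y)"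
 shows "e * pr2 V P <= pr3 V (%x y z. P x y & Q x y z)"
 unfolding pr2_conj2 pr2_def pr_def[of V "P _"] avg_cmult[symmetric] using assms
 by (intro avg_mono) auto

lemma markov_pr2:
 assumes "pr2 V P <= b" "0 < t" shows "pr V (%x. t <= pr V (P x)) <= b / t"
 using assms unfolding pr2_def by (intro markov) auto

lemma markov_pr3:
 assumes "pr3 V P <= b" "0 < t" shows "pr V (%x. t <= pr2 V (P x)) <= b / t"
 using assms unfolding pr3_def by (intro markov) auto

lemma markov_pr32:
 assumes "pr3 V P <= b" "0 < t" shows "pr2 V (%x y. t <= pr V (P x y)) <= b / t"
proof -
 have "t * pr2 V (%x y. t <= pr V (P x y)) <= pr3 V P"
  unfolding pr3_pr2 pr2_def pr_def[of V "%y. t <= pr V (P _ y)"] avg_cmult[symmetric]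
  by (intro avg_mono) auto
 then show ?thesis using assms by (simp add: field_simps)
qed

locale fspace =
 fixes V :: "'a set"
 assumes fin: "finite V" and ne: "V ~= {}"
begin

lemma card_pos: "0 < real (card V)"
 using fin ne by (simp add: card_gt_0_iff)

lemma avg_const [simp]: "avg V (%x. c) = c"
 unfolding avg_def using card_pos by simp

lemma avg_le_const: "(!!x. x \<in> V ==> f x <= c) ==> avg V f <= c"
 using avg_mono[of V f "%_. c"] by simp

lemma pr_le1 [simp]: "pr V P <= 1"
 unfolding pr_def by (rule avg_le_const) auto

lemma pr_True [simp]: "pr V (%x. True) = 1"
 unfolding pr_def by simp

lemma pr2_le1 [simp]: "pr2 V P <= 1"
 unfolding pr2_def by (rule avg_le_const) auto

lemma pr3_le1 [simp]: "pr3 V P <= 1"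
 unfolding pr3_def by (rule avg_le_const) auto

lemma pr_compl: "pr V (%x. ~ P x) = 1 - pr V P"
 using pr_split[of V "%x. True" P] by simp

lemma pr_eq1: "y \<in> V ==> pr V (%x. x = y) = 1 / card V" "y \<in> V ==> pr V (%x. y = x) = 1 / card V"
proof -
 assume y: "y \<in> V"
 then have "{x\<in>V. x = y} = {y}" "{x\<in>V. y = x} = {y}" by auto
 then show "pr V (%x. x = y) = 1 / card V" "pr V (%x. y = x) = 1 / card V"
  by (simp_all add: pr_eq_card fin)
qed

lemma pr_neq: "y \<in> V ==> pr V (%x. y ~= x) = 1 - 1 / card V"
 by (simp add: pr_compl pr_eq1)

lemma pr2_diag: "pr2 V (%x y. x = y) = 1 / card V"
proof -
 have "pr2 V (%x y. x = y) = avg V (%x. 1 / card V)"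
  unfolding pr2_def by (intro avg_cong) (simp add: pr_eq1)
 then show ?thesis by simp
qed

lemma pr2_prod: "pr2 V (%x y. P x & Q y) = pr V P * pr V Q"
 unfolding pr2_conj by (simp add: avg_multc pr_def)

lemma pr2_fst [simp]: "pr2 V (%x y. P x) = pr V P"
 using pr2_prod[of P "%_. True"] by simp

lemma pr2_snd [simp]: "pr2 V (%x y. P y) = pr V P"
 using pr2_prod[of "%_. True" P] by simp

lemma pr3_12 [simp]: "pr3 V (%x y z. P x y) = pr2 V P"
 unfolding pr3_def by simp (simp add: pr2_def)

lemma pr3_13 [simp]: "pr3 V (%x y z. P x z) = pr2 V P"
 unfolding pr3_def by simp (simp add: pr2_def)

lemma pr3_23 [simp]: "pr3 V (%x y z. P y z) = pr2 V P"
 unfolding pr3_def by simp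

text \<open>This is where codegrees above 1/3 act combinatorially: the codegree sets of the three
  pairs of a triple cannot be pairwise disjoint, and a vertex cannot have three disjoint
  neighbourhoods of that size.\<close>

lemma pr_sum3:
 assumes "pr V P + pr V Q + pr V R > 1"
 shows "\<exists>w\<in>V. (P w & Q w) | (P w & R w) | (Q w & R w)"
proof (rule ccontr)
 assume a: "~ ?thesis"
 have "pr V P + pr V Q + pr V R <= avg V (%_. 1)"
  unfolding pr_def avg_add[symmetric] using a by (intro avg_mono) auto
 then show False using assms by simp
qed

end

section \<open>Relations with few cut edges\<close>

locale trip = fspace V for V :: "'a set" +
 fixes h :: "'a => 'a => 'a => bool"
 assumes h12: "h x y z ==> h y x z" and h23: "h x y z ==> h x z y" and h_neq: "h x y z ==> x ~= y"
begin

lemma h_distinct: "h x y z ==> x ~= y & x ~= z & y ~= z"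
 using h12 h23 h_neq by metis

lemma h_perm:
 "h x y z \<longleftrightarrow> h y x z" "h x y z \<longleftrightarrow> h x z y" "h x y z \<longleftrightarrow> h z y x"
 "h x y z \<longleftrightarrow> h y z x" "h x y z \<longleftrightarrow> h z x y"
 using h12 h23 by metis+

text \<open>The size of the boundary of \<open>Q\<close> when pairs sharing an edge of the
  hypergraph count as adjacent. A union of tight components has value 0.\<close>

definition cut :: "('a => 'a => bool) => real" where
 "cut Q = pr3 V (%x y z. h x y z & Q x y & ~ Q x z)"

end

definition grel :: "('a => 'a => bool) => bool" where
 "grel Q \<longleftrightarrow> (ALL x y. Q x y --> Q y x & x ~= y)"

definition cpl :: "('a => 'a => bool) => 'a => 'a => bool" where
 "cpl Q x y \<longleftrightarrow> x ~= y & ~ Q x y"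

lemma grel_cpl: "grel Q ==> grel (cpl Q)"
 unfolding grel_def cpl_def by blast

lemma cpl_cpl: "grel Q ==> cpl (cpl Q) = Q"
 unfolding grel_def cpl_def by (intro ext) blast

text \<open>Averages run over all ordered tuples, including those with repeated vertices;
  \<open>small\<close> bounds what the diagonal costs.\<close>

locale dense_trip = trip V h for V :: "'a set" and h +
 fixes \<gamma> \<mu> :: real
 assumes \<gamma>: "0 < \<gamma>" "\<gamma> <= 1" and small: "1 / card V <= \<mu>"
  and codeg: "x \<in> V ==> y \<in> V ==> x ~= y ==> 1/3 + \<gamma> <= pr V (h x y)"
  and dens: "1/4 * pr V X * pr V Y * pr V Z - \<mu> <= pr3 V (%x y z. X x & Y y & Z z & h x y z)"
begin

text \<open>An edge leaving \<open>Q\<close> from \<open>xy\<close> to \<open>xz\<close> leaves the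
  complement from \<open>xz\<close> to \<open>xy\<close>.\<close>

lemma cut_cpl: "cut (cpl Q) = cut Q"
proof -
 have "cut (cpl Q) = pr3 V (%x y z. h x z y & Q x z & ~ Q x y)"
  unfolding cut_def cpl_def by (intro pr3_cong) (use h_distinct h_perm in blast)
 then show ?thesis
  unfolding cut_def by (subst (asm) pr3_swap23[of V "%x y z. h x y z & Q x y & ~ Q x z"])
qed

text \<open>The exponents fit Markov's inequality: a boundary of at most e^3 leaves at most a
  proportion \<open>e\<close> of vertices whose own boundary reaches e^2.\<close>

definition bad :: "real => ('a => 'a => bool) => 'a => bool" where
 "bad e Q x \<longleftrightarrow> e^2 <= pr2 V (%y z. h x y z & Q x y & ~ Q x z)"

lemma bad_cpl: "bad e (cpl Q) x = bad e Q x"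
proof -
 have "pr2 V (%y z. h x y z & cpl Q x y & ~ cpl Q x z)
  = pr2 V (%y z. h x z y & Q x z & ~ Q x y)"
  unfolding cpl_def by (intro pr2_cong) (use h_distinct h_perm in blast)
 then show ?thesis
  unfolding bad_def by (subst (asm) pr2_swap[of V "%y z. h x y z & Q x y & ~ Q x z"]) simp
qed

lemma pr_bad:
 assumes "cut Q <= e^3" "0 < e" shows "pr V (bad e Q) <= e"
proof -
 have "pr V (%x. e^2 <= pr2 V (%y z. h x y z & Q x y & ~ Q x z)) <= e^3 / e^2"
  using assms unfolding cut_def by (intro markov_pr3) auto
 then show ?thesis
  using assms unfolding bad_def by (simp add: power3_eq_cube power2_eq_square)
qed

text \<open>Degrees have a gap. If the degree exceeds \<open>e\<close>, some neighbour
  \<open>y\<close> of \<open>x\<close> has few edges \<open>xyz\<close> leaving \<open>Q\<close>, so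
  nearly the whole codegree set of \<open>xy\<close> lies in the neighbourhood of \<open>x\<close>,
  and the degree jumps to about 1/3.\<close>

lemma dich:
 assumes x: "x \<in> V" "~ bad e Q x" and e: "0 < e" "e < pr V (Q x)" and Q: "grel Q"
 shows "1/3 + \<gamma> - e <= pr V (Q x)"
proof -
 have "\<exists>y\<in>V. Q x y & pr V (%z. h x y z & ~ Q x z) < e"
 proof (rule ccontr)
  assume "~ ?thesis"
  then have *: "!!y. y \<in> V ==> Q x y ==> e <= pr V (%z. h x y z & ~ Q x z)" by force
  have "e * e <= e * pr V (Q x)" using e by simp
  also have "... <= pr2 V (%y z. Q x y & h x y z & ~ Q x z)"
  using * by (rule pr2_conj_ge)
  also have "... = pr2 V (%y z. h x y z & Q x y & ~ Q x z)"
  by (intro pr2_cong) auto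
  finally show False using x(2) unfolding bad_def power2_eq_square by simp
 qed
 then obtain y where y: "y \<in> V" "Q x y" "pr V (%z. h x y z & ~ Q x z) < e" by blast
 have "1/3 + \<gamma> <= pr V (h x y)" using codeg x y Q unfolding grel_def by blast
 also have "... <= pr V (Q x) + pr V (%z. h x y z & ~ Q x z)"
  by (rule pr_union) auto
 finally show ?thesis using y(3) by linarith
qed

lemma deg_sum: "x \<in> V ==> grel Q ==> pr V (Q x) + pr V (cpl Q x) = 1 - 1 / card V"
proof -
 assume x: "x \<in> V" and Q: "grel Q"
 have "pr V (%y. x ~= y) = pr V (%y. x ~= y & Q x y) + pr V (%y. x ~= y & ~ Q x y)"
  by (rule pr_split)
 moreover have "pr V (%y. x ~= y & Q x y) = pr V (Q x)"
  using Q unfolding grel_def by (intro pr_cong) auto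
 ultimately show ?thesis using pr_neq[OF x] unfolding cpl_def by simp
qed

lemma pr3_avg: "pr3 V P = avg V (%x. avg V (%y. avg V (%z. of_bool (P x y z))))"
 unfolding pr3_def pr2_def pr_def ..

text \<open>Goodman's count: a triangle of the complete graph that is not monochromatic has exactly two
 vertices at which both colours meet.\<close>
lemma goodman_count:
 assumes Q: "grel Q"
 shows "pr3 V h + 3 * pr3 V (%x y z. Q x y & cpl Q x z) <= 1 + 3 * cut Q"
proof -
 define N where "N = (%x y z. Q x y & cpl Q x z)"
 define C where "C = (%x y z. h x y z & Q x y & ~ Q x z)"
 \<comment> \<open>Summing over the six orderings makes both counts symmetric. On an edge
   \<open>N\<close> and \<open>C\<close> agree; on any other triple at most two of the six orderings
   satisfy \<open>N\<close>, which explains the factor 1/2.\<close>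
 have "pr3 V h + 1/2 * (pr3 V N + pr3 V (%x y z. N x z y) + pr3 V (%x y z. N y x z)
  + pr3 V (%x y z. N y z x) + pr3 V (%x y z. N z x y) + pr3 V (%x y z. N z y x))
  <= avg V (%x. avg V (%y. avg V (%z. 1))) + 1/2 * (pr3 V C + pr3 V (%x y z. C x z y) + pr3 V (%x y z. C y x z)
  + pr3 V (%x y z. C y z x) + pr3 V (%x y z. C z x y) + pr3 V (%x y z. C z y x))"
  unfolding pr3_avg avg_add[symmetric] avg_cmult[symmetric]
 proof (intro avg_mono, goal_cases)
  case (1 x y z)
  have s: "Q y x = Q x y" "Q z x = Q x z" "Q z y = Q y z" using Q unfolding grel_def by auto
  show ?case
  proof (cases "h x y z")
  case True
  have hp: "h x z y" "h y x z" "h y z x" "h z x y" "h z y x" using True h_perm by blast+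
  have d: "x ~= y" "x ~= z" "y ~= z" using True h_distinct by blast+
  have "N x y z = C x y z" "N x z y = C x z y" "N y x z = C y x z" "N y z x = C y z x"
  "N z x y = C z x y" "N z y x = C z y x"
  using True hp d unfolding N_def C_def cpl_def by auto
  then show ?thesis using True by simp
  next
  case False
  have "of_bool (N x y z) + of_bool (N x z y) + of_bool (N y x z) + of_bool (N y z x)
  + of_bool (N z x y) + of_bool (N z y x) <= (2::real)"
  unfolding N_def cpl_def s by (cases "Q x y"; cases "Q x z"; cases "Q y z") auto
  moreover have "0 <= of_bool (C x y z) + of_bool (C x z y) + of_bool (C y x z) + of_bool (C y z x)
  + of_bool (C z x y) + (of_bool (C z y x) :: real)" by simp
  moreover have "of_bool (h x y z) = (0::real)" using False by simp
  moreover have "a + 1/2 * n <= 1 + 1/2 * c" if "n <= 2" "0 <= c" "a = 0" for a n c :: real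
  using that by simp
  ultimately show ?thesis by blast
  qed
 qed
 then show ?thesis
  using pr3_swap12[of V N] pr3_swap23[of V N] pr3_swap13[of V N] pr3_rot[of V N]
  pr3_swap12[of V C] pr3_swap23[of V C] pr3_swap13[of V C] pr3_rot[of V C]
  unfolding cut_def N_def[symmetric] C_def[symmetric] by simp
qed

text \<open>The value 1/6 is a point inside the gap of \<open>dich\<close>; at vertices that are not
  bad, the complementary degree then drops to at most \<open>e\<close>.\<close>

definition pure :: "('a => 'a => bool) => 'a => bool" where
 "pure Q x \<longleftrightarrow> pr V (cpl Q x) < 1/6"

definition big :: "('a => 'a => bool) => bool" where
 "big Q \<longleftrightarrow> \<gamma>/2 <= pr V (pure Q)"

lemma pure_le:
 assumes "x \<in> V" "~ bad e Q x" "pure Q x" "0 < e" "e <= \<gamma>/100" "grel Q"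
 shows "pr V (cpl Q x) <= e"
proof (rule ccontr)
 assume "~ ?thesis"
 then have "1/3 + \<gamma> - e <= pr V (cpl Q x)"
  using dich[of x e "cpl Q"] assms bad_cpl grel_cpl by force
 then show False using assms \<gamma> unfolding pure_def by linarith
qed

text \<open>Otherwise all but a proportion of about \<gamma> of the vertices have both degrees at
  least 1/3, hence a product of at least about 2/9. Goodman's count then bounds the edge density by
  1 - 3 * 2/9 = 1/3 plus 2/3 \<gamma> and small errors, less than the codegree bound
  provides.\<close>

lemma goodman:
 assumes Q: "grel Q" and cutQ: "cut Q <= e^3" and e: "0 < e" "e <= \<gamma>/100" and \<mu>: "\<mu> <= \<gamma>/100"
 shows "big Q | big (cpl Q)"
proof (rule ccontr)
 assume a: "~ ?thesis"
 define t where "t = 1 / card V"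
 define s where "s = pr V (pure Q) + pr V (pure (cpl Q))"
 have s: "s < \<gamma>" using a unfolding big_def s_def by linarith
 have t: "0 <= t" "t <= \<gamma>/100" using small \<mu> unfolding t_def by auto
 define N where "N = pr3 V (%x y z. Q x y & cpl Q x z)"
 have N_eq: "N = avg V (%x. pr V (Q x) * pr V (cpl Q x))"
  unfolding N_def pr3_def by (simp add: pr2_prod)
 define G where "G = (%x. ~ bad e Q x & ~ pure Q x & ~ pure (cpl Q) x)"
 have "1 = pr V (%x. True)" by simp
 also have "... <= pr V G + pr V (%x. bad e Q x | pure Q x | pure (cpl Q) x)"
  unfolding G_def by (rule pr_union) auto
 also have "... <= pr V G + (pr V (bad e Q) + s)"
  unfolding s_def using pr_disj[of V "bad e Q" "%x. pure Q x | pure (cpl Q) x"]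
  pr_disj[of V "pure Q" "pure (cpl Q)"] by linarith
 finally have G: "1 - e - s <= pr V G" using pr_bad[OF cutQ e(1)] by linarith
 have "(2/9 - t/3) * pr V G <= N"
  unfolding N_eq pr_def[of V G] avg_cmult[symmetric]
 proof (intro avg_mono, goal_cases)
  case (1 x)
  show ?case
  proof (cases "G x")
  case True
  have "1/6 <= pr V (cpl Q x)" "1/6 <= pr V (Q x)"
  using True cpl_cpl[OF Q] unfolding G_def pure_def by auto
  then have "1/3 <= pr V (Q x)" "1/3 <= pr V (cpl Q x)"
  using dich[of x e Q] dich[of x e "cpl Q"] True 1 Q grel_cpl[OF Q] bad_cpl e \<gamma>
  unfolding G_def by force+
  \<comment> \<open>The two degrees add up to 1 - t, so expanding this product bounds theirs below
    by 2/9 - t/3.\<close>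
  then have "0 <= (pr V (Q x) - 1/3) * (pr V (cpl Q x) - 1/3)" by simp
  moreover have "pr V (Q x) = 1 - t - pr V (cpl Q x)"
  using deg_sum[OF 1 Q] unfolding t_def by linarith
  ultimately show ?thesis using True by (simp only: of_bool_eq) (simp add: algebra_simps)
  qed simp
 qed
 moreover have "(2/9 - t/3) * (1 - e - s) <= (2/9 - t/3) * pr V G"
  using G t \<gamma> by (intro mult_left_mono) auto
 moreover have "2/9 - t/3 - 2/9 * (e + s) <= (2/9 - t/3) * (1 - e - s)"
 proof -
  have "0 <= s" unfolding s_def by simp
  then have "0 <= t/3 * (e + s)" using t e by simp
  moreover have "(2/9 - t/3) * (1 - e - s) = 2/9 - t/3 - 2/9 * (e + s) + t/3 * (e + s)"
  by (simp add: algebra_simps add_divide_distrib diff_divide_distrib)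
  ultimately show ?thesis by linarith
 qed
 ultimately have 1: "2/9 - t/3 - 2/9 * (e + s) <= N" by linarith
 have "(1/3 + \<gamma>) * pr2 V (%x y. x ~= y) <= pr3 V (%x y z. x ~= y & h x y z)"
  by (rule pr3_conj2_ge) (use codeg in auto)
 also have "... <= pr3 V h" by (rule pr3_mono) auto
 also have "pr2 V (%x y. x ~= y) = 1 - t"
  using pr2_split[of V "%_ _. True" "%x y. x = y"] pr2_diag unfolding t_def by simp
 finally have 2: "(1/3 + \<gamma>) * (1 - t) <= pr3 V h" .
 have 3: "pr3 V h + 3 * N <= 1 + 3 * e^3"
  using goodman_count[OF Q] cutQ unfolding N_def by linarith
 have 4: "e^3 <= \<gamma>/100"
 proof -
  have "e^3 <= e^1" using e \<gamma> by (intro power_decreasing) auto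
  then show ?thesis using e by simp
 qed
 have 5: "(1/3+\<gamma>) * t <= 4/3 * t" using \<gamma> t by (intro mult_right_mono) auto
 have 6: "(1/3 + \<gamma>) * (1 - t) = 1/3 + \<gamma> - (1/3+\<gamma>) * t" by (simp only: right_diff_distrib mult_1_right)
 show False using 1 2 3 4 5 6 s t e \<gamma> by (simp add: field_simps)
qed

text \<open>Almost all pairs between a pure vertex of \<open>Q\<close> and a pure vertex of the
  complement would have to belong to both graphs.\<close>

lemma excl:
 assumes Q: "grel Q" and cutQ: "cut Q <= e^3" and e: "0 < e" "e <= \<gamma>/100" and \<mu>: "\<mu> <= e"
  and bigQ: "big Q"
 shows "pr V (pure (cpl Q)) <= 13 * e / \<gamma>"
proof -
 define A where "A = (%x. pure Q x & ~ bad e Q x)"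
 define B where "B = (%x. pure (cpl Q) x & ~ bad e Q x)"
 have be: "pr V (bad e Q) <= e" using pr_bad cutQ e by blast
 have A: "\<gamma>/4 <= pr V A"
  using pr_diff_ge[of V "pure Q" "bad e Q" A] bigQ be e \<gamma> unfolding big_def A_def by simp
 have B: "pr V (pure (cpl Q)) - e <= pr V B"
  using pr_diff_ge[of V "pure (cpl Q)" "bad e Q" B] be unfolding B_def by simp
 have "pr V A * pr V B = pr2 V (%x y. A x & B y)" by (simp add: pr2_prod)
 also have "... <= pr2 V (%x y. A x & cpl Q x y) + pr2 V (%x y. (B y & Q y x) | x = y)"
  by (rule pr2_union) (use Q in \<open>auto simp: cpl_def grel_def\<close>)
 also have "... <= pr2 V (%x y. A x & cpl Q x y) + (pr2 V (%x y. B x & Q x y) + 1 / card V)"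
  using pr2_disj[of V "%x y. B y & Q y x" "%x y. x = y"] pr2_swap[of V "%x y. B x & Q x y"] pr2_diag by simp
 also have "... <= e * pr V A + (e * pr V B + e)"
 proof -
  have "pr2 V (%x y. A x & cpl Q x y) <= e * pr V A"
  by (rule pr2_conj_le) (use pure_le e Q in \<open>auto simp: A_def\<close>)
  moreover have "pr2 V (%x y. B x & Q x y) <= e * pr V B"
  by (rule pr2_conj_le) (use pure_le[of _ e "cpl Q"] e Q grel_cpl[OF Q] cpl_cpl[OF Q] bad_cpl in \<open>auto simp: B_def\<close>)
  ultimately show ?thesis using small \<mu> by linarith
 qed
 also have "... <= 3 * e"
  using mult_left_le[OF pr_le1[of A], of e] mult_left_le[OF pr_le1[of B], of e] e by linarith
 finally have "pr V A * pr V B <= 3 * e" .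
 moreover have "\<gamma>/4 * pr V B <= pr V A * pr V B" using A by (intro mult_right_mono) auto
 ultimately have "pr V B <= 12 * e / \<gamma>" using \<gamma> by (simp add: field_simps)
 moreover have "e <= e / \<gamma>" using e \<gamma> by (simp add: field_simps)
 ultimately show ?thesis using B by linarith
qed

text \<open>By \<open>dich\<close> a degree below the bound means hardly any neighbours, that is, a
  pure vertex of the complement; \<open>excl\<close> makes such vertices rare.\<close>

lemma big_deg:
 assumes Q: "grel Q" and cutQ: "cut Q <= e^3" and e: "0 < e" "e <= \<gamma>/100" and \<mu>: "\<mu> <= e"
  and bigQ: "big Q"
 shows "pr V (%x. pr V (Q x) < 1/3 + \<gamma> - e) <= 14 * e / \<gamma>"
proof -
 have "pr V (%x. pr V (Q x) < 1/3 + \<gamma> - e) <= pr V (pure (cpl Q)) + pr V (bad e Q)"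
 proof (rule pr_union)
  fix x assume x: "x \<in> V" "pr V (Q x) < 1/3 + \<gamma> - e"
  show "pure (cpl Q) x | bad e Q x"
  using dich[of x e Q] x e Q \<gamma> unfolding pure_def cpl_cpl[OF Q] by force
 qed
 moreover have "e <= e / \<gamma>" using e \<gamma> by (simp add: field_simps)
 ultimately show ?thesis
  using excl[OF assms] pr_bad[OF cutQ e(1)] by linarith
qed

lemma big_pure:
 assumes Q: "grel Q" and cutQ: "cut Q <= e^3" and e: "0 < e" "e <= \<gamma>/100" and bigQ: "big Q"
 shows "\<gamma>/4 <= pr V (%x. pr V (cpl Q x) <= e)"
proof -
 have "pr V (pure Q) - pr V (bad e Q) <= pr V (%x. pr V (cpl Q x) <= e)"
  by (rule pr_diff_ge) (use pure_le e Q in auto)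
 then show ?thesis using bigQ pr_bad[OF cutQ e(1)] e unfolding big_def by linarith
qed

text \<open>If neither part were big, both complements would be, by \<open>goodman\<close>. Take
  \<open>x\<close> pure in \<open>Q\<close>, \<open>y\<close> with almost no pairs in
  \<open>Q1\<close> and \<open>z\<close> with almost no pairs in \<open>Q2\<close>; the density
  supplies many edges \<open>xyz\<close> of this kind. On a typical one \<open>xy\<close> falls to
  \<open>Q2\<close> and \<open>xz\<close> to \<open>Q1\<close>, so the edge crosses the boundary of
  \<open>Q1\<close>, which is sparse.\<close>

lemma big_split:
 assumes Q: "grel Q1" "grel Q2" "!!x y. Q x y \<longleftrightarrow> Q1 x y | Q2 x y" "!!x y. ~ (Q1 x y & Q2 x y)"
  and cuts: "cut Q <= e^3" "cut Q1 <= e^3" "cut Q2 <= e^3" and e: "0 < e" "e <= \<gamma>^3/10000" and \<mu>: "\<mu> <= e"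
  and bigQ: "big Q"
 shows "big Q1 | big Q2"
proof (rule ccontr)
 assume a: "~ ?thesis"
 have gQ: "grel Q" using Q unfolding grel_def by blast
 have "\<gamma>^3 <= \<gamma>^1" using \<gamma> by (intro power_decreasing) auto
 then have e2: "e <= \<gamma>/100" "e <= 1" using e \<gamma> by auto
 have b1: "big (cpl Q1)" "big (cpl Q2)"
  using a goodman[of Q1 e] goodman[of Q2 e] Q cuts e e2 \<mu> by auto
 define X where "X = (%x. pr V (cpl Q x) <= e)"
 define Y where "Y = (%x. pr V (Q1 x) <= e)"
 define Z where "Z = (%x. pr V (Q2 x) <= e)"
 have m: "\<gamma>/4 <= pr V X" "\<gamma>/4 <= pr V Y" "\<gamma>/4 <= pr V Z"
  using big_pure[of Q e] big_pure[of "cpl Q1" e] big_pure[of "cpl Q2" e] gQ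
  grel_cpl[OF Q(1)] grel_cpl[OF Q(2)] cpl_cpl[OF Q(1)] cpl_cpl[OF Q(2)]
  bigQ b1 cuts cut_cpl e e2 unfolding X_def Y_def Z_def by simp_all
 have "1/4 * (\<gamma>/4)^3 <= 1/4 * pr V X * pr V Y * pr V Z"
 proof -
  have "(\<gamma>/4) * (\<gamma>/4) * (\<gamma>/4) <= pr V X * pr V Y * pr V Z"
  using m \<gamma> by (intro mult_mono) auto
  then show ?thesis by (simp add: power3_eq_cube)
 qed
 also have "... <= pr3 V (%x y z. X x & Y y & Z z & h x y z) + \<mu>" using dens[of X Y Z] by linarith
 also have "pr3 V (%x y z. X x & Y y & Z z & h x y z) <=
  pr3 V (%x y z. X x & cpl Q x y) + pr3 V (%x y z. (X x & cpl Q x z) | (Y y & Q1 y x)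
  | (Z z & Q2 z x) | (h x z y & Q1 x z & ~ Q1 x y))"
  by (rule pr3_union) (use Q h_distinct h_perm in \<open>unfold cpl_def grel_def, blast\<close>)
 also have "... <= pr3 V (%x y z. X x & cpl Q x y) + (pr3 V (%x y z. X x & cpl Q x z)
  + (pr3 V (%x y z. Y y & Q1 y x) + (pr3 V (%x y z. Z z & Q2 z x) + pr3 V (%x y z. h x z y & Q1 x z & ~ Q1 x y))))"
  by (intro add_left_mono order_trans[OF pr3_disj] order_refl)
 also have "... = pr2 V (%x y. X x & cpl Q x y) + (pr2 V (%x y. X x & cpl Q x y)
  + (pr2 V (%x y. Y x & Q1 x y) + (pr2 V (%x y. Z x & Q2 x y) + cut Q1)))"
  using pr3_12[of "%x y. X x & cpl Q x y"] pr3_13[of "%x y. X x & cpl Q x y"]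
  pr3_12[of "%x y. Y y & Q1 y x"] pr3_13[of "%x y. Z y & Q2 y x"]
  pr2_swap[of V "%x y. Y x & Q1 x y"] pr2_swap[of V "%x y. Z x & Q2 x y"]
  pr3_swap23[of V "%x y z. h x y z & Q1 x y & ~ Q1 x z"] unfolding cut_def by simp
 also have "... <= e * pr V X + (e * pr V X + (e * pr V Y + (e * pr V Z + e^3)))"
  using cuts by (intro add_mono pr2_conj_le) (auto simp: X_def Y_def Z_def)
 also have "... <= 5 * e"
 proof -
  have "e^3 <= e^1" using e e2 by (intro power_decreasing) auto
  moreover have "e * pr V X <= e" "e * pr V Y <= e" "e * pr V Z <= e"
  using e by (simp_all add: mult_left_le)
  ultimately show ?thesis by simp
 qed
 finally have "1/4 * (\<gamma>/4)^3 <= 6 * e" using \<mu> by linarith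
 moreover have "0 < \<gamma>^3" using \<gamma> by simp
 ultimately show False using e by (simp add: power3_eq_cube field_simps)
qed

text \<open>An edge leaving the difference leaves \<open>Q\<close> or enters \<open>P\<close>, and
  by symmetry entering is as rare as leaving.\<close>

lemma cut_diff:
 assumes "!!x y. P x y ==> Q x y"
 shows "cut (%x y. Q x y & ~ P x y) <= cut Q + cut P"
proof -
 have "cut (%x y. Q x y & ~ P x y) <= pr3 V (%x y z. h x y z & Q x y & ~ Q x z)
  + pr3 V (%x y z. h x z y & P x z & ~ P x y)"
  unfolding cut_def by (rule pr3_union) (use h_perm in blast)
 then show ?thesis unfolding cut_def
  using pr3_swap23[of V "%x y z. h x y z & P x y & ~ P x z"] by simp
qed

text \<open>A big set of pairs with a sparse boundary either has no balanced sparse cut or has a big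
 almost closed part that is smaller by \<kappa>; iterating, a big part without sparse cuts is reached.\<close>
lemma exists_component:
 fixes eps :: "nat => real"
 assumes \<kappa>: "0 < \<kappa>" and M: "1 < \<kappa> * real M"
  and eps: "!!k. 0 < eps k" "!!k. 2 * eps (Suc k) <= eps k" "!!k. 2 * eps (Suc k) <= phi (eps k)"
  "!!k. 0 <= phi (eps k)" "!!k. phi (eps k) <= eps k"
  and e0: "eps 0 <= (\<gamma>^3/10000)^3" and \<mu>: "\<mu> <= \<gamma>^3/10000"
 shows "\<exists>k\<le>M. EX D. grel D & big D & cut D <= phi (eps k) &
  (ALL Q. grel Q --> (ALL x y. Q x y --> D x y) --> cut Q <= eps k -->
  pr2 V Q <= \<kappa> | pr2 V (%x y. D x y & ~ Q x y) <= \<kappa>)"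
proof (rule ccontr)
 assume neg: "~ ?thesis"
 define z where "z = \<gamma>^3/10000"
 have z: "0 < z" unfolding z_def using \<gamma> by simp
 have "\<gamma>^3 <= \<gamma>^1" using \<gamma> by (intro power_decreasing) auto
 then have z2: "z <= \<gamma>/100" "z <= 1" using \<gamma> unfolding z_def by auto
 have epsz: "eps k <= z^3" for k
 proof (induction k)
  case 0 then show ?case using e0 unfolding z_def .
 next
  case (Suc k) then show ?case using eps(1)[of "Suc k"] eps(2)[of k] by linarith
 qed
 have bigT: "big (%x y. x ~= y)"
 proof -
  have "pr V (cpl (%x y. x ~= y) x) = 0" for x unfolding cpl_def by simp
  then have "pure (%x y. x ~= y) = (%x. True)" unfolding pure_def by auto
  then show ?thesis unfolding big_def using \<gamma> by simp
 qed
 \<comment> \<open>After \<open>j\<close> splittings the measure has dropped by \<kappa> times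
   \<open>j\<close>. The index of \<open>eps\<close> runs downwards from \<open>M\<close>, because
   every splitting worsens the boundary and \<open>phi (eps k)\<close> must absorb twice
   \<open>eps (Suc k)\<close>.\<close>
 have "j <= M ==> EX D. grel D & big D & cut D <= phi (eps (M - j)) & pr2 V D <= 1 - \<kappa> * real j" for j
 proof (induction j)
  case 0
  have "cut (%x y. x ~= y) = pr3 V (%x y z. False)"
  unfolding cut_def by (intro pr3_cong) (use h_distinct in auto)
  then have "cut (%x y. x ~= y) = 0" by (simp add: pr3_def pr2_def)
  then show ?case using eps(4) bigT by (intro exI[of _ "%x y. x ~= y"]) (auto simp: grel_def)
 next
  case (Suc j)
  define k where "k = M - Suc j"
  have k: "M - j = Suc k" using Suc.prems unfolding k_def by simp
  obtain D where D: "grel D" "big D" "cut D <= phi (eps (Suc k))" "pr2 V D <= 1 - \<kappa> * real j"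
  using Suc k by auto
  have "Suc k <= M" using k by linarith
  with neg D have "~ (ALL Q. grel Q --> (ALL x y. Q x y --> D x y) --> cut Q <= eps (Suc k) -->
  pr2 V Q <= \<kappa> | pr2 V (%x y. D x y & ~ Q x y) <= \<kappa>)" by blast
  then obtain Q where Q: "grel Q" "!!x y. Q x y ==> D x y" "cut Q <= eps (Suc k)"
  "\<kappa> < pr2 V Q" "\<kappa> < pr2 V (%x y. D x y & ~ Q x y)"
  by (meson not_le)
  define Q' where "Q' = (%x y. D x y & ~ Q x y)"
  have Q'g: "grel Q'" using D(1) Q(1) unfolding grel_def Q'_def by blast
  have cQ': "cut Q' <= 2 * eps (Suc k)"
  using cut_diff[of Q D] Q(2,3) D(3) eps(5)[of "Suc k"] unfolding Q'_def by fastforce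
  have c: "cut D <= z^3" "cut Q <= z^3" "cut Q' <= z^3"
  using D(3) eps(5)[of "Suc k"] epsz[of "Suc k"] epsz[of k] Q(3) cQ' eps(2)[of k] by linarith+
  have "big Q | big Q'"
  proof (rule big_split[where e = z, OF Q(1) Q'g _ _ c])
  show "D x y \<longleftrightarrow> Q x y | Q' x y" for x y using Q(2) unfolding Q'_def by blast
  show "~ (Q x y & Q' x y)" for x y unfolding Q'_def by blast
  qed (use z \<mu> D(2) in \<open>auto simp: z_def\<close>)
  moreover have "pr2 V D = pr2 V Q + pr2 V Q'"
  proof -
  have "pr2 V (%x y. D x y & Q x y) = pr2 V Q" using Q(2) by (intro pr2_cong) auto
  then show ?thesis using pr2_split[of V D Q] unfolding Q'_def by simp
  qed
  moreover have "cut Q <= phi (eps k)" "cut Q' <= phi (eps k)"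
  using cQ' Q(3) eps(3)[of k] eps(1)[of "Suc k"] by linarith+
  moreover have "pr2 V Q <= 1 - \<kappa> * real (Suc j)" "pr2 V Q' <= 1 - \<kappa> * real (Suc j)"
  using calculation(2) D(4) Q(4,5) unfolding Q'_def by (simp_all add: algebra_simps)
  ultimately show ?case using Q(1) Q'g unfolding k_def by blast
 qed
 from this[of M] obtain D where "pr2 V D <= 1 - \<kappa> * real M" by auto
 then show False using M pr2_nonneg[of V D] by linarith
qed

end

section \<open>Fractional covers\<close>

context trip
begin

text \<open>Every quantitative condition holds up to \<nu> only. This makes the hypotheses stable
  under passing to a large vertex subset, which is needed once the absorbing structure has been
  removed.\<close>

definition fm_hyp :: "('a => 'a => bool) => ('a => 'a => 'a => bool) => real => real => bool" where
 "fm_hyp D T \<gamma> \<nu> \<longleftrightarrow> grel D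
  & (ALL x y z. T x y z --> h x y z & D x y & T x z y)
  & pr V (%x. pr V (D x) < 1/3 + \<gamma>) <= \<nu>
  & pr2 V (%x y. D x y & pr V (T x y) < 1/3 + \<gamma>) <= \<nu>
  & cut D <= \<nu>
  & (ALL X Y Z. 1/4 * pr V X * pr V Y * pr V Z - \<nu> <= pr3 V (%x y z. X x & Y y & Z z & h x y z))"

text \<open>The lowest level of width \<open>w\<close> with measure at least \<open>p\<close>. If
  all levels below weight 1 were sparse, at least half of the vertices would have weight at least 1,
  too much for an average below 1/3.\<close>

lemma popular_level:
 assumes c: "!!x. x \<in> V ==> 0 <= c x" and avg: "avg V c < 1/3"
  and K: "0 < K" and w: "w * real K = 1" and p: "0 <= p" "p * real K <= 1/2"
 obtains j where "j < K" "p <= pr V (%x. real j * w <= c x & c x < real (Suc j) * w)"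
  "pr V (%x. c x < real j * w) <= p * real K"
proof -
 let ?m = "%j. pr V (%x. real j * w <= c x & c x < real (Suc j) * w)"
 have low: "pr V (%x. c x < real j * w) <= p * real j" if "!!i. i < j ==> ?m i < p" for j
  using that
 proof (induction j)
  case 0
  have "pr V (%x. c x < real 0 * w) = pr V (%x. False)"
  by (intro pr_cong) (use c in force)
  then show ?case by simp
 next
  case (Suc j)
  have "pr V (%x. c x < real (Suc j) * w) <= pr V (%x. c x < real j * w) + ?m j"
  by (rule pr_union) auto
  then show ?case using Suc.IH Suc.prems[of j] Suc.prems by (force simp: algebra_simps)
 qed
 have "\<exists>j<K. p <= ?m j"
 proof (rule ccontr)
  assume "~ ?thesis"
  then have "pr V (%x. c x < real K * w) <= p * real K" by (intro low) (auto simp: not_le)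
  then have "pr V (%x. c x < 1) <= 1/2" using p w by (simp add: mult.commute)
  moreover have "pr V (%x. 1 <= c x) <= (1/3) / 1"
  using avg c by (intro markov) auto
  moreover have "pr V (%x. ~ c x < 1) = pr V (%x. 1 <= c x)" by (intro pr_cong) auto
  ultimately show False using pr_compl[of "%x. c x < 1"] by linarith
 qed
 then obtain j where j: "j < K" "p <= ?m j" "!!i. i < j ==> ~ (i < K & p <= ?m i)"
  using exists_least_iff[of "%j. j < K & p <= ?m j"] by auto
 moreover have "pr V (%x. c x < real j * w) <= p * real j"
  using j by (intro low) force
 moreover have "p * real j <= p * real K" using j p by (intro mult_left_mono) auto
 ultimately show ?thesis using that by force
qed

lemma avg_ge_part:
 assumes "!!x. x \<in> V ==> 0 <= b x" "!!x. x \<in> V ==> P x ==> s <= b x" "d <= pr V P" "0 <= s"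
 shows "d * s <= avg V b"
proof -
 have "d * s <= s * pr V P" using mult_left_mono[OF assms(3,4)] by (simp add: mult.commute)
 also have "... <= avg V b" unfolding pr_def avg_cmult[symmetric]
  using assms by (intro avg_mono) auto
 finally show ?thesis .
qed

text \<open>The weight of a graph with minimum degree \<open>d\<close> all of whose edges have weight at least \<open>\<sigma>\<close>:
 look at a vertex of minimum weight and its neighbourhood.\<close>
lemma nbhd_weight:
 assumes b: "!!x. x \<in> V ==> 0 <= b x" and \<sigma>: "0 <= \<sigma>"
  and good: "!!y. y \<in> V ==> G y ==> B y & (EX N. d <= pr V N & (\<forall>z\<in>V. N z --> B z & \<sigma> <= b y + b z))"
  and t: "pr V (%y. B y & ~ G y) <= t" and ne: "t < pr V B"
 shows "d * \<sigma> <= avg V (%y. of_bool (B y) * b y) | (pr V B - t) * (\<sigma> / 2) <= avg V (%y. of_bool (B y) * b y)"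
proof -
 let ?A = "avg V (%y. of_bool (B y) * b y)"
 have GB: "pr V B - t <= pr V G"
  using pr_diff_ge[of V B "%y. B y & ~ G y" G] t by auto
 then have "0 < pr V G" using ne by linarith
 then obtain y0 where "y0 \<in> V" "G y0" using ex_of_pr0 by blast
 then have "EX y. (y \<in> V & G y) & (ALL z. z \<in> V & G z --> b y <= b z)"
  using ex_min_if_finite[of "b ` {y\<in>V. G y}"] fin by (fastforce simp: not_less)
 then obtain y where y: "y \<in> V" "G y" "!!z. z \<in> V ==> G z ==> b y <= b z" by blast
 define m where "m = b y"
 have m: "0 <= m" using b y unfolding m_def by blast
 show ?thesis
 proof (cases "\<sigma>/2 <= m")
  case True
  have "(pr V B - t) * m <= ?A"
  by (rule avg_ge_part[where P = G]) (use b y good GB m in \<open>auto simp: m_def\<close>)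
  moreover have "(pr V B - t) * (\<sigma>/2) <= (pr V B - t) * m"
  using True ne by (intro mult_left_mono) auto
  ultimately show ?thesis by linarith
 next
  case False
  obtain N where N: "d <= pr V N" "!!z. z \<in> V ==> N z ==> B z & \<sigma> <= b y + b z"
  using good y by blast
  \<comment> \<open>Good vertices weigh at least the minimum \<open>m\<close>, and those in
    \<open>N\<close> at least \<sigma> - m, because together with the minimal vertex they reach
    \<sigma>.\<close>
  have "(\<sigma> - 2 * m) * pr V N + m * pr V B - m * pr V (%y. B y & ~ G y) <= ?A"
  unfolding pr_def avg_cmult[symmetric] avg_add[symmetric] avg_diff[symmetric]
  proof (intro avg_mono, goal_cases)
  case (1 z)
  have "N z ==> B z & \<sigma> - m <= b z" using N(2)[OF 1] unfolding m_def by auto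
  moreover have "G z ==> m <= b z" using y(3)[OF 1] unfolding m_def by auto
  ultimately show ?case using b[OF 1] m False by (cases "N z"; cases "B z"; cases "G z") auto
  qed
  moreover have "(\<sigma> - 2 * m) * d <= (\<sigma> - 2 * m) * pr V N"
  using False N(1) by (intro mult_left_mono) auto
  moreover have "m * pr V (%y. B y & ~ G y) <= m * t" using t m by (intro mult_left_mono)
  ultimately have 1: "(\<sigma> - 2 * m) * d + m * (pr V B - t) <= ?A" by (simp add: algebra_simps)
  define X where "X = pr V B - t"
  show ?thesis
  \<comment> \<open>The lower bound is linear in \<open>m\<close>, hence at least the smaller of its
    values at m = 0 and m = \<sigma>/2. These are the two alternatives of the claim.\<close>
  proof (cases "2 * d <= X")
  case True
  have "m * (2 * d) <= m * X" using True m by (intro mult_left_mono)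
  moreover have "(\<sigma> - 2 * m) * d = d * \<sigma> - m * (2 * d)" by (simp add: algebra_simps)
  ultimately show ?thesis using 1 unfolding X_def by linarith
  next
  case F: False
  have "(\<sigma> - 2 * m) * (X/2) <= (\<sigma> - 2 * m) * d" using F False by (intro mult_left_mono) auto
  moreover have "(\<sigma> - 2 * m) * (X/2) = X * (\<sigma>/2) - m * X" by (simp add: algebra_simps)
  ultimately have "X * (\<sigma>/2) <= ?A" using 1 unfolding X_def by linarith
  then show ?thesis unfolding X_def by simp
  qed
 qed
qed

text \<open>Let \<open>Z\<close> be the lowest popular weight level, \<open>a\<close> its weight,
  \<open>b\<close> the excess over \<open>a\<close>, and u = 1 - 3a what a triple must still carry.
  \<open>Z\<close> spans almost no pairs of \<open>D\<close>, since over a typical such pair more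
  than a third of the vertices would each have excess about \<open>u\<close>. Density 1/4 then
  implies that almost no vertex is joined in \<open>D\<close> to more than half of \<open>Z\<close>.
  On the other hand almost every vertex of \<open>Z\<close> sees an excess of more than u/6 in its
  neighbourhood. Double counting yields an average excess above u/3, and a + u/3 = 1/3.\<close>

lemma fm_core:
 assumes hyp: "fm_hyp D T \<gamma> \<nu>" and c: "!!x. x \<in> V ==> 0 <= c x & c x <= 1"
  and viol: "pr3 V (%x y z. T x y z & c x + c y + c z < 1) <= \<nu>"
  and \<gamma>: "0 < \<gamma>" "\<gamma> <= 1" and \<eta>: "0 < \<eta>" "\<eta> <= 1" and K: "0 < K" and w: "w * real K = 1" "w <= \<gamma> * \<eta> / 100"
  and p: "p * real K = \<gamma> * \<eta> / 100" and \<nu>: "0 < \<nu>" "\<nu> <= p * w * \<gamma>^2 / 18" "\<nu> <= \<gamma> * w * p^2 * (\<gamma> * \<eta>) / 1200"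
 shows "(1 - \<eta>) / 3 <= avg V c"
proof (rule ccontr)
 assume neg: "~ ?thesis"
 define q where "q = \<gamma> * \<eta> / 100"
 define g where "g = \<gamma> * \<eta>"
 have g: "0 < g" "g <= \<eta>" "g <= 1" using \<gamma> \<eta> unfolding g_def by (auto simp: mult_le_one)
 have w0: "0 < w" using w K by (metis mult.commute zero_less_mult_pos of_nat_0_less_iff zero_less_one)
 have p0: "0 < p" using p K g unfolding g_def
  by (metis divide_pos_pos mult.commute zero_less_mult_pos of_nat_0_less_iff zero_less_numeral)
 from hyp have D: "grel D" and T: "!!x y z. T x y z ==> h x y z & D x y & T x z y"
  and d1: "pr V (%x. pr V (D x) < 1/3 + \<gamma>) <= \<nu>"
  and d2: "pr2 V (%x y. D x y & pr V (T x y) < 1/3 + \<gamma>) <= \<nu>"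
  and d3: "cut D <= \<nu>"
  and dens: "!!X Y Z. 1/4 * pr V X * pr V Y * pr V Z - \<nu> <= pr3 V (%x y z. X x & Y y & Z z & h x y z)"
  unfolding fm_hyp_def by blast+
 obtain j where j: "j < K" "p <= pr V (%x. real j * w <= c x & c x < real (Suc j) * w)"
  "pr V (%x. c x < real j * w) <= p * real K"
 proof (rule popular_level[of c K w p])
  show "avg V c < 1/3" using neg \<eta> by simp
  show "p * real K <= 1/2" using p g unfolding g_def by simp
 qed (use c K w p0 in auto)
 define a where "a = real j * w"
 define Z where "Z = (%x. a <= c x & c x < a + w)"
 define b where "b = (%x. max (c x - a) 0)"
 define \<zeta> where "\<zeta> = pr V Z"
 have Z: "p <= \<zeta>" using j(2) unfolding \<zeta>_def Z_def a_def by (simp add: algebra_simps)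
 have low: "pr V (%x. c x < a) <= q" using j(3) p unfolding a_def q_def by simp
 have a0: "0 <= a" "a <= 1"
 proof -
  show "0 <= a" unfolding a_def using w0 by simp
  have "real j * w <= real K * w" using j(1) w0 by (intro mult_right_mono) auto
  then show "a <= 1" unfolding a_def using w by (simp add: mult.commute)
 qed
 have b01: "0 <= b x" "b x <= 1" if "x \<in> V" for x using c[OF that] a0 unfolding b_def by auto
 have "a + avg V b - pr V (%x. c x < a) <= avg V c"
 proof -
  have "avg V (%x. a) + avg V b - pr V (%x. c x < a) <= avg V c"
  unfolding pr_def avg_add[symmetric] avg_diff[symmetric]
  proof (intro avg_mono, goal_cases)
  case (1 x)
  then show ?case using c[OF 1] a0 by (auto simp: b_def max_def)
  qed
  then show ?thesis by simp
 qed
 then have key: "a + avg V b - q <= avg V c" using low by linarith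
 have bge0: "0 <= avg V b" using b01 by (intro avg_nonneg)
 define u where "u = 1 - 3 * a"
 have u: "\<eta> / 2 <= u" "u <= 1"
 proof -
  have "a <= (1 - \<eta>)/3 + q" using key bge0 neg by linarith
  moreover have "q <= \<eta> / 100" using g unfolding q_def g_def by simp
  ultimately have "a <= 1/3 - \<eta>/3 + \<eta>/100" by (simp add: diff_divide_distrib)
  then show "\<eta>/2 <= u" unfolding u_def using \<eta> by linarith
  show "u <= 1" unfolding u_def using a0 by simp
 qed
 have gu: "g / 2 <= \<gamma> * u" using u \<gamma> unfolding g_def by (simp add: field_simps)
 \<comment> \<open>So much average excess contradicts the assumed total, as a + u/3 = 1/3 and
   \<gamma> contributes more than all errors of size \<open>w\<close> and \<open>q\<close>.\<close>
 have contra1: False if "(1/3 + \<gamma>/2) * (u - 2 * w) <= avg V b"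
 proof -
  have "(1/3 + \<gamma>/2) * (u - 2 * w) = u/3 + \<gamma> * u / 2 - (1/3 + \<gamma>/2) * (2 * w)"
  by (simp add: algebra_simps)
  moreover have "(1/3 + \<gamma>/2) * (2 * w) <= 1 * (2 * w)" using \<gamma> w0 by (intro mult_right_mono) auto
  ultimately have "u/3 + g/4 - 2 * w <= avg V b" using that gu by linarith
  then have "a + u/3 + g/4 - 2 * w - q <= avg V c" using key by linarith
  moreover have "a + u/3 = 1/3" unfolding u_def by (simp add: field_simps)
  moreover have "q = g/100" "w <= g/100" using w unfolding q_def g_def by auto
  moreover have "avg V c < 1/3" using neg \<eta> by (simp add: diff_divide_distrib)
  ultimately show False using g by linarith
 qed
 define vi where "vi = (%x y z. T x y z & c x + c y + c z < 1)"
 have viol: "pr3 V vi <= \<nu>" using viol unfolding vi_def .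
 have nonvi: "\<sigma> <= b y + b z" if "T x y z" "~ vi x y z" "c x < 1 - 2 * a - \<sigma>" for x y z \<sigma>
  using that unfolding vi_def b_def by auto
 have case1: "pr2 V (%x y. (Z x & Z y) & D x y) <= 3 * \<nu> / \<gamma>"
 proof (rule ccontr)
  assume n: "~ ?thesis"
  have "pr2 V (%x y. (D x y & pr V (T x y) < 1/3 + \<gamma>) | \<gamma>/2 <= pr V (vi x y)) <= \<nu> + \<nu> / (\<gamma>/2)"
  by (intro order_trans[OF pr2_disj] add_mono d2 markov_pr32[OF viol]) (use \<gamma> in simp)
  also have "... <= 3 * \<nu> / \<gamma>" using \<gamma> \<nu> by (simp add: field_simps)
  finally obtain x y where xy: "x \<in> V" "y \<in> V" "Z x" "Z y" "D x y"
  "1/3 + \<gamma> <= pr V (T x y)" "pr V (vi x y) < \<gamma>/2"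
  using n ex_of_pr2[of V "%x y. (D x y & pr V (T x y) < 1/3 + \<gamma>) | \<gamma>/2 <= pr V (vi x y)"
  "%x y. (Z x & Z y) & D x y"] by (auto simp: not_le not_less)
  have "(1/3 + \<gamma>/2) * max 0 (u - 2 * w) <= avg V b"
  proof (rule avg_ge_part[where P = "%z. T x y z & ~ vi x y z"])
  show "1/3 + \<gamma>/2 <= pr V (%z. T x y z & ~ vi x y z)"
  using pr_diff_ge[of V "T x y" "vi x y" "%z. T x y z & ~ vi x y z"] xy by auto
  fix z assume "z \<in> V" "T x y z & ~ vi x y z"
  then show "max 0 (u - 2 * w) <= b z"
  using xy(3,4) unfolding vi_def Z_def b_def u_def by auto
  qed (use b01 in auto)
  moreover have "(1/3 + \<gamma>/2) * (u - 2 * w) <= (1/3 + \<gamma>/2) * max 0 (u - 2 * w)"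
  using \<gamma> by (intro mult_left_mono) auto
  ultimately show False using contra1 by linarith
 qed
 define \<beta> where "\<beta> = (%y. pr V (%x. Z x & D x y))"
 define Y where "Y = (%y. (1/2 + w) * \<zeta> < \<beta> y)"
 have \<beta>1: "\<beta> y <= \<zeta>" for y unfolding \<beta>_def \<zeta>_def by (rule pr_mono) auto
 have w12: "w <= 1/100" using w g unfolding g_def by linarith
 have Yle: "pr V Y <= g/100"
 proof -
  \<comment> \<open>Edges with two vertices in \<open>Z\<close> and one in \<open>Y\<close>: almost
    none has its pair inside \<open>Z\<close> in \<open>D\<close>, so by the sparse boundary its
    other two pairs miss \<open>D\<close> as well. This leaves at most
    \<open>((1/2 - w) * \<zeta>)^2\<close> per vertex of \<open>Y\<close>, fewer than density 1/4
    demands unless \<open>Y\<close> is small.\<close>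
  have "1/4 * \<zeta> * \<zeta> * pr V Y <= pr3 V (%x y z. Z x & Z y & Y z & h x y z) + \<nu>"
  using dens[of Z Z Y] unfolding \<zeta>_def by linarith
  also have "pr3 V (%x y z. Z x & Z y & Y z & h x y z)
  <= pr3 V (%x y z. (Z x & Z y) & D x y) + pr3 V (%x y z. (h x z y & D x z & ~ D x y)
  | (h y z x & D y z & ~ D y x) | (Y z & (Z x & ~ D x z) & (Z y & ~ D y z)))"
  by (rule pr3_union) (use D h_perm in \<open>unfold grel_def, blast\<close>)
  also have "... <= pr3 V (%x y z. (Z x & Z y) & D x y) + (pr3 V (%x y z. h x z y & D x z & ~ D x y)
  + (pr3 V (%x y z. h y z x & D y z & ~ D y x) + pr3 V (%x y z. Y z & (Z x & ~ D x z) & (Z y & ~ D y z))))"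
  by (intro add_left_mono order_trans[OF pr3_disj] order_refl)
  also have "pr3 V (%x y z. h x z y & D x z & ~ D x y) = cut D"
  unfolding cut_def by (rule pr3_swap23)
  also have "pr3 V (%x y z. h y z x & D y z & ~ D y x) = cut D"
  unfolding cut_def by (rule pr3_rot(1))
  also have "pr3 V (%x y z. Y z & (Z x & ~ D x z) & (Z y & ~ D y z))
  = pr3 V (%z x y. Y z & (Z x & ~ D x z) & (Z y & ~ D y z))"
  by (rule pr3_rot(2)[of V "%z x y. Y z & (Z x & ~ D x z) & (Z y & ~ D y z)"])
  also have "... <= ((1/2 - w) * \<zeta>)^2 * pr V Y"
  proof (rule pr3_conj_le)
  fix z assume z: "z \<in> V" "Y z"
  have "pr V (%x. Z x & ~ D x z) = \<zeta> - \<beta> z"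
  using pr_split[of V Z "%x. D x z"] unfolding \<zeta>_def \<beta>_def by simp
  moreover have "\<zeta> - \<beta> z <= (1/2 - w) * \<zeta>" using z unfolding Y_def by (simp add: algebra_simps)
  ultimately show "pr2 V (%x y. (Z x & ~ D x z) & (Z y & ~ D y z)) <= ((1/2 - w) * \<zeta>)^2"
  using \<beta>1[of z] unfolding pr2_prod power2_eq_square by (intro mult_mono) auto
  qed
  also have "pr3 V (%x y z. (Z x & Z y) & D x y) = pr2 V (%x y. (Z x & Z y) & D x y)" by simp
  finally have "1/4 * \<zeta> * \<zeta> * pr V Y <= 3 * \<nu> + 3 * \<nu> / \<gamma> + ((1/2 - w) * \<zeta>)^2 * pr V Y"
  using case1 d3 by linarith
  then have "(w - w^2) * (\<zeta>^2 * pr V Y) <= 3 * \<nu> + 3 * \<nu> / \<gamma>"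
  by (simp add: algebra_simps power2_eq_square)
  moreover have "w/2 * (\<zeta>^2 * pr V Y) <= (w - w^2) * (\<zeta>^2 * pr V Y)"
  using w0 w12 by (intro mult_right_mono) (auto simp: power2_eq_square)
  moreover have "w/2 * (p^2 * pr V Y) <= w/2 * (\<zeta>^2 * pr V Y)"
  using w0 p0 Z by (intro mult_left_mono mult_right_mono power_mono) auto
  moreover have "3 * \<nu> <= 3 * \<nu> / \<gamma>" using \<nu> \<gamma> by (simp add: field_simps)
  ultimately have "w/2 * (p^2 * pr V Y) <= 6 * \<nu> / \<gamma>" by linarith
  then have "(\<gamma> * w * p^2) * pr V Y <= 12 * \<nu>" using \<gamma> by (simp add: field_simps)
  also have "... <= (\<gamma> * w * p^2) * (g / 100)" using \<nu> unfolding g_def by simp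
  finally show ?thesis using \<gamma> w0 p0 by (subst (asm) mult_le_cancel_left_pos) auto
 qed
 \<comment> \<open>Small enough that the neighbours of \<open>x\<close> spoiled by low codegree, of
   measure below \<open>t\<close>, and those spoiled by uncovered triples, of measure at most t /
   (\<gamma>/2), together stay within \<gamma>/2.\<close>
 define t where "t = \<gamma>^2 / 6"
 have t0: "0 < t" using \<gamma> unfolding t_def by simp
 define ex where "ex = (%x. pr V (D x) < 1/3 + \<gamma> | t <= pr V (%y. D x y & pr V (T x y) < 1/3 + \<gamma>)
  | t <= pr2 V (vi x))"
 have exle: "pr V ex <= p * w"
 proof -
  have "pr V ex <= \<nu> + (\<nu>/t + \<nu>/t)"
  unfolding ex_def
  by (intro order_trans[OF pr_disj] add_mono d1 markov_pr2[OF d2 t0] markov_pr3[OF viol t0])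
  also have "... <= 3 * \<nu> / t"
  proof -
  have "\<gamma>^2 <= 1" using \<gamma> by (simp add: power_le_one)
  then have "t <= 1" unfolding t_def by simp
  then have "\<nu> <= \<nu>/t" using \<nu> t0 by (simp add: field_simps)
  then show ?thesis by simp
  qed
  also have "... <= p * w" using \<nu>(2) t0 unfolding t_def by (simp add: field_simps)
  finally show ?thesis .
 qed
 have step: "(1/3 + \<gamma>/2) * ((u - w)/2) <= avg V (%y. of_bool (D x y) * b y)"
  if x: "x \<in> V" "Z x" "~ ex x" for x
 proof -
  define G where "G = (%y. D x y & 1/3 + \<gamma> <= pr V (T x y) & pr V (vi x y) < \<gamma>/2)"
  have uw: "0 <= u - w" using u w g by (simp add: g_def)
  have tt: "t + t / (\<gamma>/2) <= \<gamma>/2"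
  proof -
  have "t + t/(\<gamma>/2) = \<gamma>^2/6 + \<gamma>/3" unfolding t_def using \<gamma> by (simp add: power2_eq_square)
  moreover have "\<gamma>^2 <= \<gamma>" using \<gamma> by (simp add: power2_eq_square mult_left_le)
  ultimately show ?thesis by linarith
  qed
  \<comment> \<open>In the link of \<open>x\<close> the covered edges \<open>yz\<close> carry excess
    at least u - w, because \<open>x\<close> itself has excess below \<open>w\<close>. The first
    alternative is already excluded by \<open>contra1\<close>.\<close>
  have "(1/3 + \<gamma>/2) * (u - w) <= avg V (%y. of_bool (D x y) * b y) |
  (pr V (D x) - \<gamma>/2) * ((u - w)/2) <= avg V (%y. of_bool (D x y) * b y)"
  proof (rule nbhd_weight[where G = G])
  show "pr V (%y. D x y & ~ G y) <= \<gamma>/2"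
  proof -
  have "pr V (%y. D x y & ~ G y) <= pr V (%y. D x y & pr V (T x y) < 1/3 + \<gamma>) + pr V (%y. \<gamma>/2 <= pr V (vi x y))"
  unfolding G_def by (rule pr_union) auto
  moreover have "pr V (%y. \<gamma>/2 <= pr V (vi x y)) <= t / (\<gamma>/2)"
  using x \<gamma> by (intro markov_pr2) (auto simp: ex_def)
  ultimately show ?thesis using x(3) tt unfolding ex_def by linarith
  qed
  show "\<gamma>/2 < pr V (D x)" using x(3) \<gamma> unfolding ex_def by linarith
  fix y assume y: "y \<in> V" "G y"
  show "D x y & (EX N. 1/3 + \<gamma>/2 <= pr V N & (\<forall>z\<in>V. N z --> D x z & u - w <= b y + b z))"
  proof (intro conjI exI[of _ "%z. T x y z & ~ vi x y z"] ballI impI)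
  show "D x y" using y unfolding G_def by blast
  show "1/3 + \<gamma>/2 <= pr V (%z. T x y z & ~ vi x y z)"
  using pr_diff_ge[of V "T x y" "vi x y" "%z. T x y z & ~ vi x y z"] y unfolding G_def by auto
  fix z assume "z \<in> V" "T x y z & ~ vi x y z"
  then show "D x z" using T by blast
  show "u - w <= b y + b z"
  using \<open>T x y z & ~ vi x y z\<close> x(2) nonvi[of x y z "u - w"] unfolding Z_def u_def by auto
  qed
  qed (use b01 uw in auto)
  then show ?thesis
  proof
  assume "(1/3 + \<gamma>/2) * (u - w) <= avg V (%y. of_bool (D x y) * b y)"
  also have "... <= avg V b" using b01 by (intro avg_mono) auto
  finally have "(1/3 + \<gamma>/2) * (u - w) <= avg V b" .
  moreover have "(1/3 + \<gamma>/2) * (u - 2*w) <= (1/3 + \<gamma>/2) * (u - w)"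
  using \<gamma> w0 by (intro mult_left_mono) auto
  ultimately have "(1/3 + \<gamma>/2) * (u - 2*w) <= avg V b" by (rule order_trans[rotated])
  then show ?thesis using contra1 by blast
  next
  assume *: "(pr V (D x) - \<gamma>/2) * ((u - w)/2) <= avg V (%y. of_bool (D x y) * b y)"
  have "(1/3 + \<gamma>/2) * ((u - w)/2) <= (pr V (D x) - \<gamma>/2) * ((u - w)/2)"
  using uw x(3) unfolding ex_def by (intro mult_right_mono) auto
  then show ?thesis using * by linarith
  qed
 qed
 have s0: "0 <= (1/3 + \<gamma>/2) * ((u - w)/2)" using u w g \<gamma> by (simp add: g_def)
 have "(1/3 + \<gamma>/2) * ((u - w)/2) * (\<zeta> - p * w)
  <= (1/3 + \<gamma>/2) * ((u - w)/2) * pr V (%x. Z x & ~ ex x)"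
  using pr_diff_ge[of V Z ex "%x. Z x & ~ ex x"] exle s0 unfolding \<zeta>_def by (intro mult_left_mono) auto
 also have "... <= avg V (%x. avg V (%y. of_bool (Z x & D x y) * b y))"
  unfolding pr_def avg_cmult[symmetric]
 proof (intro avg_mono, goal_cases)
  case (1 x)
  show ?case
  proof (cases "Z x & ~ ex x")
  case True
  then show ?thesis using step[OF 1] by simp
  next
  case False
  have "0 <= avg V (%y. of_bool (Z x & D x y) * b y)" using b01 by (intro avg_nonneg) auto
  moreover have "of_bool (Z x & ~ ex x) = (0::real)" using False by simp
  ultimately show ?thesis by (simp only: mult_zero_right)
  qed
 qed
 \<comment> \<open>Double counting: the excess of \<open>y\<close> is counted once for each of its
   \<open>D\<close>-neighbours in \<open>Z\<close>, and outside \<open>Y\<close> these are hardly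
   more than half of \<open>Z\<close>.\<close>
 also have "... = avg V (%y. \<beta> y * b y)"
  unfolding \<beta>_def pr_def avg_multc[symmetric] by (rule avg_swap)
 also have "... <= avg V (%y. (1/2 + w) * \<zeta> * b y + \<zeta> * of_bool (Y y))"
 proof (rule avg_mono)
  fix y assume y: "y \<in> V"
  show "\<beta> y * b y <= (1/2 + w) * \<zeta> * b y + \<zeta> * of_bool (Y y)"
  proof (cases "Y y")
  case True
  have "\<beta> y * b y <= \<zeta> * 1" using \<beta>1[of y] b01[OF y] Z p0 by (intro mult_mono) auto
  moreover have "0 <= (1/2 + w) * \<zeta> * b y" using b01[OF y] Z p0 w0 by simp
  ultimately show ?thesis using True by simp
  next
  case False
  then have "\<beta> y * b y <= (1/2 + w) * \<zeta> * b y" using b01[OF y] unfolding Y_def by (intro mult_right_mono) auto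
  then show ?thesis using False by simp
  qed
 qed
 also have "... = (1/2 + w) * \<zeta> * avg V b + \<zeta> * pr V Y"
  unfolding pr_def by (simp add: avg_add avg_cmult)
 also have "... <= (1/2 + w) * \<zeta> * avg V b + \<zeta> * (g/100)"
  using Yle Z p0 by (intro add_left_mono mult_left_mono) auto
 finally have "(1/3 + \<gamma>/2) * ((u - w)/2) * (\<zeta> - p * w) <= \<zeta> * ((1/2 + w) * avg V b + g/100)"
  by (simp add: algebra_simps)
 moreover have "(1/3 + \<gamma>/2) * ((u - w)/2) * (\<zeta> * (1 - w)) <= (1/3 + \<gamma>/2) * ((u - w)/2) * (\<zeta> - p * w)"
  using s0 Z w0 by (intro mult_left_mono) (auto simp: algebra_simps)
 ultimately have "\<zeta> * ((1/3 + \<gamma>/2) * ((u - w)/2) * (1 - w)) <= \<zeta> * ((1/2 + w) * avg V b + g/100)"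
  by (simp add: algebra_simps)
 then have fin1: "(1/3 + \<gamma>/2) * ((u - w)/2) * (1 - w) <= (1/2 + w) * avg V b + g/100"
  using Z p0 by (subst (asm) mult_le_cancel_left_pos) auto
 have "avg V b < u/3 + q" using key neg \<eta> unfolding u_def by (simp add: field_simps)
 then have "(1/2 + w) * avg V b <= (1/2 + w) * (u/3 + q)" using w0 by (intro mult_left_mono) auto
 also have "... <= u/6 + q/2 + w"
 proof -
  have "w * (u/3 + q) <= w * 1" using u w0 g unfolding q_def g_def by (intro mult_left_mono) auto
  then show ?thesis by (simp add: algebra_simps)
 qed
 finally have fin2: "(1/2 + w) * avg V b <= u/6 + q/2 + w" .
 have uw: "0 <= u - w" using u w g by (simp add: g_def)
 have "(1/3 + \<gamma>/2) * ((u - w)/2) * w <= 1 * (1/2) * w"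
  using \<gamma> u w0 w12 uw by (intro mult_right_mono mult_mono) auto
 moreover have "(1/3 + \<gamma>/2) * (w/2) <= 1 * (w/2)" using \<gamma> w0 by (intro mult_right_mono) auto
 moreover have "(1/3 + \<gamma>/2) * ((u - w)/2) * (1 - w) = u/6 + \<gamma> * u/4 - (1/3 + \<gamma>/2) * (w/2) - (1/3 + \<gamma>/2) * ((u - w)/2) * w"
  by (simp add: algebra_simps add_divide_distrib diff_divide_distrib)
 ultimately have "u/6 + g/8 - w <= (1/3 + \<gamma>/2) * ((u - w)/2) * (1 - w)" using gu by linarith
 moreover have "q = g/100" "w <= g/100" using w unfolding q_def g_def by auto
 ultimately show False using fin1 fin2 g by linarith
qed

end

text \<open>The level width is a small multiple of \<gamma> \<eta>, so that all rounding is
  dominated by the gain from \<gamma>. The tolerance depends on \<gamma> and \<eta> alone, uniformly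
  in the vertex set.\<close>

lemma fractional_cover_bound:
 assumes \<gamma>: "0 < \<gamma>" "\<gamma> <= 1" and \<eta>: "0 < \<eta>" "\<eta> <= (1::real)"
 shows "\<exists>\<nu>0>0. \<forall>V h D T \<nu> c. trip V h --> trip.fm_hyp V h D T \<gamma> \<nu> --> 0 < \<nu> --> \<nu> <= \<nu>0 -->
  (\<forall>x\<in>V. 0 <= c x) --> pr3 V (%x y z. T x y z & c x + c y + c z < 1) <= \<nu> --> (1 - \<eta>) / 3 <= avg V c"
proof -
 define K where "K = nat \<lceil>100 / (\<gamma> * \<eta>)\<rceil>"
 define w where "w = 1 / real K"
 define p where "p = \<gamma> * \<eta> / 100 / real K"
 have Kge: "100 / (\<gamma> * \<eta>) <= real K" unfolding K_def by (simp add: real_nat_ceiling_ge)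
 have K: "0 < K"
 proof -
  have "0 < 100 / (\<gamma> * \<eta>)" using \<gamma> \<eta> by simp
  then show ?thesis using Kge by (metis less_le_trans of_nat_0_less_iff)
 qed
 have w: "w * real K = 1" "w <= \<gamma> * \<eta> / 100" "0 < w"
  using K Kge \<gamma> \<eta> unfolding w_def by (auto simp: field_simps)
 have p: "p * real K = \<gamma> * \<eta> / 100" "0 < p" using K \<gamma> \<eta> unfolding p_def by auto
 define \<nu>0 where "\<nu>0 = min (p * w * \<gamma>^2 / 18) (\<gamma> * w * p^2 * (\<gamma> * \<eta>) / 1200)"
 have \<nu>0: "0 < \<nu>0" unfolding \<nu>0_def using p w \<gamma> \<eta> by simp
 have "(1 - \<eta>) / 3 <= avg V c" if a: "trip V h" "trip.fm_hyp V h D T \<gamma> \<nu>" "0 < \<nu>" "\<nu> <= \<nu>0" "\<forall>x\<in>V. 0 <= c x"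
  "pr3 V (%x y z. T x y z & c x + c y + c z < 1) <= \<nu>" for V :: "'a set" and h D T \<nu> c
 proof -
  interpret trip V h by fact
  \<comment> \<open>Truncating weights at 1 keeps every covered triple covered.\<close>
  have "pr3 V (%x y z. T x y z & min (c x) 1 + min (c y) 1 + min (c z) 1 < 1) <= pr3 V (%x y z. T x y z & c x + c y + c z < 1)"
  proof (rule pr3_mono)
  fix x y z assume "x \<in> V" "y \<in> V" "z \<in> V"
  "T x y z & min (c x) 1 + min (c y) 1 + min (c z) 1 < 1"
  then show "T x y z & c x + c y + c z < 1"
  using a(5)[rule_format, of x] a(5)[rule_format, of y] a(5)[rule_format, of z]
  by (auto simp: min_def split: if_splits)
  qed
  then have "(1 - \<eta>) / 3 <= avg V (%x. min (c x) 1)"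
  using a \<gamma> \<eta> K w p by (intro fm_core[where D = D and T = T and \<gamma> = \<gamma> and \<nu> = \<nu> and K = K and w = w and p = p])
  (auto simp: \<nu>0_def)
  also have "... <= avg V c" by (rule avg_mono) auto
  finally show ?thesis .
 qed
 then show ?thesis using \<nu>0 by blast
qed

section \<open>The component and its triples\<close>

locale comp0 = trip V h for V :: "'a set" and h +
 fixes D :: "'a => 'a => bool" and \<gamma> \<nu> :: real
 assumes \<gamma>: "0 < \<gamma>" "\<gamma> <= 1" and \<nu>0: "0 < \<nu>" and \<nu>\<gamma>: "\<nu> <= \<gamma> / 1000" and gD: "grel D"
  and degD: "pr V (%x. pr V (D x) < 1/3 + \<gamma>) <= \<nu>"
  and cutD: "cut D <= \<nu>"
  and codeg: "x \<in> V ==> y \<in> V ==> x ~= y ==> 1/3 + \<gamma> <= pr V (h x y)"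
  and dens: "1/4 * pr V X * pr V Y * pr V Z - \<nu> <= pr3 V (%x y z. X x & Y y & Z z & h x y z)"
begin

lemma D_sym: "D x y \<longleftrightarrow> D y x" and D_neq: "D x y ==> x ~= y"
 using gD unfolding grel_def by auto

definition T :: "'a => 'a => 'a => bool" where
 "T x y z \<longleftrightarrow> h x y z & D x y & D x z & D y z"

lemma T_perm:
 "T x y z \<longleftrightarrow> T y x z" "T x y z \<longleftrightarrow> T x z y" "T x y z \<longleftrightarrow> T z y x"
 "T x y z \<longleftrightarrow> T y z x" "T x y z \<longleftrightarrow> T z x y"
 unfolding T_def using h_perm D_sym by blast+

lemma T_D: "T x y z ==> D x y & D x z & D y z"
 unfolding T_def by blast

lemma T_h: "T x y z ==> h x y z"
 unfolding T_def by blast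

lemma T_neq: "T x y z ==> x ~= y & x ~= z & y ~= z"
 using T_h h_distinct by blast

text \<open>Such an edge crosses the boundary of \<open>D\<close> at one of the two ends of its
  \<open>D\<close>-pair.\<close>

lemma nonT: "pr3 V (%x y z. h x y z & D x y & ~ T x y z) <= 2 * \<nu>"
proof -
 have "pr3 V (%x y z. h x y z & D x y & ~ T x y z)
  <= pr3 V (%x y z. h x y z & D x y & ~ D x z) + pr3 V (%x y z. h y x z & D y x & ~ D y z)"
  by (rule pr3_union) (use h_perm D_sym in \<open>unfold T_def, blast\<close>)
 also have "pr3 V (%x y z. h y x z & D y x & ~ D y z) = cut D"
  unfolding cut_def by (rule pr3_swap12)
 finally show ?thesis using cutD unfolding cut_def by linarith
qed

lemma typ_pairs: "pr2 V (%x y. D x y & pr V (T x y) < 1/3 + \<gamma>/2) <= 4 * \<nu> / \<gamma>"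
proof -
 have "pr2 V (%x y. D x y & pr V (T x y) < 1/3 + \<gamma>/2)
  <= pr2 V (%x y. \<gamma>/2 <= pr V (%z. h x y z & D x y & ~ T x y z))"
 proof (rule pr2_mono)
  fix x y assume xy: "x \<in> V" "y \<in> V" "D x y & pr V (T x y) < 1/3 + \<gamma>/2"
  have "pr V (h x y) <= pr V (T x y) + pr V (%z. h x y z & D x y & ~ T x y z)"
  by (rule pr_union) (use xy in auto)
  then show "\<gamma>/2 <= pr V (%z. h x y z & D x y & ~ T x y z)"
  using codeg[OF xy(1,2)] D_neq xy by force
 qed
 also have "... <= 2 * \<nu> / (\<gamma>/2)"
  by (rule markov_pr32[OF nonT]) (use \<gamma> in simp)
 finally show ?thesis by simp
qed

lemma fm_hyp_T: "fm_hyp D T (\<gamma>/2) (4 * \<nu> / \<gamma>)"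
proof -
 have n: "\<nu> <= 4 * \<nu> / \<gamma>" using \<gamma> \<nu>0 by (simp add: field_simps)
 have "pr V (%x. pr V (D x) < 1/3 + \<gamma>/2) <= pr V (%x. pr V (D x) < 1/3 + \<gamma>)"
  by (rule pr_mono) (use \<gamma> in auto)
 moreover have "1/4 * pr V X * pr V Y * pr V Z - 4 * \<nu> / \<gamma> <= pr3 V (%x y z. X x & Y y & Z z & h x y z)" for X Y Z
  using dens[of X Y Z] n by linarith
 ultimately show ?thesis
  unfolding fm_hyp_def using gD degD typ_pairs cutD n T_h T_D T_perm by auto
qed

lemma pr2_D: "1/4 <= pr2 V D"
proof -
 have "(1/3 + \<gamma>) * pr V (%x. ~ pr V (D x) < 1/3 + \<gamma>) <= pr2 V (%x y. (~ pr V (D x) < 1/3 + \<gamma>) & D x y)"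
  by (rule pr2_conj_ge) auto
 also have "... <= pr2 V D" by (rule pr2_mono) auto
 finally have "(1/3 + \<gamma>) * (1 - pr V (%x. pr V (D x) < 1/3 + \<gamma>)) <= pr2 V D"
  by (simp only: pr_compl)
 moreover have "1/3 * (1 - 1/1000) <= (1/3 + \<gamma>) * (1 - pr V (%x. pr V (D x) < 1/3 + \<gamma>))"
  using degD \<nu>\<gamma> \<gamma> by (intro mult_mono) auto
 ultimately have "1/3 * (1 - 1/1000) <= pr2 V D" by (rule order_trans[rotated])
 then show ?thesis by simp
qed

lemma pr3_T: "2/25 <= pr3 V T"
proof -
 let ?N = "%x y. D x y & pr V (T x y) < 1/3 + \<gamma>/2"
 have "4 * \<nu> / \<gamma> <= 4/1000" using \<nu>\<gamma> \<gamma> by (simp add: field_simps)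
 then have "1/4 - 4/1000 <= pr2 V (%x y. D x y & ~ ?N x y)"
  using pr2_split[of V D ?N] pr2_D typ_pairs pr2_mono[of V "%x y. D x y & ?N x y" ?N] by fastforce
 then have "1/3 * (1/4 - 4/1000) <= 1/3 * pr2 V (%x y. D x y & ~ ?N x y)" by simp
 also have "... <= pr3 V (%x y z. (D x y & ~ ?N x y) & T x y z)"
  by (rule pr3_conj2_ge) (use \<gamma> in auto)
 also have "... <= pr3 V T" by (rule pr3_mono) auto
 finally show ?thesis by simp
qed

definition one :: "('a => bool) => 'a => 'a => 'a => bool" where
 "one Y x y z \<longleftrightarrow> (Y x & ~ Y y & ~ Y z) | (~ Y x & Y y & ~ Y z) | (~ Y x & ~ Y y & Y z)"

text \<open>If almost every triple has exactly one vertex in \<open>Y\<close>, then codegrees force \<open>Y\<close> to be larger than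
 a third, while weight one half off \<open>Y\<close> is then too light a fractional cover.\<close>
lemma no_split_aux:
 assumes s: "0 < s" "s <= \<gamma>/1000"
  and Y: "pr3 V (%x y z. T x y z & ~ one Y x y z) <= s"
 shows "1/3 + \<gamma>/4 <= pr V Y"
proof -
 let ?b = "%x y z. T x y z & ~ one Y x y z"
 let ?N = "%x y. ~ Y x & ~ Y y & D x y"
 have "2/25 <= pr3 V T" by (rule pr3_T)
 also have "... <= pr3 V ?b + pr3 V (%x y z. ?N x y | ?N x z | ?N y z)"
  by (rule pr3_union) (auto simp: one_def dest: T_D)
 also have "... <= s + (pr2 V ?N + (pr2 V ?N + pr2 V ?N))"
 proof -
  have "pr3 V (%x y z. ?N x y | ?N x z | ?N y z)
  <= pr3 V (%x y z. ?N x y) + (pr3 V (%x y z. ?N x z) + pr3 V (%x y z. ?N y z))"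
  by (intro order_trans[OF pr3_disj] add_left_mono order_refl)
  moreover have "pr3 V (%x y z. ?N x y) = pr2 V ?N" "pr3 V (%x y z. ?N x z) = pr2 V ?N"
  "pr3 V (%x y z. ?N y z) = pr2 V ?N"
  by (rule pr3_12 pr3_13 pr3_23)+
  ultimately show ?thesis using Y by linarith
 qed
 finally have N: "1/40 <= pr2 V ?N" using s \<gamma> by linarith
 have "pr2 V (%x y. (D x y & pr V (T x y) < 1/3 + \<gamma>/2) | \<gamma>/4 <= pr V (?b x y)) <= 4 * \<nu> / \<gamma> + s / (\<gamma>/4)"
  by (intro order_trans[OF pr2_disj] add_mono typ_pairs markov_pr32[OF Y]) (use \<gamma> in simp)
 also have "... <= 8/1000" using \<nu>\<gamma> s \<gamma> by (simp add: field_simps)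
 finally obtain x y where xy: "x \<in> V" "y \<in> V" "~ Y x" "~ Y y" "D x y" "1/3 + \<gamma>/2 <= pr V (T x y)" "pr V (?b x y) < \<gamma>/4"
  using N ex_of_pr2[of V "%x y. (D x y & pr V (T x y) < 1/3 + \<gamma>/2) | \<gamma>/4 <= pr V (?b x y)" ?N]
  by (auto simp: not_less not_le)
 have "pr V (T x y) <= pr V Y + pr V (?b x y)"
  by (rule pr_union) (use xy in \<open>auto simp: one_def\<close>)
 then show ?thesis using xy by linarith
qed

end

lemma no_split:
 assumes \<gamma>: "0 < \<gamma>" "\<gamma> <= (1::real)"
 shows "\<exists>s0>0. s0 <= \<gamma>/1000 & (\<forall>(V::'a set) h D \<nu> Y. comp0 V h D \<gamma> \<nu> --> 4 * \<nu> / \<gamma> <= s0 -->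
  s0 < pr3 V (%x y z. comp0.T h D x y z & ~ comp0.one Y x y z))"
proof -
 have "\<exists>\<nu>0>0. \<forall>(V::'a set) h D T \<nu> c. trip V h --> trip.fm_hyp V h D T (\<gamma>/2) \<nu> --> 0 < \<nu> --> \<nu> <= \<nu>0 -->
  (\<forall>x\<in>V. 0 <= c x) --> pr3 V (%x y z. T x y z & c x + c y + c z < 1) <= \<nu> --> (1 - \<gamma>/4) / 3 <= avg V c"
  by (rule fractional_cover_bound) (use \<gamma> in auto)
 then obtain \<nu>1 where \<nu>1: "0 < \<nu>1" and fm': "\<forall>(V::'a set) h D T \<nu> c. trip V h --> trip.fm_hyp V h D T (\<gamma>/2) \<nu> --> 0 < \<nu> --> \<nu> <= \<nu>1 -->
  (\<forall>x\<in>V. 0 <= c x) --> pr3 V (%x y z. T x y z & c x + c y + c z < 1) <= \<nu> --> (1 - \<gamma>/4) / 3 <= avg V c"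
  by (elim exE conjE)
 note fm = fm'[rule_format]
 define s0 where "s0 = min \<nu>1 (\<gamma>/1000)"
 have s0: "0 < s0" "s0 <= \<gamma>/1000" "s0 <= \<nu>1" using \<nu>1 \<gamma> unfolding s0_def by auto
 have "s0 < pr3 V (%x y z. comp0.T h D x y z & ~ comp0.one Y x y z)"
  if c0: "comp0 V h D \<gamma> \<nu>" and n: "4 * \<nu> / \<gamma> <= s0" for V :: "'a set" and h D \<nu> Y
 proof (rule ccontr)
  assume neg: "~ ?thesis"
  interpret comp0 V h D \<gamma> \<nu> by fact
  have Y: "pr3 V (%x y z. T x y z & ~ one Y x y z) <= s0" using neg by simp
  have hyp: "fm_hyp D T (\<gamma>/2) s0"
  proof -
  have "1/4 * pr V X * pr V Y * pr V Z - s0 <= pr3 V (%x y z. X x & Y y & Z z & h x y z)" for X Y Z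
  using fm_hyp_T n unfolding fm_hyp_def by (meson diff_left_mono order_trans)
  then show ?thesis using fm_hyp_T n unfolding fm_hyp_def by (meson order_trans)
  qed
  have "(1 - \<gamma>/4) / 3 <= avg V (%x. 1/2 * of_bool (~ Y x))"
  proof (rule fm[OF trip_axioms hyp])
  have "pr3 V (%x y z. T x y z & 1/2 * of_bool (~ Y x) + 1/2 * of_bool (~ Y y) + 1/2 * of_bool (~ Y z) < (1::real))
  <= pr3 V (%x y z. T x y z & ~ one Y x y z)"
  by (rule pr3_mono) (auto simp: one_def of_bool_def split: if_splits)
  then show "pr3 V (%x y z. T x y z & 1/2 * of_bool (~ Y x) + 1/2 * of_bool (~ Y y) + 1/2 * of_bool (~ Y z) < (1::real)) <= s0"
  using Y by linarith
  qed (use s0 in auto)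
  also have "... = 1/2 * pr V (%x. ~ Y x)" unfolding pr_def avg_cmult ..
  also have "... = 1/2 * (1 - pr V Y)" by (simp add: pr_compl)
  \<comment> \<open>A measure of \<open>Y\<close> of at least 1/3 + \<gamma>/4 would leave weight at
    most 1/3 - \<gamma>/8, too little for this bound.\<close>
  finally have "1/3 - \<gamma>/12 <= 1/2 - pr V Y / 2" by (simp add: diff_divide_distrib)
  moreover have "1/3 + \<gamma>/4 <= pr V Y" using no_split_aux[OF s0(1,2) Y] .
  ultimately show False using \<gamma> by linarith
 qed
 then show ?thesis using s0 by blast
qed

section \<open>Tight paths as lists\<close>

fun tpath :: "('a => 'a => 'a => bool) => 'a list => bool" where
 "tpath t (x # y # z # r) \<longleftrightarrow> t x y z & tpath t (y # z # r)"
| "tpath t _ \<longleftrightarrow> True"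

lemma tpath_Cons: "tpath t (x # y # r) \<longleftrightarrow> (r = [] | t x y (hd r)) & tpath t (y # r)"
 by (cases r) auto

text \<open>An overlap in two vertices is enough, as every condition concerns three consecutive
  vertices.\<close>

lemma tpath_join: "tpath t (xs @ [a, b]) ==> tpath t (a # b # ys) ==> tpath t (xs @ a # b # ys)"
proof (induction xs)
 case (Cons x xs)
 show ?case
 proof (cases xs)
  case Nil
  then show ?thesis using Cons by simp
 next
  case (Cons x' xs')
  then show ?thesis using Cons.prems Cons.IH by (cases xs') (auto simp: tpath_Cons)
 qed
qed simp

lemma tpath_short: "length xs <= 2 ==> tpath t xs"
 by (induction t xs rule: tpath.induct) auto

lemma tpath_rev:
 assumes sym: "!!x y z. t x y z ==> t z y x" shows "tpath t xs ==> tpath t (rev xs)"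
proof (induction xs)
 case (Cons x xs)
 show ?case
 proof (cases "length xs < 2")
  case True
  then show ?thesis by (intro tpath_short) simp
 next
  case False
  then obtain y ys where y: "xs = y # ys" by (cases xs) auto
  with False obtain z zs where z: "ys = z # zs" by (cases ys) auto
  have p: "t x y z" "tpath t xs" using Cons.prems unfolding y z by simp_all
  have q: "tpath t (rev zs @ [z, y])" using Cons.IH[OF p(2)] unfolding y z by simp
  have "tpath t (rev zs @ z # y # [x])" by (rule tpath_join[OF q]) (simp add: sym[OF p(1)])
  then show ?thesis unfolding y z by simp
 qed
qed simp

lemma tpath_mono:
 assumes "!!x y z. t x y z ==> u x y z" shows "tpath t xs ==> tpath u xs"
proof (induction xs)
 case (Cons x xs)
 show ?case
 proof (cases "length xs < 2")
  case True
  then show ?thesis by (intro tpath_short) simp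
 next
  case False
  then obtain y ys where y: "xs = y # ys" by (cases xs) auto
  with False obtain z zs where z: "ys = z # zs" by (cases ys) auto
  have p: "t x y z" "tpath t xs" using Cons.prems unfolding y z by simp_all
  show ?thesis using assms[OF p(1)] Cons.IH[OF p(2)] unfolding y z by simp
 qed
qed simp

lemma tpath_nth: "tpath t xs ==> i + 2 < length xs ==> t (xs ! i) (xs ! (i+1)) (xs ! (i+2))"
proof (induction xs arbitrary: i)
 case (Cons x xs)
 obtain y ys where y: "xs = y # ys" using Cons.prems(2) by (cases xs) auto
 obtain z zs where z: "ys = z # zs" using Cons.prems(2) unfolding y by (cases ys) auto
 have p: "t x y z" "tpath t xs" using Cons.prems unfolding y z by simp_all
 show ?case
 proof (cases i)
  case 0 then show ?thesis using p(1) unfolding y z by simp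
 next
  case (Suc j) then show ?thesis using Cons.IH[OF p(2), of j] Cons.prems(2) by simp
 qed
qed simp

definition nx :: "nat => nat" where "nx p = (p + 1) mod 3"

lemma nx_simps [simp]: "nx 0 = 1" "nx (Suc 0) = 2" "nx 2 = 0"
 by (auto simp: nx_def)

lemma less3: "(\<forall>p<3. P p) \<longleftrightarrow> P 0 & P (Suc 0) & P (2::nat)"
proof -
 have "{..<3::nat} = {0, Suc 0, 2}" by auto
 then have "(\<forall>p\<in>{..<3}. P p) \<longleftrightarrow> (\<forall>p\<in>{0, Suc 0, 2}. P p)" by simp
 then show ?thesis by (simp add: Ball_def all_conj_distrib)
qed

section \<open>Walk states modulo 3 over the pairs of the component\<close>

locale comp1 = comp0 V h D \<gamma> \<nu> for V :: "'a set" and h D \<gamma> \<nu> +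
 fixes s0 \<kappa> e :: real
 assumes nosplit: "s0 < pr3 V (%x y z. T x y z & ~ one Y x y z)"
  and expand: "grel Q ==> (!!x y. Q x y ==> D x y) ==> cut Q <= e ==>
  pr2 V Q <= \<kappa> | pr2 V (%x y. D x y & ~ Q x y) <= \<kappa>"
  and s0: "0 < s0" "s0 <= \<gamma>/1000"
  and \<kappa>: "0 < \<kappa>" "\<kappa> <= \<gamma> * (s0/20)^3 / 1000"
  and \<nu>s: "\<nu> <= \<gamma> * (s0/20)^3 / 1000" and \<nu>e: "\<nu> <= e / 4" and e: "0 < e"
begin

text \<open>A state \<open>(p, x, y)\<close> is an ordered pair with the length of a walk modulo 3,
  and \<open>R\<close> stands for a set of states. Following the triple \<open>xyz\<close> moves the
  state to \<open>(p + 1, y, z)\<close>; the relation says that this step neither leaves nor enters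
  \<open>R\<close>.\<close>

definition flow :: "(nat => 'a => 'a => bool) => 'a => 'a => 'a => bool" where
 "flow R x y z \<longleftrightarrow> (\<forall>p<3. R p x y = R (nx p) y z)"

definition good :: "(nat => 'a => 'a => bool) => 'a => 'a => 'a => bool" where
 "good R x y z \<longleftrightarrow> T x y z & flow R x y z & flow R x z y & flow R y x z & flow R y z x & flow R z x y & flow R z y x"

text \<open>An invariant of the unordered pair, between 0 for a pair that is never reached and 6 for
  one reached in both orders with every residue.\<close>

definition fib :: "(nat => 'a => 'a => bool) => 'a => 'a => nat" where
 "fib R x y = of_bool (R 0 x y) + of_bool (R 1 x y) + of_bool (R 2 x y)
  + of_bool (R 0 y x) + of_bool (R 1 y x) + of_bool (R 2 y x)"

lemma good_perm: "good R x y z \<longleftrightarrow> good R y x z" "good R x y z \<longleftrightarrow> good R x z y" "good R x y z \<longleftrightarrow> good R z y x"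
 "good R x y z \<longleftrightarrow> good R y z x" "good R x y z \<longleftrightarrow> good R z x y"
proof -
 have s1: "good R y x z" if "good R x y z" for x y z
  using that T_perm(1)[of x y z] unfolding good_def by simp
 have s2: "good R x z y" if "good R x y z" for x y z
  using that T_perm(2)[of x y z] unfolding good_def by simp
 have e1: "good R x y z = good R y x z" for x y z by (rule iffI; rule s1; assumption)
 have e2: "good R x y z = good R x z y" for x y z by (rule iffI; rule s2; assumption)
 show "good R x y z \<longleftrightarrow> good R y x z" by (rule e1)
 show "good R x y z \<longleftrightarrow> good R x z y" by (rule e2)
 show "good R x y z \<longleftrightarrow> good R z y x" by (rule trans[OF e1 trans[OF e2 e1]])
 show "good R x y z \<longleftrightarrow> good R y z x" by (rule trans[OF e1 e2])
 show "good R x y z \<longleftrightarrow> good R z x y" by (rule trans[OF e2 e1])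
qed

lemma fib_sym: "fib R x y = fib R y x"
 unfolding fib_def by simp

lemma fib_le: "fib R x y <= 6"
 and fib_less: "p < 3 ==> ~ R p x y ==> fib R x y < 6"
 and fib_pos: "p < 3 ==> R p x y ==> 1 <= fib R x y"
proof -
 have ob: "of_bool b <= (1::nat)" for b by simp
 note o = ob[of "R 0 x y"] ob[of "R 1 x y"] ob[of "R 2 x y"] ob[of "R 0 y x"] ob[of "R 1 y x"] ob[of "R 2 y x"]
 show "fib R x y <= 6" using o unfolding fib_def by linarith
 have p: "p = 0 | p = 1 | p = 2" if "p < 3" for p :: nat using that by auto
 show "fib R x y < 6" if "p < 3" "~ R p x y"
  using p[OF that(1)]
 proof (elim disjE)
  assume "p = 0" then have "of_bool (R 0 x y) = (0::nat)" using that by simp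
  then show ?thesis using o unfolding fib_def by linarith
 next
  assume "p = 1" then have "of_bool (R 1 x y) = (0::nat)" using that by simp
  then show ?thesis using o unfolding fib_def by linarith
 next
  assume "p = 2" then have "of_bool (R 2 x y) = (0::nat)" using that by simp
  then show ?thesis using o unfolding fib_def by linarith
 qed
 show "1 <= fib R x y" if "p < 3" "R p x y"
  using p[OF that(1)]
 proof (elim disjE)
  assume "p = 0" then have "of_bool (R 0 x y) = (1::nat)" using that by simp
  then show ?thesis unfolding fib_def by linarith
 next
  assume "p = 1" then have "of_bool (R 1 x y) = (1::nat)" using that by simp
  then show ?thesis unfolding fib_def by linarith
 next
  assume "p = 2" then have "of_bool (R 2 x y) = (1::nat)" using that by simp
  then show ?thesis unfolding fib_def by linarith
 qed
qed

lemma flowD: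
 assumes "flow R x y z"
 shows "R 0 x y = R 1 y z" "R 1 x y = R 2 y z" "R 2 x y = R 0 y z"
 using assms unfolding flow_def less3 by simp_all

text \<open>Along a good triple the steps match the six states over one pair bijectively with the
  six over another: forwards for one order of the pair, backwards for the other.\<close>

lemma fib_good:
 assumes "good R x y z" shows "fib R x y = fib R y z & fib R x y = fib R x z"
proof -
 have f: "flow R x y z" "flow R z y x" "flow R y x z" "flow R z x y"
  using assms unfolding good_def by blast+
 have "fib R x y = fib R y z"
  unfolding fib_def flowD[OF f(1)] flowD[OF f(2), symmetric] by simp
 moreover have "fib R x y = fib R x z"
  unfolding fib_def flowD[OF f(3)] flowD[OF f(4), symmetric] by simp
 ultimately show ?thesis ..
qed

text \<open>In- and out-degrees of the walk digraph agree, so an almost out-closed set is almost in-closed.\<close>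
lemma not_good:
 assumes out: "!!p. p < 3 ==> pr3 V (%x y z. T x y z & R p x y & ~ R (nx p) y z) <= \<delta>"
 shows "pr3 V (%x y z. T x y z & ~ good R x y z) <= 72 * \<delta>"
proof -
 define o1 where "o1 = (%p. pr3 V (%x y z. T x y z & R p x y & ~ R (nx p) y z))"
 define i1 where "i1 = (%p. pr3 V (%x y z. T x y z & ~ R p x y & R (nx p) y z))"
 define r where "r = (%p. pr3 V (%x y z. T x y z & R p x y))"
 have r2: "pr3 V (%x y z. T x y z & R q y z) = r q" for q
 proof -
  have "pr3 V (%x y z. T x y z & R q y z) = pr3 V (%x y z. T y z x & R q y z)"
  proof (rule pr3_cong)
  fix x y z show "(T x y z & R q y z) = (T y z x & R q y z)" using T_perm(4)[of x y z] by simp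
  qed
  also have "... = r q" unfolding r_def by (rule pr3_rot(1))
  finally show ?thesis .
 qed
 have bal: "r p - o1 p = r (nx p) - i1 p" for p
 proof -
  have "r p = pr3 V (%x y z. (T x y z & R p x y) & R (nx p) y z) + pr3 V (%x y z. (T x y z & R p x y) & ~ R (nx p) y z)"
  unfolding r_def by (rule pr3_split)
  moreover have "r (nx p) = pr3 V (%x y z. (T x y z & R (nx p) y z) & R p x y) + pr3 V (%x y z. (T x y z & R (nx p) y z) & ~ R p x y)"
  unfolding r2[symmetric] by (rule pr3_split)
  moreover have "pr3 V (%x y z. (T x y z & R p x y) & R (nx p) y z) = pr3 V (%x y z. (T x y z & R (nx p) y z) & R p x y)"
  "pr3 V (%x y z. (T x y z & R p x y) & ~ R (nx p) y z) = o1 p"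
  "pr3 V (%x y z. (T x y z & R (nx p) y z) & ~ R p x y) = i1 p"
  unfolding o1_def i1_def by (intro pr3_cong; blast)+
  ultimately show ?thesis by linarith
 qed
 have o: "o1 0 <= \<delta>" "o1 1 <= \<delta>" "o1 2 <= \<delta>" using out[of 0] out[of 1] out[of 2] unfolding o1_def by auto
 have ip: "0 <= i1 0" "0 <= i1 1" "0 <= i1 2" unfolding i1_def by auto
 have isum: "o1 0 + o1 1 + o1 2 = i1 0 + i1 1 + i1 2"
  using bal[of 0] bal[of 1] bal[of 2] by simp
 have nf: "pr3 V (%x y z. T x y z & ~ flow R x y z) <= 12 * \<delta>"
 proof -
  let ?c = "%p x y z. (T x y z & R p x y & ~ R (nx p) y z) | (T x y z & ~ R p x y & R (nx p) y z)"
  have c: "pr3 V (?c p) <= o1 p + i1 p" for p unfolding o1_def i1_def by (rule pr3_disj)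
  have "pr3 V (%x y z. T x y z & ~ flow R x y z) <= pr3 V (%x y z. ?c 0 x y z | ?c 1 x y z | ?c 2 x y z)"
  by (rule pr3_mono) (auto simp: flow_def less3)
  also have "... <= pr3 V (?c 0) + (pr3 V (?c 1) + pr3 V (?c 2))"
  by (intro order_trans[OF pr3_disj] add_left_mono order_refl)
  also have "... <= (o1 0 + i1 0) + ((o1 1 + i1 1) + (o1 2 + i1 2))"
  by (intro add_mono c)
  finally show ?thesis using o ip isum by linarith
 qed
 let ?f = "%x y z. T x y z & ~ flow R x y z"
 have "pr3 V (%x y z. T x y z & ~ good R x y z) <= pr3 V (%x y z. ?f x y z | ?f x z y | ?f y x z | ?f y z x | ?f z x y | ?f z y x)"
 proof (rule pr3_mono)
  fix x y z assume a: "T x y z & ~ good R x y z"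
  then show "?f x y z | ?f x z y | ?f y x z | ?f y z x | ?f z x y | ?f z y x"
  using T_perm[of x y z] unfolding good_def by simp
 qed
 also have "... <= pr3 V ?f + (pr3 V (%x y z. ?f x z y) + (pr3 V (%x y z. ?f y x z) + (pr3 V (%x y z. ?f y z x)
  + (pr3 V (%x y z. ?f z x y) + pr3 V (%x y z. ?f z y x)))))"
  by (intro order_trans[OF pr3_disj] add_left_mono order_refl)
 also have "... = 6 * pr3 V ?f"
  using pr3_swap12[of V ?f] pr3_swap23[of V ?f] pr3_swap13[of V ?f] pr3_rot[of V ?f] by simp
 finally show ?thesis using nf by linarith
qed

text \<open>Good triples have the same value of \<open>fib\<close> on all their pairs, so only
  exceptional triples and edges leaving the component contribute to the boundary of a superlevel
  set.\<close>

lemma cut_level: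
 assumes ng: "pr3 V (%x y z. T x y z & ~ good R x y z) <= b" and b: "b <= e/2"
 shows "cut (%x y. D x y & k <= fib R x y) <= e"
proof -
 have "cut (%x y. D x y & k <= fib R x y) <= pr3 V (%x y z. h x y z & D x y & ~ T x y z)
  + pr3 V (%x y z. T x y z & ~ good R x y z)"
  unfolding cut_def
 proof (rule pr3_union)
  fix x y z assume a: "h x y z & (D x y & k <= fib R x y) & ~ (D x z & k <= fib R x z)"
  show "(h x y z & D x y & ~ T x y z) | (T x y z & ~ good R x y z)"
  proof (cases "T x y z & good R x y z")
  case True
  then have "D x z" "fib R x y = fib R x z" using T_D fib_good by blast+
  then show ?thesis using a by simp
  qed (use a in blast)
 qed
 then show ?thesis using nonT ng b \<nu>e by linarith
qed

text \<open>By expansion each superlevel set of \<open>fib\<close> is almost empty or almost all of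
  \<open>D\<close>, so \<open>fib\<close> is almost constant. The value 6 is the desired outcome,
  and 0 contradicts \<open>start\<close>.\<close>

lemma constant_fibre:
 assumes ng: "pr3 V (%x y z. T x y z & ~ good R x y z) <= b" and b: "b <= e/2"
  and start: "\<exists>p<3. \<kappa> < pr2 V (%x y. D x y & R p x y)"
 obtains "!!p. p < 3 ==> pr2 V (%x y. D x y & ~ R p x y) <= \<kappa>"
 | k where "1 <= k" "k <= 5" "pr2 V (%x y. D x y & fib R x y ~= k) <= 2 * \<kappa>"
proof -
 define Q where "Q = (%k x y. D x y & k <= fib R x y)"
 have Q: "pr2 V (Q k) <= \<kappa> | pr2 V (%x y. D x y & ~ Q k x y) <= \<kappa>" for k
 proof (rule expand)
  show "grel (Q k)" unfolding Q_def grel_def using D_sym D_neq fib_sym by metis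
  show "cut (Q k) <= e" unfolding Q_def using cut_level[OF ng b] .
 qed (auto simp: Q_def)
 define P where "P = (%k. pr2 V (%x y. D x y & ~ Q k x y) <= \<kappa>)"
 have P0: "P 0"
 proof -
  have "pr2 V (%x y. D x y & ~ Q 0 x y) = pr2 V (%x y. False)" unfolding Q_def by (intro pr2_cong) auto
  then show ?thesis unfolding P_def using \<kappa> by (simp add: pr2_def)
 qed
 show ?thesis
 proof (cases "P 6")
  case True
  have "pr2 V (%x y. D x y & ~ R p x y) <= \<kappa>" if "p < 3" for p
  proof -
  have "pr2 V (%x y. D x y & ~ R p x y) <= pr2 V (%x y. D x y & ~ Q 6 x y)"
  proof (rule pr2_mono)
  fix x y assume a: "D x y & ~ R p x y"
  then have "fib R x y < 6" using fib_less[OF that] by blast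
  then show "D x y & ~ Q 6 x y" using a unfolding Q_def by simp
  qed
  then show ?thesis using True unfolding P_def by linarith
  qed
  then show ?thesis using that(1) by blast
 next
  case False
  define k where "k = (GREATEST k. P k & k <= 6)"
  have k: "P k & k <= 6" unfolding k_def by (rule GreatestI_nat[of _ 0 6]) (use P0 in auto)
  have kmax: "!!j. P j & j <= 6 ==> j <= k" unfolding k_def by (rule Greatest_le_nat[of _ _ 6]) auto
  have "k ~= 6" using k False by blast
  then have k5: "k <= 5" using k by linarith
  then have "~ P (Suc k)" using kmax[of "Suc k"] by auto
  then have q: "pr2 V (Q (Suc k)) <= \<kappa>" using Q unfolding P_def by blast
  have "k ~= 0"
  proof
  assume "k = 0"
  obtain p where p: "p < 3" "\<kappa> < pr2 V (%x y. D x y & R p x y)" using start by blast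
  have "pr2 V (%x y. D x y & R p x y) <= pr2 V (Q (Suc k))"
  proof (rule pr2_mono)
  fix x y assume a: "D x y & R p x y"
  then have "1 <= fib R x y" using fib_pos[OF p(1)] by blast
  then show "Q (Suc k) x y" using a \<open>k = 0\<close> unfolding Q_def by simp
  qed
  then show False using p(2) q by linarith
  qed
  moreover have "pr2 V (%x y. D x y & fib R x y ~= k) <= pr2 V (%x y. D x y & ~ Q k x y) + pr2 V (Q (Suc k))"
  by (rule pr2_union) (auto simp: Q_def)
  ultimately show ?thesis using that(2)[of k] k5 k q unfolding P_def by linarith
 qed
qed

end

section \<open>Connecting pairs\<close>

lemma nx_less: "nx p < 3"
 unfolding nx_def by simp

lemma nx3: "p < 3 ==> nx (nx (nx p)) = p"
proof -
 assume "p < 3"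
 then have "p = 0 | p = 1 | p = 2" by auto
 then show ?thesis by auto
qed

lemma nx_mod: "nx (n mod 3) = Suc n mod 3"
 unfolding nx_def by (simp add: mod_simps)

context comp1
begin

text \<open>Over one pair, the residues belonging to \<open>xy\<close> and those belonging to
  \<open>yx\<close> are two subsets of Z/3. For \<open>arc\<close> the second is the first shifted
  by one, for \<open>zer\<close> the two agree. If the fibre is neither empty nor full,
  \<open>arc\<close> is a genuine orientation.\<close>

definition arc :: "(nat => 'a => 'a => bool) => nat => 'a => 'a => bool" where
 "arc R k x y \<longleftrightarrow> D x y & fib R x y = k & (\<forall>p<3. R p x y = R (nx p) y x)"

definition zer :: "(nat => 'a => 'a => bool) => nat => 'a => 'a => bool" where
 "zer R k x y \<longleftrightarrow> D x y & fib R x y = k & (\<forall>p<3. R p x y = R p y x)"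

definition good2 :: "(nat => 'a => 'a => bool) => nat => 'a => 'a => 'a => bool" where
 "good2 R k x y z \<longleftrightarrow> good R x y z & fib R x y = k & fib R y z = k & fib R x z = k"

definition apx :: "(nat => 'a => 'a => bool) => nat => 'a => 'a => 'a => bool" where
 "apx R k x y z \<longleftrightarrow> arc R k x y & arc R k z y & zer R k x z"

definition apxd :: "(nat => 'a => 'a => bool) => nat => 'a => 'a => 'a => bool" where
 "apxd R k x y z \<longleftrightarrow> apx R k x y z | apx R k y x z | apx R k x z y"

lemma good2_12: "good2 R k x y z ==> good2 R k y x z"
 using good_perm(1)[of R x y z] fib_sym[of R x y] unfolding good2_def by simp

lemma good2_23: "good2 R k x y z ==> good2 R k x z y"
 using good_perm(2)[of R x y z] fib_sym[of R z y] unfolding good2_def by simp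

lemma flow1: "flow R x y z ==> p < 3 ==> R p x y = R (nx p) y z"
 unfolding flow_def by blast

lemma good2_flow:
 assumes "good2 R k x y z"
 shows "flow R x y z" "flow R x z y" "flow R y x z" "flow R y z x" "flow R z x y" "flow R z y x"
 using assms unfolding good2_def good_def by blast+

text \<open>Turning around \<open>y\<close> through the ordered pairs \<open>xy\<close>,
  \<open>yz\<close>, \<open>zw\<close>, \<open>wy\<close>, \<open>yx\<close> takes four steps, which
  add 1 to the residue.\<close>

lemma arcI:
 assumes g1: "good2 R k x y z" and g2: "good2 R k y z w" and g3: "good2 R k y x w"
 shows "arc R k x y"
proof -
 have "R p x y = R (nx p) y x" if p: "p < 3" for p
 proof -
  have "R p x y = R (nx p) y z" by (rule flow1[OF good2_flow(1)[OF g1] p])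
  also have "... = R (nx (nx p)) z w" by (rule flow1[OF good2_flow(1)[OF g2] nx_less])
  also have "... = R (nx (nx (nx p))) w y" by (rule flow1[OF good2_flow(4)[OF g2] nx_less])
  also have "... = R p w y" by (simp only: nx3[OF p])
  also have "... = R (nx p) y x" by (rule flow1[OF good2_flow(5)[OF g3] p])
  finally show ?thesis .
 qed
 moreover have "D x y" "fib R x y = k" using g1 T_D unfolding good2_def good_def by blast+
 ultimately show ?thesis unfolding arc_def by blast
qed

text \<open>Two of the three codegree sets of a triple share a vertex \<open>w\<close>; walking around the three
 triples through \<open>y\<close> swaps the roles of the other two vertices.\<close>
lemma apexI:
 assumes g1: "good2 R k x y z" and g2: "good2 R k y z w" and g3: "good2 R k y x w"
 shows "apx R k x y z"
proof -
 have a1: "arc R k x y" by (rule arcI[OF g1 g2 g3])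
 have a2: "arc R k z y" by (rule arcI[OF good2_12[OF good2_23[OF good2_12[OF g1]]] g3 g2])
 have "R p x z = R p z x" if p: "p < 3" for p
 proof -
  have "R p x z = R (nx p) z y" by (rule flow1[OF good2_flow(2)[OF g1] p])
  also have "... = R (nx (nx p)) y z" using a2 nx_less[of p] unfolding arc_def by blast
  also have "... = R (nx (nx (nx p))) z x" by (rule flow1[OF good2_flow(4)[OF g1] nx_less])
  also have "... = R p z x" by (simp only: nx3[OF p])
  finally show ?thesis .
 qed
 moreover have "D x z" "fib R x z = k" using g1 T_D unfolding good2_def good_def by blast+
 ultimately show ?thesis using a1 a2 unfolding apx_def zer_def by blast
qed

lemma fib_const:
 assumes "R 1 x y = R 0 x y" "R 2 x y = R 0 x y" "R 0 y x = R 0 x y" "R 1 y x = R 0 x y" "R 2 y x = R 0 x y"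
 shows "fib R x y = 0 | fib R x y = 6"
 unfolding fib_def assms by simp

text \<open>Two of these relations at once make the set of residues invariant under a nonzero shift
  of Z/3, so that the fibre is empty or full.\<close>

lemma arc_excl:
 assumes k: "1 <= k" "k <= (5::nat)"
 shows "~ (arc R k x y & arc R k y x)" "~ (arc R k x y & zer R k x y)" "~ (arc R k x y & zer R k y x)"
proof -
 have a: "fib R x y = k" "R 0 x y = R 1 y x" "R 1 x y = R 2 y x" "R 2 x y = R 0 y x" if "arc R k x y" for x y
  using that unfolding arc_def less3 by simp_all
 have z: "R 0 x y = R 0 y x" "R 1 x y = R 1 y x" "R 2 x y = R 2 y x" if "zer R k x y" for x y
  using that unfolding zer_def less3 by simp_all
 show "~ (arc R k x y & arc R k y x)"
 proof
  assume b: "arc R k x y & arc R k y x"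
  note e = a(2-4)[OF conjunct1[OF b]] a(2-4)[OF conjunct2[OF b]]
  have "fib R x y = 0 | fib R x y = 6" by (rule fib_const) (use e in argo)+
  then show False using a(1) b k by auto
 qed
 have *: False if b: "arc R k x y" and c: "R 0 x y = R 0 y x" "R 1 x y = R 1 y x" "R 2 x y = R 2 y x"
 proof -
  note e = a(2-4)[OF b] c
  have "fib R x y = 0 | fib R x y = 6" by (rule fib_const) (use e in argo)+
  then show False using a(1)[OF b] k by auto
 qed
 show "~ (arc R k x y & zer R k x y)" using *[OF _ z(1) z(2) z(3)] by blast
 show "~ (arc R k x y & zer R k y x)"
  using *[OF _ z(1)[symmetric] z(2)[symmetric] z(3)[symmetric]] by blast
qed

text \<open>In a typical triple the three codegree sets have total measure above 1, so two of them
  share a vertex \<open>w\<close>; \<open>apexI\<close> then applies at the common vertex of the two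
  pairs concerned.\<close>

lemma apex_almost_all:
 assumes ng: "pr3 V (%x y z. T x y z & ~ good R x y z) <= b" and b: "b <= \<gamma> * (s0/20)^3 / 1000"
  and k: "pr2 V (%x y. D x y & fib R x y ~= k) <= 2 * \<kappa>"
 shows "pr3 V (%x y z. T x y z & ~ apxd R k x y z) <= (s0/20)^3 / 4"
proof -
 define s where "s = s0 / 20"
 define B where "B = (%x y z. T x y z & ~ good2 R k x y z)"
 let ?f = "%x y. D x y & fib R x y ~= k"
 have "pr3 V B <= pr3 V (%x y z. T x y z & ~ good R x y z) + pr3 V (%x y z. ?f x y | ?f y z | ?f x z)"
  unfolding B_def by (rule pr3_union) (auto simp: good2_def dest: T_D)
 also have "... <= b + (pr3 V (%x y z. ?f x y) + (pr3 V (%x y z. ?f y z) + pr3 V (%x y z. ?f x z)))"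
  by (intro order_trans[OF pr3_disj] add_mono add_left_mono order_refl ng)
 also have "... = b + 3 * pr2 V ?f"
  unfolding pr3_12[of ?f] pr3_23[of ?f] pr3_13[of ?f] by simp
 finally have B: "pr3 V B <= 7 * \<gamma> * s^3 / 1000"
  using b k \<kappa> unfolding s_def by linarith
 define N where "N = (%x y. (D x y & pr V (T x y) < 1/3 + \<gamma>/2) | \<gamma>/6 <= pr V (B x y))"
 have "pr2 V N <= 4 * \<nu> / \<gamma> + (7 * \<gamma> * s^3 / 1000) / (\<gamma>/6)"
  unfolding N_def by (intro order_trans[OF pr2_disj] add_mono typ_pairs markov_pr32[OF B]) (use \<gamma> in simp)
 also have "... <= 4 * s^3 / 1000 + 42 * s^3 / 1000"
  using \<nu>s \<gamma> unfolding s_def by (intro add_mono) (auto simp: field_simps)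
 finally have N: "pr2 V N <= 46 * s^3 / 1000" by simp
 have deg: "1/3 + \<gamma>/3 <= pr V (good2 R k x y)" if "x \<in> V" "y \<in> V" "D x y" "~ N x y" for x y
  using pr_diff_ge[of V "T x y" "B x y" "good2 R k x y"] that unfolding N_def B_def by auto
 have "pr3 V (%x y z. T x y z & ~ apxd R k x y z) <= pr3 V B + pr3 V (%x y z. N x y | N y z | N x z)"
 proof (rule pr3_union)
  fix x y z assume xyz: "x \<in> V" "y \<in> V" "z \<in> V" and a: "T x y z & ~ apxd R k x y z"
  show "B x y z | N x y | N y z | N x z"
  proof (rule ccontr)
  assume n: "~ ?thesis"
  have g: "good2 R k x y z" using n a unfolding B_def by blast
  have DD: "D x y" "D x z" "D y z" using a T_D by blast+
  have "1 < pr V (good2 R k x y) + pr V (good2 R k y z) + pr V (good2 R k x z)"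
  using deg[OF xyz(1,2) DD(1)] deg[OF xyz(2,3) DD(3)] deg[OF xyz(1,3) DD(2)] n \<gamma> by linarith
  then obtain w where w: "w \<in> V" "good2 R k x y w & good2 R k y z w | good2 R k x y w & good2 R k x z w
  | good2 R k y z w & good2 R k x z w"
  using pr_sum3[of "good2 R k x y" "good2 R k y z" "good2 R k x z"] by auto
  from w(2) have "apxd R k x y z"
  proof (elim disjE conjE)
  assume "good2 R k x y w" "good2 R k y z w"
  then show ?thesis unfolding apxd_def using apexI[OF g, of w] good2_12 by blast
  next
  assume "good2 R k x y w" "good2 R k x z w"
  then show ?thesis unfolding apxd_def using apexI[OF good2_12[OF g], of w] by blast
  next
  assume "good2 R k y z w" "good2 R k x z w"
  then show ?thesis unfolding apxd_def using apexI[OF good2_23[OF g], of w] good2_12 by blast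
  qed
  then show False using a by blast
  qed
 qed
 also have "... <= 7 * \<gamma> * s^3 / 1000 + (pr3 V (%x y z. N x y) + (pr3 V (%x y z. N y z) + pr3 V (%x y z. N x z)))"
  by (intro order_trans[OF pr3_disj] add_mono add_left_mono order_refl B)
 also have "... = 7 * \<gamma> * s^3 / 1000 + 3 * pr2 V N"
  unfolding pr3_12[of N] pr3_23[of N] pr3_13[of N] by simp
 also have "... <= 7 * s^3 / 1000 + 3 * (46 * s^3 / 1000)"
 proof -
  have "0 < s" using s0 unfolding s_def by simp
  then have "\<gamma> * s^3 <= 1 * s^3" using \<gamma> by (intro mult_right_mono) auto
  then show ?thesis using N by simp
 qed
 also have "... <= s^3 / 4"
 proof -
  have "0 < s" using s0 unfolding s_def by simp
  then show ?thesis by simp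
 qed
 finally show ?thesis unfolding s_def .
qed

text \<open>Suppose almost all triples have an apex. An out-neighbour \<open>c\<close> of
  \<open>y\<close> is then the apex of most triples over \<open>yc\<close>, which gives
  \<open>y\<close> many neutral neighbours; a neutral neighbour gives many out-neighbours; an
  in-neighbour gives many in-neighbours. A typical vertex with noticeable in- and out-degree would
  thus have three disjoint neighbourhoods above 1/3. So almost all arcs run from vertices with
  out-arcs to vertices with hardly any, and the latter meet almost every triple exactly once, in its
  apex. This is the pattern that \<open>nosplit\<close> forbids.\<close>

lemma fibre_not_constant:
 assumes ng: "pr3 V (%x y z. T x y z & ~ good R x y z) <= b" and b: "b <= \<gamma> * (s0/20)^3 / 1000"
  and k: "1 <= k" "k <= 5" and kf: "pr2 V (%x y. D x y & fib R x y ~= k) <= 2 * \<kappa>"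
 shows False
proof -
 define s where "s = s0 / 20"
 have s: "0 < s" "s <= \<gamma>/20000" "s < 1" using s0 \<gamma> unfolding s_def by auto
 define U where "U = (%x y z. T x y z & ~ apxd R k x y z)"
 have U: "pr3 V U <= s^3/4"
  using apex_almost_all[OF ng b kf] unfolding U_def s_def .
 define lo where "lo = (%y b. D y b & pr V (T y b) < 1/3 + \<gamma>/2)"
 define bd where "bd = (%y. s^2 <= pr2 V (U y) | s/2 <= pr V (lo y))"
 have bd: "pr V bd <= s/2"
 proof -
  have "pr V bd <= (s^3/4)/s^2 + (4 * \<nu> / \<gamma>) / (s/2)"
  unfolding bd_def lo_def
  by (intro order_trans[OF pr_disj] add_mono markov_pr3[OF U] markov_pr2[OF typ_pairs]) (use s in auto)
  also have "... <= s/4 + s/4"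
  proof (rule add_mono)
  show "(s^3/4)/s^2 <= s/4" using s by (simp add: power3_eq_cube power2_eq_square)
  have "4 * \<nu> / \<gamma> <= 4 * s^3 / 1000" using \<nu>s \<gamma> unfolding s_def by (simp add: field_simps)
  then have "(4 * \<nu> / \<gamma>) / (s/2) <= (4 * s^3 / 1000) / (s/2)" using s by (intro divide_right_mono) auto
  also have "... = s * s * (8/1000)" using s by (simp add: power3_eq_cube)
  also have "... <= s * 1 * (8/1000)" using s by (intro mult_right_mono mult_left_mono) auto
  also have "... <= s/4" using s by simp
  finally show "(4 * \<nu> / \<gamma>) / (s/2) <= s/4" .
  qed
  finally show ?thesis by simp
 qed
 \<comment> \<open>From a set \<open>B\<close> of neighbours of one type, larger than the error, a
   typical \<open>c\<close> is chosen; nearly all triples \<open>ycz\<close> have an apex, which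
   determines the type of the pair \<open>yz\<close>.\<close>
 have step: "1/3 + \<gamma>/4 <= pr V P"
  if y: "y \<in> V" "~ bd y" and B: "s < pr V B" "!!c. B c ==> D y c"
  and P: "!!c z. c \<in> V ==> z \<in> V ==> B c ==> apxd R k y c z ==> P z" for y B P
 proof -
  have "s - s/2 < pr V B - pr V (lo y)" using y B unfolding bd_def by linarith
  also have "... <= pr V (%c. B c & ~ lo y c)" by (rule pr_diff_ge) auto
  finally have m: "s/2 < pr V (%c. B c & ~ lo y c)" by simp
  have "\<exists>c\<in>V. B c & ~ lo y c & pr V (U y c) < 2 * s"
  proof (rule ccontr)
  assume "~ ?thesis"
  then have "!!c. c \<in> V ==> B c & ~ lo y c ==> 2 * s <= pr V (U y c)" by force
  then have "2 * s * pr V (%c. B c & ~ lo y c) <= pr2 V (%c z. (B c & ~ lo y c) & U y c z)"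
  by (rule pr2_conj_ge)
  also have "... <= pr2 V (U y)" by (rule pr2_mono) auto
  also have "... < s^2" using y unfolding bd_def by simp
  finally have "s * (2 * pr V (%c. B c & ~ lo y c)) < s * s" by (simp add: power2_eq_square mult.commute mult.left_commute)
  then show False using m s by (simp add: mult_less_cancel_left_pos)
  qed
  then obtain c where c: "c \<in> V" "B c" "~ lo y c" "pr V (U y c) < 2 * s" by blast
  have "pr V (T y c) <= pr V P + pr V (U y c)"
  by (rule pr_union) (use c P in \<open>auto simp: U_def\<close>)
  moreover have "1/3 + \<gamma>/2 <= pr V (T y c)" using c B(2)[OF c(2)] unfolding lo_def by simp
  ultimately show ?thesis using c(4) s by linarith
 qed
 note ex1 = arc_excl[OF k, of R]
 \<comment> \<open>Vertices with hardly any outgoing arcs, the candidates for apexes.\<close>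
 define Y where "Y = (%y. pr V (arc R k y) <= s)"
 have inle: "pr V (%x. arc R k x y) <= s" if y: "y \<in> V" "~ bd y" "~ Y y" for y
 proof (rule ccontr)
  assume n: "~ ?thesis"
  have E: "1/3 + \<gamma>/4 <= pr V (zer R k y)"
  proof (rule step[OF y(1,2), of "arc R k y"])
  show "zer R k y z" if "arc R k y c" "apxd R k y c z" for c z
  using that ex1(1)[of y c] ex1(2)[of y c] unfolding apxd_def apx_def by blast
  qed (use y in \<open>auto simp: Y_def arc_def\<close>)
  have O: "1/3 + \<gamma>/4 <= pr V (arc R k y)"
  proof (rule step[OF y(1,2), of "zer R k y"])
  show "arc R k y z" if "zer R k y c" "apxd R k y c z" for c z
  using that ex1(2)[of y c] ex1(3)[of c y] unfolding apxd_def apx_def by blast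
  qed (use E s \<gamma> in \<open>auto simp: zer_def\<close>)
  have I: "1/3 + \<gamma>/4 <= pr V (%x. arc R k x y)"
  proof (rule step[OF y(1,2), of "%x. arc R k x y"])
  show "arc R k z y" if "arc R k c y" "apxd R k y c z" for c z
  using that ex1(1)[of y c] ex1(3)[of c y] unfolding apxd_def apx_def by blast
  qed (use n D_sym in \<open>auto simp: arc_def\<close>)
  have "1 < pr V (zer R k y) + pr V (arc R k y) + pr V (%x. arc R k x y)" using E O I \<gamma> by linarith
  then obtain w where "zer R k y w & arc R k y w | zer R k y w & arc R k w y | arc R k y w & arc R k w y"
  using pr_sum3 by blast
  then show False using ex1(1)[of y w] ex1(2)[of y w] ex1(3)[of w y] by blast
 qed
 define W where "W = (%x y. arc R k x y & (Y x | ~ Y y))"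
 have W: "pr2 V W <= 3 * s"
 proof -
  have "pr2 V W <= pr2 V (%x y. Y x & arc R k x y) + pr2 V (%x y. bd y | ((~ bd y & ~ Y y) & arc R k x y))"
  unfolding W_def by (rule pr2_union) auto
  also have "... <= pr2 V (%x y. Y x & arc R k x y) + (pr2 V (%x y. bd y) + pr2 V (%x y. (~ bd y & ~ Y y) & arc R k x y))"
  by (intro add_left_mono pr2_disj)
  also have "pr2 V (%x y. (~ bd y & ~ Y y) & arc R k x y) = pr2 V (%y x. (~ bd y & ~ Y y) & arc R k x y)"
  by (rule pr2_swap)
  also have "pr2 V (%x y. bd y) = pr V bd" by simp
  also have "pr2 V (%x y. Y x & arc R k x y) <= s * pr V Y" by (rule pr2_conj_le) (auto simp: Y_def)
  also have "pr2 V (%y x. (~ bd y & ~ Y y) & arc R k x y) <= s * pr V (%y. ~ bd y & ~ Y y)"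
  by (rule pr2_conj_le) (use inle in auto)
  also have "s * pr V Y + (pr V bd + s * pr V (%y. ~ bd y & ~ Y y)) <= s + (s/2 + s)"
  using s by (intro add_mono mult_left_le bd) auto
  finally show ?thesis using s by linarith
 qed
 have "pr3 V (%x y z. T x y z & ~ one Y x y z)
  <= pr3 V U + pr3 V (%x y z. W x y | W z y | W y x | W z x | W x z | W y z)"
  by (rule pr3_union) (unfold U_def apxd_def apx_def W_def one_def, blast)
 also have "... <= s^3/4 + (pr3 V (%x y z. W x y) + (pr3 V (%x y z. W z y) + (pr3 V (%x y z. W y x)
  + (pr3 V (%x y z. W z x) + (pr3 V (%x y z. W x z) + pr3 V (%x y z. W y z))))))"
  by (intro order_trans[OF pr3_disj] add_mono add_left_mono order_refl U)
 also have "... = s^3/4 + 6 * pr2 V W"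
  unfolding pr3_12[of W] pr3_23[of W] pr3_13[of W] pr3_12[of "%x y. W y x"] pr3_23[of "%x y. W y x"]
  pr3_13[of "%x y. W y x"] pr2_swap[of V W] by simp
 also have "... <= s^1/4 + 6 * (3 * s)"
  using s W by (intro add_mono divide_right_mono power_decreasing) auto
 also have "... < s0" using s unfolding s_def by simp
 finally show False using nosplit[of Y] by linarith
qed

lemma closed_set:
 assumes out: "!!p. p < 3 ==> pr3 V (%x y z. T x y z & R p x y & ~ R (nx p) y z) <= \<delta>"
  and \<delta>: "72 * \<delta> <= \<gamma> * (s0/20)^3 / 1000" "72 * \<delta> <= e / 2"
  and start: "\<exists>p<3. \<kappa> < pr2 V (%x y. D x y & R p x y)" and p: "p < 3"
 shows "pr2 V (%x y. D x y & ~ R p x y) <= \<kappa>"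
proof -
 have ng: "pr3 V (%x y z. T x y z & ~ good R x y z) <= 72 * \<delta>"
  by (rule not_good) (rule out)
 show ?thesis
 proof (rule constant_fibre[OF ng \<delta>(2) start])
  assume "!!p. p < 3 ==> pr2 V (%x y. D x y & ~ R p x y) <= \<kappa>"
  then show ?thesis using p by blast
 next
  fix k assume "1 <= k" "k <= 5" "pr2 V (%x y. D x y & fib R x y ~= k) <= 2 * \<kappa>"
  then have False by (rule fibre_not_constant[OF ng \<delta>(1)])
  then show ?thesis ..
 qed
qed

text \<open>A state is added only if it has many predecessors, so that a path can later be traced
  back around any small forbidden set. The residue starts at 2 because two vertices follow
  \<open>a\<close> and \<open>b\<close>.\<close>

primrec grow :: "real => 'a => 'a => nat => nat => 'a => 'a => bool" where
 "grow \<delta> a b 0 = (%p x y. p = 2 & T a b x & T b x y)"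
| "grow \<delta> a b (Suc k) = (%p y z. grow \<delta> a b k p y z |
  (p < 3 & D y z & \<delta> <= pr V (%x. T x y z & grow \<delta> a b k (nx (nx p)) x y)))"

text \<open>The bound 1/20 is far above \<kappa>, as the initial set of \<open>closed_set\<close>
  requires, and below the 1/15 that typical pairs provide.\<close>

definition start :: "'a => 'a => bool" where
 "start a b \<longleftrightarrow> 1/20 <= pr2 V (%x y. T a b x & T b x y)"

lemma grow_mono: "k <= l ==> grow \<delta> a b k p x y ==> grow \<delta> a b l p x y"
 by (induction l rule: dec_induct) auto

text \<open>By the rule of growth, a state missing from the next stage has few predecessors in the
  current one. All other violations end in newly added states.\<close>

lemma grow_step_closed:
 assumes \<delta>: "0 < \<delta>" and p: "p < 3"
  and inc: "pr2 V (%x y. grow \<delta> a b (Suc k) (nx p) x y & ~ grow \<delta> a b k (nx p) x y) <= \<delta>"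
 shows "pr3 V (%x y z. T x y z & grow \<delta> a b k p x y & ~ grow \<delta> a b k (nx p) y z) <= 2 * \<delta>"
proof -
 let ?new = "%y z. grow \<delta> a b (Suc k) (nx p) y z & ~ grow \<delta> a b k (nx p) y z"
 let ?P = "%y z x. ~ grow \<delta> a b (Suc k) (nx p) y z & (T x y z & grow \<delta> a b k p x y)"
 have "pr3 V (%x y z. T x y z & grow \<delta> a b k p x y & ~ grow \<delta> a b k (nx p) y z)
  <= pr3 V (%x y z. ?new y z) + pr3 V (%x y z. ?P y z x)"
  by (rule pr3_union) blast
 also have "pr3 V (%x y z. ?new y z) = pr2 V ?new" by (rule pr3_23)
 also have "pr3 V (%x y z. ?P y z x) = pr3 V ?P" by (rule pr3_rot(1))
 also have "pr3 V ?P <= \<delta> * pr2 V (%y z. ~ grow \<delta> a b (Suc k) (nx p) y z)"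
 proof (rule pr3_conj2_le)
  fix y z assume a: "y \<in> V" "z \<in> V" "~ grow \<delta> a b (Suc k) (nx p) y z"
  show "pr V (%x. T x y z & grow \<delta> a b k p x y) <= \<delta>"
  proof (cases "D y z")
  case True
  then show ?thesis using a nx_less[of p] nx3[OF p] by simp
  next
  case False
  have "pr V (%x. T x y z & grow \<delta> a b k p x y) = pr V (%x. False)"
  by (rule pr_cong) (use False T_D in blast)
  then show ?thesis using \<delta> by simp
  qed
 qed
 also have "\<delta> * pr2 V (%y z. ~ grow \<delta> a b (Suc k) (nx p) y z) <= \<delta>"
  using \<delta> by (intro mult_left_le) auto
 finally show ?thesis using inc by linarith
qed

lemma \<kappa>_small: "\<kappa> <= 1/1000"
proof -
 have "s0/20 <= 1" using s0 \<gamma> by simp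
 then have "(s0/20)^3 <= 1" using s0 by (intro power_le_one) auto
 then have "\<gamma> * (s0/20)^3 <= 1 * 1" using \<gamma> s0 by (intro mult_mono) auto
 then show ?thesis using \<kappa> by linarith
qed

text \<open>The three residue classes have total measure at most 3, so one of \<open>K\<close>
  rounds adds less than \<delta>. At that stage the states are almost closed, and
  \<open>closed_set\<close> spreads them over almost all of \<open>D\<close> in every residue class.
  The constant 144 is 2 * 72, from \<open>grow_step_closed\<close> and
  \<open>not_good\<close>.\<close>

lemma reach:
 assumes \<delta>: "0 < \<delta>" "144 * \<delta> <= \<gamma> * (s0/20)^3 / 1000" "144 * \<delta> <= e / 2" and K: "3 < \<delta> * real K"
  and st: "start a b" and p: "p < 3"
 shows "pr2 V (%x y. D x y & ~ grow \<delta> a b K p x y) <= \<kappa>"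
proof -
 let ?g = "grow \<delta> a b"
 define m where "m = (%k. pr2 V (?g k 0) + pr2 V (?g k 1) + pr2 V (?g k 2))"
 have split: "pr2 V (?g (Suc k) p) = pr2 V (?g k p) + pr2 V (%x y. ?g (Suc k) p x y & ~ ?g k p x y)" for k p
 proof -
  have "pr2 V (%x y. ?g (Suc k) p x y & ?g k p x y) = pr2 V (?g k p)"
  by (rule pr2_cong) auto
  then show ?thesis using pr2_split[of V "?g (Suc k) p" "?g k p"] by linarith
 qed
 have "\<exists>k<K. m (Suc k) < m k + \<delta>"
 proof (rule ccontr)
  assume n: "~ ?thesis"
  have "k <= K ==> \<delta> * real k <= m k" for k
  proof (induction k)
  case 0
  show ?case unfolding m_def by simp
  next
  case (Suc k)
  have "k < K" using Suc.prems by simp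
  then have "~ m (Suc k) < m k + \<delta>" using n by blast
  then have "m k + \<delta> <= m (Suc k)" by linarith
  moreover have "\<delta> * real k <= m k" using Suc by simp
  ultimately show ?case by (simp add: distrib_left)
  qed
  then have "\<delta> * real K <= m K" by simp
  also have "... <= 1 + 1 + 1" unfolding m_def by (intro add_mono) simp_all
  finally show False using K by simp
 qed
 then obtain k where k: "k < K" "m (Suc k) < m k + \<delta>" by blast
 have inc: "pr2 V (%x y. ?g (Suc k) q x y & ~ ?g k q x y) <= \<delta>" if "q < 3" for q
 proof -
  define d where "d = (%q. pr2 V (%x y. ?g (Suc k) q x y & ~ ?g k q x y))"
  have d0: "0 <= d q" for q unfolding d_def by simp
  have "d 0 + d 1 + d 2 < \<delta>"
  using k(2) split[of k 0] split[of k 1] split[of k 2] unfolding m_def d_def by linarith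
  moreover have "q = 0 | q = 1 | q = 2" using that by auto
  moreover note d0[of 0] d0[of 1] d0[of 2]
  ultimately have "d 0 <= \<delta>" "d 1 <= \<delta>" "d 2 <= \<delta>" "q \<in> {0, 1, 2}" by auto
  then have "d q <= \<delta>" by auto
  then show ?thesis unfolding d_def .
 qed
 have "pr2 V (%x y. D x y & ~ ?g k p x y) <= \<kappa>"
 proof (rule closed_set[where \<delta> = "2 * \<delta>"])
  show "pr3 V (%x y z. T x y z & ?g k q x y & ~ ?g k (nx q) y z) <= 2 * \<delta>" if "q < 3" for q
  using grow_step_closed[OF \<delta>(1) that inc[OF nx_less]] .
  have "\<kappa> < pr2 V (%x y. T a b x & T b x y)" using st \<kappa>_small unfolding start_def by linarith
  also have "... <= pr2 V (%x y. D x y & ?g k 2 x y)"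
  proof (rule pr2_mono)
  fix x y assume a: "T a b x & T b x y"
  then have "?g 0 2 x y" by simp
  then have "?g k 2 x y" by (rule grow_mono[rotated]) simp
  then show "D x y & ?g k 2 x y" using a T_D by blast
  qed
  finally show "\<exists>p<3. \<kappa> < pr2 V (%x y. D x y & ?g k p x y)" by (intro exI[of _ 2]) simp
 qed (use \<delta> p in auto)
 moreover have "pr2 V (%x y. D x y & ~ ?g K p x y) <= pr2 V (%x y. D x y & ~ ?g k p x y)"
  by (rule pr2_mono) (use grow_mono[of k K] k(1) in auto)
 ultimately show ?thesis by linarith
qed

text \<open>The path is built from its end. The predecessor \<open>x\<close> is taken from a
  proportion \<delta> of all vertices, outside the forbidden set, to which \<open>z\<close> is added
  before continuing.\<close>

lemma backtrack:
 assumes "grow \<delta> a b k p y z" "y \<in> V" "z \<in> V" "finite F" "y \<notin> F" "z \<notin> F" "{y, z} \<inter> {a, b} = {}"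
  "real (card F + k + 4) < \<delta> * real (card V)"
 shows "EX w. distinct w & set w \<subseteq> V & set w \<inter> (F \<union> {a, b, y, z}) = {} & tpath T (a # b # w @ [y, z])
  & length w <= k & (length w + 2) mod 3 = p"
 using assms
proof (induction k arbitrary: p y z F)
 case 0
 then show ?case by (intro exI[of _ "[]"]) auto
next
 case (Suc k)
 show ?case
 proof (cases "grow \<delta> a b k p y z")
  case True
  then obtain w where "distinct w & set w \<subseteq> V & set w \<inter> (F \<union> {a, b, y, z}) = {} & tpath T (a # b # w @ [y, z])
  & length w <= k & (length w + 2) mod 3 = p"
  using Suc.IH[OF True Suc.prems(2-7)] Suc.prems(8) by force
  then show ?thesis by (intro exI[of _ w]) auto
 next
  case False
  let ?P = "%x. T x y z & grow \<delta> a b k (nx (nx p)) x y"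
  have p: "p < 3" and d: "\<delta> <= pr V ?P" using Suc.prems(1) False by auto
  have "real (card (F \<union> {a, b})) < \<delta> * real (card V)"
  proof -
  have "card (F \<union> {a, b}) <= card F + card {a, b}" by (rule card_Un_le)
  also have "... <= card F + 2" by (simp add: card_insert_if)
  finally show ?thesis using Suc.prems(8) by linarith
  qed
  also have "... <= real (card {x\<in>V. ?P x})"
  using d card_pos unfolding pr_eq_card[OF fin] by (simp add: field_simps)
  finally have "card (F \<union> {a, b}) < card {x\<in>V. ?P x}" by simp
  then have "~ {x\<in>V. ?P x} \<subseteq> F \<union> {a, b}"
  using card_mono[of "F \<union> {a, b}" "{x\<in>V. ?P x}"] Suc.prems(4) by auto
  then obtain x where x: "x \<in> V" "T x y z" "grow \<delta> a b k (nx (nx p)) x y" "x \<notin> F" "x ~= a" "x ~= b" by blast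
  have neq: "x ~= y" "x ~= z" "y ~= z" using T_neq[OF x(2)] by auto
  have "EX w. distinct w & set w \<subseteq> V & set w \<inter> (insert z F \<union> {a, b, x, y}) = {} & tpath T (a # b # w @ [x, y])
  & length w <= k & (length w + 2) mod 3 = nx (nx p)"
  proof (rule Suc.IH[OF x(3,1) Suc.prems(2)])
  have "card (insert z F) <= card F + 1" using Suc.prems(4) by (simp add: card_insert_if)
  then show "real (card (insert z F) + k + 4) < \<delta> * real (card V)" using Suc.prems(8) by linarith
  qed (use Suc.prems x neq in auto)
  then obtain w where w: "distinct w" "set w \<subseteq> V" "set w \<inter> (insert z F \<union> {a, b, x, y}) = {}"
  "tpath T (a # b # w @ [x, y])" "length w <= k" "(length w + 2) mod 3 = nx (nx p)" by blast
  have "tpath T ((a # b # w) @ x # y # [z])"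
  by (rule tpath_join) (use w(4) x(2) in auto)
  moreover have "(length (w @ [x]) + 2) mod 3 = p"
  proof -
  have "(length (w @ [x]) + 2) mod 3 = nx ((length w + 2) mod 3)" unfolding nx_mod by simp
  then show ?thesis using w(6) nx3[OF p] by simp
  qed
  ultimately show ?thesis
  by (intro exI[of _ "w @ [x]"]) (use w x neq in auto)
 qed
qed

text \<open>Walks from \<open>ab\<close> and, in reverse, from \<open>dc\<close> both reach almost
  all of \<open>D\<close>, so they share a pair \<open>yz\<close> outside \<open>F\<close>. Only the
  second walk is used to adjust the residue.\<close>

lemma connect:
 assumes \<delta>: "0 < \<delta>" "144 * \<delta> <= \<gamma> * (s0/20)^3 / 1000" "144 * \<delta> <= e / 2" and K: "3 < \<delta> * real K"
  and st: "start a b" "start d c" and F: "finite F" "{a, b, c, d} \<subseteq> F"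
  and sz: "real (card F + 2 * K + 10) < \<delta> * real (card V)" and r: "r < 3"
 shows "EX u. distinct u & set u \<subseteq> V & set u \<inter> F = {} & tpath T (a # b # u @ [c, d])
  & length u <= 2 * K + 2 & length u mod 3 = r"
proof -
 \<comment> \<open>The residue of a state includes the two vertices of its pair. The first walk
   already accounts for \<open>y\<close> and \<open>z\<close>, so the second must end in residue r +
   2 for its interior to have residue \<open>r\<close>.\<close>
 define q where "q = nx (nx r)"
 have q: "q < 3" unfolding q_def by (rule nx_less)
 have \<delta>1: "\<delta> <= 1/100"
 proof -
  have "s0/20 <= 1" using s0 \<gamma> by simp
  then have "(s0/20)^3 <= 1" using s0 by (intro power_le_one) auto
  then have "\<gamma> * (s0/20)^3 <= 1 * 1" using \<gamma> s0 by (intro mult_mono) auto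
  then show ?thesis using \<delta> by linarith
 qed
 have prF: "pr V (%x. x \<in> F) <= 1/100"
 proof -
  have "card {x\<in>V. x \<in> F} <= card F" using F(1) by (intro card_mono) auto
  then have "real (card {x\<in>V. x \<in> F}) <= \<delta> * real (card V)" using sz by linarith
  also have "... <= 1/100 * real (card V)" using \<delta>1 by (intro mult_right_mono) auto
  finally show ?thesis using card_pos unfolding pr_eq_card[OF fin] by (simp add: field_simps)
 qed
 let ?A = "%x y. D x y & ~ grow \<delta> a b K 0 x y" and ?B = "%x y. D x y & ~ grow \<delta> d c K q x y"
 have A: "pr2 V ?A <= \<kappa>" by (rule reach[OF \<delta> K st(1)]) simp
 have B: "pr2 V (%x y. ?B y x) <= \<kappa>"
  unfolding pr2_swap[of V ?B] by (rule reach[OF \<delta> K st(2) q])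
 have "pr2 V (%x y. ?A x y | ?B y x | x \<in> F | y \<in> F) <= \<kappa> + (\<kappa> + (1/100 + 1/100))"
 proof (intro order_trans[OF pr2_disj] add_mono A B)
  show "pr2 V (%x y. x \<in> F) <= 1/100" using prF by simp
  show "pr2 V (%x y. y \<in> F) <= 1/100" using prF by simp
 qed
 also have "... < pr2 V D" using pr2_D \<kappa>_small by linarith
 finally have lt: "pr2 V (%x y. ?A x y | ?B y x | x \<in> F | y \<in> F) < pr2 V D" .
 obtain y z where yz: "y \<in> V" "z \<in> V" "D y z" "~ (?A y z | ?B z y | y \<in> F | z \<in> F)"
  using ex_of_pr2[OF lt] by blast
 have g: "grow \<delta> a b K 0 y z" "grow \<delta> d c K q z y" "y \<notin> F" "z \<notin> F"
  using yz D_sym[of y z] by auto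
 have "EX w. distinct w & set w \<subseteq> V & set w \<inter> (F \<union> {a, b, y, z}) = {} & tpath T (a # b # w @ [y, z])
  & length w <= K & (length w + 2) mod 3 = 0"
  by (rule backtrack[OF g(1) yz(1,2) F(1) g(3,4)]) (use g(3,4) F sz in auto)
 then obtain w where w: "distinct w" "set w \<subseteq> V" "set w \<inter> (F \<union> {a, b, y, z}) = {}" "tpath T (a # b # w @ [y, z])"
  "length w <= K" "(length w + 2) mod 3 = 0" by (elim exE conjE) (rule that)
 have "EX w'. distinct w' & set w' \<subseteq> V & set w' \<inter> ((F \<union> set w) \<union> {d, c, z, y}) = {} & tpath T (d # c # w' @ [z, y])
  & length w' <= K & (length w' + 2) mod 3 = q"
 proof (rule backtrack[OF g(2) yz(2,1)])
  have "card (F \<union> set w) <= card F + card (set w)" by (rule card_Un_le)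
  moreover have "card (set w) <= K" using card_length[of w] w(5) by linarith
  ultimately show "real (card (F \<union> set w) + K + 4) < \<delta> * real (card V)" using sz by linarith
 qed (use g(3,4) F w(3) in auto)
 then obtain w' where w': "distinct w'" "set w' \<subseteq> V" "set w' \<inter> ((F \<union> set w) \<union> {d, c, z, y}) = {}"
  "tpath T (d # c # w' @ [z, y])" "length w' <= K" "(length w' + 2) mod 3 = q" by (elim exE conjE) (rule that)
 have "tpath T (rev (d # c # w' @ [z, y]))"
  by (rule tpath_rev[OF T_perm(3)[THEN iffD1] w'(4)])
 then have t2: "tpath T (y # z # (rev w' @ [c, d]))" by simp
 have "tpath T ((a # b # w) @ y # z # (rev w' @ [c, d]))"
  by (rule tpath_join[OF _ t2]) (use w(4) in simp)
 then have t: "tpath T (a # b # (w @ [y, z] @ rev w') @ [c, d])" by simp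
 have l: "length (w @ [y, z] @ rev w') mod 3 = r"
 proof -
  have "length (w @ [y, z] @ rev w') mod 3 = ((length w + 2) + length w') mod 3" by simp
  also have "... = length w' mod 3" using w(6) by presburger
  also have "... = nx ((length w' + 2) mod 3)" unfolding nx_mod by simp
  also have "... = r" using w'(6) nx3[OF r] unfolding q_def by simp
  finally show ?thesis .
 qed
 have d: "distinct (w @ [y, z] @ rev w')" using w(1,3) w'(1,3) D_neq[OF yz(3)] by auto
 have s: "set (w @ [y, z] @ rev w') \<subseteq> V" "set (w @ [y, z] @ rev w') \<inter> F = {}"
  using w(2,3) w'(2,3) yz(1,2) g(3,4) by auto
 have "length (w @ [y, z] @ rev w') <= 2 * K + 2" using w(5) w'(5) by simp
 then show ?thesis using t l d s by blast
qed

end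

section \<open>Exchanging vertices\<close>

definition pr4 :: "'a set => ('a => 'a => 'a => 'a => bool) => real" where
 "pr4 V P = avg V (%x. pr3 V (P x))"

lemma pr4_nonneg [simp]: "0 <= pr4 V P"
 unfolding pr4_def by (rule avg_nonneg) auto

lemma of_bool_mult: "of_bool (P & Q) = (of_bool P * of_bool Q :: real)"
 by simp

context fspace
begin

text \<open>Edges with an end of degree below m/4 have measure at most m/2; each remaining edge
  \<open>bc\<close> extends to a proportion of at least (m/4)^2 of all choices of \<open>a\<close>
  and \<open>d\<close>.\<close>

lemma path_count:
 assumes sym: "!!x y. M x y ==> M y x" and m: "0 < m" "m <= pr2 V M"
 shows "m^3 / 32 <= pr4 V (%a b c d. M a b & M b c & M c d)"
proof -
 define d where "d = (%b. pr V (M b))"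
 have sym': "M x y = M y x" for x y using sym by blast
 have "pr4 V (%a b c d. M a b & M b c & M c d)
  = avg V (%a. avg V (%b. avg V (%c. avg V (%d. of_bool (M a b) * of_bool (M b c) * of_bool (M c d)))))"
  unfolding pr4_def pr3_def pr2_def pr_def of_bool_mult by (simp only: mult.assoc)
 also have "... = avg V (%b. avg V (%a. avg V (%c. avg V (%d. of_bool (M a b) * of_bool (M b c) * of_bool (M c d)))))"
  by (rule avg_swap)
 also have "... = avg V (%b. avg V (%a. of_bool (M a b) * avg V (%c. of_bool (M b c) * d c)))"
  unfolding d_def pr_def avg_cmult[symmetric] by (simp only: mult.assoc)
 also have "... = avg V (%b. d b * avg V (%c. of_bool (M b c) * d c))"
 proof (rule avg_cong)
  fix b assume "b \<in> V"
  have "d b = avg V (%a. of_bool (M a b))" unfolding d_def pr_def by (rule avg_cong) (use sym' in simp)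
  then show "avg V (%a. of_bool (M a b) * avg V (%c. of_bool (M b c) * d c)) = d b * avg V (%c. of_bool (M b c) * d c)"
  by (simp only: avg_multc)
 qed
 finally have eq: "pr4 V (%a b c d. M a b & M b c & M c d) = avg V (%b. avg V (%c. d b * (of_bool (M b c) * d c)))"
  by (simp only: avg_cmult)
 let ?lo = "%b c. d b < m/4 & M b c"
 have lo: "pr2 V ?lo <= m/4"
 proof -
  have "pr2 V ?lo <= m/4 * pr V (%b. d b < m/4)" by (rule pr2_conj_le) (auto simp: d_def)
  also have "... <= m/4" using m by (intro mult_left_le) auto
  finally show ?thesis .
 qed
 let ?hi = "%b c. M b c & m/4 <= d b & m/4 <= d c"
 have "pr2 V M <= pr2 V ?hi + pr2 V (%b c. ?lo b c | ?lo c b)"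
  by (rule pr2_union) (use sym in auto)
 also have "... <= pr2 V ?hi + (pr2 V ?lo + pr2 V (%b c. ?lo c b))"
  by (intro add_left_mono pr2_disj)
 finally have hi: "m/2 <= pr2 V ?hi" using lo pr2_swap[of V ?lo] m by linarith
 have "m^3/32 = (m/4)^2 * (m/2)" by (simp add: power2_eq_square power3_eq_cube)
 also have "... <= (m/4)^2 * pr2 V ?hi" using hi by (intro mult_left_mono) auto
 also have "... = avg V (%b. avg V (%c. (m/4)^2 * of_bool (?hi b c)))"
  unfolding pr2_def pr_def avg_cmult ..
 also have "... <= avg V (%b. avg V (%c. d b * (of_bool (M b c) * d c)))"
 proof (intro avg_mono)
  fix b c assume "b \<in> V" "c \<in> V"
  have d0: "0 <= d b" "0 <= d c" unfolding d_def by auto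
  show "(m/4)^2 * of_bool (?hi b c) <= d b * (of_bool (M b c) * d c)"
  proof (cases "?hi b c")
  case True
  then have "(m/4) * (m/4) <= d b * d c" using m d0 by (intro mult_mono) auto
  then show ?thesis using True by (simp add: power2_eq_square)
  next
  case False
  have "of_bool (?hi b c) = (0::real)" using False by simp
  then show ?thesis using d0 by (simp only: mult_zero_right) simp
  qed
 qed
 finally show ?thesis using eq by linarith
qed

end

section \<open>Links of vertices and chains of exchanges\<close>

locale comp2 = comp1 V h D \<gamma> \<nu> s0 \<kappa> e for V :: "'a set" and h D \<gamma> \<nu> s0 \<kappa> e +
 assumes pureD: "\<gamma>/4 <= pr V (%x. pr V (cpl D x) <= 1/10)" and n\<nu>: "1 / card V <= \<nu>"
  and \<kappa>2: "\<kappa> <= (\<gamma>/25)^5 / 10^12" and \<nu>2: "\<nu> <= \<gamma> * (\<gamma>/25)^5 / 10^14" and \<nu>3: "\<nu> <= \<gamma> * e / 1000"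
begin

definition G :: "'a => 'a => bool" where
 "G x y \<longleftrightarrow> D x y & start x y & start y x"

definition L :: "'a => 'a => 'a => bool" where
 "L v b c \<longleftrightarrow> h v b c & G b c"

text \<open>This makes \<open>a, b, x, c, d\<close> a tight path whose end pairs do not involve
  \<open>x\<close> and lie in \<open>G\<close>, so other paths can be attached whichever vertex
  occupies the middle.\<close>

definition W :: "'a => 'a => 'a => 'a => 'a => bool" where
 "W x a b c d \<longleftrightarrow> L x a b & L x b c & L x c d"

text \<open>The density that \<open>link_size\<close> guarantees for every link: 7/30 times
  \<gamma>/4, minus errors.\<close>

definition l0 :: real where "l0 = \<gamma>/25"

lemma l0: "0 < l0" "l0 <= 1/25" using \<gamma> unfolding l0_def by auto

lemma G_sym: "G x y ==> G y x"
 unfolding G_def using D_sym by blast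

lemma L_sym: "L v x y ==> L v y x"
 unfolding L_def using G_sym h23 by blast

text \<open>At least 1/5 of all vertices \<open>u\<close> continue a typical pair \<open>xy\<close>
  to another typical pair \<open>yu\<close>, and each of these has 1/3 continuations; 1/15 exceeds
  the 1/20 of \<open>start\<close>.\<close>

lemma nonstart: "pr2 V (%x y. D x y & ~ start x y) <= 44 * \<nu> / \<gamma>"
proof -
 let ?lo = "%x y. D x y & pr V (T x y) < 1/3 + \<gamma>/2"
 have "pr2 V (%x y. D x y & ~ start x y) <= pr2 V ?lo + pr2 V (%x y. 1/10 <= pr V (?lo y))"
 proof (rule pr2_union)
  fix x y assume xy: "x \<in> V" "y \<in> V" "D x y & ~ start x y"
  show "?lo x y | 1/10 <= pr V (?lo y)"
  proof (rule ccontr)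
  assume n: "~ ?thesis"
  have "1/5 <= pr V (%u. T x y u & ~ ?lo y u)"
  using pr_diff_ge[of V "T x y" "?lo y" "%u. T x y u & ~ ?lo y u"] n xy \<gamma> by auto
  then have "1/3 * (1/5) <= 1/3 * pr V (%u. T x y u & ~ ?lo y u)" by simp
  also have "... <= pr2 V (%u v. (T x y u & ~ ?lo y u) & T y u v)"
  by (rule pr2_conj_ge) (use \<gamma> T_D in force)
  also have "... <= pr2 V (%u v. T x y u & T y u v)" by (rule pr2_mono) auto
  finally show False using xy unfolding start_def by simp
  qed
 qed
 also have "pr2 V (%x y. 1/10 <= pr V (?lo y)) = pr V (%y. 1/10 <= pr V (?lo y))" by simp
 also have "pr V (%y. 1/10 <= pr V (?lo y)) <= (4 * \<nu> / \<gamma>) / (1/10)"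
  by (rule markov_pr2[OF typ_pairs]) simp
 finally show ?thesis using typ_pairs by simp
qed

lemma nonG: "pr2 V (%x y. D x y & ~ G x y) <= 88 * \<nu> / \<gamma>"
proof -
 have "pr2 V (%x y. D x y & ~ G x y) <= pr2 V (%x y. D x y & ~ start x y) + pr2 V (%x y. D y x & ~ start y x)"
  by (rule pr2_union) (use D_sym in \<open>auto simp: G_def\<close>)
 then show ?thesis using nonstart pr2_swap[of V "%x y. D x y & ~ start x y"] by simp
qed

lemma \<nu>_small: "88 * \<nu> / \<gamma> <= l0^5 / 10^12" "\<nu> <= l0^5 / 10^14"
proof -
 show "88 * \<nu> / \<gamma> <= l0^5 / 10^12" using \<nu>2 \<gamma> \<nu>0 unfolding l0_def by (simp add: field_simps)
 have "\<gamma> * (\<gamma>/25)^5 <= 1 * (\<gamma>/25)^5" using \<gamma> by (intro mult_right_mono) auto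
 then show "\<nu> <= l0^5 / 10^14" using \<nu>2 unfolding l0_def by simp
qed

lemma l0_pow: "l0^5 <= l0 / 10^5"
proof -
 have "l0^4 <= (1/25)^4" using l0 by (intro power_mono) auto
 also have "... <= 1/10^5" by (simp add: power_divide)
 finally have "l0 * l0^4 <= l0 * (1/10^5)" using l0 by (intro mult_left_mono) auto
 then show ?thesis by (simp add: power_eq_if)
qed

text \<open>Every vertex \<open>v\<close> is attached to the component, however its own pairs lie:
  if \<open>x\<close> is pure in \<open>D\<close>, the codegree set of \<open>vx\<close> exceeds
  1/3, and all but a tenth of the vertices are joined to \<open>x\<close> by
  \<open>D\<close>.\<close>

lemma link_size: "v \<in> V ==> l0 <= pr2 V (L v)"
proof -
 assume v: "v \<in> V"
 let ?p = "%x. pr V (cpl D x) <= 1/10"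
 have "\<gamma>/4 - 1 / card V <= pr V ?p - pr V (%x. x = v)" using pureD v by (simp add: pr_eq1)
 also have "... <= pr V (%x. ?p x & x ~= v)" by (rule pr_diff_ge) auto
 finally have p: "\<gamma>/4 - \<nu> <= pr V (%x. ?p x & x ~= v)" using n\<nu> by linarith
 have "7/30 * pr V (%x. ?p x & x ~= v) <= pr2 V (%x z. (?p x & x ~= v) & (h v x z & D x z))"
 proof (rule pr2_conj_ge)
  fix x assume x: "x \<in> V" "?p x & x ~= v"
  have "pr V (h v x) - pr V (cpl D x) <= pr V (%z. h v x z & D x z)"
  by (rule pr_diff_ge) (auto simp: cpl_def dest: h_distinct)
  then show "7/30 <= pr V (%z. h v x z & D x z)" using x codeg[OF v x(1)] \<gamma> by auto
 qed
 also have "... <= pr2 V (L v) + pr2 V (%x y. D x y & ~ G x y)"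
  by (rule pr2_union) (auto simp: L_def)
 finally have 1: "7/30 * pr V (%x. ?p x & x ~= v) <= pr2 V (L v) + l0/1000"
  using nonG \<nu>_small l0_pow l0 by simp
 have "\<nu> <= l0/1000" using \<nu>_small l0_pow l0 by simp
 moreover have "\<gamma> = 25 * l0" unfolding l0_def by simp
 ultimately show ?thesis using 1 p l0 by linarith
qed

text \<open>Vertices from which at most \<open>j\<close> exchanges lead into \<open>Y\<close>, where
  each exchange is possible through many common link pairs, hence also outside any small
  set.\<close>

primrec ygrow :: "real => ('a => bool) => nat => 'a => bool" where
 "ygrow \<theta> Y 0 = Y"
| "ygrow \<theta> Y (Suc j) = (%v. ygrow \<theta> Y j v | \<theta> <= pr3 V (%u b c. ygrow \<theta> Y j u & L u b c & L v b c))"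

lemma ygrow_mono: "k <= l ==> ygrow \<theta> Y k v ==> ygrow \<theta> Y l v"
 by (induction l rule: dec_induct) auto

text \<open>If no exchange leads out of \<open>Y\<close>, the neighbourhood of almost every pair lies inside or outside
 \<open>Y\<close>; then the number of vertices in \<open>Y\<close> is constant on almost all triples of the component.\<close>
lemma exchange_stall:
 assumes \<theta>: "0 < \<theta>" "\<theta> <= l0^5 / 10^12" "100 * \<theta> <= e" "100 * \<theta> <= s0"
  and st: "avg V (%v. of_bool (~ Y v) * pr3 V (%u b c. Y u & L u b c & L v b c)) <= 2 * \<theta>"
  and big: "l0^4 / 10^10 <= pr V Y"
 shows "pr V (%v. ~ Y v) <= 1/100"
proof -
 define y where "y = (%b c. pr V (%u. Y u & h u b c))"
 define z where "z = (%b c. pr V (%u. ~ Y u & h u b c))"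
 have yz0: "0 <= y b c" "0 <= z b c" for b c unfolding y_def z_def by auto
 have yz: "1/3 <= y b c + z b c" if "b \<in> V" "c \<in> V" "b ~= c" for b c
 proof -
  have "pr V (h b c) <= y b c + z b c"
  unfolding y_def z_def by (rule pr_union) (use h_perm in blast)
  then show ?thesis using codeg[OF that] \<gamma> by linarith
 qed
 \<comment> \<open>The assumption is rewritten as an average over the pairs \<open>bc\<close> in
   \<open>G\<close> of the product of their degrees into \<open>Y\<close> and into its
   complement.\<close>
 have "avg V (%v. of_bool (~ Y v) * pr3 V (%u b c. Y u & L u b c & L v b c))
  = avg V (%v. avg V (%u. avg V (%b. avg V (%c. of_bool (G b c) * (of_bool (~ Y v & h v b c) * of_bool (Y u & h u b c))))))"
  unfolding pr3_def pr2_def pr_def avg_cmult[symmetric] L_def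
  by (intro avg_cong) (auto simp: of_bool_def)
 also have "... = avg V (%v. avg V (%b. avg V (%c. of_bool (G b c) * (of_bool (~ Y v & h v b c) * y b c))))"
 proof (rule avg_cong)
  fix v
  have "avg V (%u. avg V (%b. avg V (%c. of_bool (G b c) * (of_bool (~ Y v & h v b c) * of_bool (Y u & h u b c)))))
  = avg V (%b. avg V (%u. avg V (%c. of_bool (G b c) * (of_bool (~ Y v & h v b c) * of_bool (Y u & h u b c)))))"
  by (rule avg_swap)
  also have "... = avg V (%b. avg V (%c. avg V (%u. of_bool (G b c) * (of_bool (~ Y v & h v b c) * of_bool (Y u & h u b c)))))"
  by (rule avg_cong, rule avg_swap)
  finally show "avg V (%u. avg V (%b. avg V (%c. of_bool (G b c) * (of_bool (~ Y v & h v b c) * of_bool (Y u & h u b c)))))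
  = avg V (%b. avg V (%c. of_bool (G b c) * (of_bool (~ Y v & h v b c) * y b c)))"
  by (simp only: y_def pr_def avg_cmult)
 qed
 also have "... = avg V (%b. avg V (%c. of_bool (G b c) * (z b c * y b c)))"
 proof -
  have "avg V (%v. avg V (%b. avg V (%c. of_bool (G b c) * (of_bool (~ Y v & h v b c) * y b c))))
  = avg V (%b. avg V (%v. avg V (%c. of_bool (G b c) * (of_bool (~ Y v & h v b c) * y b c))))"
  by (rule avg_swap)
  also have "... = avg V (%b. avg V (%c. avg V (%v. of_bool (G b c) * (of_bool (~ Y v & h v b c) * y b c))))"
  by (rule avg_cong, rule avg_swap)
  finally show ?thesis by (simp only: z_def pr_def avg_cmult avg_multc)
 qed
 finally have st2: "avg V (%b. avg V (%c. of_bool (G b c) * (z b c * y b c))) <= 2 * \<theta>" using st by simp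
 \<comment> \<open>The two degrees of a pair add up to at least 1/3, so the larger is at least 1/6
   and a small product forces the smaller one down. Almost every pair therefore has a side
   containing nearly all of its third vertices.\<close>
 define maj where "maj = (%b c. z b c < y b c)"
 have maj_sym: "maj b c = maj c b" for b c
 proof -
  have "y b c = y c b" "z b c = z c b" unfolding y_def z_def by (intro pr_cong; use h_perm(2) in blast)+
  then show ?thesis unfolding maj_def by simp
 qed
 define dev where "dev = (%b c u. G b c & (h b c u & Y u ~= maj b c))"
 have dev: "pr3 V dev <= 12 * \<theta>"
 proof -
  have "pr3 V dev = avg V (%b. avg V (%c. of_bool (G b c) * pr V (%u. h b c u & Y u ~= maj b c)))"
  unfolding dev_def pr3_pr2 pr_conj_const ..
  also have "... <= avg V (%b. avg V (%c. 6 * (of_bool (G b c) * (z b c * y b c))))"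
  proof (intro avg_mono)
  fix b c assume bc: "b \<in> V" "c \<in> V"
  show "of_bool (G b c) * pr V (%u. h b c u & Y u ~= maj b c) <= 6 * (of_bool (G b c) * (z b c * y b c))"
  proof (cases "G b c")
  case True
  then have "b ~= c" using D_neq unfolding G_def by blast
  then have s: "1/3 <= y b c + z b c" using yz bc by blast
  show ?thesis
  proof (cases "maj b c")
  case m: True
  have "pr V (%u. h b c u & Y u ~= maj b c) = z b c"
  unfolding z_def by (rule pr_cong) (use m h_perm in auto)
  moreover have "1/6 * z b c <= y b c * z b c"
  using m s yz0 unfolding maj_def by (intro mult_right_mono) auto
  ultimately show ?thesis using True by (simp add: mult.commute)
  next
  case m: False
  have "pr V (%u. h b c u & Y u ~= maj b c) = y b c"
  unfolding y_def by (rule pr_cong) (use m h_perm in auto)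
  moreover have "1/6 * y b c <= z b c * y b c"
  using m s yz0 unfolding maj_def by (intro mult_right_mono) auto
  ultimately show ?thesis using True by (simp add: mult.commute)
  qed
  qed simp
  qed
  also have "... = 6 * avg V (%b. avg V (%c. of_bool (G b c) * (z b c * y b c)))" by (simp only: avg_cmult)
  finally show ?thesis using st2 by linarith
 qed
 \<comment> \<open>The number of vertices of \<open>Y\<close> in a triple over \<open>bc\<close>,
   predicted from the pair alone. On a typical triple the predictions of its pairs agree with the
   true number \<open>t\<close>, so the level sets of \<open>j\<close> have a sparse
   boundary.\<close>
 define j where "j = (%b c. (of_bool (Y b) + of_bool (Y c) + of_bool (maj b c) :: nat))"
 define t where "t = (%b c u. (of_bool (Y b) + of_bool (Y c) + of_bool (Y u) :: nat))"
 have j_sym: "j b c = j c b" for b c unfolding j_def using maj_sym[of b c] by simp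
 have jt: "j b c = t b c u" if "G b c" "h b c u" "~ dev b c u" for b c u
  using that unfolding j_def t_def dev_def by simp
 define Q where "Q = (%i b c. D b c & j b c = i)"
 let ?nG = "%x y. D x y & ~ G x y"
 have cutQ: "cut (Q i) <= e" for i
 proof -
  have "cut (Q i) <= pr3 V (%x y z. h x y z & D x y & ~ T x y z) + pr3 V (%x y z. ?nG x y | ?nG x z | dev x y z | dev x z y)"
  unfolding cut_def
  proof (rule pr3_union)
  fix x y u assume a: "h x y u & Q i x y & ~ Q i x u"
  have "Q i x u" if "T x y u" "~ (?nG x y | ?nG x u | dev x y u | dev x u y)"
  proof -
  have g: "D x y" "D x u" "G x y" "G x u" using that T_D by blast+
  have "j x y = t x y u" by (rule jt) (use a g that in auto)
  moreover have "j x u = t x u y" by (rule jt) (use a g that h23 in auto)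
  moreover have "t x y u = t x u y" unfolding t_def by simp
  ultimately show ?thesis using a g unfolding Q_def by simp
  qed
  then show "(h x y u & D x y & ~ T x y u) | (?nG x y | ?nG x u | dev x y u | dev x u y)"
  using a unfolding Q_def by blast
  qed
  also have "... <= 2 * \<nu> + (pr3 V (%x y z. ?nG x y) + (pr3 V (%x y z. ?nG x z) + (pr3 V dev + pr3 V (%x y z. dev x z y))))"
  by (intro order_trans[OF pr3_disj] add_mono add_left_mono order_refl nonT)
  also have "... = 2 * \<nu> + (pr2 V ?nG + (pr2 V ?nG + (pr3 V dev + pr3 V dev)))"
  unfolding pr3_12[of ?nG] pr3_13[of ?nG] pr3_swap23[of V dev] ..
  also have "... <= 2 * \<nu> + 176 * \<nu> / \<gamma> + 24 * \<theta>" using nonG dev by simp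
  also have "... <= e"
  proof -
  have "176 * \<nu> / \<gamma> <= 176/1000 * e" using \<nu>3 \<gamma> by (simp add: field_simps)
  moreover have "\<gamma> * e <= 1 * e" using \<gamma> e by (intro mult_right_mono) auto
  ultimately show ?thesis using \<nu>3 \<theta> e by linarith
  qed
  finally show ?thesis .
 qed
 have alt: "pr2 V (Q i) <= \<kappa> | pr2 V (%x y. D x y & ~ Q i x y) <= \<kappa>" for i
 proof (rule expand[OF _ _ cutQ])
  show "grel (Q i)" unfolding grel_def Q_def using D_sym D_neq j_sym by metis
 qed (auto simp: Q_def)
 have "\<exists>i\<le>3. pr2 V (%x y. D x y & ~ Q i x y) <= \<kappa>"
 proof (rule ccontr)
  assume "~ ?thesis"
  then have q: "pr2 V (Q i) <= \<kappa>" if "i <= 3" for i using alt that by blast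
  have "pr2 V D <= pr2 V (%x y. Q 0 x y | Q 1 x y | Q 2 x y | Q 3 x y)"
  by (rule pr2_mono) (auto simp: Q_def j_def)
  also have "... <= \<kappa> + (\<kappa> + (\<kappa> + \<kappa>))" by (intro order_trans[OF pr2_disj] add_mono q) auto
  finally show False using pr2_D \<kappa>_small by linarith
 qed
 then obtain i where i: "i <= 3" "pr2 V (%x y. D x y & ~ Q i x y) <= \<kappa>" by blast
 define b where "b = \<kappa> + 88 * \<nu> / \<gamma> + 12 * \<theta>"
 have ti: "pr3 V (%x y z. T x y z & t x y z ~= i) <= b"
 proof -
  have "pr3 V (%x y z. T x y z & t x y z ~= i)
  <= pr3 V (%x y z. (D x y & ~ Q i x y) | ?nG x y) + pr3 V dev"
  proof (rule pr3_union)
  fix x y u assume a: "T x y u & t x y u ~= i"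
  then show "((D x y & ~ Q i x y) | ?nG x y) | dev x y u"
  proof -
  have d: "D x y" "h x y u" using a T_h T_D by blast+
  show ?thesis
  proof (cases "G x y & ~ dev x y u")
  case True
  then have "j x y = t x y u" using jt d by blast
  then show ?thesis using a d unfolding Q_def by simp
  qed (use d in blast)
  qed
  qed
  also have "pr3 V (%x y z. (D x y & ~ Q i x y) | ?nG x y) = pr2 V (%x y. (D x y & ~ Q i x y) | ?nG x y)"
  by (rule pr3_12)
  also have "... <= pr2 V (%x y. D x y & ~ Q i x y) + pr2 V ?nG" by (rule pr2_disj)
  finally show ?thesis using i nonG dev unfolding b_def by linarith
 qed
 have bs: "b <= 14 * l0^5 / 10^12" using \<kappa>2 \<theta> \<nu>_small unfolding b_def l0_def by linarith
 have bs0: "b <= s0"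
 proof -
  have s: "0 < s0/20" "s0/20 <= 1" using s0 \<gamma> by auto
  have c: "(s0/20)^3 <= (s0/20)^1" using s by (intro power_decreasing) auto
  have "\<gamma> * (s0/20)^3 <= 1 * (s0/20)^3" using \<gamma> s by (intro mult_right_mono) auto
  then have "\<kappa> <= s0/20/1000" using \<kappa> c by simp
  moreover have "88 * \<nu> / \<gamma> <= 88 * (s0/20)^3/1000" using \<nu>s \<gamma> by (simp add: field_simps)
  ultimately show ?thesis using \<theta> c s unfolding b_def by simp
 qed
 \<comment> \<open>Vertices all of whose triples are exceptional must be rare, since each has a link
   of density at least \<open>l0\<close>.\<close>
 have cover: "l0 * pr V P <= b + 2 * \<nu>" if "!!x y u. P x ==> t x y u ~= i" for P
 proof -
  have "l0 * pr V P <= pr3 V (%u x y. P u & L u x y)"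
  by (rule pr3_conj_ge) (use link_size in auto)
  also have "... <= pr3 V (%x y z. T x y z & t x y z ~= i) + pr3 V (%u x y. h x y u & D x y & ~ T x y u)"
  proof (rule pr3_union)
  fix u x y assume a: "P u & L u x y"
  then have "h x y u" "D x y" using h_perm(4)[of u x y] unfolding L_def G_def by auto
  then show "(T u x y & t u x y ~= i) | (h x y u & D x y & ~ T x y u)"
  using that[of u x y] a T_perm(4)[of u x y] by simp
  qed
  also have "pr3 V (%u x y. h x y u & D x y & ~ T x y u) = pr3 V (%x y u. h x y u & D x y & ~ T x y u)"
  by (rule pr3_rot(1))
  finally show ?thesis using ti nonT by linarith
 qed
 have lt: "b + 2 * \<nu> <= 15 * l0^5/10^12"
 proof -
  define q where "q = l0^5"
  have "0 < q" unfolding q_def using l0 by simp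
  then show ?thesis using bs \<nu>_small(2) unfolding q_def[symmetric] by simp
 qed
 \<comment> \<open>The value 0 contradicts the size of \<open>Y\<close>, the value 3 gives the
   claim, and 1 and 2 are the patterns that \<open>nosplit\<close> forbids for \<open>Y\<close> and
   for its complement.\<close>
 have "i = 0 | i = 1 | i = 2 | i = 3" using i(1) by auto
 then show ?thesis
 proof (elim disjE)
  assume i0: "i = 0"
  have "l0 * pr V Y <= b + 2 * \<nu>" by (rule cover) (auto simp: t_def i0)
  moreover have "l0 * (l0^4/10^10) <= l0 * pr V Y" using big l0 by (intro mult_left_mono) auto
  ultimately have "l0^5 / 10^10 <= 15 * l0^5 / 10^12" using lt by (simp add: power_eq_if)
  then have "l0^5 <= 0" by simp
  then show ?thesis using zero_less_power[OF l0(1), of 5] by simp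
 next
  assume i1: "i = 1"
  have "pr3 V (%x y z. T x y z & ~ one Y x y z) <= pr3 V (%x y z. T x y z & t x y z ~= i)"
  by (rule pr3_mono) (auto simp: one_def t_def i1 of_bool_def split: if_splits)
  then show ?thesis using nosplit[of Y] ti bs0 by linarith
 next
  assume i2: "i = 2"
  have "pr3 V (%x y z. T x y z & ~ one (%x. ~ Y x) x y z) <= pr3 V (%x y z. T x y z & t x y z ~= i)"
  by (rule pr3_mono) (auto simp: one_def t_def i2 of_bool_def split: if_splits)
  then show ?thesis using nosplit[of "%x. ~ Y x"] ti bs0 by linarith
 next
  assume i3: "i = 3"
  have "l0 * pr V (%v. ~ Y v) <= b + 2 * \<nu>"
  by (rule cover) (auto simp: t_def i3 of_bool_def split: if_splits)
  also have "... <= l0 * (1/100)" using lt l0_pow l0 by simp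
  finally show ?thesis using l0 by (subst (asm) mult_le_cancel_left_pos) auto
 qed
qed

text \<open>Some round adds at most \<theta>, and then at most one vertex in a hundred is missing.
  Any vertex still enters in one more step, because each of its link pairs has more than a third of
  all vertices above it.\<close>

lemma exchange_all:
 assumes \<theta>: "0 < \<theta>" "\<theta> <= l0^5 / 10^12" "100 * \<theta> <= e" "100 * \<theta> <= s0" and J: "1 < \<theta> * real J"
  and big: "l0^4 / 10^10 <= pr V Y" and v: "v \<in> V"
 shows "ygrow \<theta> Y J v"
proof -
 let ?g = "ygrow \<theta> Y"
 have split: "pr V (?g (Suc k)) = pr V (?g k) + pr V (%x. ?g (Suc k) x & ~ ?g k x)" for k
 proof -
  have "pr V (%x. ?g (Suc k) x & ?g k x) = pr V (?g k)" by (rule pr_cong) auto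
  then show ?thesis using pr_split[of V "?g (Suc k)" "?g k"] by linarith
 qed
 have "\<exists>k<J. pr V (%x. ?g (Suc k) x & ~ ?g k x) <= \<theta>"
 proof (rule ccontr)
  assume n: "~ ?thesis"
  have "k <= J ==> \<theta> * real k <= pr V (?g k)" for k
  proof (induction k)
  case 0
  show ?case by simp
  next
  case (Suc k)
  then have "\<theta> < pr V (%x. ?g (Suc k) x & ~ ?g k x)" using n by (simp add: not_le)
  moreover have "\<theta> * real k <= pr V (?g k)" using Suc by simp
  ultimately show ?case using split[of k] by (simp add: distrib_left)
  qed
  then have "\<theta> * real J <= pr V (?g J)" by simp
  then show False using J pr_le1[of "?g J"] by linarith
 qed
 then obtain k where k: "k < J" "pr V (%x. ?g (Suc k) x & ~ ?g k x) <= \<theta>" by blast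
 have "pr V (%v. ~ ?g k v) <= 1/100"
 proof (rule exchange_stall[OF \<theta>])
  have "avg V (%v. of_bool (~ ?g k v) * pr3 V (%u b c. ?g k u & L u b c & L v b c))
  <= avg V (%v. \<theta> + of_bool (?g (Suc k) v & ~ ?g k v))"
  proof (rule avg_mono)
  fix v assume "v \<in> V"
  show "of_bool (~ ?g k v) * pr3 V (%u b c. ?g k u & L u b c & L v b c) <= \<theta> + of_bool (?g (Suc k) v & ~ ?g k v)"
  proof -
  define p where "p = pr3 V (%u b c. ?g k u & L u b c & L v b c)"
  have "p <= 1" unfolding p_def by simp
  then show ?thesis unfolding p_def[symmetric] using \<theta>(1) by (auto simp: p_def[symmetric])
  qed
  qed
  also have "... = \<theta> + pr V (%x. ?g (Suc k) x & ~ ?g k x)" unfolding avg_add pr_def by simp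
  finally show "avg V (%v. of_bool (~ ?g k v) * pr3 V (%u b c. ?g k u & L u b c & L v b c)) <= 2 * \<theta>"
  using k(2) by linarith
  have "pr V Y <= pr V (?g k)" by (rule pr_mono) (use ygrow_mono[of 0 k] in auto)
  then show "l0^4/10^10 <= pr V (?g k)" using big by linarith
 qed
 have "1/4 * l0 <= 1/4 * pr2 V (L v)" using link_size[OF v] by simp
 also have "... <= pr3 V (%b c u. L v b c & (?g k u & h u b c))"
 proof (rule pr3_conj2_ge)
  fix b c assume bc: "b \<in> V" "c \<in> V" "L v b c"
  then have "b ~= c" using D_neq unfolding L_def G_def by blast
  then have "1/3 + \<gamma> <= pr V (h b c)" using codeg bc by blast
  moreover have "pr V (h b c) - pr V (%v. ~ ?g k v) <= pr V (%u. ?g k u & h u b c)"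
  by (rule pr_diff_ge) (use h_perm in blast)
  ultimately show "1/4 <= pr V (%u. ?g k u & h u b c)" using \<open>pr V (%v. ~ ?g k v) <= 1/100\<close> \<gamma> by linarith
 qed
 also have "... <= pr3 V (%b c u. ?g k u & L u b c & L v b c)"
  by (rule pr3_mono) (auto simp: L_def)
 also have "... = pr3 V (%u b c. ?g k u & L u b c & L v b c)"
  by (rule pr3_rot(1)[symmetric])
 finally have "1/4 * l0 <= pr3 V (%u b c. ?g k u & L u b c & L v b c)" .
 moreover have "l0^5/10^12 <= l0/10^5/10^12" using l0_pow by (intro divide_right_mono) auto
 then have "\<theta> <= 1/4 * l0" using \<theta>(2) l0 by simp
 ultimately have "\<theta> <= pr3 V (%u b c. ?g k u & L u b c & L v b c)" by linarith
 then have "?g (Suc k) v" by simp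
 then show ?thesis using ygrow_mono[of "Suc k" J] k(1) by simp
qed

end

section \<open>Complete tripartite tiles and fractional matchings\<close>

lemma sum_card_swap:
 assumes "finite P" "finite C"
 shows "(\<Sum>p\<in>P. card {c\<in>C. r p c}) = (\<Sum>c\<in>C. card {p\<in>P. r p c})"
proof -
 have "(\<Sum>p\<in>P. card {c\<in>C. r p c}) = (\<Sum>p\<in>P. \<Sum>c\<in>C. of_bool (r p c))"
  using assms by (intro sum.cong) (auto simp: of_bool_def sum.If_cases Int_def)
 also have "... = (\<Sum>c\<in>C. \<Sum>p\<in>P. of_bool (r p c))" by (rule sum.swap)
 also have "... = (\<Sum>c\<in>C. card {p\<in>P. r p c})"
  using assms by (intro sum.cong) (auto simp: of_bool_def sum.If_cases Int_def)
 finally show ?thesis .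
qed

lemma common_neighbours:
 assumes fin: "finite P" "finite C" and \<rho>: "0 < \<rho>" "\<rho> <= (1::real)"
  and deg: "!!p. p \<in> P ==> \<rho> * card C <= card {c\<in>C. r p c}"
 shows "real t <= \<rho> * card C / 2 ==>
  \<exists>C'\<subseteq>C. card C' = t & (\<rho>/2)^t * card P <= card {p\<in>P. \<forall>c\<in>C'. r p c}"
proof (induction t)
 case 0
 show ?case by (intro exI[of _ "{}"]) auto
next
 case (Suc t)
 then obtain C' where C': "C' \<subseteq> C" "card C' = t" "(\<rho>/2)^t * card P <= card {p\<in>P. \<forall>c\<in>C'. r p c}" by auto
 define P' where "P' = {p\<in>P. \<forall>c\<in>C'. r p c}"
 define E where "E = C - C'"
 have finC': "finite C'" using C'(1) fin(2) finite_subset by blast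
 have cE: "card E <= card C" unfolding E_def using fin by (intro card_mono) auto
 have "\<rho> * card C <= card C" using \<rho> by (simp add: mult_left_le_one_le)
 then have tC: "real (Suc t) <= card C" using Suc.prems by linarith
 have Ene: "E ~= {}"
 proof
  assume "E = {}"
  then have "card C <= card C'" unfolding E_def using finC' by (intro card_mono) auto
  then show False using tC C'(2) by simp
 qed
 have finE: "finite E" unfolding E_def using fin by simp
 have "\<exists>c\<in>E. \<rho>/2 * card P' <= card {p\<in>P'. r p c}"
 proof (rule ccontr)
  assume "~ ?thesis"
  then have "(\<Sum>c\<in>E. real (card {p\<in>P'. r p c})) < (\<Sum>c\<in>E. \<rho>/2 * card P')"
  using Ene finE by (intro sum_strict_mono) auto
  also have "... = card E * (\<rho>/2 * card P')" by simp
  also have "... <= card C * (\<rho>/2 * card P')" using cE \<rho> by (intro mult_right_mono) auto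
  finally have 1: "(\<Sum>c\<in>E. real (card {p\<in>P'. r p c})) < card C * (\<rho>/2 * card P')" .
  have "(\<Sum>p\<in>P'. \<rho> * card C / 2) <= (\<Sum>p\<in>P'. real (card {c\<in>E. r p c}))"
  proof (rule sum_mono)
  fix p assume p: "p \<in> P'"
  have "{c\<in>C. r p c} \<subseteq> {c\<in>E. r p c} \<union> C'" unfolding E_def by auto
  then have "card {c\<in>C. r p c} <= card ({c\<in>E. r p c} \<union> C')"
  using finE finC' by (intro card_mono) auto
  also have "... <= card {c\<in>E. r p c} + t" using card_Un_le C'(2) by metis
  finally have "\<rho> * card C <= card {c\<in>E. r p c} + real t"
  using deg[of p] p unfolding P'_def by force
  then show "\<rho> * card C / 2 <= card {c\<in>E. r p c}" using Suc.prems by linarith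
  qed
  moreover have "(\<Sum>p\<in>P'. real (card {c\<in>E. r p c})) = (\<Sum>c\<in>E. real (card {p\<in>P'. r p c}))"
  using sum_card_swap[of P' E r] fin finE unfolding P'_def by (simp flip: of_nat_sum)
  moreover have "(\<Sum>p\<in>P'. \<rho> * card C / 2) = card C * (\<rho>/2 * card P')" by simp
  ultimately show False using 1 by linarith
 qed
 then obtain c where c: "c \<in> E" "\<rho>/2 * card P' <= card {p\<in>P'. r p c}" by blast
 have "{p\<in>P'. r p c} = {p\<in>P. \<forall>x\<in>insert c C'. r p x}" unfolding P'_def by auto
 moreover have "(\<rho>/2)^Suc t * card P <= \<rho>/2 * card P'"
  using mult_left_mono[OF C'(3), of "\<rho>/2"] \<rho> unfolding P'_def by simp
 ultimately have "(\<rho>/2)^Suc t * card P <= card {p\<in>P. \<forall>x\<in>insert c C'. r p x}" using c(2) by simp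
 then show ?case
  using c(1) C' finC' by (intro exI[of _ "insert c C'"]) (auto simp: E_def)
qed

lemma many_heavy:
 assumes fin: "finite P" "finite C" and \<rho>: "0 < (\<rho>::real)"
  and tot: "\<rho> * card P * card C <= (\<Sum>p\<in>P. real (card {c\<in>C. r p c}))"
  and C0: "0 < card C"
 shows "\<rho>/2 * card P <= card {p\<in>P. \<rho>/2 * card C <= card {c\<in>C. r p c}}"
proof -
 let ?h = "%p. \<rho>/2 * card C <= real (card {c\<in>C. r p c})"
 have "(\<Sum>p\<in>P. real (card {c\<in>C. r p c})) <= (\<Sum>p\<in>P. \<rho>/2 * card C + (if ?h p then real (card C) else 0))"
 proof (rule sum_mono)
  fix p assume "p \<in> P"
  have "card {c\<in>C. r p c} <= card C" using fin by (intro card_mono) auto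
  then show "real (card {c\<in>C. r p c}) <= \<rho>/2 * card C + (if ?h p then real (card C) else 0)"
  using \<rho> by (auto intro: add_increasing)
 qed
 also have "... = card P * (\<rho>/2 * card C) + card C * card {p\<in>P. ?h p}"
  using fin by (simp add: sum.distrib sum.If_cases Int_def)
 finally have "card C * (\<rho>/2 * card P) <= card C * card {p\<in>P. ?h p}"
  using tot by (simp add: algebra_simps)
 then show ?thesis using C0 by simp
qed

lemma complete_bipartite:
 assumes fin: "finite A" "finite B" and \<rho>: "0 < \<rho>" "\<rho> <= (1::real)"
  and tot: "\<rho> * card A * card B <= card {(a, b). a \<in> A & b \<in> B & r a b}"
  and tB: "real t <= \<rho> * card B / 4" and tA: "real t <= (\<rho>/4)^t * (\<rho>/2) * card A" and t: "0 < t"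
 shows "\<exists>A'\<subseteq>A. \<exists>B'\<subseteq>B. card A' = t & card B' = t & (\<forall>a\<in>A'. \<forall>b\<in>B'. r a b)"
proof -
 have B0: "0 < card B" using tB t by (cases "card B = 0") auto
 have eq: "{(a, b). a \<in> A & b \<in> B & r a b} = (SIGMA a:A. {b\<in>B. r a b})" by auto
 have "\<rho> * card A * card B <= (\<Sum>a\<in>A. real (card {b\<in>B. r a b}))"
  using tot fin unfolding eq by (simp add: card_SigmaI)
 then have h: "\<rho>/2 * card A <= card {a\<in>A. \<rho>/2 * card B <= card {b\<in>B. r a b}}"
  by (rule many_heavy[OF fin \<rho>(1) _ B0])
 define A1 where "A1 = {a\<in>A. \<rho>/2 * card B <= card {b\<in>B. r a b}}"
 have "\<exists>B'\<subseteq>B. card B' = t & (\<rho>/2/2)^t * card A1 <= card {a\<in>A1. \<forall>b\<in>B'. r a b}"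
  by (rule common_neighbours) (use fin \<rho> tB in \<open>auto simp: A1_def\<close>)
 then obtain B' where B': "B' \<subseteq> B" "card B' = t" "(\<rho>/4)^t * card A1 <= card {a\<in>A1. \<forall>b\<in>B'. r a b}" by auto
 have "(\<rho>/4)^t * (\<rho>/2 * card A) <= (\<rho>/4)^t * card A1"
  using h \<rho> unfolding A1_def by (intro mult_left_mono) auto
 then have "real t <= card {a\<in>A1. \<forall>b\<in>B'. r a b}" using tA B'(3) by (simp add: mult.assoc)
 then have "t <= card {a\<in>A1. \<forall>b\<in>B'. r a b}" by simp
 then obtain A' where A': "A' \<subseteq> {a\<in>A1. \<forall>b\<in>B'. r a b}" "card A' = t"
  by (rule obtain_subset_with_card_n) (rule that)
 have "A' \<subseteq> A" "\<forall>a\<in>A'. \<forall>b\<in>B'. r a b" using A'(1) unfolding A1_def by auto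
 then show ?thesis using B'(1,2) A'(2) by (intro exI[of _ A'] exI[of _ B'] conjI)
qed

text \<open>The third class is fixed as a set of common neighbours of many pairs from
  \<open>A\<close> and \<open>B\<close>; these pairs form a bipartite graph of density \<rho>2, to
  which \<open>complete_bipartite\<close> applies. The threshold is uniform in the sets and in the
  relation.\<close>

lemma complete_tripartite:
 fixes \<rho> :: real and t :: nat
 assumes \<rho>: "0 < \<rho>" "\<rho> <= 1" and t: "0 < t"
 shows "EX m0. \<forall>A B C (T :: 'a => 'a => 'a => bool). finite A --> finite B --> finite C -->
  m0 <= card A --> m0 <= card B --> m0 <= card C -->
  \<rho> * card A * card B * card C <= card {(a, b, c). a \<in> A & b \<in> B & c \<in> C & T a b c} -->
  (\<exists>A'\<subseteq>A. \<exists>B'\<subseteq>B. \<exists>C'\<subseteq>C. card A' = t & card B' = t & card C' = t & (\<forall>a\<in>A'. \<forall>b\<in>B'. \<forall>c\<in>C'. T a b c))"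
proof -
 define \<rho>2 where "\<rho>2 = (\<rho>/4)^t * (\<rho>/2)"
 have \<rho>2: "0 < \<rho>2" "\<rho>2 <= 1"
 proof -
  show "0 < \<rho>2" unfolding \<rho>2_def using \<rho> by simp
  have "(\<rho>/4)^t <= 1" using \<rho> by (intro power_le_one) auto
  then have "\<rho>2 <= 1 * 1" unfolding \<rho>2_def using \<rho> by (intro mult_mono) auto
  then show "\<rho>2 <= 1" by simp
 qed
 define \<sigma> where "\<sigma> = min (\<rho>/4) (min (\<rho>2/4) ((\<rho>2/4)^t * (\<rho>2/2)))"
 have \<sigma>: "0 < \<sigma>" unfolding \<sigma>_def using \<rho> \<rho>2 by simp
 define m0 where "m0 = nat \<lceil>real t / \<sigma>\<rceil>"
 have m0: "real t <= x * real m" if "m0 <= m" "\<sigma> <= x" for m x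
 proof -
  have "real t / \<sigma> <= real m0" unfolding m0_def by (rule real_nat_ceiling_ge)
  then have "real t / \<sigma> <= real m" using that(1) by (meson of_nat_le_iff order_trans)
  then have "real t <= \<sigma> * real m" using \<sigma> by (simp add: field_simps)
  also have "... <= x * real m" using that(2) by (intro mult_right_mono) auto
  finally show ?thesis .
 qed
 have s: "\<sigma> <= \<rho>/4" "\<sigma> <= \<rho>2/4" "\<sigma> <= (\<rho>2/4)^t * (\<rho>2/2)" unfolding \<sigma>_def by auto
 show ?thesis
 proof (intro exI[of _ m0] allI impI)
  fix A B C :: "'a set" and T :: "'a => 'a => 'a => bool"
  assume fin: "finite A" "finite B" "finite C" and m: "m0 <= card A" "m0 <= card B" "m0 <= card C"
  and tot: "\<rho> * card A * card B * card C <= card {(a, b, c). a \<in> A & b \<in> B & c \<in> C & T a b c}"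
  have C0: "0 < card C" using m0[OF m(3) s(1)] t by (cases "card C = 0") auto
  let ?r = "%p c. T (fst p) (snd p) c"
  have "card {(a, b, c). a \<in> A & b \<in> B & c \<in> C & T a b c} = card (SIGMA p:A\<times>B. {c\<in>C. ?r p c})"
  proof (rule bij_betw_same_card[of "%(a,b,c). ((a,b),c)"])
  show "bij_betw (%(a,b,c). ((a,b),c)) {(a, b, c). a \<in> A & b \<in> B & c \<in> C & T a b c} (SIGMA p:A\<times>B. {c\<in>C. ?r p c})"
  by (rule bij_betw_byWitness[where f' = "%((a,b),c). (a,b,c)"]) auto
  qed
  then have "\<rho> * card (A \<times> B) * card C <= (\<Sum>p\<in>A\<times>B. real (card {c\<in>C. ?r p c}))"
  using tot fin by (simp add: card_SigmaI card_cartesian_product mult.assoc)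
  then have h: "\<rho>/2 * card (A \<times> B) <= card {p\<in>A\<times>B. \<rho>/2 * card C <= card {c\<in>C. ?r p c}}"
  by (rule many_heavy[OF finite_cartesian_product[OF fin(1,2)] fin(3) \<rho>(1) _ C0])
  define P1 where "P1 = {p\<in>A\<times>B. \<rho>/2 * card C <= card {c\<in>C. ?r p c}}"
  have "\<exists>C'\<subseteq>C. card C' = t & (\<rho>/2/2)^t * card P1 <= card {p\<in>P1. \<forall>c\<in>C'. ?r p c}"
  by (rule common_neighbours) (use fin \<rho> m0[OF m(3) s(1)] in \<open>auto simp: P1_def\<close>)
  then obtain C' where C': "C' \<subseteq> C" "card C' = t" "(\<rho>/4)^t * card P1 <= card {p\<in>P1. \<forall>c\<in>C'. ?r p c}" by auto
  have "\<rho>2 * card A * card B = (\<rho>/4)^t * (\<rho>/2 * card (A \<times> B))"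
  unfolding \<rho>2_def by (simp add: card_cartesian_product)
  also have "... <= (\<rho>/4)^t * card P1" using h \<rho> unfolding P1_def by (intro mult_left_mono) auto
  also have "... <= card {p\<in>P1. \<forall>c\<in>C'. ?r p c}" by (rule C'(3))
  also have "... <= card {(a, b). a \<in> A & b \<in> B & (\<forall>c\<in>C'. T a b c)}"
  proof -
  have "finite {(a, b). a \<in> A & b \<in> B & (\<forall>c\<in>C'. T a b c)}"
  by (rule finite_subset[of _ "A \<times> B"]) (use fin in auto)
  then show ?thesis by (intro of_nat_mono card_mono) (auto simp: P1_def)
  qed
  finally have "\<exists>A'\<subseteq>A. \<exists>B'\<subseteq>B. card A' = t & card B' = t & (\<forall>a\<in>A'. \<forall>b\<in>B'. \<forall>c\<in>C'. T a b c)"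
  using m0[OF m(2) s(2)] m0[OF m(1) s(3)] t by (intro complete_bipartite[OF fin(1,2) \<rho>2]) auto
  then show "\<exists>A'\<subseteq>A. \<exists>B'\<subseteq>B. \<exists>C'\<subseteq>C. card A' = t & card B' = t & card C' = t & (\<forall>a\<in>A'. \<forall>b\<in>B'. \<forall>c\<in>C'. T a b c)"
  using C'(1,2) by blast
 qed
qed

text \<open>The load of \<open>i\<close>. Lists are used because a fractional matching is
  represented by triples with multiplicity.\<close>

definition cnt :: "('b \<times> 'b \<times> 'b) list => 'b => nat" where
 "cnt es i = length (filter (%(a, b, c). i = a | i = b | i = c) es)"

lemma cnt_simps [simp]: "cnt [] i = 0"
 "cnt ((a, b, c) # es) i = of_bool (i = a | i = b | i = c) + cnt es i"
 unfolding cnt_def by auto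

lemma sum_indicator3:
 assumes "finite I" "a \<in> I" "b \<in> I" "c \<in> I" "a ~= b" "a ~= c" "b ~= c"
 shows "(\<Sum>i\<in>I. f i * of_bool (i = a | i = b | i = c)) = f a + f b + (f c :: real)"
proof -
 have "(\<Sum>i\<in>I. f i * of_bool (i = a | i = b | i = c)) = (\<Sum>i\<in>{a, b, c}. f i)"
  using assms by (intro sum.mono_neutral_cong_right) auto
 then show ?thesis using assms by simp
qed

text \<open>Always adding a triple on which the current load is small keeps the second moment of the load
 close to that of a perfectly balanced load.\<close>
lemma balanced_triples:
 fixes I :: "'b set" and R :: "'b => 'b => 'b => bool" and \<eta> :: real
 defines "r \<equiv> real (card I)"
 assumes I: "finite I" "I ~= {}" and \<eta>: "\<eta> <= 1/2"
  and dual: "!!c::'b => real. (\<forall>i\<in>I. 0 <= c i) ==> sum c I < (1 - \<eta>) * r / 3 ==>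
  \<exists>i\<in>I. \<exists>j\<in>I. \<exists>k\<in>I. i ~= j & i ~= k & j ~= k & R i j k & c i + c j + c k < 1"
 shows "EX es. length es = N & (\<forall>(i, j, k)\<in>set es. i \<in> I & j \<in> I & k \<in> I & i ~= j & i ~= k & j ~= k & R i j k)
  & (\<Sum>i\<in>I. real (cnt es i)) = 3 * real N
  & (\<Sum>i\<in>I. (real (cnt es i))^2) <= 9 * real N * (real N + 1) / ((1 - \<eta>) * r) + 3 * real N"
proof (induction N)
 case 0
 show ?case by (intro exI[of _ "[]"]) auto
next
 case (Suc N)
 then obtain es where es: "length es = N"
  "\<forall>(i, j, k)\<in>set es. i \<in> I & j \<in> I & k \<in> I & i ~= j & i ~= k & j ~= k & R i j k"
  "(\<Sum>i\<in>I. real (cnt es i)) = 3 * real N"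
  "(\<Sum>i\<in>I. (real (cnt es i))^2) <= 9 * real N * (real N + 1) / ((1 - \<eta>) * r) + 3 * real N" by blast
 define u where "u = (%i. real (cnt es i))"
 have r0: "0 < r" unfolding r_def using I by (simp add: card_gt_0_iff)
 \<comment> \<open>Scales the present load to a total weight just below the admissible value, so
   that the hypothesis returns a triple of small load.\<close>
 define l where "l = (1 - \<eta>) * r / (9 * (real N + 1))"
 have l0: "0 < l" unfolding l_def using r0 \<eta> by simp
 have "\<exists>i\<in>I. \<exists>j\<in>I. \<exists>k\<in>I. i ~= j & i ~= k & j ~= k & R i j k & l * u i + l * u j + l * u k < 1"
 proof (rule dual)
  show "\<forall>i\<in>I. 0 <= l * u i" using l0 unfolding u_def by simp
  have "(\<Sum>i\<in>I. l * u i) = l * (3 * real N)" using es(3) unfolding u_def by (simp flip: sum_distrib_left)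
  also have "... = (1 - \<eta>) * r / 3 * (real N / (real N + 1))" unfolding l_def by (simp add: field_simps)
  also have "... < (1 - \<eta>) * r / 3 * 1" using r0 \<eta> by (intro mult_strict_left_mono) auto
  finally show "(\<Sum>i\<in>I. l * u i) < (1 - \<eta>) * r / 3" by simp
 qed
 then obtain a b c where abc: "a \<in> I" "b \<in> I" "c \<in> I" "a ~= b" "a ~= c" "b ~= c" "R a b c"
  "l * u a + l * u b + l * u c < 1" by blast
 have "u a + u b + u c <= 1 / l" using abc(8) l0 by (simp add: field_simps)
 then have ul: "u a + u b + u c <= 9 * (real N + 1) / ((1 - \<eta>) * r)" unfolding l_def by simp
 have c': "real (cnt ((a, b, c) # es) i) = u i + of_bool (i = a | i = b | i = c)" for i
  unfolding u_def by simp
 have "(\<Sum>i\<in>I. real (cnt ((a, b, c) # es) i)) = 3 * real N + (\<Sum>i\<in>I. 1 * of_bool (i = a | i = b | i = c))"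
  unfolding c' sum.distrib using es(3) unfolding u_def by simp
 also have "... = 3 * real (Suc N)" using sum_indicator3[OF I(1) abc(1-6), of "%_. 1"] by simp
 finally have s1: "(\<Sum>i\<in>I. real (cnt ((a, b, c) # es) i)) = 3 * real (Suc N)" .
 have sq: "(u i + of_bool P)^2 = (u i)^2 + (2 * u i + 1) * of_bool P" for i P
  by (cases P) (auto simp: power2_eq_square algebra_simps)
 have "(\<Sum>i\<in>I. (real (cnt ((a, b, c) # es) i))^2)
  = (\<Sum>i\<in>I. (u i)^2) + (\<Sum>i\<in>I. (2 * u i + 1) * of_bool (i = a | i = b | i = c))"
  unfolding c' sq sum.distrib ..
 also have "... = (\<Sum>i\<in>I. (u i)^2) + (2 * (u a + u b + u c) + 3)"
  using sum_indicator3[OF I(1) abc(1-6), of "%i. 2 * u i + 1"] by simp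
 also have "... <= (9 * real N * (real N + 1) / ((1 - \<eta>) * r) + 3 * real N) + (2 * (9 * (real N + 1) / ((1 - \<eta>) * r)) + 3)"
  using es(4) ul unfolding u_def by (intro add_mono mult_left_mono) auto
 also have "... = 9 * real (Suc N) * (real (Suc N) + 1) / ((1 - \<eta>) * r) + 3 * real (Suc N)"
 proof -
  have "9 * real (Suc N) * (real (Suc N) + 1) = 9 * real N * (real N + 1) + 2 * (9 * (real N + 1))"
  by (simp add: algebra_simps)
  then show ?thesis by (simp only: add_divide_distrib) simp
 qed
 finally show ?case using s1 es(1,2) abc by (intro exI[of _ "(a, b, c) # es"]) auto
qed

lemma touched_le:
 assumes "finite S"
 shows "length (filter (%(a, b, c). a \<in> S | b \<in> S | c \<in> S) es) <= (\<Sum>i\<in>S. cnt es i)"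
proof (induction es)
 case (Cons e es)
 obtain a b c where e: "e = (a, b, c)" by (cases e)
 have "of_bool (a \<in> S | b \<in> S | c \<in> S) <= (\<Sum>i\<in>S. of_bool (i = a | i = b | i = c) :: nat)"
 proof (cases "a \<in> S | b \<in> S | c \<in> S")
  case True
  then obtain j where j: "j \<in> S" "j = a | j = b | j = c" by blast
  then have "of_bool (j = a | j = b | j = c) <= (\<Sum>i\<in>S. of_bool (i = a | i = b | i = c) :: nat)"
  using assms by (intro member_le_sum) auto
  then show ?thesis using j True by simp
 qed simp
 then show ?case using Cons e by (auto simp: sum.distrib)
qed simp

lemma cnt_filter_le: "cnt (filter P es) i <= cnt es i"
 unfolding cnt_def by (induction es) auto

text \<open>A quantitative substitute for linear duality. The second moment gives a mean squared
  deviation of order \<omega>^3 q^2. Deviations above \<omega> q cost a factor \<omega>^2, so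
  overloaded elements carry only a proportion of order \<omega> of the load, and the triples through
  them are dropped. The bound \<open>P\<close> on the multiplicity depends on \<omega>
  alone.\<close>

lemma balanced_matching:
 fixes \<omega> :: real
 assumes \<omega>: "0 < \<omega>" "\<omega> <= 1/2"
 shows "\<exists>P>0. \<forall>(I :: 'b set) R. finite I --> I ~= {} -->
  (\<forall>c::'b => real. (\<forall>i\<in>I. 0 <= c i) --> sum c I < (1 - \<omega>^3) * card I / 3 -->
  (\<exists>i\<in>I. \<exists>j\<in>I. \<exists>k\<in>I. i ~= j & i ~= k & j ~= k & R i j k & c i + c j + c k < 1)) -->
  (EX es. (\<forall>(i, j, k)\<in>set es. i \<in> I & j \<in> I & k \<in> I & i ~= j & i ~= k & j ~= k & R i j k)
  & (ALL i. cnt es i <= P) & (1 - 25 * \<omega>) * real P * card I / 3 <= length es)"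
proof -
 \<comment> \<open>The constant 13 collects the rounding terms 6q + 6q + qr of the variance
   estimate, with r at least 1.\<close>
 define Q where "Q = nat \<lceil>13 / \<omega>^3\<rceil>"
 define P where "P = nat \<lfloor>(1 + \<omega>) * real Q\<rfloor>"
 have Q: "13 / \<omega>^3 <= real Q" unfolding Q_def by (rule real_nat_ceiling_ge)
 have w3: "0 < \<omega>^3" "\<omega>^3 <= 1/2"
 proof -
  have "\<omega>^3 <= \<omega>^1" using \<omega> by (intro power_decreasing) auto
  then show "0 < \<omega>^3" "\<omega>^3 <= 1/2" using \<omega> by auto
 qed
 have Q13: "13 <= \<omega>^3 * real Q" using Q w3 by (simp add: field_simps)
 have Q1: "1 <= real Q"
 proof -
  have "\<omega>^3 * real Q <= 1/2 * real Q" using w3 by (intro mult_right_mono) auto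
  then show ?thesis using Q13 by linarith
 qed
 have Pr: "real P <= (1 + \<omega>) * real Q" unfolding P_def using \<omega> by (simp add: of_nat_nat)
 have PQ: "real x <= (1 + \<omega>) * real Q ==> x <= P" for x :: nat unfolding P_def by (simp add: le_nat_floor)
 have P0: "0 < P"
 proof -
  have "Q <= P" by (rule PQ) (use \<omega> in \<open>simp add: algebra_simps\<close>)
  then show ?thesis using Q1 by simp
 qed
 show ?thesis
 proof (intro exI[of _ P] conjI allI impI P0)
  fix I :: "'b set" and R :: "'b => 'b => 'b => bool"
  assume I: "finite I" "I ~= {}" and dual: "\<forall>c::'b => real. (\<forall>i\<in>I. 0 <= c i) --> sum c I < (1 - \<omega>^3) * card I / 3 -->
  (\<exists>i\<in>I. \<exists>j\<in>I. \<exists>k\<in>I. i ~= j & i ~= k & j ~= k & R i j k & c i + c j + c k < 1)"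
  define r where "r = real (card I)"
  have r: "1 <= r" unfolding r_def using I by (simp add: Suc_leI card_gt_0_iff)
  define N where "N = nat \<lfloor>real Q * r / 3\<rfloor>"
  have N: "real N <= real Q * r / 3" "real Q * r / 3 - 1 <= real N"
  proof -
  have "0 <= real Q * r / 3" using r by simp
  then show "real N <= real Q * r / 3" "real Q * r / 3 - 1 <= real N" unfolding N_def by linarith+
  qed
  have "EX es. length es = N & (\<forall>(i, j, k)\<in>set es. i \<in> I & j \<in> I & k \<in> I & i ~= j & i ~= k & j ~= k & R i j k)
  & (\<Sum>i\<in>I. real (cnt es i)) = 3 * real N
  & (\<Sum>i\<in>I. (real (cnt es i))^2) <= 9 * real N * (real N + 1) / ((1 - \<omega>^3) * r) + 3 * real N"
  unfolding r_def
  proof (rule balanced_triples[OF I w3(2)])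
  fix c :: "'b => real" assume "\<forall>i\<in>I. 0 <= c i" "sum c I < (1 - \<omega>^3) * real (card I) / 3"
  then show "\<exists>i\<in>I. \<exists>j\<in>I. \<exists>k\<in>I. i ~= j & i ~= k & j ~= k & R i j k & c i + c j + c k < 1"
  using dual[rule_format, of c] by blast
  qed
  then obtain es where es: "length es = N"
  "\<forall>(i, j, k)\<in>set es. i \<in> I & j \<in> I & k \<in> I & i ~= j & i ~= k & j ~= k & R i j k"
  "(\<Sum>i\<in>I. real (cnt es i)) = 3 * real N"
  "(\<Sum>i\<in>I. (real (cnt es i))^2) <= 9 * real N * (real N + 1) / ((1 - \<omega>^3) * r) + 3 * real N"
  by (elim exE conjE) (rule that)
  define u where "u = (%i. real (cnt es i))"
  define q where "q = real Q"
  have var: "(\<Sum>i\<in>I. (u i - q)^2) <= 3 * \<omega>^3 * q^2 * r"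
  proof -
  have "(\<Sum>i\<in>I. (u i - q)^2) = (\<Sum>i\<in>I. (u i)^2 - 2 * q * u i + q^2)"
  by (intro sum.cong) (auto simp: power2_eq_square algebra_simps)
  also have "... = (\<Sum>i\<in>I. (u i)^2) - 2 * q * (3 * real N) + r * q^2"
  using es(3) unfolding u_def r_def by (simp add: sum.distrib sum_subtractf flip: sum_distrib_left)
  finally have 1: "(\<Sum>i\<in>I. (u i - q)^2) <= 9 * real N * (real N + 1) / ((1 - \<omega>^3) * r) + 3 * real N - 6 * q * real N + r * q^2"
  using es(4) unfolding u_def by simp
  have "0 <= q * r / 3" using r unfolding q_def by simp
  then have "9 * real N * (real N + 1) <= 9 * (q * r / 3) * (q * r / 3 + 1)"
  using N(1) unfolding q_def[symmetric] by (intro mult_mono) auto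
  also have "... = r * (q^2 * r + 3 * q)" by (simp add: power2_eq_square algebra_simps)
  finally have "9 * real N * (real N + 1) / ((1 - \<omega>^3) * r) <= r * (q^2 * r + 3 * q) / ((1 - \<omega>^3) * r)"
  using w3 r by (intro divide_right_mono) auto
  also have "... = (q^2 * r + 3 * q) / (1 - \<omega>^3)" using r by simp
  also have "... <= (q^2 * r + 3 * q) * (1 + 2 * \<omega>^3)"
  proof -
  have "\<omega>^3 * \<omega>^3 <= \<omega>^3 * (1/2)" using w3 by (intro mult_left_mono) auto
  then have "1 <= (1 + 2 * \<omega>^3) * (1 - \<omega>^3)" using w3 by (simp add: algebra_simps)
  then have "1 / (1 - \<omega>^3) <= 1 + 2 * \<omega>^3" using w3 by (simp add: field_simps)
  then have "(q^2 * r + 3 * q) * (1 / (1 - \<omega>^3)) <= (q^2 * r + 3 * q) * (1 + 2 * \<omega>^3)"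
  using r unfolding q_def by (intro mult_left_mono) auto
  then show ?thesis by simp
  qed
  also have "... <= q^2 * r + 2 * \<omega>^3 * q^2 * r + 6 * q"
  proof -
  have "3 * q * (1 + 2 * \<omega>^3) <= 3 * q * 2" using w3 unfolding q_def by (intro mult_left_mono) auto
  then show ?thesis by (simp add: algebra_simps)
  qed
  finally have 2: "9 * real N * (real N + 1) / ((1 - \<omega>^3) * r) <= q^2 * r + 2 * \<omega>^3 * q^2 * r + 6 * q" .
  have "6 * q * (q * r / 3 - 1) <= 6 * q * real N" using N unfolding q_def by (intro mult_left_mono) auto
  then have 3: "2 * q^2 * r - 6 * q <= 6 * q * real N" by (simp add: power2_eq_square algebra_simps)
  have 4: "3 * real N <= q * r" using N unfolding q_def by simp
  have 5: "13 * q * r <= \<omega>^3 * q^2 * r"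
  using mult_right_mono[OF Q13, of "q * r"] r unfolding q_def by (simp add: power2_eq_square algebra_simps)
  have 6: "q * 1 <= q * r" using r unfolding q_def by (intro mult_left_mono) auto
  show ?thesis using 1 2 3 4 5 6 by (simp add: algebra_simps)
  qed
  define Ov where "Ov = {i\<in>I. (1 + \<omega>) * q < u i}"
  have ov: "(\<Sum>i\<in>Ov. u i) <= 6 * \<omega> * q * r"
  proof -
  have "\<omega>^2 * q * (\<Sum>i\<in>Ov. u i) <= (\<Sum>i\<in>Ov. 2 * (u i - q)^2)"
  unfolding sum_distrib_left
  proof (rule sum_mono)
  fix i assume i: "i \<in> Ov"
  define d where "d = u i - q"
  have d: "\<omega> * q <= d" using i unfolding Ov_def d_def by (simp add: algebra_simps)
  have q0: "0 <= q" unfolding q_def by simp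
  have d0: "0 <= d" by (rule order_trans[OF _ d]) (use \<omega> q0 in simp)
  have "\<omega>^2 * q * q <= d * d"
  using mult_mono[OF d d d0] \<omega> q0 by (simp add: power2_eq_square algebra_simps)
  moreover have "\<omega>^2 * q * d <= d * d"
  proof -
  have "\<omega> * (\<omega> * q) <= 1 * (\<omega> * q)" using \<omega> q0 by (intro mult_right_mono) auto
  then have "\<omega>^2 * q <= d" using d by (simp add: power2_eq_square mult.assoc)
  then show ?thesis using d0 by (intro mult_right_mono)
  qed
  moreover have "u i = q + d" unfolding d_def by simp
  ultimately show "\<omega>^2 * q * u i <= 2 * (u i - q)^2"
  unfolding d_def[symmetric] by (simp add: power2_eq_square algebra_simps)
  qed
  also have "... <= (\<Sum>i\<in>I. 2 * (u i - q)^2)"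
  by (intro sum_mono2 I) (auto simp: Ov_def)
  also have "... = 2 * (\<Sum>i\<in>I. (u i - q)^2)" by (simp add: sum_distrib_left)
  also have "... <= 2 * (3 * \<omega>^3 * q^2 * r)" using var by (intro mult_left_mono) auto
  also have "... = \<omega>^2 * q * (6 * \<omega> * q * r)" by (simp add: power2_eq_square power3_eq_cube algebra_simps)
  finally show ?thesis
  using \<omega> Q1 unfolding q_def by (subst (asm) mult_le_cancel_left_pos) auto
  qed
  let ?t = "%(a, b, c). a \<in> Ov | b \<in> Ov | c \<in> Ov"
  define es' where "es' = filter (%e. ~ ?t e) es"
  have finO: "finite Ov" unfolding Ov_def using I by simp
  have "length es = length (filter ?t es) + length es'" unfolding es'_def
  by (rule sum_length_filter_compl[symmetric])
  moreover have "real (length (filter ?t es)) <= 6 * \<omega> * q * r"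
  proof -
  have "real (length (filter ?t es)) <= real (\<Sum>i\<in>Ov. cnt es i)"
  by (rule of_nat_mono[OF touched_le[OF finO]])
  then show ?thesis using ov unfolding u_def by simp
  qed
  ultimately have len: "q * r / 3 - 1 - 6 * \<omega> * q * r <= length es'" using es(1) N unfolding q_def by linarith
  show "EX es. (\<forall>(i, j, k)\<in>set es. i \<in> I & j \<in> I & k \<in> I & i ~= j & i ~= k & j ~= k & R i j k)
  & (ALL i. cnt es i <= P) & (1 - 25 * \<omega>) * real P * card I / 3 <= length es"
  proof (intro exI[of _ es'] conjI allI)
  show "\<forall>(i, j, k)\<in>set es'. i \<in> I & j \<in> I & k \<in> I & i ~= j & i ~= k & j ~= k & R i j k"
  using es(2) unfolding es'_def by auto
  show "cnt es' i <= P" for i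
  proof (cases "i \<in> Ov | i \<notin> I")
  case True
  have "filter (%(a, b, c). i = a | i = b | i = c) es' = []"
  using True es(2) unfolding es'_def by (auto simp: filter_empty_conv)
  then show ?thesis unfolding cnt_def by simp
  next
  case False
  then have "real (cnt es i) <= (1 + \<omega>) * real Q" unfolding Ov_def u_def q_def by auto
  then have "cnt es i <= P" by (rule PQ)
  then show ?thesis using cnt_filter_le[of "%e. ~ ?t e" es i] unfolding es'_def by linarith
  qed
  have eq: "q * r / 3 - 8 * \<omega> * q * r = (1 - 24 * \<omega>) * q * r / 3" by (simp add: field_simps)
  have "(1 - 25 * \<omega>) * real P * r / 3 <= q * r / 3 - 8 * \<omega> * q * r"
  proof (cases "25 * \<omega> <= 1")
  case True
  have "(1 - 25 * \<omega>) * real P <= (1 - 25 * \<omega>) * ((1 + \<omega>) * q)"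
  using Pr True unfolding q_def by (intro mult_left_mono) auto
  also have "... <= (1 - 24 * \<omega>) * q"
  proof -
  have "0 <= 25 * \<omega> * \<omega> * q" using \<omega> unfolding q_def by simp
  then show ?thesis by (simp add: algebra_simps)
  qed
  finally have "(1 - 25 * \<omega>) * real P * r <= (1 - 24 * \<omega>) * q * r" using r by (intro mult_right_mono) auto
  then show ?thesis unfolding eq by (rule divide_right_mono) simp
  next
  case False
  have "(1 - 25 * \<omega>) * real P <= (1 - 25 * \<omega>) * q"
  proof -
  have "q <= real P" unfolding q_def using PQ[of Q] \<omega> by (simp add: algebra_simps)
  then show ?thesis using False by (intro mult_left_mono_neg) auto
  qed
  also have "... <= (1 - 24 * \<omega>) * q" using \<omega> unfolding q_def by (intro mult_right_mono) auto
  finally have "(1 - 25 * \<omega>) * real P * r <= (1 - 24 * \<omega>) * q * r" using r by (intro mult_right_mono) auto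
  then show ?thesis unfolding eq by (rule divide_right_mono) simp
  qed
  moreover have "1 <= 2 * \<omega> * q * r"
  proof -
  have "\<omega>^3 <= \<omega>^1" using \<omega> by (intro power_decreasing) auto
  then have "\<omega>^3 * q <= \<omega> * q" unfolding q_def by (intro mult_right_mono) auto
  then have "13 <= \<omega> * q" using Q13 unfolding q_def by linarith
  then have "13 * 1 <= \<omega> * q * r" using r by (intro mult_mono) auto
  then show ?thesis by linarith
  qed
  ultimately show "(1 - 25 * \<omega>) * real P * card I / 3 <= length es'" using len unfolding r_def by linarith
  qed
 qed
qed

section \<open>Exchange slots\<close>

text \<open>The weight of an index halves with every good element chosen so far; a choice of at most average total
 weight keeps the total weight decreasing geometrically.\<close>
lemma mult_weights:
 fixes good :: "'i => 'g => bool" and \<beta> :: real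
 assumes I: "finite I" "I ~= {}" and X: "finite X" "X ~= {}" and \<beta>: "0 < \<beta>" "\<beta> <= 1" and P0: "P []"
  and step: "!!gs i. P gs ==> length gs < N ==> i \<in> I ==> \<beta> * card X <= card {g \<in> X. good i g & P (g # gs)}"
 shows "EX gs. P gs & length gs <= N & (\<Sum>i\<in>I. (1/2)^length (filter (good i) gs)) <= card I * (1 - \<beta>/2)^N"
proof -
 have "k <= N ==> EX gs. P gs & length gs = k & (\<Sum>i\<in>I. (1/2)^length (filter (good i) gs)) <= card I * (1 - \<beta>/2)^k" for k
 proof (induction k)
  case 0
  then show ?case using P0 by (intro exI[of _ "[]"]) simp
 next
  case (Suc k)
  then obtain gs where gs: "P gs" "length gs = k" "(\<Sum>i\<in>I. (1/2)^length (filter (good i) gs)) <= card I * (1 - \<beta>/2)^k"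
  by auto
  define w where "w i = (1/2::real)^length (filter (good i) gs)" for i
  have w0: "0 < w i" for i unfolding w_def by simp
  define f where "f g = (\<Sum>i\<in>I. w i * (1 - of_bool (good i g & P (g # gs)) / 2))" for g
  have "(\<Sum>g\<in>X. f g) = (\<Sum>i\<in>I. \<Sum>g\<in>X. w i * (1 - of_bool (good i g & P (g # gs)) / 2))"
  unfolding f_def by (rule sum.swap)
  also have "... <= (\<Sum>i\<in>I. w i * (card X * (1 - \<beta>/2)))"
  proof (rule sum_mono)
  fix i assume i: "i \<in> I"
  have "(\<Sum>g\<in>X. w i * (1 - of_bool (good i g & P (g # gs)) / 2)) = w i * (card X - (\<Sum>g\<in>X. of_bool (good i g & P (g # gs))) / 2)"
  proof -
  have "(\<Sum>g\<in>X. 1 - of_bool (good i g & P (g # gs)) / 2) = (\<Sum>g\<in>X. (1::real)) - (\<Sum>g\<in>X. of_bool (good i g & P (g # gs)) / 2)"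
  by (rule sum_subtractf)
  also have "(\<Sum>g\<in>X. of_bool (good i g & P (g # gs)) / 2) = (\<Sum>g\<in>X. of_bool (good i g & P (g # gs)) :: real) / 2"
  by (rule sum_divide_distrib[symmetric])
  finally show ?thesis unfolding sum_distrib_left[symmetric] by simp
  qed
  also have "(\<Sum>g\<in>X. of_bool (good i g & P (g # gs)) :: real) = card {g \<in> X. good i g & P (g # gs)}"
  using X by (simp add: sum_of_bool_eq Int_def)
  also have "w i * (real (card X) - card {g \<in> X. good i g & P (g # gs)} / 2) <= w i * (card X * (1 - \<beta>/2))"
  using step[OF gs(1) _ i] gs(2) Suc.prems w0[of i] by (intro mult_left_mono) (auto simp: algebra_simps)
  finally show "(\<Sum>g\<in>X. w i * (1 - of_bool (good i g & P (g # gs)) / 2)) <= w i * (card X * (1 - \<beta>/2))" .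
  qed
  also have "... = card X * (sum w I * (1 - \<beta>/2))" unfolding sum_distrib_right[symmetric] by simp
  finally have le: "(\<Sum>g\<in>X. f g) <= card X * (sum w I * (1 - \<beta>/2))" .
  have "\<exists>g\<in>X. f g <= sum w I * (1 - \<beta>/2)"
  proof (rule ccontr)
  assume "~ ?thesis"
  then have "(\<Sum>g\<in>X. sum w I * (1 - \<beta>/2)) < (\<Sum>g\<in>X. f g)" using X by (intro sum_strict_mono) auto
  then show False using le by simp
  qed
  then obtain g where g: "g \<in> X" "f g <= sum w I * (1 - \<beta>/2)" by blast
  have "0 < sum w I" using I w0 by (intro sum_pos) auto
  then have "sum w I * (1 - \<beta>/2) < sum w I * 1" using \<beta> by (intro mult_strict_left_mono) auto
  then have "f g < sum w I" using g(2) by linarith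
  \<comment> \<open>A choice violating \<open>P\<close> would leave all weights as they are, which
    the averaging has excluded.\<close>
  have Pg: "P (g # gs)"
  proof (rule ccontr)
  assume "~ P (g # gs)"
  then have "f g = sum w I" unfolding f_def by simp
  then show False using \<open>f g < sum w I\<close> by simp
  qed
  have "(\<Sum>i\<in>I. (1/2)^length (filter (good i) (g # gs))) = f g"
  unfolding f_def w_def using Pg by (intro sum.cong) auto
  also have "... <= (card I * (1 - \<beta>/2)^k) * (1 - \<beta>/2)"
  by (rule order_trans[OF g(2)], rule mult_right_mono) (use gs(3) \<beta> in \<open>auto simp: w_def\<close>)
  finally have "(\<Sum>i\<in>I. (1/2)^length (filter (good i) (g # gs))) <= card I * (1 - \<beta>/2)^Suc k"
  by (simp only: power_Suc2 mult.assoc)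
  moreover have "length (g # gs) = Suc k" using gs(2) by simp
  ultimately show ?case using Pg by blast
 qed
 then show ?thesis by blast
qed

lemma card5:
 assumes "finite V"
 shows "real (card {g \<in> V \<times> V \<times> V \<times> V \<times> V. case g of (u, a, b, c, d) => Q u a b c d})
  = real (card V)^5 * avg V (%u. pr4 V (Q u))"
proof (cases "V = {}")
 case False
 have "avg V (%u. pr4 V (Q u)) = (\<Sum>u\<in>V. \<Sum>a\<in>V. \<Sum>b\<in>V. \<Sum>c\<in>V. \<Sum>d\<in>V. of_bool (Q u a b c d)) / real (card V)^5"
  unfolding pr4_def pr3_def pr2_def pr_def avg_def
  by (simp add: sum_divide_distrib[symmetric] power_eq_if)
 also have "(\<Sum>u\<in>V. \<Sum>a\<in>V. \<Sum>b\<in>V. \<Sum>c\<in>V. \<Sum>d\<in>V. of_bool (Q u a b c d) :: real)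
  = (\<Sum>g\<in>V \<times> V \<times> V \<times> V \<times> V. of_bool (case g of (u, a, b, c, d) => Q u a b c d))"
  by (simp add: sum.cartesian_product split_def)
 also have "... = real (card {g \<in> V \<times> V \<times> V \<times> V \<times> V. case g of (u, a, b, c, d) => Q u a b c d})"
  using assms by (simp add: sum_of_bool_eq Int_def)
 finally show ?thesis using False assms by simp
qed simp

context fspace
begin

lemma pr4_eq_rare: "pr4 V (%a b c d. a = c) = 1 / card V" "pr4 V (%a b c d. a = d) = 1 / card V"
 "pr4 V (%a b c d. b = d) = 1 / card V"
proof -
 have k: "pr V (%d. P) = of_bool P" for P by (simp add: pr_def)
 have "pr4 V (%a b c d. a = c) = avg V (%a. pr V (%c. a = c))"
  unfolding pr4_def pr3_def pr2_def k by (simp flip: pr_def)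
 also have "... = avg V (%a. 1 / card V)" by (rule avg_cong) (rule pr_eq1(2))
 finally show "pr4 V (%a b c d. a = c) = 1 / card V" by simp
 have "pr4 V (%a b c d. a = d) = avg V (%a. pr V (%c. a = c))"
  unfolding pr4_def pr3_def pr2_def by simp
 also have "... = avg V (%a. 1 / card V)" by (rule avg_cong) (rule pr_eq1(2))
 finally show "pr4 V (%a b c d. a = d) = 1 / card V" by simp
 have "pr4 V (%a b c d. b = d) = avg V (%b. pr V (%d. b = d))"
  unfolding pr4_def pr3_def pr2_def by simp
 also have "... = avg V (%a. 1 / card V)" by (rule avg_cong) (rule pr_eq1(2))
 finally show "pr4 V (%a b c d. b = d) = 1 / card V" by simp
qed

lemma pr4_union: "(!!a b c d. a \<in> V ==> b \<in> V ==> c \<in> V ==> d \<in> V ==> P a b c d ==> Q a b c d | R a b c d) ==> pr4 V P <= pr4 V Q + pr4 V R"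
 unfolding pr4_def avg_add[symmetric] by (intro avg_mono pr3_union) auto

lemma pr_mem: "finite F ==> pr V (%x. x \<in> F) <= card F / card V"
proof -
 assume "finite F"
 then have "card {x\<in>V. x \<in> F} <= card F" by (intro card_mono) auto
 then show ?thesis unfolding pr_eq_card[OF fin] by (intro divide_right_mono) auto
qed

end

fun blk :: "'a \<times> 'a \<times> 'a \<times> 'a \<times> 'a => 'a list" where
 "blk (u, a, b, c, d) = [a, b, u, c, d]"

context comp2
begin

fun Wt :: "'a => 'a \<times> 'a \<times> 'a \<times> 'a => bool" where
 "Wt u (a, b, c, d) = W u a b c d"

lemma L_neq: "L v b c ==> v ~= b & v ~= c & b ~= c"
 unfolding L_def using h_distinct[of v b c] by simp

text \<open>Paths in the common link graph of \<open>u\<close> and \<open>v\<close>. Those meeting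
  \<open>F\<close> are avoided by shrinking that graph, and only the three coincidences among
  \<open>a, b, c, d\<close> not excluded by adjacency are subtracted.\<close>

lemma slot_inner:
 fixes m :: real
 assumes u: "u \<notin> F" and F: "finite F" and m: "0 < m" "m <= pr2 V (%b c. L u b c & L v b c)"
  and sF: "4 * real (card F) <= m * card V" and n: "3 / card V <= m^3 / 512"
 shows "m^3 / 512 <= pr4 V (%a b c d. W u a b c d & W v a b c d & distinct [a, b, u, c, d] & {a, b, u, c, d} \<inter> F = {})"
proof -
 define M where "M b c \<longleftrightarrow> L u b c & L v b c & b \<notin> F & c \<notin> F" for b c
 define p where "p = pr V (%x. x \<in> F)"
 have p: "p <= m/4"
 proof -
  have "real (card F) / card V <= m/4" using sF card_pos by (simp add: field_simps)
  then show ?thesis using pr_mem[OF F] unfolding p_def by linarith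
 qed
 have pf: "pr2 V (%b c. b \<in> F) = p" "pr2 V (%b c. c \<in> F) = p"
 proof -
  show "pr2 V (%b c. c \<in> F) = p" unfolding pr2_def p_def by simp
  then show "pr2 V (%b c. b \<in> F) = p" using pr2_swap[of V "%b c. c \<in> F"] by simp
 qed
 have "pr2 V (%b c. L u b c & L v b c) <= pr2 V M + pr2 V (%b c. b \<in> F | c \<in> F)"
  by (rule pr2_union) (auto simp: M_def)
 also have "pr2 V (%b c. b \<in> F | c \<in> F) <= p + p" unfolding pf[symmetric] using pr2_disj[of V "%b c. b \<in> F" "%b c. c \<in> F"] pf by simp
 finally have M: "m/2 <= pr2 V M" using p m(2) by linarith
 have Ms: "M x y ==> M y x" for x y unfolding M_def using L_sym by blast
 have "(m/2)^3 / 32 <= pr4 V (%a b c d. M a b & M b c & M c d)"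
  by (rule path_count[OF Ms _ M]) (use m in auto)
 also have "... <= pr4 V (%a b c d. W u a b c d & W v a b c d & distinct [a, b, u, c, d] & {a, b, u, c, d} \<inter> F = {})
  + pr4 V (%a b c d. a = c | a = d | b = d)"
 proof (rule pr4_union)
  fix a b c d assume s: "M a b & M b c & M c d"
  have "u ~= a" "u ~= b" "u ~= c" "u ~= d" "a ~= b" "b ~= c" "c ~= d"
  using s L_neq[of u a b] L_neq[of u b c] L_neq[of u c d] unfolding M_def by simp_all
  moreover have "W u a b c d" "W v a b c d" "a \<notin> F" "b \<notin> F" "c \<notin> F" "d \<notin> F" using s unfolding W_def M_def by simp_all
  ultimately show "(W u a b c d & W v a b c d & distinct [a, b, u, c, d] & {a, b, u, c, d} \<inter> F = {}) | (a = c | a = d | b = d)"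
  using u by (cases "a = c | a = d | b = d") auto
 qed
 also have "pr4 V (%a b c d. a = c | a = d | b = d) <= pr4 V (%a b c d. a = c) + pr4 V (%a b c d. a = d | b = d)"
  by (rule pr4_union) auto
 also have "pr4 V (%a b c d. a = d | b = d) <= pr4 V (%a b c d. a = d) + pr4 V (%a b c d. b = d)"
  by (rule pr4_union) auto
 finally show ?thesis using n unfolding pr4_eq_rare by (simp add: power_divide)
qed

text \<open>By averaging, a proportion \<theta>/2 of all vertices lies in \<open>Y\<close> and
  shares link density at least \<theta>/2 with \<open>v\<close>. Half of these survive the removal
  of \<open>F\<close>, and each contributes the paths of \<open>slot_inner\<close>.\<close>

lemma slot_count:
 fixes \<theta> :: real
 assumes \<theta>: "0 < \<theta>" "\<theta> <= pr3 V (%u b c. Y u & L u b c & L v b c)"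
  and F: "finite F" "8 * real (card F) <= \<theta> * card V" and n: "3 / card V <= \<theta>^3 / 4096"
 shows "\<theta>^4 / 2^14 <= avg V (%u. pr4 V (%a b c d. Y u & W u a b c d & W v a b c d
  & distinct [a, b, u, c, d] & {a, b, u, c, d} \<inter> F = {}))"
proof -
 let ?q = "%u. pr2 V (%b c. L u b c & L v b c)"
 let ?Y = "%u. Y u & \<theta>/2 <= ?q u"
 have "\<theta> <= avg V (%u. of_bool (Y u) * ?q u)" using \<theta>(2) unfolding pr3_conj .
 also have "... <= avg V (%u. \<theta>/2 + of_bool (?Y u))"
 proof (rule avg_mono)
  fix u
  define q where "q = ?q u"
  have "q <= 1" unfolding q_def by simp
  then show "of_bool (Y u) * ?q u <= \<theta>/2 + of_bool (?Y u)" unfolding q_def[symmetric] using \<theta>(1) by auto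
 qed
 also have "... = \<theta>/2 + pr V ?Y" unfolding avg_add pr_def by simp
 finally have 1: "\<theta>/2 <= pr V ?Y" by linarith
 have "real (card F) / card V <= \<theta>/8" using F(2) card_pos by (simp add: field_simps)
 then have "pr V (%x. x \<in> F) <= \<theta>/4" using pr_mem[OF F(1)] \<theta> by linarith
 moreover have "pr V ?Y - pr V (%x. x \<in> F) <= pr V (%u. ?Y u & u \<notin> F)" by (rule pr_diff_ge) auto
 ultimately have "\<theta>/4 <= pr V (%u. ?Y u & u \<notin> F)" using 1 by linarith
 then have "\<theta>/4 * (\<theta>^3/4096) <= pr V (%u. ?Y u & u \<notin> F) * (\<theta>^3/4096)" using \<theta> by (intro mult_right_mono) auto
 also have "... = avg V (%u. of_bool (?Y u & u \<notin> F) * (\<theta>^3/4096))" unfolding pr_def avg_multc ..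
 also have "... <= avg V (%u. pr4 V (%a b c d. Y u & W u a b c d & W v a b c d
  & distinct [a, b, u, c, d] & {a, b, u, c, d} \<inter> F = {}))"
 proof (rule avg_mono)
  fix u
  show "of_bool (?Y u & u \<notin> F) * (\<theta>^3/4096) <= pr4 V (%a b c d. Y u & W u a b c d & W v a b c d
  & distinct [a, b, u, c, d] & {a, b, u, c, d} \<inter> F = {})"
  proof (cases "?Y u & u \<notin> F")
  case True
  have "(\<theta>/2)^3/512 <= pr4 V (%a b c d. W u a b c d & W v a b c d & distinct [a, b, u, c, d] & {a, b, u, c, d} \<inter> F = {})"
  proof (rule slot_inner[where m = "\<theta>/2"])
  show "3 / real (card V) <= (\<theta>/2)^3 / 512" using n by (simp add: power_divide)
  qed (use True F \<theta> in auto)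
  then show ?thesis using True by (simp add: power_divide)
  next
  case False
  then have "of_bool (?Y u & u \<notin> F) = (0::real)" unfolding of_bool_eq_0_iff .
  then show ?thesis by (simp only: mult_zero_left pr4_nonneg)
  qed
 qed
 finally show ?thesis by (simp add: power_eq_if)
qed

text \<open>Slots with enough possible middle vertices for \<open>exchange_all\<close> to apply to
  the set of these vertices.\<close>

definition rich :: "'a \<times> 'a \<times> 'a \<times> 'a => bool" where
 "rich \<tau> \<longleftrightarrow> l0^4 / 10^10 <= pr V (%u. Wt u \<tau>)"

text \<open>If every slot of \<open>x\<close> avoiding \<open>F\<close> were poor, there would be
  fewer pairs of a slot and a second middle vertex for it than \<open>slot_count\<close>
  supplies.\<close>

lemma rich_slot:
 assumes x: "x \<in> V" and F: "finite F" "40 * real (card F) <= l0 * card V" and n: "3 / card V <= (l0/4)^3 / 4096"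
 shows "\<exists>a\<in>V. \<exists>b\<in>V. \<exists>c\<in>V. \<exists>d\<in>V. W x a b c d & distinct [a, b, x, c, d] & {a, b, c, d} \<inter> F = {} & rich (a, b, c, d)"
proof (rule ccontr)
 assume neg: "~ ?thesis"
 have "1/4 * l0 <= 1/4 * pr2 V (L x)" using link_size[OF x] by simp
 also have "... <= pr3 V (%b c u. L x b c & h u b c)"
 proof (rule pr3_conj2_ge)
  fix b c assume bc: "b \<in> V" "c \<in> V" "L x b c"
  then have "b ~= c" using L_neq by blast
  then have "1/3 + \<gamma> <= pr V (h b c)" using codeg bc by simp
  also have "pr V (h b c) = pr V (%u. h u b c)" by (rule pr_cong) (rule h_perm(5))
  finally show "1/4 <= pr V (%u. h u b c)" using \<gamma> by linarith
 qed
 also have "... <= pr3 V (%b c u. True & L u b c & L x b c)"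
  by (rule pr3_mono) (auto simp: L_def)
 also have "... = pr3 V (%u b c. True & L u b c & L x b c)"
  using pr3_rot(1)[of V "%u b c. True & L u b c & L x b c"] pr3_rot(2)[of V "%u b c. True & L u b c & L x b c"] by simp
 finally have 1: "l0/4 <= pr3 V (%u b c. True & L u b c & L x b c)" by simp
 let ?Q = "%u a b c d. W u a b c d & W x a b c d & distinct [a, b, u, c, d] & {a, b, u, c, d} \<inter> F = {}"
 have "(l0/4)^4 / 2^14 <= avg V (%u. pr4 V (%a b c d. True & ?Q u a b c d))"
  by (rule slot_count[OF _ 1 F(1) _ n]) (use F(2) l0 card_pos in \<open>auto simp: field_simps\<close>)
 also have "... = avg V (%u. avg V (%a. avg V (%b. avg V (%c. avg V (%d. of_bool (?Q u a b c d))))))"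
  unfolding pr4_def pr3_def pr2_def pr_def by simp
 also have "... = avg V (%a. avg V (%u. avg V (%b. avg V (%c. avg V (%d. of_bool (?Q u a b c d))))))" by (rule avg_swap)
 also have "... = avg V (%a. avg V (%b. avg V (%u. avg V (%c. avg V (%d. of_bool (?Q u a b c d))))))"
  by (rule avg_cong, rule avg_swap)
 also have "... = avg V (%a. avg V (%b. avg V (%c. avg V (%u. avg V (%d. of_bool (?Q u a b c d))))))"
  by (rule avg_cong, rule avg_cong, rule avg_swap)
 also have "... = avg V (%a. avg V (%b. avg V (%c. avg V (%d. avg V (%u. of_bool (?Q u a b c d))))))"
  by (rule avg_cong, rule avg_cong, rule avg_cong, rule avg_swap)
 also have "... <= l0^4/10^10"
 proof (rule avg_le_const, rule avg_le_const, rule avg_le_const, rule avg_le_const)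
  fix a b c d assume V: "a \<in> V" "b \<in> V" "c \<in> V" "d \<in> V"
  show "avg V (%u. of_bool (?Q u a b c d)) <= l0^4/10^10"
  proof (cases "W x a b c d & distinct [a, b, x, c, d] & {a, b, c, d} \<inter> F = {}")
  case True
  then have "~ rich (a, b, c, d)" using neg V by blast
  then have "pr V (%u. W u a b c d) <= l0^4/10^10" unfolding rich_def by simp
  moreover have "avg V (%u. of_bool (?Q u a b c d)) <= pr V (%u. W u a b c d)"
  unfolding pr_def by (rule avg_mono) auto
  ultimately show ?thesis by linarith
  next
  case False
  have "~ ?Q u a b c d" for u
  proof
  assume Q: "?Q u a b c d"
  have "x ~= a" "x ~= b" "x ~= c" "x ~= d"
  using Q L_neq[of x a b] L_neq[of x c d] unfolding W_def by auto
  then show False using False Q by auto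
  qed
  then have "(%u. of_bool (?Q u a b c d) :: real) = (%u. 0)" by (intro ext) (simp only: of_bool_eq)
  then show ?thesis using l0 by simp
  qed
 qed
 finally show False using l0 by (simp add: power_divide)
qed

text \<open>A derandomised choice of slots. An index is a vertex, the four corners of a target slot
  and a number of remaining exchanges, which bounds the number of indices by |V|^5 times
  \<open>J\<close>. Every useful slot halves the weight of the indices it serves, and disjointness
  is part of the invariant \<open>P\<close>.\<close>

lemma slot_family:
 fixes \<theta> :: real
 assumes \<theta>: "0 < \<theta>" "\<theta> <= 1" and F: "finite F" "8 * (real (card F) + 5 * N) <= \<theta> * card V" and n: "3 / card V <= \<theta>^3 / 4096"
  and M: "real (card V)^5 * real J * (1 - \<theta>^4/2^15)^N < (1/2)^M"
 shows "EX gs. length gs <= N & distinct (concat (map blk gs)) & set (concat (map blk gs)) \<subseteq> V - F & (\<forall>(u, \<tau>)\<in>set gs. Wt u \<tau>)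
  & (\<forall>\<tau> v j. fst \<tau> \<in> V & fst (snd \<tau>) \<in> V & fst (snd (snd \<tau>)) \<in> V & snd (snd (snd \<tau>)) \<in> V --> v \<in> V --> j < J -->
  \<theta> <= pr3 V (%u b c. ygrow \<theta> (%u. Wt u \<tau>) j u & L u b c & L v b c) -->
  M < length (filter (%(u, \<sigma>). ygrow \<theta> (%u. Wt u \<tau>) j u & Wt v \<sigma>) gs))"
proof -
 let ?X = "V \<times> V \<times> V \<times> V \<times> V"
 let ?\<beta> = "\<theta>^4/2^14"
 define I where "I = {(v, \<tau>, j). v \<in> V & \<tau> \<in> V \<times> V \<times> V \<times> V & j < J & \<theta> <= pr3 V (%u b c. ygrow \<theta> (%u. Wt u \<tau>) j u & L u b c & L v b c)}"
 define good where "good = (%(v, \<tau>, j) (u, \<sigma>). ygrow \<theta> (%u. Wt u \<tau>) j u & Wt v \<sigma>)"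
 define P where "P gs \<longleftrightarrow> distinct (concat (map blk gs)) & set (concat (map blk gs)) \<subseteq> V - F & (\<forall>(u, \<tau>)\<in>set gs. Wt u \<tau>)" for gs
 have Is: "I \<subseteq> V \<times> (V \<times> V \<times> V \<times> V) \<times> {..<J}" unfolding I_def by auto
 then have fI: "finite I" by (rule finite_subset) (use fin in auto)
 have "card I <= card (V \<times> (V \<times> V \<times> V \<times> V) \<times> {..<J})" by (rule card_mono[OF _ Is]) (use fin in auto)
 then have "real (card I) <= real (card (V \<times> (V \<times> V \<times> V \<times> V) \<times> {..<J}))" by (rule of_nat_mono)
 then have cI: "real (card I) <= real (card V)^5 * real J" by (simp add: card_cartesian_product power_eq_if)
 have "EX gs. P gs & length gs <= N & (\<forall>i\<in>I. M < length (filter (good i) gs))"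
 proof (cases "I = {}")
  case True
  then show ?thesis by (intro exI[of _ "[]"]) (simp add: P_def)
 next
  case False
  have \<theta>4: "0 < ?\<beta>" "?\<beta> <= 1" using \<theta> power_le_one[of \<theta> 4] by (auto simp: divide_le_eq)
  have "EX gs. P gs & length gs <= N & (\<Sum>i\<in>I. (1/2)^length (filter (good i) gs)) <= card I * (1 - ?\<beta>/2)^N"
  proof (rule mult_weights[where X = ?X, OF fI False _ _ \<theta>4])
  show "finite ?X" "?X ~= {}" using fin ne by auto
  show "P []" unfolding P_def by simp
  fix gs i assume gs: "P gs" "length gs < N" and i: "i \<in> I"
  obtain v \<tau> j where ij: "i = (v, \<tau>, j)" by (cases i)
  define Y where "Y = ygrow \<theta> (%u. Wt u \<tau>) j"
  define F' where "F' = F \<union> set (concat (map blk gs))"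
  have len: "length (concat (map blk g)) = 5 * length g" for g :: "('a \<times> 'a \<times> 'a \<times> 'a \<times> 'a) list" by (induction g) auto
  have "card F' <= card F + card (set (concat (map blk gs)))" unfolding F'_def by (rule card_Un_le)
  also have "card (set (concat (map blk gs))) <= 5 * N" using card_length[of "concat (map blk gs)"] gs(2) unfolding len by linarith
  finally have "real (card F') <= real (card F + 5 * N)" by simp
  then have F': "finite F'" "8 * real (card F') <= \<theta> * card V" using F unfolding F'_def by auto
  define A where "A = avg V (%u. pr4 V (%a b c d. Y u & W u a b c d & W v a b c d
  & distinct [a, b, u, c, d] & {a, b, u, c, d} \<inter> F' = {}))"
  have "\<theta> <= pr3 V (%u b c. Y u & L u b c & L v b c)" using i unfolding ij I_def Y_def by blast
  then have "?\<beta> <= A" unfolding A_def by (rule slot_count[OF \<theta>(1) _ F' n])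
  then have "?\<beta> * real (card V)^5 <= real (card V)^5 * A" by (metis mult.commute mult_left_mono zero_le_power of_nat_0_le_iff)
  also have "... = real (card V)^5 * avg V (%u. pr4 V (%a b c d. Y u & W u a b c d & W v a b c d
  & distinct [a, b, u, c, d] & {a, b, u, c, d} \<inter> F' = {}))" unfolding A_def ..
  also have "... = card {g \<in> ?X. case g of (u, a, b, c, d) => Y u & W u a b c d & W v a b c d
  & distinct [a, b, u, c, d] & {a, b, u, c, d} \<inter> F' = {}}" by (rule card5[OF fin, symmetric])
  also have "... <= card {g \<in> ?X. good i g & P (g # gs)}"
  proof (intro of_nat_mono card_mono)
  show "{g \<in> ?X. case g of (u, a, b, c, d) => Y u & W u a b c d & W v a b c d
  & distinct [a, b, u, c, d] & {a, b, u, c, d} \<inter> F' = {}} \<subseteq> {g \<in> ?X. good i g & P (g # gs)}"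
  proof
  fix g assume g: "g \<in> {g \<in> ?X. case g of (u, a, b, c, d) => Y u & W u a b c d & W v a b c d
  & distinct [a, b, u, c, d] & {a, b, u, c, d} \<inter> F' = {}}"
  obtain u a b c d where geq: "g = (u, a, b, c, d)" by (cases g)
  have q: "g \<in> ?X" "Y u" "W u a b c d" "W v a b c d" "distinct [a, b, u, c, d]" "{a, b, u, c, d} \<inter> F' = {}"
  using g unfolding geq by simp_all
  have bl: "blk g = [a, b, u, c, d]" unfolding geq by simp
  have "set (blk g) \<inter> set (concat (map blk gs)) = {}" unfolding bl using q(6) unfolding F'_def by auto
  moreover have "set (blk g) \<subseteq> V - F" unfolding bl using q(1,6) unfolding geq F'_def by auto
  moreover have "distinct (blk g)" unfolding bl by (rule q(5))
  ultimately have "P (g # gs)" using gs(1) q(3) unfolding P_def geq by (auto simp del: blk.simps)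
  moreover have "good i g" using q(2,4) unfolding good_def ij geq Y_def by simp
  ultimately show "g \<in> {g \<in> ?X. good i g & P (g # gs)}" using q(1) by simp
  qed
  qed (use fin in auto)
  finally show "?\<beta> * real (card ?X) <= real (card {g \<in> ?X. good i g & P (g # gs)})"
  by (simp add: card_cartesian_product power_eq_if)
  qed
  then obtain gs where gs: "P gs" "length gs <= N" "(\<Sum>i\<in>I. (1/2)^length (filter (good i) gs)) <= card I * (1 - ?\<beta>/2)^N" by blast
  have "M < length (filter (good i) gs)" if "i \<in> I" for i
  proof -
  have "(1/2::real)^length (filter (good i) gs) <= (\<Sum>i\<in>I. (1/2)^length (filter (good i) gs))"
  by (rule member_le_sum[OF that _ fI]) simp
  also have "... <= (real (card V)^5 * real J) * (1 - ?\<beta>/2)^N"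
  by (rule order_trans[OF gs(3)], rule mult_right_mono[OF cI]) (use \<theta>4 in auto)
  also have "... < (1/2)^M" using M by simp
  finally have lt: "(1/2::real)^length (filter (good i) gs) < (1/2)^M" .
  show ?thesis
  proof (rule ccontr)
  assume "~ ?thesis"
  then have "(1/2::real)^M <= (1/2)^length (filter (good i) gs)" by (intro power_decreasing) auto
  then show False using lt by linarith
  qed
  qed
  then show ?thesis using gs by blast
 qed
 then obtain gs where gs: "P gs" "length gs <= N" and good: "\<forall>i\<in>I. M < length (filter (good i) gs)" by blast
 have "M < length (filter (%(u, \<sigma>). ygrow \<theta> (%u. Wt u \<tau>) j u & Wt v \<sigma>) gs)"
  if "fst \<tau> \<in> V & fst (snd \<tau>) \<in> V & fst (snd (snd \<tau>)) \<in> V & snd (snd (snd \<tau>)) \<in> V" "v \<in> V" "j < J"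
  "\<theta> <= pr3 V (%u b c. ygrow \<theta> (%u. Wt u \<tau>) j u & L u b c & L v b c)" for \<tau> v j
 proof -
  have "(v, \<tau>, j) \<in> I" using that unfolding I_def by (auto simp: mem_Times_iff)
  then have "M < length (filter (good (v, \<tau>, j)) gs)" using good by blast
  then show ?thesis unfolding good_def by simp
 qed
 then show ?thesis using gs unfolding P_def by blast
qed

end

section \<open>Almost perfect tilings\<close>

text \<open>The dual form of an almost perfect fractional matching, strengthened so that a light
  weighting fails on a positive proportion of triples. This survives the loss of a few triples and
  the passage to clusters.\<close>

definition robust_cover :: "'a set => ('a => 'a => 'a => bool) => real => real => bool" where
 "robust_cover V T \<eta> \<nu> \<longleftrightarrow> (\<forall>c::'a => real. (\<forall>x\<in>V. 0 <= c x) --> avg V c < (1 - \<eta>) / 3 -->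
  \<nu> < pr3 V (%x y z. T x y z & c x + c y + c z < 1))"

definition is_tile :: "nat => ('a => 'a => 'a => bool) => 'a set \<times> 'a set \<times> 'a set => bool" where
 "is_tile t T \<tau> \<longleftrightarrow> (case \<tau> of (A, B, C) => finite A & finite B & finite C & card A = t & card B = t & card C = t
  & A \<inter> B = {} & A \<inter> C = {} & B \<inter> C = {} & (\<forall>a\<in>A. \<forall>b\<in>B. \<forall>c\<in>C. T a b c))"

definition supp :: "'a set \<times> 'a set \<times> 'a set => 'a set" where
 "supp \<tau> = (case \<tau> of (A, B, C) => A \<union> B \<union> C)"

fun tiling :: "nat => ('a => 'a => 'a => bool) => 'a set => ('a set \<times> 'a set \<times> 'a set) list => bool" where
 "tiling t T V [] \<longleftrightarrow> True"
| "tiling t T V (\<tau> # ts) \<longleftrightarrow> is_tile t T \<tau> & supp \<tau> \<subseteq> V & tiling t T (V - supp \<tau>) ts"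

definition supps :: "('a set \<times> 'a set \<times> 'a set) list => 'a set" where
 "supps ts = (\<Union>\<tau>\<in>set ts. supp \<tau>)"

lemma supps_simps [simp]: "supps [] = {}" "supps (\<tau> # ts) = supp \<tau> \<union> supps ts" "supps (ts @ us) = supps ts \<union> supps us"
 unfolding supps_def by auto

lemma card_supp: "is_tile t T \<tau> ==> finite (supp \<tau>) & card (supp \<tau>) = 3 * t"
proof -
 assume a: "is_tile t T \<tau>"
 obtain A B C where t: "\<tau> = (A, B, C)" by (cases \<tau>) auto
 have p: "finite A" "finite B" "finite C" "card A = t" "card B = t" "card C = t"
  "A \<inter> B = {}" "(A \<union> B) \<inter> C = {}"
  using a unfolding is_tile_def t by auto
 have "card (A \<union> B \<union> C) = card (A \<union> B) + card C" by (rule card_Un_disjoint) (use p in auto)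
 also have "card (A \<union> B) = card A + card B" by (rule card_Un_disjoint) (use p in auto)
 finally show ?thesis using p unfolding supp_def t by simp
qed

lemma tiling_mono: "tiling t T U ts ==> U \<subseteq> V ==> tiling t T V ts"
proof (induction ts arbitrary: U V)
 case (Cons \<tau> ts)
 have "U - supp \<tau> \<subseteq> V - supp \<tau>" using Cons.prems(2) by blast
 then show ?case using Cons.IH[of "U - supp \<tau>" "V - supp \<tau>"] Cons.prems by auto
qed simp

lemma tiling_supps: "tiling t T V ts ==> supps ts \<subseteq> V"
 by (induction ts arbitrary: V) auto

lemma tiling_append:
 "tiling t T U ts ==> tiling t T V us ==> U \<inter> V = {} ==> tiling t T (U \<union> V) (ts @ us)"
proof (induction ts arbitrary: U)
 case Nil
 then show ?case using tiling_mono[of t T V us "U \<union> V"] by auto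
next
 case (Cons \<tau> ts)
 have "tiling t T ((U - supp \<tau>) \<union> V) (ts @ us)" by (rule Cons.IH) (use Cons.prems in auto)
 moreover have "(U - supp \<tau>) \<union> V = (U \<union> V) - supp \<tau>" using Cons.prems by auto
 ultimately show ?case using Cons.prems by auto
qed

lemma card_supps: "tiling t T V ts ==> finite (supps ts) & card (supps ts) = 3 * t * length ts"
proof (induction ts arbitrary: V)
 case (Cons \<tau> ts)
 have c: "finite (supp \<tau>)" "card (supp \<tau>) = 3 * t" using card_supp[of t T \<tau>] Cons.prems by simp_all
 have "supp \<tau> \<inter> supps ts = {}" using tiling_supps[of t T "V - supp \<tau>" ts] Cons.prems by auto
 then have "card (supp \<tau> \<union> supps ts) = card (supp \<tau>) + card (supps ts)"
  using c Cons.IH[of "V - supp \<tau>"] Cons.prems by (intro card_Un_disjoint) auto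
 then show ?case using c Cons.IH[of "V - supp \<tau>"] Cons.prems by simp
qed simp

lemma chop:
 assumes "finite X" "0 < m"
 shows "EX P. finite P & card P = card X div m & (\<forall>S\<in>P. card S = m & S \<subseteq> X) & (\<forall>S\<in>P. \<forall>S'\<in>P. S ~= S' --> S \<inter> S' = {})"
 using assms(1)
proof (induction "card X" arbitrary: X rule: less_induct)
 case less
 show ?case
 proof (cases "card X < m")
  case True
  then show ?thesis by (intro exI[of _ "{}"]) auto
 next
  case False
  then have "m <= card X" by simp
  then obtain S where S: "S \<subseteq> X" "card S = m" by (rule obtain_subset_with_card_n) (rule that)
  have fS: "finite S" using S(1) less.prems finite_subset by blast
  have c: "card (X - S) = card X - m" using S fS by (simp add: card_Diff_subset)
  have "card (X - S) < card X" using c False assms(2) by simp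
  from less.hyps[OF this] obtain P where P: "finite P" "card P = card (X - S) div m"
  "\<forall>S'\<in>P. card S' = m & S' \<subseteq> X - S" "\<forall>S'\<in>P. \<forall>S''\<in>P. S' ~= S'' --> S' \<inter> S'' = {}"
  using less.prems by auto
  have "S \<notin> P"
  proof
  assume "S \<in> P"
  then have "S \<subseteq> X - S" using P(3) by blast
  then have "S = {}" by blast
  then show False using S(2) assms(2) by simp
  qed
  then have "card (insert S P) = Suc ((card X - m) div m)" using P(1,2) c by simp
  also have "... = card X div m" using \<open>m <= card X\<close> assms(2) by (simp add: le_div_geq)
  finally have "card (insert S P) = card X div m" .
  moreover have "\<forall>S'\<in>insert S P. card S' = m & S' \<subseteq> X" using P(3) S by auto
  moreover have "\<forall>S'\<in>insert S P. \<forall>S''\<in>insert S P. S' ~= S'' --> S' \<inter> S'' = {}"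
  using P(3,4) by fastforce
  ultimately show ?thesis using P(1) by (intro exI[of _ "insert S P"]) auto
 qed
qed

text \<open>Greedy extraction of small tiles from dense triples of clusters, as long as only a small part of
 every cluster has been used.\<close>
lemma extract_tiles:
 fixes \<rho> :: real and t m0 m :: nat and T :: "'a => 'a => 'a => bool"
 assumes m0: "!!A B C. finite A ==> finite B ==> finite C ==> m0 <= card A ==> m0 <= card B ==> m0 <= card C ==>
  \<rho>/2 * card A * card B * card C <= card {(a, b, c). a \<in> A & b \<in> B & c \<in> C & T a b c} ==>
  \<exists>A'\<subseteq>A. \<exists>B'\<subseteq>B. \<exists>C'\<subseteq>C. card A' = t & card B' = t & card C' = t & (\<forall>a\<in>A'. \<forall>b\<in>B'. \<forall>c\<in>C'. T a b c)"
  and \<rho>: "0 < \<rho>" "\<rho> <= 1" and m: "2 * m0 <= m"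
  and fam: "!!S. S \<in> \<C> ==> finite S & card S = m" "!!S S'. S \<in> \<C> ==> S' \<in> \<C> ==> S ~= S' ==> S \<inter> S' = {}"
 shows "(\<forall>(A, B, C)\<in>set es. A \<in> \<C> & B \<in> \<C> & C \<in> \<C> & A ~= B & A ~= C & B ~= C &
  \<rho> * real m^3 <= card {(a, b, c). a \<in> A & b \<in> B & c \<in> C & T a b c}) ==>
  (ALL S. real t * cnt es S <= \<rho> * m / 6) ==>
  EX ts. tiling t T (\<Union>\<C>) ts & length ts = length es & (\<forall>S\<in>\<C>. card (supps ts \<inter> S) = t * cnt es S)"
proof (induction es)
 case Nil
 show ?case by (intro exI[of _ "[]"]) auto
next
 case (Cons e es)
 obtain A B C where e: "e = (A, B, C)" by (cases e)
 have cle: "real t * cnt es S <= \<rho> * m / 6" for S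
 proof -
  have "real t * cnt es S <= real t * cnt (e # es) S" unfolding e by (intro mult_left_mono) auto
  then show ?thesis using Cons.prems(2) order_trans by blast
 qed
 then obtain ts where ts: "tiling t T (\<Union>\<C>) ts" "length ts = length es" "\<forall>S\<in>\<C>. card (supps ts \<inter> S) = t * cnt es S"
  using Cons.IH Cons.prems(1) by auto
 define X where "X = supps ts"
 have X: "finite X" using card_supps[OF ts(1)] unfolding X_def by simp
 have ABC: "A \<in> \<C>" "B \<in> \<C>" "C \<in> \<C>" "A ~= B" "A ~= C" "B ~= C"
  "\<rho> * real m^3 <= card {(a, b, c). a \<in> A & b \<in> B & c \<in> C & T a b c}"
  using Cons.prems(1) unfolding e by auto
 have used: "real (card (X \<inter> S)) <= \<rho> * m / 6" if "S \<in> \<C>" for S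
  using ts(3) cle[of S] that unfolding X_def by simp
 have left: "finite (S - X)" "m0 <= card (S - X)" "card (S - X) <= m" if S: "S \<in> \<C>" for S
 proof -
  have f: "finite S" "card S = m" using fam(1)[OF S] by auto
  show "finite (S - X)" using f by simp
  show "card (S - X) <= m" using f card_mono[of S "S - X"] by auto
  have "card (S - X) + card (X \<inter> S) = card S"
  using f card_Diff_subset_Int[of S X] card_mono[of S "X \<inter> S"] by (simp add: Int_commute)
  moreover have "\<rho> * m / 6 <= m / 6" using \<rho> by (simp add: mult_left_le_one_le)
  ultimately have "real m <= 2 * real (card (S - X))" using used[OF S] f by linarith
  then show "m0 <= card (S - X)" using m by linarith
 qed
 let ?E = "%A B C. {(a, b, c). a \<in> A & b \<in> B & c \<in> C & T a b c}"
 \<comment> \<open>The used part of each of the three clusters is at most \<rho>/6 of it and costs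
   at most \<rho>/6 * m^3 triples, so half of the density remains.\<close>
 have dens: "\<rho>/2 * card (A - X) * card (B - X) * card (C - X) <= card (?E (A - X) (B - X) (C - X))"
 proof -
  have fE: "finite (A \<times> B \<times> C)" using fam(1) ABC by auto
  have "?E A B C \<subseteq> ?E (A - X) (B - X) (C - X) \<union> (X \<inter> A) \<times> B \<times> C \<union> A \<times> (X \<inter> B) \<times> C \<union> A \<times> B \<times> (X \<inter> C)"
  by auto
  then have "card (?E A B C) <= card (?E (A - X) (B - X) (C - X) \<union> (X \<inter> A) \<times> B \<times> C \<union> A \<times> (X \<inter> B) \<times> C \<union> A \<times> B \<times> (X \<inter> C))"
  by (rule card_mono[rotated]) (rule finite_subset[OF _ fE], auto)
  also have "... <= card (?E (A - X) (B - X) (C - X)) + card ((X \<inter> A) \<times> B \<times> C) + card (A \<times> (X \<inter> B) \<times> C) + card (A \<times> B \<times> (X \<inter> C))"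
  by (intro order_trans[OF card_Un_le] add_right_mono order_refl)
  also have "... = card (?E (A - X) (B - X) (C - X)) + card (X \<inter> A) * m^2 + card (X \<inter> B) * m^2 + card (X \<inter> C) * m^2"
  using fam(1) ABC by (simp add: card_cartesian_product power2_eq_square algebra_simps)
  finally have "real (card (?E A B C)) <= card (?E (A - X) (B - X) (C - X)) + real (card (X \<inter> A)) * m^2 + real (card (X \<inter> B)) * m^2 + real (card (X \<inter> C)) * m^2"
  by (simp flip: of_nat_add of_nat_mult of_nat_power)
  moreover have "real (card (X \<inter> S)) * m^2 <= \<rho> * m / 6 * m^2" if "S \<in> \<C>" for S
  using used[OF that] by (intro mult_right_mono) auto
  from this[OF ABC(1)] this[OF ABC(2)] this[OF ABC(3)]
  have "real (card (X \<inter> A)) * m^2 + real (card (X \<inter> B)) * m^2 + real (card (X \<inter> C)) * m^2 <= \<rho>/2 * real m^3"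
  by (simp add: power2_eq_square power3_eq_cube)
  ultimately have 1: "\<rho>/2 * real m^3 <= card (?E (A - X) (B - X) (C - X))" using ABC(7) by simp
  have "real (card (A - X)) * card (B - X) * card (C - X) <= real m * m * m"
  using left(3) ABC by (intro mult_mono) auto
  then have "\<rho>/2 * (real (card (A - X)) * card (B - X) * card (C - X)) <= \<rho>/2 * (real m * m * m)"
  using \<rho> by (intro mult_left_mono) auto
  then show ?thesis using 1 by (simp add: power3_eq_cube mult.assoc)
 qed
 obtain A' B' C' where t': "A' \<subseteq> A - X" "B' \<subseteq> B - X" "C' \<subseteq> C - X" "card A' = t" "card B' = t" "card C' = t"
  "\<forall>a\<in>A'. \<forall>b\<in>B'. \<forall>c\<in>C'. T a b c"
  using m0[OF left(1)[OF ABC(1)] left(1)[OF ABC(2)] left(1)[OF ABC(3)] left(2)[OF ABC(1)] left(2)[OF ABC(2)] left(2)[OF ABC(3)] dens]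
  by (elim exE conjE) (rule that)?
 have fin': "finite A'" "finite B'" "finite C'"
  using t'(1-3) left(1) ABC by (meson finite_subset)+
 have dAB: "A \<inter> B = {}" "A \<inter> C = {}" "B \<inter> C = {}" using fam(2) ABC by blast+
 have til: "is_tile t T (A', B', C')"
  unfolding is_tile_def using fin' t' dAB by auto
 have sub: "supp (A', B', C') \<subseteq> \<Union>\<C> - X" unfolding supp_def using t' ABC by auto
 have "tiling t T (\<Union>\<C> - supp (A', B', C')) ts"
 proof -
  have "tiling t T U ts ==> supps ts \<inter> Z = {} ==> tiling t T (U - Z) ts" for U Z
  proof (induction ts arbitrary: U)
  case (Cons \<tau> ts)
  have "U - Z - supp \<tau> = U - supp \<tau> - Z" by blast
  then show ?case using Cons by auto
  qed simp
  then show ?thesis using ts(1) sub unfolding X_def by auto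
 qed
 then have new: "tiling t T (\<Union>\<C>) ((A', B', C') # ts)" using til sub by auto
 have "card (supps ((A', B', C') # ts) \<inter> S) = t * cnt (e # es) S" if S: "S \<in> \<C>" for S
 proof -
  have eq: "supps ((A', B', C') # ts) \<inter> S = (supp (A', B', C') \<inter> S) \<union> (X \<inter> S)" unfolding X_def by auto
  have "card (supps ((A', B', C') # ts) \<inter> S) = card (supp (A', B', C') \<inter> S) + card (X \<inter> S)"
  unfolding eq by (rule card_Un_disjoint) (use sub X fin' in \<open>auto simp: supp_def\<close>)
  moreover have "card (supp (A', B', C') \<inter> S) = t * of_bool (S = A | S = B | S = C)"
  proof -
  consider "S = A" | "S = B" | "S = C" | "S ~= A" "S ~= B" "S ~= C" by blast
  then show ?thesis
  proof cases
  case 1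
  then have "supp (A', B', C') \<inter> S = A'" using t' dAB unfolding supp_def by auto
  then show ?thesis using t' 1 by simp
  next
  case 2
  then have "supp (A', B', C') \<inter> S = B'" using t' dAB unfolding supp_def by auto
  then show ?thesis using t' 2 by simp
  next
  case 3
  then have "supp (A', B', C') \<inter> S = C'" using t' dAB unfolding supp_def by auto
  then show ?thesis using t' 3 by simp
  next
  case 4
  then have "A \<inter> S = {}" "B \<inter> S = {}" "C \<inter> S = {}" using fam(2) ABC S by blast+
  then have "supp (A', B', C') \<inter> S = {}" using t' unfolding supp_def by auto
  then show ?thesis using 4 by simp
  qed
  qed
  ultimately show ?thesis using ts(3) S unfolding e X_def by (simp add: algebra_simps)
 qed
 then show ?case using new ts(2) by (intro exI[of _ "(A', B', C') # ts"]) auto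
qed

text \<open>A complete tripartite piece remains complete after deletions, so its remainder splits
  into small tiles with only a rounding loss in each class.\<close>

lemma subtile:
 assumes "is_tile m T (A, B, C)" and X: "card (X \<inter> A) <= k" "card (X \<inter> B) <= k" "card (X \<inter> C) <= k" and t: "0 < t"
 shows "EX us. tiling t T (supp (A, B, C) - X) us & length us = (m - k) div t"
proof -
 have til: "finite A" "finite B" "finite C" "card A = m" "card B = m" "card C = m"
  "A \<inter> B = {}" "A \<inter> C = {}" "B \<inter> C = {}" "\<forall>a\<in>A. \<forall>b\<in>B. \<forall>c\<in>C. T a b c"
  using assms(1) unfolding is_tile_def by auto
 have F: "finite A0 ==> finite B0 ==> finite C0 ==> A0 \<subseteq> A ==> B0 \<subseteq> B ==> C0 \<subseteq> C ==> l * t <= card A0 ==> l * t <= card B0 ==> l * t <= card C0 ==>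
  EX us. tiling t T (A0 \<union> B0 \<union> C0) us & length us = l" for l A0 B0 C0
 proof (induction l arbitrary: A0 B0 C0)
  case 0
  show ?case by (intro exI[of _ "[]"]) auto
 next
  case (Suc l)
  have "t <= card A0" "t <= card B0" "t <= card C0" using Suc.prems by auto
  then obtain A1 B1 C1 where s: "A1 \<subseteq> A0" "card A1 = t" "B1 \<subseteq> B0" "card B1 = t" "C1 \<subseteq> C0" "card C1 = t"
  by (metis obtain_subset_with_card_n)
  have f: "finite A1" "finite B1" "finite C1" using s Suc.prems(1-3) finite_subset by blast+
  have "EX us. tiling t T ((A0 - A1) \<union> (B0 - B1) \<union> (C0 - C1)) us & length us = l"
  by (rule Suc.IH) (use Suc.prems s f in \<open>auto simp: card_Diff_subset\<close>)
  then obtain us where us: "tiling t T ((A0 - A1) \<union> (B0 - B1) \<union> (C0 - C1)) us" "length us = l" by blast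
  have su: "A1 \<subseteq> A" "B1 \<subseteq> B" "C1 \<subseteq> C" using s(1,3,5) Suc.prems(4-6) by blast+
  have "A1 \<inter> B1 = {}" "A1 \<inter> C1 = {}" "B1 \<inter> C1 = {}" using su til(7-9) by blast+
  moreover have "\<forall>a\<in>A1. \<forall>b\<in>B1. \<forall>c\<in>C1. T a b c" using su til(10) by blast
  ultimately have "is_tile t T (A1, B1, C1)" unfolding is_tile_def using f s(2,4,6) by simp
  moreover have "supp (A1, B1, C1) \<subseteq> A0 \<union> B0 \<union> C0" unfolding supp_def using s by auto
  moreover have "tiling t T ((A0 \<union> B0 \<union> C0) - supp (A1, B1, C1)) us"
  proof (rule tiling_mono[OF us(1)])
  have "A0 \<inter> B1 = {}" "A0 \<inter> C1 = {}" "B0 \<inter> A1 = {}" "B0 \<inter> C1 = {}" "C0 \<inter> A1 = {}" "C0 \<inter> B1 = {}"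
  using su til(7-9) Suc.prems(4-6) by blast+
  then show "A0 - A1 \<union> (B0 - B1) \<union> (C0 - C1) \<subseteq> A0 \<union> B0 \<union> C0 - supp (A1, B1, C1)"
  unfolding supp_def by auto
  qed
  ultimately show ?case using us(2) by (intro exI[of _ "(A1, B1, C1) # us"]) auto
 qed
 have G: "(m - k) div t * t <= card (S - X)" if "finite S" "card S = m" "card (X \<inter> S) <= k" for S
 proof -
  have "card (S - X) = card S - card (S \<inter> X)" using that by (intro card_Diff_subset_Int) auto
  then have "m - k <= card (S - X)" using that by (simp add: Int_commute)
  moreover have "(m - k) div t * t <= m - k" by simp
  ultimately show ?thesis by linarith
 qed
 have "EX us. tiling t T ((A - X) \<union> (B - X) \<union> (C - X)) us & length us = (m - k) div t"
 proof (rule F)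
  show "(m - k) div t * t <= card (A - X)" "(m - k) div t * t <= card (B - X)" "(m - k) div t * t <= card (C - X)"
  using G til X by blast+
 qed (use til in auto)
 moreover have "(A - X) \<union> (B - X) \<union> (C - X) = supp (A, B, C) - X" unfolding supp_def by auto
 ultimately show ?thesis by simp
qed

lemma subtiles:
 assumes "tiling m T V ts" "0 < t"
  and "!!A B C. (A, B, C) \<in> set ts ==> card (X \<inter> A) <= k & card (X \<inter> B) <= k & card (X \<inter> C) <= k"
 shows "EX us. tiling t T (supps ts - X) us & length us = length ts * ((m - k) div t)"
 using assms
proof (induction ts arbitrary: V)
 case Nil
 show ?case by (intro exI[of _ "[]"]) auto
next
 case (Cons \<tau> ts)
 obtain A B C where e: "\<tau> = (A, B, C)" by (cases \<tau>)
 have "EX us. tiling t T (supps ts - X) us & length us = length ts * ((m - k) div t)"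
  by (rule Cons.IH[of "V - supp \<tau>"]) (use Cons.prems in auto)
 then obtain us where us: "tiling t T (supps ts - X) us" "length us = length ts * ((m - k) div t)" by blast
 obtain vs where vs: "tiling t T (supp \<tau> - X) vs" "length vs = (m - k) div t"
  using subtile[of m T A B C X k t] Cons.prems unfolding e by auto
 have d: "(supp \<tau> - X) \<inter> (supps ts - X) = {}"
  using tiling_supps[of m T "V - supp \<tau>" ts] Cons.prems(1) by auto
 have "tiling t T ((supp \<tau> - X) \<union> (supps ts - X)) (vs @ us)"
  by (rule tiling_append[OF vs(1) us(1) d])
 moreover have "(supp \<tau> - X) \<union> (supps ts - X) = supps (\<tau> # ts) - X" by auto
 ultimately show ?case using us(2) vs(2) by (intro exI[of _ "vs @ us"]) auto
qed

lemma tiling_restrict: "tiling t T V ts ==> tiling t T (supps ts) ts"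
proof (induction ts arbitrary: V)
 case (Cons \<tau> ts)
 have "supps ts \<inter> supp \<tau> = {}" using tiling_supps[of t T "V - supp \<tau>" ts] Cons.prems by auto
 then have "supp \<tau> \<union> supps ts - supp \<tau> = supps ts" by blast
 then show ?case using Cons.IH[of "V - supp \<tau>"] Cons.prems by simp
qed simp

definition parts :: "('a set \<times> 'a set \<times> 'a set) list => 'a set set" where
 "parts ts = (\<Union>(A, B, C)\<in>set ts. {A, B, C})"

lemma parts_simps [simp]: "parts [] = {}" "parts ((A, B, C) # ts) = {A, B, C} \<union> parts ts"
 unfolding parts_def by auto

lemma tiling_parts:
 assumes "0 < m"
 shows "tiling m T V ts ==> finite (parts ts) & card (parts ts) = 3 * length ts & \<Union>(parts ts) = supps ts
  & (\<forall>S\<in>parts ts. finite S & card S = m) & (\<forall>S\<in>parts ts. \<forall>S'\<in>parts ts. S ~= S' --> S \<inter> S' = {})"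
proof (induction ts arbitrary: V)
 case (Cons \<tau> ts)
 obtain A B C where e: "\<tau> = (A, B, C)" by (cases \<tau>)
 have "is_tile m T (A, B, C)" using Cons.prems unfolding e by simp
 then have til: "finite A" "finite B" "finite C" "card A = m" "card B = m" "card C = m"
  "A \<inter> B = {}" "A \<inter> C = {}" "B \<inter> C = {}"
  unfolding is_tile_def by auto
 have ne: "A ~= {}" "B ~= {}" "C ~= {}" using til(4-6) assms by auto
 have neq: "A ~= B" "A ~= C" "B ~= C" using ne til(7-9) by auto
 have IH: "finite (parts ts)" "card (parts ts) = 3 * length ts" "\<Union>(parts ts) = supps ts"
  "\<forall>S\<in>parts ts. finite S & card S = m" "\<forall>S\<in>parts ts. \<forall>S'\<in>parts ts. S ~= S' --> S \<inter> S' = {}"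
  using Cons.IH[of "V - supp \<tau>"] Cons.prems by auto
 have "supps ts \<subseteq> V - supp \<tau>" using tiling_supps[of m T "V - supp \<tau>" ts] Cons.prems by auto
 then have d: "(A \<union> B \<union> C) \<inter> supps ts = {}" unfolding e supp_def by auto
 have out: "X \<inter> S = {}" if "X \<in> {A, B, C}" "S \<in> parts ts" for X S
  using that d IH(3) by blast
 have notin: "A \<notin> parts ts" "B \<notin> parts ts" "C \<notin> parts ts" using out ne by blast+
 have "card ({A, B, C} \<union> parts ts) = card {A, B, C} + card (parts ts)"
  by (rule card_Un_disjoint) (use IH notin in auto)
 also have "card {A, B, C} = 3" using neq by simp
 finally have c: "card (parts (\<tau> # ts)) = 3 * length (\<tau> # ts)" using IH unfolding e by simp
 have pd: "X \<inter> Y = {}" if "X \<in> {A, B, C}" "Y \<in> {A, B, C}" "X ~= Y" for X Y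
  using that til(7-9) by auto
 have dj: "\<forall>S\<in>{A, B, C} \<union> parts ts. \<forall>S'\<in>{A, B, C} \<union> parts ts. S ~= S' --> S \<inter> S' = {}"
  using pd out IH(5) by (metis Int_commute Un_iff)
 have sz: "\<forall>S\<in>{A, B, C} \<union> parts ts. finite S & card S = m" using til(1-6) IH(4) by auto
 have un: "\<Union>({A, B, C} \<union> parts ts) = supps (\<tau> # ts)" using IH(3) unfolding e by (auto simp: supp_def)
 show ?case using c dj sz un IH(1) unfolding e by simp
qed simp

lemma pr3_card:
 assumes "finite V"
 shows "pr3 V P * real (card V)^3 = real (card {(x, y, z). x \<in> V & y \<in> V & z \<in> V & P x y z})"
proof (cases "card V = 0")
 case True
 then have "{(x, y, z). x \<in> V & y \<in> V & z \<in> V & P x y z} = {}" using assms by auto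
 then show ?thesis using True by (simp only: card.empty) simp
next
 case False
 have "{(x, y, z). x \<in> V & y \<in> V & z \<in> V & P x y z} = (SIGMA x:V. SIGMA y:V. {z\<in>V. P x y z})" by auto
 then have "real (card {(x, y, z). x \<in> V & y \<in> V & z \<in> V & P x y z}) = (\<Sum>x\<in>V. \<Sum>y\<in>V. real (card {z\<in>V. P x y z}))"
  using assms by (simp add: card_SigmaI)
 also have "... = (\<Sum>x\<in>V. \<Sum>y\<in>V. pr V (P x y) * card V)"
  using False by (simp add: pr_eq_card[OF assms])
 also have "... = pr3 V P * real (card V)^3"
  unfolding pr3_def pr2_def avg_def using False
  by (simp add: power3_eq_cube sum_distrib_right sum_divide_distrib)
 finally show ?thesis by simp
qed

text \<open>A robust fractional cover bound passes to any partition into small clusters.\<close>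
lemma cluster_triple:
 fixes V :: "'a set" and \<nu> \<omega> :: real
 assumes V: "finite V" and cov: "robust_cover V T (\<omega>^3/2) \<nu>" and \<omega>: "0 < \<omega>" "\<omega> <= 1/2" and \<nu>: "0 < \<nu>"
  and fam: "finite \<C>" "!!S. S \<in> \<C> ==> finite S & card S = m & S \<subseteq> V" "!!S S'. S \<in> \<C> ==> S' \<in> \<C> ==> S ~= S' ==> S \<inter> S' = {}"
  and rest: "card V <= m * card \<C> + m" and n1: "6 * real m <= \<nu> * card V" and n2: "6 * real m <= \<omega>^3 * card V" and m: "0 < m"
  and c: "\<forall>S\<in>\<C>. 0 <= c S" and sum: "sum c \<C> < (1 - \<omega>^3) * card \<C> / 3"
 shows "\<exists>A\<in>\<C>. \<exists>B\<in>\<C>. \<exists>C\<in>\<C>. A ~= B & A ~= C & B ~= C &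
  \<nu>/2 * real m^3 <= card {(a, b, c). a \<in> A & b \<in> B & c \<in> C & T a b c} & c A + c B + c C < 1"
proof (rule ccontr)
 assume neg: "~ ?thesis"
 define n where "n = real (card V)"
 define cl where "cl = (%x. THE S. S \<in> \<C> & x \<in> S)"
 have cl: "cl x = S" if "S \<in> \<C>" "x \<in> S" for x S
  unfolding cl_def by (rule the_equality) (use that fam(3) in blast)+
 \<comment> \<open>Vertices inherit the weight of their cluster. Weight 1 on the few vertices
   outside the clusters covers every triple that meets them.\<close>
 define d where "d = (%x. if x \<in> \<Union>\<C> then c (cl x) else 1)"
 have UV: "\<Union>\<C> \<subseteq> V" using fam(2) by blast
 have cardU: "card (\<Union>\<C>) = m * card \<C>"
 proof -
  have "card (\<Union>\<C>) = (\<Sum>S\<in>\<C>. card S)"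
  by (rule card_Union_disjoint) (use fam in \<open>auto simp: pairwise_def disjnt_def\<close>)
  then show ?thesis using fam(2) by simp
 qed
 have mC: "real m * card \<C> <= n" using card_mono[OF V UV] unfolding cardU n_def by (simp flip: of_nat_mult)
 have n0: "0 < n"
 proof -
  have "0 < 6 * real m" using m by simp
  then have "0 < \<nu> * n" using n1 unfolding n_def by linarith
  then show ?thesis using \<nu> by (simp add: zero_less_mult_iff)
 qed
 have "(\<Sum>x\<in>V. d x) = (\<Sum>x\<in>\<Union>\<C>. d x) + (\<Sum>x\<in>V - \<Union>\<C>. d x)"
  using sum.subset_diff[OF UV V, of d] by simp
 also have "(\<Sum>x\<in>V - \<Union>\<C>. d x) = card (V - \<Union>\<C>)" unfolding d_def by simp
 also have "(\<Sum>x\<in>\<Union>\<C>. d x) = (\<Sum>S\<in>\<C>. \<Sum>x\<in>S. d x)"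
  by (rule sum.Union_disjoint[unfolded comp_def]) (use fam in auto)
 also have "... = (\<Sum>S\<in>\<C>. real m * c S)"
 proof (rule sum.cong[OF refl])
  fix S assume S: "S \<in> \<C>"
  have "(\<Sum>x\<in>S. d x) = (\<Sum>x\<in>S. c S)"
  by (rule sum.cong[OF refl]) (use S cl[OF S] in \<open>auto simp: d_def\<close>)
  then show "(\<Sum>x\<in>S. d x) = real m * c S" using fam(2)[OF S] by simp
 qed
 also have "... = real m * sum c \<C>" by (simp add: sum_distrib_left)
 finally have sd: "(\<Sum>x\<in>V. d x) = real m * sum c \<C> + card (V - \<Union>\<C>)" by simp
 have "card (V - \<Union>\<C>) <= m"
  using rest cardU V UV finite_subset[OF UV V] by (simp add: card_Diff_subset)
 moreover have "real m * sum c \<C> < real m * ((1 - \<omega>^3) * card \<C> / 3)" using sum m by simp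
 moreover have "real m * ((1 - \<omega>^3) * card \<C> / 3) <= (1 - \<omega>^3) * n / 3"
 proof -
  have "\<omega>^3 <= 1" using \<omega> by (intro power_le_one) auto
  then have "(1 - \<omega>^3) * (real m * card \<C>) <= (1 - \<omega>^3) * n" using mC by (intro mult_left_mono) auto
  then have "(1 - \<omega>^3) * (real m * card \<C>) / 3 <= (1 - \<omega>^3) * n / 3" by (rule divide_right_mono) simp
  then show ?thesis by (simp only: mult.left_commute times_divide_eq_right)
 qed
 ultimately have "(\<Sum>x\<in>V. d x) < (1 - \<omega>^3) * n / 3 + m" using sd by linarith
 also have "... <= (1 - \<omega>^3) * n / 3 + \<omega>^3 * n / 6" using n2 unfolding n_def by simp
 also have "... = (1 - \<omega>^3/2) / 3 * n" by (simp add: field_simps)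
 finally have "avg V d < (1 - \<omega>^3/2) / 3" using n0 unfolding avg_def n_def by (simp add: field_simps)
 moreover have "\<forall>x\<in>V. 0 <= d x" unfolding d_def using c cl by auto
 ultimately have "\<nu> < pr3 V (%x y z. T x y z & d x + d y + d z < 1)"
  using cov unfolding robust_cover_def by blast
 then have "\<nu> * n^3 < pr3 V (%x y z. T x y z & d x + d y + d z < 1) * n^3" using n0 by simp
 also have "... = card {(x, y, z). x \<in> V & y \<in> V & z \<in> V & T x y z & d x + d y + d z < 1}"
  unfolding n_def by (rule pr3_card[OF V])
 finally have big: "\<nu> * n^3 < card {(x, y, z). x \<in> V & y \<in> V & z \<in> V & T x y z & d x + d y + d z < 1}" .
 define M where "M = (%x. if x \<in> \<Union>\<C> then cl x else {})"
 have M: "finite (M x)" "card (M x) <= m" for x unfolding M_def using cl fam(2) by auto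
 \<comment> \<open>Triples whose first two vertices share a cluster; \<open>N2\<close> and
   \<open>N3\<close> are its coordinate permutations. They are negligible because clusters are small
   against \<open>V\<close>.\<close>
 define N1 where "N1 = (SIGMA x:V. M x \<times> V)"
 define N2 where "N2 = (%(x, y, z). (x, z, y)) ` N1"
 define N3 where "N3 = (%(x, y, z). (z, x, y)) ` N1"
 have N1: "finite N1" "card N1 <= card V * (m * card V)"
 proof -
  show "finite N1" unfolding N1_def using V M by auto
  have "card N1 = (\<Sum>x\<in>V. card (M x) * card V)"
  unfolding N1_def using V M(1) by (simp add: card_SigmaI card_cartesian_product)
  also have "... <= (\<Sum>x\<in>V. m * card V)" using M(2) by (intro sum_mono mult_right_mono) auto
  finally show "card N1 <= card V * (m * card V)" by simp
 qed
 have "card N2 <= card N1" "card N3 <= card N1"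
  unfolding N2_def N3_def by (rule card_image_le[OF N1(1)])+
 moreover have "finite N2" "finite N3" unfolding N2_def N3_def using N1(1) by simp_all
 ultimately have N23: "card N2 <= card V * (m * card V)" "card N3 <= card V * (m * card V)" "finite N2" "finite N3"
  using N1(2) by simp_all
 define K where "K = {(A, B, C). A \<in> \<C> & B \<in> \<C> & C \<in> \<C> & A ~= B & A ~= C & B ~= C & c A + c B + c C < 1}"
 let ?E = "%(A, B, C). {(a, b, c). a \<in> A & b \<in> B & c \<in> C & T a b c}"
 have K: "finite K" "card K <= card \<C> ^ 3"
 proof -
  have s: "K \<subseteq> \<C> \<times> \<C> \<times> \<C>" unfolding K_def by auto
  have f: "finite (\<C> \<times> \<C> \<times> \<C>)" using fam(1) by simp
  show "finite K" by (rule finite_subset[OF s f])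
  show "card K <= card \<C> ^ 3" using card_mono[OF f s] by (simp add: card_cartesian_product power3_eq_cube)
 qed
 have Efin: "finite (?E k)" if "k \<in> K" for k
 proof -
  obtain A B C where k0: "k = (A, B, C)" by (cases k)
  then have k: "k = (A, B, C)" "A \<in> \<C>" "B \<in> \<C>" "C \<in> \<C>" using that unfolding K_def by auto
  have "finite (A \<times> B \<times> C)" using k fam(2) by auto
  then show ?thesis unfolding k by (rule finite_subset[rotated]) auto
 qed
 have Ele: "real (card (?E k)) <= \<nu>/2 * real m^3" if kK: "k \<in> K" for k
 proof -
  obtain A B C where k0: "k = (A, B, C)" by (cases k)
  then have k: "k = (A, B, C)" "A \<in> \<C>" "B \<in> \<C>" "C \<in> \<C>" "A ~= B" "A ~= C" "B ~= C" "c A + c B + c C < 1"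
  using kK unfolding K_def by auto
  have "~ \<nu>/2 * real m^3 <= card (?E k)" using neg k by auto
  then show ?thesis by simp
 qed
 have "{(x, y, z). x \<in> V & y \<in> V & z \<in> V & T x y z & d x + d y + d z < 1} \<subseteq> N1 \<union> N2 \<union> N3 \<union> (\<Union>k\<in>K. ?E k)"
 proof clarify
  fix x y z assume a: "x \<in> V" "y \<in> V" "z \<in> V" "T x y z" "d x + d y + d z < 1"
  and n: "(x, y, z) \<notin> (\<Union>k\<in>K. ?E k)" "(x, y, z) \<notin> N3" "(x, y, z) \<notin> N2"
  have d0: "0 <= d x" "0 <= d y" "0 <= d z" using \<open>\<forall>x\<in>V. 0 <= d x\<close> a by auto
  have u: "x \<in> \<Union>\<C>" "y \<in> \<Union>\<C>" "z \<in> \<Union>\<C>"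
  using a(5) d0 unfolding d_def by (auto split: if_splits)
  obtain A B C where ABC: "A \<in> \<C>" "x \<in> A" "B \<in> \<C>" "y \<in> B" "C \<in> \<C>" "z \<in> C" using u by blast
  have cls: "cl x = A" "cl y = B" "cl z = C" using cl ABC by blast+
  have dd: "d x = c A" "d y = c B" "d z = c C" unfolding d_def using u cls by auto
  show "(x, y, z) \<in> N1"
  proof (rule ccontr)
  assume n1: "(x, y, z) \<notin> N1"
  have "A ~= B" using n1 a ABC cls u unfolding N1_def M_def by auto
  moreover have "A ~= C"
  proof
  assume "A = C"
  then have "(x, z, y) \<in> N1" using a ABC cls u unfolding N1_def M_def by auto
  then have "(x, y, z) \<in> N2" unfolding N2_def by force
  then show False using n by blast
  qed
  moreover have "B ~= C"
  proof
  assume "B = C"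
  then have "(y, z, x) \<in> N1" using a ABC cls u unfolding N1_def M_def by auto
  then have "(x, y, z) \<in> N3" unfolding N3_def by force
  then show False using n by blast
  qed
  ultimately have "(A, B, C) \<in> K" using ABC a(5) dd unfolding K_def by auto
  moreover have "(x, y, z) \<in> ?E (A, B, C)" using ABC a by auto
  ultimately show False using n(1) by blast
  qed
 qed
 then have "card {(x, y, z). x \<in> V & y \<in> V & z \<in> V & T x y z & d x + d y + d z < 1} <= card (N1 \<union> N2 \<union> N3 \<union> (\<Union>k\<in>K. ?E k))"
  using N1 N23 K(1) Efin by (intro card_mono) auto
 also have "... <= card N1 + card N2 + card N3 + card (\<Union>k\<in>K. ?E k)"
  by (intro order_trans[OF card_Un_le] add_right_mono order_refl)
 finally have 1: "real (card {(x, y, z). x \<in> V & y \<in> V & z \<in> V & T x y z & d x + d y + d z < 1})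
  <= real (card N1 + card N2 + card N3) + real (card (\<Union>k\<in>K. ?E k))" by linarith
 have 2: "real (card N1 + card N2 + card N3) <= 3 * (n * (real m * n))"
 proof -
  have "card N1 + card N2 + card N3 <= 3 * (card V * (m * card V))" using N1(2) N23(1,2) by linarith
  then have "real (card N1 + card N2 + card N3) <= real (3 * (card V * (m * card V)))" by (rule of_nat_mono)
  then show ?thesis unfolding n_def by simp
 qed
 have "real (card (\<Union>k\<in>K. ?E k)) <= real (\<Sum>k\<in>K. card (?E k))"
  by (rule of_nat_mono[OF card_UN_le[OF K(1)]])
 also have "... = (\<Sum>k\<in>K. real (card (?E k)))" by simp
 also have "... <= (\<Sum>k\<in>K. \<nu>/2 * real m^3)" by (rule sum_mono) (rule Ele)
 also have "... = real (card K) * (\<nu>/2 * real m^3)" by simp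
 also have "... <= real (card \<C>)^3 * (\<nu>/2 * real m^3)"
  using K(2) \<nu> by (intro mult_right_mono) (simp_all flip: of_nat_power)
 also have "... = \<nu>/2 * (real m * card \<C>)^3" by (simp add: power_mult_distrib)
 also have "... <= \<nu>/2 * n^3" using mC \<nu> by (intro mult_left_mono power_mono) auto
 finally have 3: "real (card (\<Union>k\<in>K. ?E k)) <= \<nu>/2 * n^3" .
 have "\<nu> * n^3 < 3 * (n * (real m * n)) + \<nu>/2 * n^3" using big 1 2 3 by linarith
 moreover have "6 * real m * (n * n) <= \<nu> * n * (n * n)" using n1 n0 unfolding n_def by (intro mult_right_mono) auto
 moreover have "3 * (n * (real m * n)) = 1/2 * (6 * real m * (n * n))" "\<nu> * n * (n * n) = \<nu> * n^3" "\<nu>/2 * n^3 = 1/2 * (\<nu> * n^3)"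
  by (simp_all add: power3_eq_cube)
 ultimately show False by linarith
qed

lemma cnt_append: "cnt (xs @ ys) i = cnt xs i + cnt ys i"
 unfolding cnt_def by simp

lemma cnt_replicate: "cnt (concat (map (replicate s) es)) i = s * cnt es i"
proof (induction es)
 case (Cons e es)
 obtain a b c where e: "e = (a, b, c)" by (cases e)
 have "cnt (replicate s e) i = s * of_bool (i = a | i = b | i = c)"
  unfolding e by (induction s) auto
 then show ?case using Cons by (simp add: cnt_append e algebra_simps)
qed simp

lemma length_replicate_concat: "length (concat (map (replicate s) es)) = s * length es"
 by (induction es) auto

definition good_for :: "real => real => nat => 'a set => ('a => 'a => 'a => bool) => bool" where
 "good_for \<omega> \<nu> n0 V T \<longleftrightarrow> finite V & n0 <= card V & robust_cover V T (\<omega>^3/2) \<nu>"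

text \<open>The type argument keeps the vertex type visible. The quantifier over \<open>t\<close> is
  inside because the hypothesis of \<open>tiling_step\<close> is used for tiles far larger than
  those it produces.\<close>

definition coverable :: "'a itself => real => real => real => bool" where
 "coverable _ \<omega> \<nu> \<theta> \<longleftrightarrow> (\<forall>t>0. EX n0. \<forall>(V :: 'a set) T. good_for \<omega> \<nu> n0 V T -->
  (EX ts. tiling t T V ts & \<theta> * card V <= 3 * real t * length ts))"

lemma increment_arith:
 fixes a b :: real
 shows "a + b - m - d <= z ==> e <= b ==> m <= w/12 ==> c + d <= w/12 ==> e = 5/12 * w - c ==> 0 <= w ==> l = a + w/4 ==> l <= z"
 by linarith

text \<open>Tiles of a much larger size serve as clusters: a small proportion of every cluster is reassigned to
 a nearly perfect fractional matching of the clusters, the remainder of the tiles is cut into small tiles.\<close>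
lemma tiling_step:
 fixes \<omega> \<nu> \<theta> :: real
 assumes \<omega>: "0 < \<omega>" "\<omega> <= 1/2" and \<nu>: "0 < \<nu>" "\<nu> <= 1" and \<theta>: "0 <= \<theta>" "\<theta> <= 1 - 30 * \<omega>"
  and cov: "coverable TYPE('a) \<omega> \<nu> \<theta>"
 shows "coverable TYPE('a) \<omega> \<nu> (\<theta> + \<nu> * \<omega> / 4)"
 unfolding coverable_def
proof (intro allI impI)
 fix t :: nat assume t: "0 < t"
 define \<rho> where "\<rho> = \<nu>/2"
 have \<rho>: "0 < \<rho>" "\<rho> <= 1" unfolding \<rho>_def using \<nu> by auto
 obtain P where P: "0 < P" and match: "\<forall>(I :: 'a set set) R. finite I --> I ~= {} -->
  (\<forall>c::'a set => real. (\<forall>i\<in>I. 0 <= c i) --> sum c I < (1 - \<omega>^3) * card I / 3 -->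
  (\<exists>i\<in>I. \<exists>j\<in>I. \<exists>k\<in>I. i ~= j & i ~= k & j ~= k & R i j k & c i + c j + c k < 1)) -->
  (EX es. (\<forall>(i, j, k)\<in>set es. i \<in> I & j \<in> I & k \<in> I & i ~= j & i ~= k & j ~= k & R i j k)
  & (ALL i. cnt es i <= P) & (1 - 25 * \<omega>) * real P * card I / 3 <= length es)"
  using balanced_matching[OF \<omega>, where ?'b = "'a set"] by (elim exE conjE) (rule that)?
 have "EX m0. \<forall>A B C (T :: 'a => 'a => 'a => bool). finite A --> finite B --> finite C -->
  m0 <= card A --> m0 <= card B --> m0 <= card C -->
  \<rho>/2 * card A * card B * card C <= card {(a, b, c). a \<in> A & b \<in> B & c \<in> C & T a b c} -->
  (\<exists>A'\<subseteq>A. \<exists>B'\<subseteq>B. \<exists>C'\<subseteq>C. card A' = t & card B' = t & card C' = t & (\<forall>a\<in>A'. \<forall>b\<in>B'. \<forall>c\<in>C'. T a b c))"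
  by (rule complete_tripartite) (use \<rho> t in auto)
 then obtain m0 where m0: "\<forall>A B C (T :: 'a => 'a => 'a => bool). finite A --> finite B --> finite C -->
  m0 <= card A --> m0 <= card B --> m0 <= card C -->
  \<rho>/2 * card A * card B * card C <= card {(a, b, c). a \<in> A & b \<in> B & c \<in> C & T a b c} -->
  (\<exists>A'\<subseteq>A. \<exists>B'\<subseteq>B. \<exists>C'\<subseteq>C. card A' = t & card B' = t & card C' = t & (\<forall>a\<in>A'. \<forall>b\<in>B'. \<forall>c\<in>C'. T a b c))" by (elim exE)
 \<comment> \<open>Large enough to find a small tile in half of each of three clusters, and to make
   the rounding of \<open>s\<close> and of the division by \<open>t\<close> negligible against
   \<omega> \<nu>.\<close>
 define m where "m = 2 * m0 + nat \<lceil>(36 * real P * t + 12 * t) / (\<omega> * \<nu>)\<rceil> + 1"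
 have m: "2 * m0 <= m" "0 < m" "(36 * real P * t + 12 * t) / (\<omega> * \<nu>) <= real m"
  unfolding m_def using real_nat_ceiling_ge[of "(36 * real P * t + 12 * t) / (\<omega> * \<nu>)"] by linarith+
 obtain n1 where n1: "\<forall>(V :: 'a set) T. good_for \<omega> \<nu> n1 V T --> (EX ts. tiling m T V ts & \<theta> * card V <= 3 * real m * length ts)"
  using cov m(2) unfolding coverable_def by blast
 define n0 where "n0 = n1 + nat \<lceil>12 * real m / (\<omega> * \<nu>)\<rceil> + nat \<lceil>6 * real m / \<omega>^3\<rceil> + nat \<lceil>6 * real m / \<nu>\<rceil> + m + 1"
 show "EX n0. \<forall>(V :: 'a set) T. good_for \<omega> \<nu> n0 V T -->
  (EX ts. tiling t T V ts & (\<theta> + \<nu> * \<omega> / 4) * card V <= 3 * real t * length ts)"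
 proof (intro exI[of _ n0] allI impI)
  fix V :: "'a set" and T assume good: "good_for \<omega> \<nu> n0 V T"
  then have V: "finite V" and n0: "n0 <= card V" and rc: "robust_cover V T (\<omega>^3/2) \<nu>"
  unfolding good_for_def by auto
  define n where "n = real (card V)"
  have large: "12 * real m / (\<omega> * \<nu>) <= n" "6 * real m / \<omega>^3 <= n" "6 * real m / \<nu> <= n" "m < card V" "n1 <= card V"
  using n0 unfolding n0_def n_def by linarith+
  have n00: "0 < n" using large(4) unfolding n_def by simp
  have "good_for \<omega> \<nu> n1 V T" using V rc large unfolding good_for_def by simp
  then obtain ts where ts: "tiling m T V ts" "\<theta> * n <= 3 * real m * length ts"
  using n1 unfolding n_def by blast
  note pts = tiling_parts[OF m(2) ts(1)]
  define U where "U = V - supps ts"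
  obtain Pc where Pc: "finite Pc" "card Pc = card U div m" "\<forall>S\<in>Pc. card S = m & S \<subseteq> U"
  "\<forall>S\<in>Pc. \<forall>S'\<in>Pc. S ~= S' --> S \<inter> S' = {}"
  using chop[of U m] V m(2) unfolding U_def by auto
  define \<C> where "\<C> = parts ts \<union> Pc"
  have sub: "supps ts \<subseteq> V" by (rule tiling_supps[OF ts(1)])
  have famP: "finite S & card S = m & S \<subseteq> supps ts" if "S \<in> parts ts" for S
  using pts that by blast
  have famU: "finite S & card S = m & S \<subseteq> U" if "S \<in> Pc" for S
  using Pc(3) that V finite_subset unfolding U_def by blast
  have fam: "finite S & card S = m & S \<subseteq> V" if "S \<in> \<C>" for S
  using that famP[of S] famU[of S] sub unfolding \<C>_def U_def by blast
  have dis: "S \<inter> S' = {}" if "S \<in> \<C>" "S' \<in> \<C>" "S ~= S'" for S S'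
  proof -
  consider "S \<in> parts ts" "S' \<in> parts ts" | "S \<in> Pc" "S' \<in> Pc" | "S \<in> parts ts" "S' \<in> Pc" | "S \<in> Pc" "S' \<in> parts ts"
  using \<open>S \<in> \<C>\<close> \<open>S' \<in> \<C>\<close> unfolding \<C>_def by blast
  then show ?thesis
  proof cases
  case 1 then show ?thesis using pts that(3) by blast
  next
  case 2 then show ?thesis using Pc(4) that(3) by blast
  next
  case 3 then show ?thesis using famP[of S] famU[of S'] unfolding U_def by blast
  next
  case 4 then show ?thesis using famP[of S'] famU[of S] unfolding U_def by blast
  qed
  qed
  have "parts ts \<inter> Pc = {}"
  proof (rule ccontr)
  assume "parts ts \<inter> Pc ~= {}"
  then obtain S where S: "S \<in> parts ts" "S \<in> Pc" by blast
  then have "S = {}" using famP[of S] famU[of S] unfolding U_def by blast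
  then show False using famP[OF S(1)] m(2) by simp
  qed
  then have cC: "card \<C> = 3 * length ts + card U div m"
  unfolding \<C>_def using card_Un_disjoint[of "parts ts" Pc] pts Pc(1,2) by simp
  have finC: "finite \<C>" unfolding \<C>_def using pts Pc(1) by simp
  have "card V = 3 * m * length ts + card U"
  unfolding U_def using card_supps[OF ts(1)] sub card_mono[OF V sub] by (simp add: card_Diff_subset)
  moreover have "card U <= m * (card U div m) + m"
  using mod_less_divisor[OF m(2), of "card U"] mult_div_mod_eq[of m "card U"] by linarith
  ultimately have rest: "card V <= m * card \<C> + m" unfolding cC by (simp add: algebra_simps)
  have Cne: "\<C> ~= {}" using rest large(4) by auto
  have "EX es. (\<forall>(A, B, C)\<in>set es. A \<in> \<C> & B \<in> \<C> & C \<in> \<C> & A ~= B & A ~= C & B ~= C & \<rho> * real m^3 <= card {(a, b, c). a \<in> A & b \<in> B & c \<in> C & T a b c})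
  & (ALL i. cnt es i <= P) & (1 - 25 * \<omega>) * real P * card \<C> / 3 <= length es"
  proof (rule match[rule_format, OF finC Cne])
  fix c :: "'a set => real" assume c0: "!!i. i \<in> \<C> ==> 0 <= c i" and c1: "sum c \<C> < (1 - \<omega>^3) * real (card \<C>) / 3"
  have c: "\<forall>i\<in>\<C>. 0 <= c i" "sum c \<C> < (1 - \<omega>^3) * real (card \<C>) / 3" using c0 c1 by auto
  show "\<exists>A\<in>\<C>. \<exists>B\<in>\<C>. \<exists>C\<in>\<C>. A ~= B & A ~= C & B ~= C & \<rho> * real m^3 <= card {(a, b, c). a \<in> A & b \<in> B & c \<in> C & T a b c} & c A + c B + c C < 1"
  unfolding \<rho>_def
  proof (rule cluster_triple[OF V rc \<omega> \<nu>(1) finC fam dis rest _ _ m(2) c])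
  show "6 * real m <= \<nu> * card V" using large(3) \<nu> unfolding n_def by (simp add: field_simps)
  show "6 * real m <= \<omega>^3 * card V" using large(2) \<omega> unfolding n_def by (simp add: field_simps)
  qed
  qed
  then obtain es where es: "\<forall>(A, B, C)\<in>set es. A \<in> \<C> & B \<in> \<C> & C \<in> \<C> & A ~= B & A ~= C & B ~= C & \<rho> * real m^3 <= card {(a, b, c). a \<in> A & b \<in> B & c \<in> C & T a b c}"
  "ALL i. cnt es i <= P" "(1 - 25 * \<omega>) * real P * card \<C> / 3 <= length es" by (elim exE conjE) (rule that)?
  \<comment> \<open>Each triple of the matching is used \<open>s\<close> times, so that no cluster
    loses more than \<open>k\<close> vertices, which is about a proportion \<rho>/6.\<close>
  define s where "s = nat \<lfloor>\<rho> * m / (6 * P * t)\<rfloor>"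
  define k where "k = P * s * t"
  have s: "real s <= \<rho> * m / (6 * P * t)" "\<rho> * m / (6 * P * t) - 1 <= real s"
  proof -
  have "0 <= \<rho> * m / (6 * P * t)" using \<rho> by simp
  then show "real s <= \<rho> * m / (6 * P * t)" "\<rho> * m / (6 * P * t) - 1 <= real s" unfolding s_def by linarith+
  qed
  have Pt: "0 < real P * t" using P t by simp
  have k: "real k <= \<rho> * m / 6" "\<rho> * m / 6 - real P * t <= real k"
  proof -
  have "real s * (6 * P * t) <= \<rho> * m" by (rule pos_le_divide_eq[THEN iffD1, OF _ s(1)]) (use P t in simp)
  moreover have "\<rho> * m / (6 * P * t) <= real s + 1" using s(2) by simp
  then have "\<rho> * m <= (real s + 1) * (6 * P * t)" by (rule pos_divide_le_eq[THEN iffD1, rotated]) (use P t in simp)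
  ultimately show "real k <= \<rho> * m / 6" "\<rho> * m / 6 - real P * t <= real k"
  unfolding k_def by (simp_all add: algebra_simps)
  qed
  define es2 where "es2 = concat (map (replicate s) es)"
  have "EX ts2. tiling t T (\<Union>\<C>) ts2 & length ts2 = length es2 & (\<forall>S\<in>\<C>. card (supps ts2 \<inter> S) = t * cnt es2 S)"
  proof (rule extract_tiles[OF _ \<rho> m(1)])
  show "\<exists>A'\<subseteq>A. \<exists>B'\<subseteq>B. \<exists>C'\<subseteq>C. card A' = t & card B' = t & card C' = t & (\<forall>a\<in>A'. \<forall>b\<in>B'. \<forall>c\<in>C'. T a b c)"
  if "finite A" "finite B" "finite C" "m0 <= card A" "m0 <= card B" "m0 <= card C"
  "\<rho>/2 * card A * card B * card C <= card {(a, b, c). a \<in> A & b \<in> B & c \<in> C & T a b c}" for A B C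
  using m0[rule_format, OF that] .
  show "\<forall>(A, B, C)\<in>set es2. A \<in> \<C> & B \<in> \<C> & C \<in> \<C> & A ~= B & A ~= C & B ~= C & \<rho> * real m^3 <= card {(a, b, c). a \<in> A & b \<in> B & c \<in> C & T a b c}"
  proof -
  have "set es2 \<subseteq> set es" unfolding es2_def by auto
  then show ?thesis using es(1) by blast
  qed
  show "ALL S. real t * cnt es2 S <= \<rho> * m / 6"
  proof
  fix S
  have "t * (s * cnt es S) <= t * (s * P)" using es(2) by (intro mult_le_mono2) auto
  then have "t * cnt es2 S <= k" unfolding es2_def cnt_replicate k_def by (simp add: mult.commute mult.left_commute)
  then have "real (t * cnt es2 S) <= real k" by (rule of_nat_mono)
  then show "real t * cnt es2 S <= \<rho> * m / 6" using k(1) by simp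
  qed
  qed (use fam dis in auto)
  then obtain ts2 where ts2: "tiling t T (\<Union>\<C>) ts2" "length ts2 = length es2" "\<forall>S\<in>\<C>. card (supps ts2 \<inter> S) = t * cnt es2 S"
  by blast
  define X where "X = supps ts2"
  have Xk: "card (X \<inter> S) <= k" if "S \<in> \<C>" for S
  proof -
  have "t * (s * cnt es S) <= t * (s * P)" using es(2) by (intro mult_le_mono2) auto
  then show ?thesis using ts2(3) that unfolding X_def es2_def cnt_replicate k_def
  by (simp add: mult.commute mult.left_commute)
  qed
  have "EX us. tiling t T (supps ts - X) us & length us = length ts * ((m - k) div t)"
  proof (rule subtiles[OF ts(1) t])
  fix A B C assume "(A, B, C) \<in> set ts"
  then have "A \<in> \<C>" "B \<in> \<C>" "C \<in> \<C>" unfolding \<C>_def parts_def by auto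
  then show "card (X \<inter> A) <= k & card (X \<inter> B) <= k & card (X \<inter> C) <= k" using Xk by blast
  qed
  then obtain us where us: "tiling t T (supps ts - X) us" "length us = length ts * ((m - k) div t)" by blast
  have "tiling t T ((supps ts - X) \<union> X) (us @ ts2)"
  by (rule tiling_append[OF us(1)]) (use tiling_restrict[OF ts2(1)] in \<open>auto simp: X_def\<close>)
  moreover have "(supps ts - X) \<union> X \<subseteq> V"
  using sub tiling_supps[OF ts2(1)] fam unfolding X_def by blast
  ultimately have til: "tiling t T V (us @ ts2)" by (rule tiling_mono)
  define y where "y = 3 * real (length ts)"
  have y0: "0 <= y" unfolding y_def by simp
  have yn: "real m * y <= n"
  proof -
  have "3 * m * length ts <= card V" using card_supps[OF ts(1)] card_mono[OF V sub] by simp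
  then have "real (3 * m * length ts) <= n" unfolding n_def by (rule of_nat_mono)
  then show ?thesis unfolding y_def by (simp add: mult.commute mult.left_commute)
  qed
  have ylam: "\<theta> * n <= real m * y" using ts(2) unfolding y_def by (simp add: mult.commute mult.left_commute)
  have len1: "y * (real m - k - t) <= 3 * real t * length us"
  proof -
  have "real m - k - t <= real t * ((m - k) div t)"
  proof -
  have "(m - k) mod t < t" using t by simp
  then have "m - k <= t * ((m - k) div t) + t" using mult_div_mod_eq[of t "m - k"] by linarith
  then have "real (m - k) <= real (t * ((m - k) div t) + t)" by (rule of_nat_mono)
  then show ?thesis by simp
  qed
  then have "y * (real m - k - t) <= y * (real t * ((m - k) div t))" using y0 by (intro mult_left_mono)
  also have "... = 3 * real t * length us" unfolding y_def us(2) by simp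
  finally show ?thesis .
  qed
  have len2: "real k * ((1 - 25 * \<omega>) * card \<C>) <= 3 * real t * length ts2"
  proof -
  have "3 * real t * real s * ((1 - 25 * \<omega>) * real P * card \<C> / 3) <= 3 * real t * real s * length es"
  using es(3) by (intro mult_left_mono) auto
  moreover have "3 * real t * real s * ((1 - 25 * \<omega>) * real P * card \<C> / 3) = real k * ((1 - 25 * \<omega>) * card \<C>)"
  unfolding k_def by simp
  moreover have "3 * real t * real s * length es = 3 * real t * length ts2"
  unfolding ts2(2) es2_def length_replicate_concat by simp
  ultimately show ?thesis by linarith
  qed
  \<comment> \<open>The proportion reserved in every cluster. It costs the old tiles at rate
    \<theta> and the matching returns it at rate 1 - 25\<omega>, a net gain of at least 5\<omega>
    times \<open>q\<close>, where \<open>q\<close> is close to \<nu>/12.\<close>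
  define q where "q = real k / m"
  have mr: "0 < real m" using m(2) by simp
  have q: "0 <= q" "q <= 1" "\<nu>/12 - real P * t / m <= q"
  proof -
  show "0 <= q" unfolding q_def by simp
  have "\<rho> * m <= 1 * real m" using \<rho> by (intro mult_right_mono) auto
  then have "\<rho> * m / 6 <= real m" by simp
  then have "real k <= real m" using k(1) by linarith
  then show "q <= 1" unfolding q_def using mr by simp
  have "(\<rho> * m / 6 - real P * t) / m <= q" unfolding q_def using k(2) by (intro divide_right_mono) auto
  then show "\<nu>/12 - real P * t / m <= q" using mr unfolding \<rho>_def by (simp add: diff_divide_distrib)
  qed
  have o25: "0 <= 1 - 25 * \<omega>" using \<theta> \<omega> by linarith
  have kq: "real k = q * m" unfolding q_def using mr by simp
  have A1: "\<theta> * n * (1 - q) - n * (t / m) <= 3 * real t * length us"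
  proof -
  have "\<theta> * n * (1 - q) <= real m * y * (1 - q)" using ylam q by (intro mult_right_mono) auto
  moreover have "real t / m * (real m * y) <= real t / m * n" using yn by (intro mult_left_mono) auto
  moreover have "y * (real m - k - t) = real m * y * (1 - q) - real t / m * (real m * y)"
  unfolding kq using mr by (simp add: algebra_simps)
  ultimately show ?thesis using len1 by (simp add: mult.commute)
  qed
  have A2: "q * (1 - 25 * \<omega>) * (n - m) <= 3 * real t * length ts2"
  proof -
  have "real (card V) <= real (m * card \<C> + m)" using rest by (rule of_nat_mono)
  then have "n - m <= real m * card \<C>" unfolding n_def by simp
  then have "q * (1 - 25 * \<omega>) * (n - m) <= q * (1 - 25 * \<omega>) * (real m * card \<C>)"
  using q o25 by (intro mult_left_mono) auto
  also have "... = real k * ((1 - 25 * \<omega>) * card \<C>)" unfolding kq by simp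
  finally show ?thesis using len2 by linarith
  qed
  have A3: "q * (1 - 25 * \<omega>) * m <= m"
  proof -
  have "q * (1 - 25 * \<omega>) <= 1 * 1" using q o25 \<omega> by (intro mult_mono) auto
  then show ?thesis using mr by (simp add: mult_left_le_one_le q o25)
  qed
  have A4: "n * (q * (5 * \<omega>)) <= n * (q * (1 - 25 * \<omega> - \<theta>))"
  using q \<theta> n00 by (intro mult_left_mono) auto
  have "\<theta> * n * (1 - q) + q * (1 - 25 * \<omega>) * (n - m) = \<theta> * n + n * (q * (1 - 25 * \<omega> - \<theta>)) - q * (1 - 25 * \<omega>) * m"
  by (simp add: algebra_simps)
  then have A5: "\<theta> * n + n * (q * (5 * \<omega>)) - m - n * (t / m) <= 3 * real t * length (us @ ts2)"
  using A1 A2 A3 A4 by (simp add: distrib_left)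
  have A6: "n * ((\<nu>/12 - real P * t / m) * (5 * \<omega>)) <= n * (q * (5 * \<omega>))"
  using q \<omega> n00 by (intro mult_left_mono mult_right_mono) auto
  have A7: "real m <= \<omega> * \<nu> / 12 * n" using large(1) \<omega> \<nu> by (simp add: field_simps)
  have A8: "36 * real P * t / m + 12 * t / m <= \<omega> * \<nu>"
  proof -
  have "36 * real P * t + 12 * t <= \<omega> * \<nu> * m" using m(3) \<omega> \<nu> by (simp add: field_simps)
  then have "(36 * real P * t + 12 * t) / m <= \<omega> * \<nu>" using mr by (simp add: field_simps)
  then show ?thesis by (simp add: add_divide_distrib)
  qed
  have A9: "real P * t / m * (5 * \<omega>) + t / m <= \<omega> * \<nu> / 12"
  proof -
  have "real P * t / m * (5 * \<omega>) <= real P * t / m * 3" using \<omega> by (intro mult_left_mono) auto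
  moreover have "12 * (real P * t / m * 3) = 36 * real P * t / m" "12 * (t / m) = 12 * t / real m" by simp_all
  ultimately show ?thesis using A8 by linarith
  qed
  have A10: "n * (real P * t / m * (5 * \<omega>) + t / m) <= n * (\<omega> * \<nu> / 12)"
  using A9 n00 by (intro mult_left_mono) auto
  have eq1: "n * ((\<nu>/12 - real P * t / m) * (5 * \<omega>)) = 5/12 * (\<omega> * \<nu> * n) - n * (real P * t / m * (5 * \<omega>))"
  by (simp add: algebra_simps)
  have "(\<theta> + \<nu> * \<omega> / 4) * n <= 3 * real t * length (us @ ts2)"
  proof (rule increment_arith[OF A5 A6 _ _ eq1])
  show "real m <= \<omega> * \<nu> * n / 12" using A7 by simp
  show "n * (real P * t / m * (5 * \<omega>)) + n * (t / m) <= \<omega> * \<nu> * n / 12"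
  using A10 unfolding distrib_left by (simp add: mult.commute mult.left_commute)
  show "0 <= \<omega> * \<nu> * n" using \<omega> \<nu> n00 by simp
  show "(\<theta> + \<nu> * \<omega> / 4) * n = \<theta> * n + \<omega> * \<nu> * n / 4" by (simp add: algebra_simps)
  qed
  then show "EX ts. tiling t T V ts & (\<theta> + \<nu> * \<omega> / 4) * card V <= 3 * real t * length ts"
  using til unfolding n_def by blast
 qed
qed

text \<open>Starting from the empty tiling, each step gains the fixed amount \<nu> \<omega> / 4
  until 1 - 30\<omega> is reached.\<close>

lemma almost_tiling:
 assumes \<omega>: "0 < \<omega>" "\<omega> <= 1/30" and \<nu>: "0 < \<nu>" "\<nu> <= (1::real)" and t: "0 < t"
 shows "EX n0. \<forall>(V :: 'a set) T. good_for \<omega> \<nu> n0 V T -->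
  (EX ts. tiling t T V ts & (1 - 30 * \<omega>) * card V <= 3 * real t * length ts)"
proof -
 define k where "k = \<nu> * \<omega> / 4"
 have k: "0 < k" unfolding k_def using \<omega> \<nu> by simp
 have ind: "real j * k <= 1 - 30 * \<omega> + k ==> coverable TYPE('a) \<omega> \<nu> (real j * k)" for j
 proof (induction j)
  case 0
  have "EX ts. tiling t T V ts & 0 * card V <= 3 * real t * length ts" for t and V :: "'a set" and T
  by (intro exI[of _ "[]"]) simp
  then show ?case unfolding coverable_def by simp
 next
  case (Suc j)
  have j: "real j * k <= 1 - 30 * \<omega>" using Suc.prems by (simp add: algebra_simps)
  have "coverable TYPE('a) \<omega> \<nu> (real j * k + \<nu> * \<omega> / 4)"
  by (rule tiling_step) (use Suc.IH j k \<omega> \<nu> in auto)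
  then show ?case unfolding k_def[symmetric] by (simp add: algebra_simps)
 qed
 define j where "j = nat \<lfloor>(1 - 30 * \<omega>) / k\<rfloor> + 1"
 have "0 <= (1 - 30 * \<omega>) / k" using \<omega> k by simp
 then have "real j <= (1 - 30 * \<omega>) / k + 1" "(1 - 30 * \<omega>) / k <= real j" unfolding j_def by linarith+
 then have j: "real j * k <= 1 - 30 * \<omega> + k" "1 - 30 * \<omega> <= real j * k" using k by (simp_all add: field_simps)
 obtain n0 where n0: "\<forall>(V :: 'a set) T. good_for \<omega> \<nu> n0 V T -->
  (EX ts. tiling t T V ts & real j * k * card V <= 3 * real t * length ts)"
  using ind[OF j(1)] t unfolding coverable_def by blast
 have "EX ts. tiling t T V ts & (1 - 30 * \<omega>) * card V <= 3 * real t * length ts" if "good_for \<omega> \<nu> n0 V T" for V :: "'a set" and T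
 proof -
  have "(1 - 30 * \<omega>) * card V <= real j * k * card V" using j(2) by (intro mult_right_mono) auto
  then show ?thesis using n0 that order_trans by blast
 qed
 then show ?thesis by blast
qed

section \<open>Weaving blocks\<close>

definition same_ends :: "'a list => 'a list => bool" where
 "same_ends b b' \<longleftrightarrow> 4 <= length b & 4 <= length b' & take 2 b = take 2 b' & drop (length b - 2) b = drop (length b' - 2) b'"

text \<open>Blocks and connectors are kept apart so that blocks can be exchanged later. A connector
  is tested only with the last two vertices of its block and the first two of the next;
  \<open>e\<close> is the pair that follows the last connector.\<close>

fun woven :: "('a => 'a => 'a => bool) => 'a list list => 'a list list => 'a list => bool" where
 "woven t (b # bs) (u # us) e \<longleftrightarrow> 4 <= length b & tpath t b
  & tpath t (drop (length b - 2) b @ u @ (case bs of [] => e | b' # _ => take 2 b')) & woven t bs us e"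
| "woven t [] [] e \<longleftrightarrow> True"
| "woven t _ _ e \<longleftrightarrow> False"

fun weave :: "'a list list => 'a list list => 'a list" where
 "weave (b # bs) (u # us) = b @ u @ weave bs us"
| "weave _ _ = []"

lemma mset_weave: "length bs = length us ==> mset (weave bs us) = mset (concat bs) + mset (concat us)"
 by (induction bs us rule: list_induct2) auto

lemma tpath_join2: "length f = 2 ==> tpath t (xs @ f) ==> tpath t (f @ ys) ==> tpath t (xs @ f @ ys)"
proof -
 assume a: "length f = 2" "tpath t (xs @ f)" "tpath t (f @ ys)"
 obtain x f' where "f = x # f'" "length f' = 1" using a(1) by (cases f) auto
 then obtain y where f: "f = [x, y]" by (cases f') auto
 show ?thesis using tpath_join[of t xs x y ys] a(2,3) unfolding f by simp
qed

lemma woven_tpath: "woven t bs us e ==> length e = 2 ==>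
 tpath t (weave bs us @ e) & take 2 (weave bs us @ e) = (case bs of [] => e | b # _ => take 2 b)"
proof (induction t bs us e rule: woven.induct)
 case (1 t b bs u us e)
 define R where "R = weave bs us @ e"
 define f where "f = (case bs of [] => e | b' # _ => take 2 b')"
 have IH: "tpath t R" "take 2 R = f" using 1 unfolding R_def f_def by auto
 have w: "4 <= length b" "tpath t b" "tpath t (drop (length b - 2) b @ u @ f)" using 1 unfolding f_def by auto
 have f2: "length f = 2"
 proof (cases bs)
  case (Cons b' bs')
  then have "4 <= length b'" using 1(2) by (cases us) auto
  then show ?thesis unfolding f_def Cons by simp
 qed (use 1 in \<open>simp add: f_def\<close>)
 define d where "d = drop (length b - 2) b"
 have d2: "length d = 2" unfolding d_def using w by simp
 have R: "f @ drop 2 R = R" using IH(2) append_take_drop_id[of 2 R] by metis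
 have "tpath t ((d @ u) @ f @ drop 2 R)"
  by (rule tpath_join2[OF f2]) (use w IH R in \<open>simp_all add: d_def\<close>)
 then have "tpath t (d @ (u @ R))" using R by simp
 moreover have "tpath t (take (length b - 2) b @ d)" unfolding d_def using w by simp
 ultimately have "tpath t (take (length b - 2) b @ d @ (u @ R))" by (intro tpath_join2[OF d2])
 moreover have "take (length b - 2) b @ d @ (u @ R) = b @ u @ R" unfolding d_def by (simp only: append_assoc[symmetric] append_take_drop_id)
 ultimately show ?case using w unfolding R_def by simp
qed (auto intro: tpath_short)

text \<open>The conditions on connectors see only the end pairs of the blocks.\<close>

lemma woven_swap: "woven t bs us e ==> list_all2 (%b b'. same_ends b b' & tpath t b') bs bs' ==> woven t bs' us e"
proof (induction t bs us e arbitrary: bs' rule: woven.induct)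
 case (1 t b bs u us e)
 obtain c cs where c: "bs' = c # cs" "same_ends b c" "tpath t c" "list_all2 (%b b'. same_ends b b' & tpath t b') bs cs"
  using 1(3) by (cases bs') auto
 have "(case bs of [] => e | b' # _ => take 2 b') = (case cs of [] => e | b' # _ => take 2 b')"
  using c(4) by (cases bs; cases cs) (auto simp: same_ends_def)
 moreover have "woven t cs us e" using 1 c(4) by simp
 ultimately show ?case using 1(2) c unfolding same_ends_def by auto
qed auto

definition last2 :: "'a list => 'a list" where "last2 b = drop (length b - 2) b"

lemma two_ends: "4 <= length b ==> take 2 b = [b ! 0, b ! 1] & last2 b = [b ! (length b - 2), b ! (length b - 1)]"
proof -
 assume a: "4 <= length b"
 obtain x y r where b: "b = x # y # r" using a by (cases b; cases "tl b") auto
 have "length (last2 b) = 2" unfolding last2_def using a by simp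
 then obtain z w where zw: "last2 b = [z, w]" by (metis length_0_conv length_Suc_conv numeral_2_eq_2)
 have e: "last2 b ! 0 = b ! (length b - 2 + 0)" "last2 b ! 1 = b ! (length b - 2 + 1)"
  unfolding last2_def using a by (intro nth_drop; simp)+
 have "length b - 2 + 1 = length b - 1" using a by simp
 then have "z = b ! (length b - 2)" "w = b ! (length b - 1)" using e unfolding zw by simp_all
 moreover have "take 2 b = [b ! 0, b ! 1]" unfolding b by simp
 ultimately show ?thesis unfolding zw by simp
qed

fun inter :: "'a list => 'a list => 'a list => 'a list" where
 "inter (a # as) (b # bs) (c # cs) = a # b # c # inter as bs cs"
| "inter _ _ _ = []"

lemma inter_facts:
 assumes "length as = length bs" "length bs = length cs"
 shows "length (inter as bs cs) = 3 * length as & mset (inter as bs cs) = mset as + mset bs + mset cs"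
 using assms by (induction as bs cs rule: inter.induct) auto

lemma inter_tpath:
 assumes "length as = length bs" "length bs = length cs" "set as \<subseteq> A" "set bs \<subseteq> B" "set cs \<subseteq> C"
  and t: "!!a b c. a \<in> A ==> b \<in> B ==> c \<in> C ==> t a b c & t b c a & t c a b"
 shows "tpath t (inter as bs cs)"
 using assms(1-5)
proof (induction as bs cs rule: inter.induct)
 case (1 a as b bs c cs)
 then have IH: "tpath t (inter as bs cs)" by simp
 show ?case
 proof (cases as)
  case Nil
  then have "bs = []" "cs = []" using 1 by auto
  then show ?thesis using Nil 1 t by simp
 next
  case (Cons a' as')
  obtain b' bs' where b: "bs = b' # bs'" using Cons 1 by (cases bs) auto
  obtain c' cs' where c: "cs = c' # cs'" using b 1 by (cases cs) auto
  show ?thesis using IH 1 t unfolding Cons b c by auto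
 qed
qed auto

lemma inter_append: "length as = length bs ==> length bs = length cs ==> inter (as @ as') (bs @ bs') (cs @ cs') = inter as bs cs @ inter as' bs' cs'"
 by (induction as bs cs rule: inter.induct) auto

fun rest4 :: "'a \<times> 'a \<times> 'a \<times> 'a => 'a list" where "rest4 (a, b, c, d) = [a, b, c, d]"

lemma mset_blk: "mset (blk (u, \<tau>)) = add_mset u (mset (rest4 \<tau>))"
 by (cases \<tau>) simp

lemma mset_blks: "mset (concat (map blk gs)) = mset (map fst gs) + mset (concat (map rest4 (map snd gs)))"
proof (induction gs)
 case (Cons g gs)
 then show ?case using mset_blk[of "fst g" "snd g"] by simp
qed simp

context comp2
begin

text \<open>Four vertices at least, so that the two end pairs occupy different places; both lie in
  \<open>G\<close>, hence connectors can be attached in either direction.\<close>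

definition okb :: "'a list => bool" where
 "okb b \<longleftrightarrow> 4 <= length b & tpath h b & G (b ! 0) (b ! 1) & G (b ! (length b - 2)) (b ! (length b - 1))"

lemma okb_self: "okb b ==> same_ends b b & tpath h b"
 unfolding okb_def same_ends_def by simp

lemma blk_okb: "Wt u \<tau> ==> okb (blk (u, \<tau>))"
proof -
 assume W: "Wt u \<tau>"
 obtain a b c d where t: "\<tau> = (a, b, c, d)" by (cases \<tau>)
 have "h u a b" "h u b c" "h u c d" "G a b" "G c d" using W unfolding t by (auto simp: W_def L_def)
 moreover have "h a b u" "h b u c" "h u c d"
  using \<open>h u a b\<close> \<open>h u b c\<close> \<open>h u c d\<close> h_perm(5)[of a b u] h_perm(1)[of b u c] by simp_all
 ultimately show ?thesis unfolding okb_def t by (simp add: numeral_eq_Suc)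
qed

lemma blk_same: "same_ends (blk (u, \<tau>)) (blk (v, \<tau>))"
 unfolding same_ends_def by (cases \<tau>) simp

text \<open>Connectors are chosen from the last block backwards, each avoiding \<open>F\<close> and
  those already present. The connector of the first block corrects the residue of the total
  length.\<close>

lemma connect_blocks:
 assumes \<delta>: "0 < \<delta>" "144 * \<delta> <= \<gamma> * (s0/20)^3 / 1000" "144 * \<delta> <= e / 2" and K: "3 < \<delta> * real K"
  and E: "E = [p, q]" "G p q" "{p, q} \<subseteq> F" and F: "finite F"
 shows "\<forall>b\<in>set bs. okb b & set (take 2 b) \<subseteq> F & set (last2 b) \<subseteq> F ==> r < 3 ==>
  real (card F + length bs * (2 * K + 2) + 2 * K + 10) < \<delta> * card V ==>
  EX us. length us = length bs & woven h bs us E & distinct (concat us) & set (concat us) \<subseteq> V - F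
  & length (concat us) <= length bs * (2 * K + 2) & (bs ~= [] --> length (concat us) mod 3 = r)"
proof (induction bs)
 case Nil
 show ?case by (intro exI[of _ "[]"]) simp
next
 case (Cons b bs)
 then obtain us where us: "length us = length bs" "woven h bs us E" "distinct (concat us)" "set (concat us) \<subseteq> V - F"
  "length (concat us) <= length bs * (2 * K + 2)" by auto
 define F' where "F' = F \<union> set (concat us)"
 have F': "finite F'" unfolding F'_def using F by simp
 have "card F' <= card F + length bs * (2 * K + 2)"
  unfolding F'_def using card_Un_le[of F "set (concat us)"] card_length[of "concat us"] us(5) by linarith
 then have "card F' + 2 * K + 10 <= card F + length (b # bs) * (2 * K + 2) + 2 * K + 10" by simp
 then have "real (card F' + 2 * K + 10) <= real (card F + length (b # bs) * (2 * K + 2) + 2 * K + 10)" by (rule of_nat_mono)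
 then have sz: "real (card F' + 2 * K + 10) < \<delta> * card V" using Cons.prems(3) by linarith
 define f where "f = (case bs of [] => E | b' # _ => take 2 b')"
 have "EX c d. f = [c, d] & G c d & {c, d} \<subseteq> F"
 proof (cases bs)
  case Nil
  then show ?thesis using E unfolding f_def by simp
 next
  case (Cons b' bs')
  then have b': "okb b'" "set (take 2 b') \<subseteq> F" using Cons.prems(1) by auto
  then show ?thesis using two_ends[of b'] unfolding f_def Cons okb_def by auto
 qed
 then obtain c d where f: "f = [c, d]" "G c d" "{c, d} \<subseteq> F" by blast
 have b: "okb b" "set (last2 b) \<subseteq> F" using Cons.prems(1) by auto
 define x y where "x = b ! (length b - 2)" and "y = b ! (length b - 1)"
 have l2: "last2 b = [x, y]" "G x y" using b two_ends[of b] unfolding x_def y_def okb_def by auto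
 \<comment> \<open>Adding twice the length of the later connectors subtracts it modulo 3.\<close>
 define r' where "r' = (r + 2 * length (concat us)) mod 3"
 have "EX u. distinct u & set u \<subseteq> V & set u \<inter> F' = {} & tpath T (x # y # u @ [c, d]) & length u <= 2 * K + 2 & length u mod 3 = r'"
 proof (rule connect[OF \<delta> K _ _ F' _ sz])
  show "start x y" "start d c" using l2 f unfolding G_def by auto
  show "{x, y, c, d} \<subseteq> F'" using b(2) f(3) unfolding l2 F'_def by auto
  show "r' < 3" unfolding r'_def by simp
 qed
 then obtain u where u: "distinct u" "set u \<subseteq> V" "set u \<inter> F' = {}" "tpath T (x # y # u @ [c, d])" "length u <= 2 * K + 2" "length u mod 3 = r'"
  by blast
 have "tpath h (x # y # u @ [c, d])" by (rule tpath_mono[OF _ u(4)]) (rule T_h)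
 then have "tpath h (drop (length b - 2) b @ u @ f)" using l2(1) unfolding last2_def f(1) by simp
 then have "woven h (b # bs) (u # us) E" using us(2) b(1) unfolding okb_def f_def by simp
 moreover have "distinct (concat (u # us))" "set (concat (u # us)) \<subseteq> V - F"
  using u us unfolding F'_def by auto
 moreover have "length (concat (u # us)) <= length (b # bs) * (2 * K + 2)" using u(5) us(5) by simp
 moreover have "length (concat (u # us)) mod 3 = r"
 proof -
  have "length (concat (u # us)) mod 3 = (length u mod 3 + length (concat us)) mod 3" by (simp add: mod_simps)
  also have "... = (r + 3 * length (concat us)) mod 3" unfolding u(6) r'_def mod_add_left_eq by (simp add: algebra_simps)
  also have "... = r" using Cons.prems(2) by simp
  finally show ?thesis .
 qed
 ultimately show ?case using us(1) by (intro exI[of _ "u # us"]) simp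
qed

definition T' :: "'a => 'a => 'a => bool" where
 "T' x y z \<longleftrightarrow> T x y z & G x y & G y z & G x z"

lemma T'_rot: "T' x y z ==> T' y z x"
 unfolding T'_def using T_perm(4)[of x y z] G_sym by blast

lemma T'_h: "T' x y z ==> h x y z & h y z x & h z x y"
 using T'_rot[of x y z] T'_rot[of y z x] T_h unfolding T'_def by blast

lemma T'_neq: "T' x y z ==> x ~= y & x ~= z & y ~= z"
 unfolding T'_def using T_neq by blast

text \<open>\<open>E\<close> reserves a short path before connectors are known, and these may run
  through the rest of the tile. Afterwards \<open>E\<close> is stretched between the same end pairs
  with equally many vertices from each class. Hence its length is divisible by 3, and each vertex
  taken by a connector costs at most three vertices of the tile.\<close>

lemma tile_block:
 assumes til: "is_tile t T' \<tau>" and t: "2 <= t"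
 shows "EX E. length E = 6 & distinct E & set E \<subseteq> supp \<tau> & okb E &
  (ALL Z. finite Z --> set E \<inter> Z = {} --> (EX b. same_ends E b & tpath h b & distinct b & set b \<subseteq> supp \<tau> - Z
  & length b mod 3 = 0 & 3 * t <= length b + 3 * card (Z \<inter> supp \<tau>)))"
proof -
 obtain A B C where \<tau>: "\<tau> = (A, B, C)" by (cases \<tau>)
 have fin: "finite A" "finite B" "finite C" "card A = t" "card B = t" "card C = t" "A \<inter> B = {}" "A \<inter> C = {}" "B \<inter> C = {}"
  and all: "!!a b c. a \<in> A ==> b \<in> B ==> c \<in> C ==> T' a b c"
  using til unfolding is_tile_def \<tau> by auto
 have two: "\<exists>x\<in>S. \<exists>y\<in>S. x ~= y" if "finite S" "card S = t" for S :: "'a set"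
 proof -
  have "~ card S <= Suc 0" using that t by simp
  then show ?thesis using that(1) card_le_Suc0_iff_eq by blast
 qed
 obtain a1 a2 where a: "a1 \<in> A" "a2 \<in> A" "a1 ~= a2" using two fin by blast
 obtain b1 b2 where b: "b1 \<in> B" "b2 \<in> B" "b1 ~= b2" using two fin by blast
 obtain c1 c2 where c: "c1 \<in> C" "c2 \<in> C" "c1 ~= c2" using two fin by blast
 define E where "E = [a1, b1, c1, a2, b2, c2]"
 have perm: "h x y z & h y z x & h z x y" if "x \<in> A" "y \<in> B" "z \<in> C" for x y z
  using T'_h[OF all[OF that]] .
 have G1: "G a1 b1" "G b2 c2" using all[OF a(1) b(1) c(1)] all[OF a(2) b(2) c(2)] unfolding T'_def by auto
 have long: "EX l. set l = S' & distinct l & length l = s" if "finite S" "s <= card S" "S' \<subseteq> S" "card S' = s" for S S' :: "'a set" and s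
  using that finite_distinct_list[of S'] finite_subset distinct_card by metis
 have tp: "tpath h (inter (a1 # la @ [a2]) (b1 # lb @ [b2]) (c1 # lc @ [c2]))"
  if "length la = length lb" "length lb = length lc" "set la \<subseteq> A" "set lb \<subseteq> B" "set lc \<subseteq> C" for la lb lc
  by (rule inter_tpath[of _ _ _ A B C]) (use that a b c perm in auto)
 have ext: "inter (a1 # la @ [a2]) (b1 # lb @ [b2]) (c1 # lc @ [c2]) = [a1, b1, c1] @ inter la lb lc @ [a2, b2, c2]"
  if "length la = length lb" "length lb = length lc" for la lb lc
  using inter_append[OF that, of "[a2]" "[b2]" "[c2]"] by simp
 have "tpath h E" using tp[of "[]" "[]" "[]"] unfolding E_def by simp
 then have "okb E" using G1 unfolding okb_def E_def by (simp add: numeral_eq_Suc)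
 moreover have "distinct E" unfolding E_def using a b c fin by auto
 moreover have "set E \<subseteq> supp \<tau>" unfolding E_def supp_def \<tau> using a b c by auto
 moreover have main: "EX b. same_ends E b & tpath h b & distinct b & set b \<subseteq> supp \<tau> - Z & length b mod 3 = 0 & 3 * t <= length b + 3 * card (Z \<inter> supp \<tau>)"
  if Z: "finite Z" "set E \<inter> Z = {}" for Z
 proof -
  \<comment> \<open>Subtraction of natural numbers is harmless: if the connectors use too much of
    the tile, \<open>s\<close> is 0 and only the six reserved vertices remain.\<close>
  define s where "s = t - 2 - card (Z \<inter> supp \<tau>)"
  have pick: "EX l. distinct l & length l = s & set l \<subseteq> S - Z - {x, y}"
  if S: "finite S" "card S = t" "S \<subseteq> supp \<tau>" for S x y
  proof -
  have "card (Z \<inter> S) <= card (Z \<inter> supp \<tau>)" using Z(1) S(3) by (intro card_mono) auto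
  moreover have "card S = card (S - Z) + card (Z \<inter> S)"
  using card_Diff_subset_Int[of S Z] card_mono[OF S(1), of "S \<inter> Z"] S(1) by (simp add: Int_commute)
  moreover have "card (S - Z) <= card (S - Z - {x, y}) + card {x, y}"
  using diff_card_le_card_Diff[of "{x, y}" "S - Z"] by simp
  moreover have "card {x, y} <= 2" by (cases "x = y") auto
  ultimately have "s <= card (S - Z - {x, y})" unfolding s_def using S(2) by linarith
  then obtain S' where S': "S' \<subseteq> S - Z - {x, y}" "card S' = s" "finite S'" by (rule obtain_subset_with_card_n)
  obtain l where "set l = S'" "distinct l" using finite_distinct_list[OF S'(3)] by blast
  then show ?thesis using S' distinct_card[of l] by auto
  qed
  obtain la where la: "distinct la" "length la = s" "set la \<subseteq> A - Z - {a1, a2}" using pick[of A] fin unfolding supp_def \<tau> by auto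
  obtain lb where lb: "distinct lb" "length lb = s" "set lb \<subseteq> B - Z - {b1, b2}" using pick[of B] fin unfolding supp_def \<tau> by auto
  obtain lc where lc: "distinct lc" "length lc = s" "set lc \<subseteq> C - Z - {c1, c2}" using pick[of C] fin unfolding supp_def \<tau> by auto
  define w where "w = inter (a1 # la @ [a2]) (b1 # lb @ [b2]) (c1 # lc @ [c2])"
  have wf: "length w = 3 * (s + 2)" "mset w = mset (a1 # la @ [a2]) + mset (b1 # lb @ [b2]) + mset (c1 # lc @ [c2])"
  using inter_facts[of "a1 # la @ [a2]" "b1 # lb @ [b2]" "c1 # lc @ [c2]"] la lb lc unfolding w_def by auto
  have "mset w = mset ((a1 # la @ [a2]) @ (b1 # lb @ [b2]) @ (c1 # lc @ [c2]))" using wf(2) by simp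
  then have sw: "set w = set ((a1 # la @ [a2]) @ (b1 # lb @ [b2]) @ (c1 # lc @ [c2]))"
  and dw: "distinct w \<longleftrightarrow> distinct ((a1 # la @ [a2]) @ (b1 # lb @ [b2]) @ (c1 # lc @ [c2]))"
  using mset_eq_setD mset_eq_imp_distinct_iff by blast+
  have sub: "set (a1 # la @ [a2]) \<subseteq> A" "set (b1 # lb @ [b2]) \<subseteq> B" "set (c1 # lc @ [c2]) \<subseteq> C"
  using la lb lc a b c by auto
  have "distinct w" unfolding dw distinct_append set_append
  proof (intro conjI)
  show "distinct (a1 # la @ [a2])" "distinct (b1 # lb @ [b2])" "distinct (c1 # lc @ [c2])" using la lb lc a b c by auto
  qed (use sub fin in blast)+
  moreover have "set w \<subseteq> supp \<tau> - Z"
  proof -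
  have "set w \<subseteq> A \<union> B \<union> C" unfolding sw using sub by auto
  moreover have "set w \<inter> Z = {}" unfolding sw using la lb lc Z(2) unfolding E_def by auto
  ultimately show ?thesis unfolding supp_def \<tau> by auto
  qed
  moreover have "tpath h w" unfolding w_def by (rule tp) (use la lb lc in auto)
  moreover have "same_ends E w"
  proof -
  have w3: "w = [a1, b1] @ ([c1] @ inter la lb lc @ [a2]) @ [b2, c2]" unfolding w_def using ext[of la lb lc] la lb lc by simp
  show ?thesis unfolding same_ends_def E_def w3 by (simp add: numeral_eq_Suc)
  qed
  moreover have "length w mod 3 = 0" "3 * t <= length w + 3 * card (Z \<inter> supp \<tau>)" unfolding wf s_def by auto
  ultimately show ?thesis by (intro exI[of _ w] conjI)
 qed
 moreover have "length E = 6" unfolding E_def by simp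
 moreover have "ALL Z. finite Z --> set E \<inter> Z = {} --> (EX b. same_ends E b & tpath h b & distinct b & set b \<subseteq> supp \<tau> - Z
  & length b mod 3 = 0 & 3 * t <= length b + 3 * card (Z \<inter> supp \<tau>))"
  by (intro allI impI) (rule main; assumption)
 ultimately show ?thesis by (intro exI[of _ E] conjI)
qed

type_synonym 'b gadget = "('b \<times> 'b \<times> 'b \<times> 'b \<times> 'b) \<times> ('b \<times> 'b \<times> 'b \<times> 'b \<times> 'b) \<times> ('b \<times> 'b \<times> 'b \<times> 'b \<times> 'b) \<times> 'b list"

fun gblocks :: "'a gadget => 'a list list" where
 "gblocks (s1, s2, s3, E) = [blk s1, blk s2, blk s3, E]"

text \<open>The six vertices of \<open>E\<close> form a tight path both with and without the three
  middle vertices of the slots between them. Switching to the longer path empties all three slots,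
  which can then receive other vertices; this is why vertices are absorbed in threes.\<close>

fun gadget :: "'a gadget => bool" where
 "gadget ((x, \<tau>1), (y, \<tau>2), (z, \<tau>3), E) \<longleftrightarrow> Wt x \<tau>1 & Wt y \<tau>2 & Wt z \<tau>3 & rich \<tau>1 & rich \<tau>2 & rich \<tau>3
  & set (rest4 \<tau>1) \<subseteq> V & set (rest4 \<tau>2) \<subseteq> V & set (rest4 \<tau>3) \<subseteq> V
  & length E = 6 & okb E & tpath h (take 3 E @ [x, y, z] @ drop 3 E)"

text \<open>A vertex \<open>v\<close> of level j + 1 replaces the occupant \<open>w\<close> of some
  slot, where \<open>w\<close> has level \<open>j\<close>; then \<open>w\<close> is routed on until
  some \<open>u\<close> fits into \<tau>. \<open>U\<close> records the altered slots, and since more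
  than \<open>M\<close> slots are useful an unaltered one is always left.\<close>

lemma route:
 assumes gs0: "\<forall>(u, \<sigma>)\<in>set gs0. u \<in> V"
  and rt: "!!v j. v \<in> V ==> j < J ==> \<theta> <= pr3 V (%u b c. ygrow \<theta> (%u. Wt u \<tau>) j u & L u b c & L v b c) ==>
  M < length (filter (%(u, \<sigma>). ygrow \<theta> (%u. Wt u \<tau>) j u & Wt v \<sigma>) gs0)"
 shows "ygrow \<theta> (%u. Wt u \<tau>) j v ==> j <= J ==> v \<in> V ==> finite U ==> card U + j <= M ==>
  length gs = length gs0 & (\<forall>i<length gs. i \<notin> U --> gs ! i = gs0 ! i) ==> \<forall>(u, \<sigma>)\<in>set gs. Wt u \<sigma> ==>
  EX gs' U' u. finite U' & card U' <= card U + j & (length gs' = length gs0 & (\<forall>i<length gs'. i \<notin> U' --> gs' ! i = gs0 ! i))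
  & map snd gs' = map snd gs & (\<forall>(u, \<sigma>)\<in>set gs'. Wt u \<sigma>) & u \<in> V & Wt u \<tau>
  & add_mset u (mset (map fst gs')) = add_mset v (mset (map fst gs))"
proof (induction j arbitrary: v gs U)
 case 0
 then show ?case by (intro exI[of _ gs] exI[of _ U] exI[of _ v]) auto
next
 case (Suc j)
 show ?case
 proof (cases "ygrow \<theta> (%u. Wt u \<tau>) j v")
  case True
  have "EX gs' U' u. finite U' & card U' <= card U + j & (length gs' = length gs0 & (\<forall>i<length gs'. i \<notin> U' --> gs' ! i = gs0 ! i))
  & map snd gs' = map snd gs & (\<forall>(u, \<sigma>)\<in>set gs'. Wt u \<sigma>) & u \<in> V & Wt u \<tau>
  & add_mset u (mset (map fst gs')) = add_mset v (mset (map fst gs))"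
  by (rule Suc.IH[OF True]) (use Suc.prems in auto)
  then obtain gs' U' u where g: "finite U'" "card U' <= card U + j" "length gs' = length gs0 & (\<forall>i<length gs'. i \<notin> U' --> gs' ! i = gs0 ! i)"
  "map snd gs' = map snd gs" "\<forall>(u, \<sigma>)\<in>set gs'. Wt u \<sigma>" "u \<in> V" "Wt u \<tau>"
  "add_mset u (mset (map fst gs')) = add_mset v (mset (map fst gs))" by (elim exE conjE) (rule that; (assumption | intro conjI; assumption))
  have "card U' <= card U + Suc j" using g(2) by simp
  then show ?thesis by (intro exI[of _ gs'] exI[of _ U'] exI[of _ u] conjI g(1,4-8) g(3)[THEN conjunct1] g(3)[THEN conjunct2])
 next
  case False
  then have "\<theta> <= pr3 V (%u b c. ygrow \<theta> (%u. Wt u \<tau>) j u & L u b c & L v b c)" using Suc.prems(1) by simp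
  then have "M < length (filter (%(u, \<sigma>). ygrow \<theta> (%u. Wt u \<tau>) j u & Wt v \<sigma>) gs0)" using rt Suc.prems(2,3) by simp
  then have "card U < card {i. i < length gs0 & (case gs0 ! i of (u, \<sigma>) => ygrow \<theta> (%u. Wt u \<tau>) j u & Wt v \<sigma>)}"
  using Suc.prems(5) unfolding length_filter_conv_card by linarith
  then have "~ {i. i < length gs0 & (case gs0 ! i of (u, \<sigma>) => ygrow \<theta> (%u. Wt u \<tau>) j u & Wt v \<sigma>)} \<subseteq> U"
  using card_mono[OF Suc.prems(4)] by (meson leD)
  then obtain i where i: "i < length gs0" "i \<notin> U" "case gs0 ! i of (u, \<sigma>) => ygrow \<theta> (%u. Wt u \<tau>) j u & Wt v \<sigma>"
  unfolding subset_eq Ball_def not_all not_imp mem_Collect_eq by (elim exE conjE) (rule that)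
  obtain w \<sigma> where w: "gs0 ! i = (w, \<sigma>)" by (cases "gs0 ! i")
  have wf: "ygrow \<theta> (%u. Wt u \<tau>) j w" "Wt v \<sigma>" using i(3) unfolding w by auto
  have wV: "w \<in> V" using gs0 nth_mem[OF i(1)] unfolding w by auto
  have gsi: "gs ! i = (w, \<sigma>)" "i < length gs" using Suc.prems(6) i(1,2) w by auto
  define gs1 where "gs1 = gs[i := (v, \<sigma>)]"
  have len1: "length gs1 = length gs" unfolding gs1_def by simp
  have snd1: "map snd gs1 = map snd gs"
  unfolding gs1_def using gsi by (metis list_update_id map_update snd_conv)
  have m1: "add_mset w (mset (map fst gs1)) = add_mset v (mset (map fst gs))"
  proof -
  have "w \<in># mset (map fst gs)" using gsi nth_mem[of i gs] by force
  moreover have "mset (map fst gs1) = add_mset v (mset (map fst gs) - {#w#})"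
  unfolding gs1_def map_update using mset_update[of i "map fst gs" v] gsi by simp
  ultimately show ?thesis by simp
  qed
  have W1: "\<forall>(u, \<sigma>)\<in>set gs1. Wt u \<sigma>"
  proof
  fix g assume "g \<in> set gs1"
  then have "g \<in> insert (v, \<sigma>) (set gs)" using set_update_subset_insert[of gs i "(v, \<sigma>)"] unfolding gs1_def by blast
  then show "case g of (u, \<sigma>) => Wt u \<sigma>" using wf(2) Suc.prems(7) by auto
  qed
  have comp1: "length gs1 = length gs0 & (\<forall>k<length gs1. k \<notin> insert i U --> gs1 ! k = gs0 ! k)"
  using Suc.prems(6) unfolding gs1_def by auto
  have cU: "card (insert i U) <= card U + 1" using Suc.prems(4) by (simp add: card_insert_if)
  have "EX gs' U' u. finite U' & card U' <= card (insert i U) + j & (length gs' = length gs0 & (\<forall>i<length gs'. i \<notin> U' --> gs' ! i = gs0 ! i))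
  & map snd gs' = map snd gs1 & (\<forall>(u, \<sigma>)\<in>set gs'. Wt u \<sigma>) & u \<in> V & Wt u \<tau>
  & add_mset u (mset (map fst gs')) = add_mset w (mset (map fst gs1))"
  by (rule Suc.IH[OF wf(1) _ wV _ _ comp1 W1]) (use Suc.prems cU in auto)
  then obtain gs' U' u where g: "finite U'" "card U' <= card (insert i U) + j" "length gs' = length gs0 & (\<forall>i<length gs'. i \<notin> U' --> gs' ! i = gs0 ! i)"
  "map snd gs' = map snd gs" "\<forall>(u, \<sigma>)\<in>set gs'. Wt u \<sigma>" "u \<in> V" "Wt u \<tau>"
  "add_mset u (mset (map fst gs')) = add_mset v (mset (map fst gs))"
  unfolding snd1 m1 by (elim exE conjE) (rule that; (assumption | intro conjI; assumption))
  have "card U' <= card U + Suc j" using g(2) cU by simp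
  then show ?thesis by (intro exI[of _ gs'] exI[of _ U'] exI[of _ u] conjI g(1,4-8) g(3)[THEN conjunct1] g(3)[THEN conjunct2])
 qed
qed

end

section \<open>Absorption\<close>

definition compat :: "'b list => 'b list => nat set => bool" where
 "compat gs0 gs U \<longleftrightarrow> length gs = length gs0 & (\<forall>i<length gs. i \<notin> U --> gs ! i = gs0 ! i)"

lemma tiling_blocks:
 "tiling t T U ts ==> (\<forall>\<tau>\<in>set ts. distinct (f \<tau>) & set (f \<tau>) \<subseteq> supp \<tau>) ==> distinct (concat (map f ts)) & set (concat (map f ts)) \<subseteq> U"
proof (induction ts arbitrary: U)
 case (Cons \<tau> ts)
 have "distinct (concat (map f ts)) & set (concat (map f ts)) \<subseteq> U - supp \<tau>"
  by (rule Cons.IH) (use Cons.prems in simp_all)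
 moreover have "distinct (f \<tau>)" "set (f \<tau>) \<subseteq> supp \<tau>" "supp \<tau> \<subseteq> U" using Cons.prems by simp_all
 ultimately show ?case by auto
qed simp

lemma tiling_cover:
 assumes Z: "finite Z"
 shows "tiling t T U ts ==> (\<forall>\<tau>\<in>set ts. m <= length (f \<tau>) + 3 * card (Z \<inter> supp \<tau>)) ==>
  m * length ts <= length (concat (map f ts)) + 3 * card (Z \<inter> U)"
proof (induction ts arbitrary: U)
 case (Cons \<tau> ts)
 then have IH: "m * length ts <= length (concat (map f ts)) + 3 * card (Z \<inter> (U - supp \<tau>))" by simp
 have "card (Z \<inter> (U - supp \<tau>)) + card (Z \<inter> supp \<tau>) = card ((Z \<inter> (U - supp \<tau>)) \<union> (Z \<inter> supp \<tau>))"
  using Z by (intro card_Un_disjoint[symmetric]) auto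
 also have "... <= card (Z \<inter> U)" using Z Cons.prems(1) by (intro card_mono) auto
 finally show ?case using IH Cons.prems(2) by simp
qed simp

lemma tile_mem: "tiling t T U ts ==> \<tau> \<in> set ts ==> is_tile t T \<tau>"
 by (induction ts arbitrary: U) auto

lemma woven_append: "woven t xs us (take 2 b) ==> woven t (b # ys) vs e ==> woven t (xs @ b # ys) (us @ vs) e"
proof (induction t xs us "take 2 b" rule: woven.induct)
 case (1 t c cs u us)
 then have "woven t (cs @ b # ys) (us @ vs) e" by simp
 then show ?case using 1 by (cases cs) auto
qed auto

context comp2
begin

lemma rich_slot':
 assumes "x \<in> V" "finite F" "40 * real (card F) <= l0 * card V" "3 / card V <= (l0/4)^3 / 4096"
 shows "\<exists>\<tau>. Wt x \<tau> & distinct (blk (x, \<tau>)) & set (rest4 \<tau>) \<inter> F = {} & set (rest4 \<tau>) \<subseteq> V & rich \<tau>"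
proof -
 obtain a b c d where "a \<in> V" "b \<in> V" "c \<in> V" "d \<in> V" "W x a b c d" "distinct [a, b, x, c, d]" "{a, b, c, d} \<inter> F = {}" "rich (a, b, c, d)"
  using rich_slot[OF assms] by (elim bexE conjE) (rule that)
 then show ?thesis by (intro exI[of _ "(a, b, c, d)"]) auto
qed

lemma set_blk: "set (blk (x, \<tau>)) = insert x (set (rest4 \<tau>))"
 by (cases \<tau>) auto

lemma card_rest4: "card (set (rest4 \<tau>)) <= 4"
 using card_length[of "rest4 \<tau>"] by (cases \<tau>) simp

lemma nonT': "pr3 V (%x y z. T x y z & ~ T' x y z) <= 264 * \<nu> / \<gamma>"
proof -
 have "pr3 V (%x y z. T x y z & ~ T' x y z) <= pr3 V (%x y z. (D x y & ~ G x y) | ((D y z & ~ G y z) | (D x z & ~ G x z)))"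
  by (rule pr3_mono) (use T_D in \<open>auto simp: T'_def\<close>)
 also have "pr3 V (%x y z. (D x y & ~ G x y) | ((D y z & ~ G y z) | (D x z & ~ G x z)))
  <= pr3 V (%x y z. D x y & ~ G x y) + pr3 V (%x y z. (D y z & ~ G y z) | (D x z & ~ G x z))" by (rule pr3_disj)
 also have "pr3 V (%x y z. (D y z & ~ G y z) | (D x z & ~ G x z))
  <= pr3 V (%x y z. D y z & ~ G y z) + pr3 V (%x y z. D x z & ~ G x z)" by (rule pr3_disj)
 finally have "pr3 V (%x y z. T x y z & ~ T' x y z) <= 3 * pr2 V (%x y. D x y & ~ G x y)"
  using pr3_12[of "%x y. D x y & ~ G x y"] pr3_13[of "%x y. D x y & ~ G x y"] pr3_23[of "%x y. D x y & ~ G x y"] by linarith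
 moreover have "3 * (88 * \<nu> / \<gamma>) = 264 * \<nu> / \<gamma>" by simp
 ultimately show ?thesis using nonG by linarith
qed

lemma pr3_T': "1/25 <= pr3 V T'"
proof -
 have "pr3 V T <= pr3 V T' + pr3 V (%x y z. T x y z & ~ T' x y z)" by (rule pr3_union) auto
 moreover have "264 * \<nu> / \<gamma> <= 1/100"
 proof -
  have "l0^5 <= 1" using l0 by (intro power_le_one) auto
  then show ?thesis using \<nu>_small(1) by simp
 qed
 ultimately show ?thesis using nonT' pr3_T by linarith
qed

text \<open>A complete tripartite piece of \<open>T'\<close> with classes of size 3 provides nine
  vertices. Six of them form \<open>E\<close>; the middle three become occupants of rich slots,
  chosen one after another outside everything used so far.\<close>

lemma gadget_exists:
 assumes ctri: "\<forall>A B C (T :: 'a => 'a => 'a => bool). finite A --> finite B --> finite C -->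
  m0 <= card A --> m0 <= card B --> m0 <= card C -->
  1/50 * card A * card B * card C <= card {(a, b, c). a \<in> A & b \<in> B & c \<in> C & T a b c} -->
  (\<exists>A'\<subseteq>A. \<exists>B'\<subseteq>B. \<exists>C'\<subseteq>C. card A' = 3 & card B' = 3 & card C' = 3 & (\<forall>a\<in>A'. \<forall>b\<in>B'. \<forall>c\<in>C'. T a b c))"
  and F: "finite F" "400 * real (card F + 40) <= l0 * card V" and m0: "m0 + card F <= card V" and n: "3 / card V <= (l0/4)^3 / 4096"
 shows "EX q. gadget q & distinct (concat (gblocks q)) & set (concat (gblocks q)) \<subseteq> V - F"
proof -
 define A where "A = V - F"
 define N where "N = real (card V)"
 have N0: "0 < N" unfolding N_def by (rule card_pos)
 have fA: "finite A" "m0 <= card A" using fin F m0 diff_card_le_card_Diff[of F V] unfolding A_def by auto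
 have cnt: "1/50 * card A * card A * card A <= card {(a, b, c). a \<in> A & b \<in> A & c \<in> A & T' a b c}"
 proof -
  define p where "p = pr V (%x. x \<in> F)"
  have "l0 * N <= 1/25 * N" using l0 N0 by (intro mult_right_mono) auto
  then have "400 * real (card F) <= 1/25 * N" using F(2) unfolding N_def by simp
  then have "real (card F) / N <= 1/10000" using N0 by (simp add: field_simps)
  then have p: "p <= 1/10000" using pr_mem[OF F(1)] unfolding p_def N_def by linarith
  have pp: "pr3 V (%x y z. x \<in> F) = p" "pr3 V (%x y z. y \<in> F) = p" "pr3 V (%x y z. z \<in> F) = p"
  unfolding p_def pr3_def pr2_def by (simp_all add: pr_def)
  have "pr3 V T' <= pr3 V (%x y z. x \<notin> F & y \<notin> F & z \<notin> F & T' x y z) + pr3 V (%x y z. x \<in> F | (y \<in> F | z \<in> F))"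
  by (rule pr3_union) auto
  also have "pr3 V (%x y z. x \<in> F | (y \<in> F | z \<in> F)) <= pr3 V (%x y z. x \<in> F) + pr3 V (%x y z. y \<in> F | z \<in> F)" by (rule pr3_disj)
  also have "pr3 V (%x y z. y \<in> F | z \<in> F) <= pr3 V (%x y z. y \<in> F) + pr3 V (%x y z. z \<in> F)" by (rule pr3_disj)
  finally have "1/50 <= pr3 V (%x y z. x \<notin> F & y \<notin> F & z \<notin> F & T' x y z)" using pr3_T' p unfolding pp by linarith
  then have "1/50 * N^3 <= pr3 V (%x y z. x \<notin> F & y \<notin> F & z \<notin> F & T' x y z) * N^3"
  using N0 by (intro mult_right_mono) auto
  also have "... = card {(x, y, z). x \<in> V & y \<in> V & z \<in> V & x \<notin> F & y \<notin> F & z \<notin> F & T' x y z}"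
  unfolding N_def by (rule pr3_card[OF fin])
  also have "{(x, y, z). x \<in> V & y \<in> V & z \<in> V & x \<notin> F & y \<notin> F & z \<notin> F & T' x y z} = {(a, b, c). a \<in> A & b \<in> A & c \<in> A & T' a b c}"
  unfolding A_def by auto
  finally have 1: "1/50 * N^3 <= card {(a, b, c). a \<in> A & b \<in> A & c \<in> A & T' a b c}" .
  have "real (card A) <= N" unfolding N_def A_def using fin by (intro of_nat_mono card_mono) auto
  then have "1/50 * real (card A)^3 <= 1/50 * N^3" by (intro mult_left_mono power_mono) auto
  then show ?thesis using 1 by (simp add: power3_eq_cube)
 qed
 obtain A' B' C' where ABC: "A' \<subseteq> A" "B' \<subseteq> A" "C' \<subseteq> A" "card A' = 3" "card B' = 3" "card C' = 3" "\<forall>a\<in>A'. \<forall>b\<in>B'. \<forall>c\<in>C'. T' a b c"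
  using ctri[rule_format, OF fA(1) fA(1) fA(1) fA(2) fA(2) fA(2) cnt] by (elim exE conjE) (rule that)
 obtain a1 a2 a3 where a: "A' = {a1, a2, a3}" "a1 ~= a2" "a1 ~= a3" "a2 ~= a3" using ABC(4) unfolding card_3_iff by metis
 obtain b1 b2 b3 where b: "B' = {b1, b2, b3}" "b1 ~= b2" "b1 ~= b3" "b2 ~= b3" using ABC(5) unfolding card_3_iff by metis
 obtain c1 c2 c3 where c: "C' = {c1, c2, c3}" "c1 ~= c2" "c1 ~= c3" "c2 ~= c3" using ABC(6) unfolding card_3_iff by metis
 have tr: "T' x y z" if "x \<in> A'" "y \<in> B'" "z \<in> C'" for x y z using ABC(7) that by simp
 have perm: "h x y z & h y z x & h z x y" if "x \<in> A'" "y \<in> B'" "z \<in> C'" for x y z using T'_h[OF tr[OF that]] .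
 have dis: "A' \<inter> B' = {}" "A' \<inter> C' = {}" "B' \<inter> C' = {}"
 proof -
  have "x ~= y & x ~= z & y ~= z" if "x \<in> A'" "y \<in> B'" "z \<in> C'" for x y z using T'_neq[OF tr[OF that]] .
  then show "A' \<inter> B' = {}" "A' \<inter> C' = {}" "B' \<inter> C' = {}" using a(1) b(1) c(1) by blast+
 qed
 define E where "E = [a1, b1, c1, a3, b3, c3]"
 have "tpath h (inter [a1, a3] [b1, b3] [c1, c3])" by (rule inter_tpath[of _ _ _ A' B' C']) (use a b c perm in auto)
 then have tE: "tpath h E" unfolding E_def by simp
 have "tpath h (inter [a1, a2, a3] [b1, b2, b3] [c1, c2, c3])" by (rule inter_tpath[of _ _ _ A' B' C']) (use a b c perm in auto)
 then have t9: "tpath h (take 3 E @ [a2, b2, c2] @ drop 3 E)" unfolding E_def by (simp add: numeral_eq_Suc)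
 have "G a1 b1" "G b3 c3" using tr[of a1 b1 c1] tr[of a3 b3 c3] a b c unfolding T'_def by auto
 then have okE: "okb E" using tE unfolding okb_def E_def by (simp add: numeral_eq_Suc)
 define F1 where "F1 = F \<union> (A' \<union> (B' \<union> C'))"
 have cF1: "finite F1" "card F1 <= card F + 9"
 proof -
  show "finite F1" unfolding F1_def a b c using F by simp
  have "card F1 <= card F + card (A' \<union> (B' \<union> C'))" unfolding F1_def by (rule card_Un_le)
  also have "card (A' \<union> (B' \<union> C')) <= card A' + card (B' \<union> C')" by (rule card_Un_le)
  also have "card (B' \<union> C') <= card B' + card C'" by (rule card_Un_le)
  finally show "card F1 <= card F + 9" using ABC(4-6) by simp
 qed
 have sz: "40 * real (card X) <= l0 * card V" if "card X <= card F + 40" for X :: "'a set"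
 proof -
  have "40 * real (card X) <= 400 * real (card F + 40)" using that by simp
  then show ?thesis using F(2) by linarith
 qed
 have inV: "a2 \<in> V" "b2 \<in> V" "c2 \<in> V" using ABC(1-3) a b c unfolding A_def by auto
 obtain \<tau>1 where t1: "Wt a2 \<tau>1" "distinct (blk (a2, \<tau>1))" "set (rest4 \<tau>1) \<inter> F1 = {}" "set (rest4 \<tau>1) \<subseteq> V" "rich \<tau>1"
  using rich_slot'[OF inV(1) cF1(1) sz n] cF1(2) by auto
 define F2 where "F2 = F1 \<union> set (rest4 \<tau>1)"
 have cF2: "finite F2" "card F2 <= card F + 13"
  unfolding F2_def using cF1 card_Un_le[of F1 "set (rest4 \<tau>1)"] card_rest4[of \<tau>1] by (simp, linarith)
 obtain \<tau>2 where t2: "Wt b2 \<tau>2" "distinct (blk (b2, \<tau>2))" "set (rest4 \<tau>2) \<inter> F2 = {}" "set (rest4 \<tau>2) \<subseteq> V" "rich \<tau>2"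
  using rich_slot'[OF inV(2) cF2(1) sz n] cF2(2) by auto
 define F3 where "F3 = F2 \<union> set (rest4 \<tau>2)"
 have cF3: "finite F3" "card F3 <= card F + 17"
  unfolding F3_def using cF2 card_Un_le[of F2 "set (rest4 \<tau>2)"] card_rest4[of \<tau>2] by (simp, linarith)
 obtain \<tau>3 where t3: "Wt c2 \<tau>3" "distinct (blk (c2, \<tau>3))" "set (rest4 \<tau>3) \<inter> F3 = {}" "set (rest4 \<tau>3) \<subseteq> V" "rich \<tau>3"
  using rich_slot'[OF inV(3) cF3(1) sz n] cF3(2) by auto
 define q where "q = ((a2, \<tau>1), (b2, \<tau>2), (c2, \<tau>3), E)"
 have "gadget q" unfolding q_def using t1 t2 t3 okE t9 by (simp add: E_def)
 moreover have cq: "concat (gblocks q) = blk (a2, \<tau>1) @ blk (b2, \<tau>2) @ blk (c2, \<tau>3) @ E" unfolding q_def by simp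
 have mid: "a2 \<in> F1" "b2 \<in> F1" "c2 \<in> F1" "a2 ~= b2" "a2 ~= c2" "b2 ~= c2" using dis unfolding F1_def a b c by auto
 have Es: "set E \<subseteq> F1" "a2 \<notin> set E" "b2 \<notin> set E" "c2 \<notin> set E" "distinct E"
  using dis a b c unfolding F1_def E_def by auto
 have "distinct (concat (gblocks q))" unfolding cq distinct_append set_append set_blk
 proof (intro conjI)
  show "insert a2 (set (rest4 \<tau>1)) \<inter> (insert b2 (set (rest4 \<tau>2)) \<union> (insert c2 (set (rest4 \<tau>3)) \<union> set E)) = {}"
  using t1(3) t2(3) t3(3) mid Es unfolding F3_def F2_def by blast
  show "insert b2 (set (rest4 \<tau>2)) \<inter> (insert c2 (set (rest4 \<tau>3)) \<union> set E) = {}"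
  using t2(3) t3(3) mid Es unfolding F3_def F2_def by blast
  show "insert c2 (set (rest4 \<tau>3)) \<inter> set E = {}" using t3(3) mid Es unfolding F3_def F2_def by blast
 qed (use t1 t2 t3 Es in auto)
 moreover have "set (concat (gblocks q)) \<subseteq> V - F"
 proof -
  have "set E \<subseteq> A" "a2 \<in> A" "b2 \<in> A" "c2 \<in> A" using ABC(1-3) unfolding E_def a b c by auto
  then show ?thesis unfolding cq set_append set_blk using t1(3,4) t2(3,4) t3(3,4) unfolding F3_def F2_def F1_def A_def by blast
 qed
 ultimately show ?thesis by blast
qed

lemma length_gblocks: "gadget q ==> length (concat (gblocks q)) = 21 & length (gblocks q) = 4"
proof -
 assume g: "gadget q"
 obtain s1 s2 s3 E where q: "q = (s1, s2, s3, E)" by (cases q)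
 have l: "length (blk s) = 5" for s :: "'a \<times> 'a \<times> 'a \<times> 'a \<times> 'a" by (cases s) simp
 have "length E = 6" using g unfolding q by (cases s1; cases s2; cases s3) simp
 then show ?thesis unfolding q by (simp add: l)
qed

lemma gadgets_exist:
 assumes ctri: "\<forall>A B C (T :: 'a => 'a => 'a => bool). finite A --> finite B --> finite C -->
  m0 <= card A --> m0 <= card B --> m0 <= card C -->
  1/50 * card A * card B * card C <= card {(a, b, c). a \<in> A & b \<in> B & c \<in> C & T a b c} -->
  (\<exists>A'\<subseteq>A. \<exists>B'\<subseteq>B. \<exists>C'\<subseteq>C. card A' = 3 & card B' = 3 & card C' = 3 & (\<forall>a\<in>A'. \<forall>b\<in>B'. \<forall>c\<in>C'. T a b c))"
  and F: "finite F" and n: "3 / card V <= (l0/4)^3 / 4096"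
 shows "400 * real (card F + 21 * k + 40) <= l0 * card V ==> m0 + card F + 21 * k <= card V ==>
  EX qs. length qs = k & (\<forall>q\<in>set qs. gadget q) & distinct (concat (concat (map gblocks qs))) & set (concat (concat (map gblocks qs))) \<subseteq> V - F
  & length (concat (concat (map gblocks qs))) = 21 * k & length (concat (map gblocks qs)) = 4 * k"
proof (induction k)
 case 0
 show ?case by (intro exI[of _ "[]"]) simp
next
 case (Suc k)
 then obtain qs where qs: "length qs = k" "\<forall>q\<in>set qs. gadget q" "distinct (concat (concat (map gblocks qs)))"
  "set (concat (concat (map gblocks qs))) \<subseteq> V - F" "length (concat (concat (map gblocks qs))) = 21 * k" "length (concat (map gblocks qs)) = 4 * k"
  by auto
 define F' where "F' = F \<union> set (concat (concat (map gblocks qs)))"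
 have "card F' <= card F + 21 * k"
  unfolding F'_def using card_Un_le[of F "set (concat (concat (map gblocks qs)))"] card_length[of "concat (concat (map gblocks qs))"] qs(5) by linarith
 then have F': "finite F'" "400 * real (card F' + 40) <= l0 * card V" "m0 + card F' <= card V"
  using Suc.prems F unfolding F'_def by auto
 obtain q where q: "gadget q" "distinct (concat (gblocks q))" "set (concat (gblocks q)) \<subseteq> V - F'"
  using gadget_exists[OF ctri F' n] by blast
 have "distinct (concat (concat (map gblocks (q # qs))))"
  using q(2,3) qs(3) unfolding F'_def by (simp add: distinct_append) blast
 moreover have "set (concat (concat (map gblocks (q # qs)))) \<subseteq> V - F" using q(3) qs(4) unfolding F'_def by auto
 ultimately show ?case using q(1) qs length_gblocks[OF q(1)] by (intro exI[of _ "q # qs"]) simp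
qed

lemma route1:
 assumes gs0: "\<forall>(u, \<sigma>)\<in>set gs0. u \<in> V"
  and rt: "\<forall>\<tau> v j. set (rest4 \<tau>) \<subseteq> V --> v \<in> V --> j < J --> \<theta> <= pr3 V (%u b c. ygrow \<theta> (%u. Wt u \<tau>) j u & L u b c & L v b c) -->
  M < length (filter (%(u, \<sigma>). ygrow \<theta> (%u. Wt u \<tau>) j u & Wt v \<sigma>) gs0)"
  and ex: "\<forall>\<tau> v. rich \<tau> --> v \<in> V --> ygrow \<theta> (%u. Wt u \<tau>) J v"
  and \<tau>: "rich \<tau>" "set (rest4 \<tau>) \<subseteq> V" and v: "v \<in> V" and U: "finite U" "card U + J <= M" and c: "compat gs0 gs U" and Wg: "\<forall>(u, \<sigma>)\<in>set gs. Wt u \<sigma>"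
 shows "EX gs' U' u. finite U' & card U' <= card U + J & compat gs0 gs' U'
  & map snd gs' = map snd gs & (\<forall>(u, \<sigma>)\<in>set gs'. Wt u \<sigma>) & u \<in> V & Wt u \<tau>
  & mset (map fst gs') + {#u#} = mset (map fst gs) + {#v#}"
 using route[OF gs0 rt[rule_format, OF \<tau>(2)] ex[rule_format, OF \<tau>(1) v] order_refl v U c[unfolded compat_def] Wg]
 unfolding compat_def by simp

text \<open>For every three vertices of \<open>R\<close> one gadget moves its occupants into
  \<open>E\<close>, and the three vertices are routed to the emptied slots. The remaining gadgets
  are left as they are. Multisets certify that exactly \<open>R\<close> has been added.\<close>

lemma absorb:
 assumes gs0: "\<forall>(u, \<sigma>)\<in>set gs0. u \<in> V"
  and rt: "\<forall>\<tau> v j. set (rest4 \<tau>) \<subseteq> V --> v \<in> V --> j < J --> \<theta> <= pr3 V (%u b c. ygrow \<theta> (%u. Wt u \<tau>) j u & L u b c & L v b c) -->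
  M < length (filter (%(u, \<sigma>). ygrow \<theta> (%u. Wt u \<tau>) j u & Wt v \<sigma>) gs0)"
  and ex: "\<forall>\<tau> v. rich \<tau> --> v \<in> V --> ygrow \<theta> (%u. Wt u \<tau>) J v"
 shows "\<forall>q\<in>set qs. gadget q ==> length R = 3 * k ==> k <= length qs ==> set R \<subseteq> V ==> finite U ==> card U + 3 * k * J <= M ==>
  compat gs0 gs U ==> \<forall>(u, \<sigma>)\<in>set gs. Wt u \<sigma> ==>
  EX gs' bb. map snd gs' = map snd gs & (\<forall>(u, \<sigma>)\<in>set gs'. Wt u \<sigma>)
  & list_all2 (%b b'. same_ends b b' & tpath h b') (concat (map gblocks qs)) bb
  & mset (map fst gs') + mset (concat bb) = mset (map fst gs) + mset (concat (concat (map gblocks qs))) + mset R"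
proof (induction qs arbitrary: R k U gs)
 case Nil
 then show ?case by (intro exI[of _ gs] exI[of _ "[]"]) simp
next
 case (Cons q qs)
 obtain s1 s2 s3 E where q0: "q = (s1, s2, s3, E)" by (cases q)
 obtain x t1 where s1: "s1 = (x, t1)" by (cases s1)
 obtain y t2 where s2: "s2 = (y, t2)" by (cases s2)
 obtain z t3 where s3: "s3 = (z, t3)" by (cases s3)
 have q: "q = ((x, t1), (y, t2), (z, t3), E)" unfolding q0 s1 s2 s3 ..
 have g: "Wt x t1" "Wt y t2" "Wt z t3" "rich t1" "rich t2" "rich t3" "set (rest4 t1) \<subseteq> V" "set (rest4 t2) \<subseteq> V" "set (rest4 t3) \<subseteq> V"
  "length E = 6" "okb E" "tpath h (take 3 E @ [x, y, z] @ drop 3 E)"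
  using Cons.prems(1) unfolding q by auto
 have gq: "\<forall>q\<in>set qs. gadget q" using Cons.prems(1) by simp
 have gb: "gblocks q = [blk (x, t1), blk (y, t2), blk (z, t3), E]" unfolding q by simp
 show ?case
 proof (cases k)
  case 0
  then have R: "R = []" using Cons.prems(2) by simp
  have "EX gs' bb. map snd gs' = map snd gs & (\<forall>(u, \<sigma>)\<in>set gs'. Wt u \<sigma>)
  & list_all2 (%b b'. same_ends b b' & tpath h b') (concat (map gblocks qs)) bb
  & mset (map fst gs') + mset (concat bb) = mset (map fst gs) + mset (concat (concat (map gblocks qs))) + mset []"
  by (rule Cons.IH[OF gq, of "[]" 0 U gs]) (use Cons.prems in auto)
  then obtain gs' bb where IH: "map snd gs' = map snd gs" "\<forall>(u, \<sigma>)\<in>set gs'. Wt u \<sigma>"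
  "list_all2 (%b b'. same_ends b b' & tpath h b') (concat (map gblocks qs)) bb"
  "mset (map fst gs') + mset (concat bb) = mset (map fst gs) + mset (concat (concat (map gblocks qs))) + mset []"
  by (elim exE conjE) (rule that)
  have "list_all2 (%b b'. same_ends b b' & tpath h b') (gblocks q) (gblocks q)"
  unfolding gb using okb_self[OF blk_okb[OF g(1)]] okb_self[OF blk_okb[OF g(2)]] okb_self[OF blk_okb[OF g(3)]] okb_self[OF g(11)]
  by (simp del: blk.simps)
  then have "list_all2 (%b b'. same_ends b b' & tpath h b') (concat (map gblocks (q # qs))) (gblocks q @ bb)"
  using IH(3) by (simp add: list_all2_appendI)
  moreover have "mset (map fst gs') + mset (concat (gblocks q @ bb)) = mset (map fst gs) + mset (concat (concat (map gblocks (q # qs)))) + mset R"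
  using IH(4) unfolding R by (simp add: ac_simps del: gblocks.simps)
  ultimately show ?thesis using IH(1,2) by blast
 next
  case (Suc k')
  obtain v1 v2 v3 R' where R: "R = v1 # v2 # v3 # R'" "length R' = 3 * k'"
  proof -
  have "length R = Suc (Suc (Suc (3 * k')))" using Cons.prems(2) unfolding Suc by simp
  then show ?thesis using that by (auto simp: length_Suc_conv)
  qed
  have v: "v1 \<in> V" "v2 \<in> V" "v3 \<in> V" "set R' \<subseteq> V" using Cons.prems(4) unfolding R by auto
  have J3: "card U + J + J + J + 3 * k' * J <= M" using Cons.prems(6) unfolding Suc by (simp add: algebra_simps)
  have M1: "card U + J <= M" using J3 by linarith
  obtain g1 U1 u1 where r1: "finite U1" "card U1 <= card U + J" "compat gs0 g1 U1" "map snd g1 = map snd gs" "\<forall>(u, \<sigma>)\<in>set g1. Wt u \<sigma>"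
  "u1 \<in> V" "Wt u1 t1" "mset (map fst g1) + {#u1#} = mset (map fst gs) + {#v1#}"
  using route1[OF gs0 rt ex g(4,7) v(1) Cons.prems(5) M1 Cons.prems(7,8)] by (elim exE conjE) (rule that)
  have M2: "card U1 + J <= M" using J3 r1(2) by linarith
  obtain g2 U2 u2 where r2: "finite U2" "card U2 <= card U1 + J" "compat gs0 g2 U2" "map snd g2 = map snd g1" "\<forall>(u, \<sigma>)\<in>set g2. Wt u \<sigma>"
  "u2 \<in> V" "Wt u2 t2" "mset (map fst g2) + {#u2#} = mset (map fst g1) + {#v2#}"
  using route1[OF gs0 rt ex g(5,8) v(2) r1(1) M2 r1(3,5)] by (elim exE conjE) (rule that)
  have M3: "card U2 + J <= M" using J3 r1(2) r2(2) by linarith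
  obtain g3 U3 u3 where r3: "finite U3" "card U3 <= card U2 + J" "compat gs0 g3 U3" "map snd g3 = map snd g2" "\<forall>(u, \<sigma>)\<in>set g3. Wt u \<sigma>"
  "u3 \<in> V" "Wt u3 t3" "mset (map fst g3) + {#u3#} = mset (map fst g2) + {#v3#}"
  using route1[OF gs0 rt ex g(6,9) v(3) r2(1) M3 r2(3,5)] by (elim exE conjE) (rule that)
  have "EX gs' bb. map snd gs' = map snd g3 & (\<forall>(u, \<sigma>)\<in>set gs'. Wt u \<sigma>)
  & list_all2 (%b b'. same_ends b b' & tpath h b') (concat (map gblocks qs)) bb
  & mset (map fst gs') + mset (concat bb) = mset (map fst g3) + mset (concat (concat (map gblocks qs))) + mset R'"
  by (rule Cons.IH[OF gq R(2) _ v(4) r3(1) _ r3(3,5)]) (use Cons.prems(3) J3 r1(2) r2(2) r3(2) in \<open>auto simp: Suc\<close>)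
  then obtain gs' bb where IH: "map snd gs' = map snd g3" "\<forall>(u, \<sigma>)\<in>set gs'. Wt u \<sigma>"
  "list_all2 (%b b'. same_ends b b' & tpath h b') (concat (map gblocks qs)) bb"
  "mset (map fst gs') + mset (concat bb) = mset (map fst g3) + mset (concat (concat (map gblocks qs))) + mset R'"
  by (elim exE conjE) (rule that)
  define E' where "E' = take 3 E @ [x, y, z] @ drop 3 E"
  define nb where "nb = [blk (u1, t1), blk (u2, t2), blk (u3, t3), E']"
  have "same_ends E E'"
  proof -
  obtain e1 e2 e3 e4 e5 e6 where "E = [e1, e2, e3, e4, e5, e6]" using g(10) by (auto simp: length_Suc_conv numeral_eq_Suc)
  then show ?thesis unfolding same_ends_def E'_def by (simp add: numeral_eq_Suc)
  qed
  then have "list_all2 (%b b'. same_ends b b' & tpath h b') (gblocks q) nb"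
  unfolding gb nb_def using okb_self[OF blk_okb[OF r1(7)]] okb_self[OF blk_okb[OF r2(7)]] okb_self[OF blk_okb[OF r3(7)]] g(12)
  by (simp add: blk_same E'_def del: blk.simps)
  then have "list_all2 (%b b'. same_ends b b' & tpath h b') (concat (map gblocks (q # qs))) (nb @ bb)"
  using IH(3) by (simp add: list_all2_appendI)
  moreover have "mset (map fst gs') + mset (concat (nb @ bb)) = mset (map fst gs) + mset (concat (concat (map gblocks (q # qs)))) + mset R"
  \<comment> \<open>Comparing multiplicities pointwise lets the vertices handed on by the three
    routes cancel linearly.\<close>
  proof (rule multiset_eqI)
  fix a
  have mE: "mset E' = mset E + {#x#} + {#y#} + {#z#}"
  proof -
  have "mset E = mset (take 3 E) + mset (drop 3 E)" by (metis append_take_drop_id mset_append)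
  then show ?thesis unfolding E'_def by simp
  qed
  have bm: "mset (blk (u, t)) = mset (rest4 t) + {#u#}" for u :: 'a and t unfolding mset_blk by simp
  have nbm: "mset (concat (nb @ bb)) = mset (rest4 t1) + {#u1#} + (mset (rest4 t2) + {#u2#}) + (mset (rest4 t3) + {#u3#}) + mset E' + mset (concat bb)"
  unfolding nb_def by (simp add: bm ac_simps del: blk.simps)
  have gm: "mset (concat (concat (map gblocks (q # qs)))) = mset (rest4 t1) + {#x#} + (mset (rest4 t2) + {#y#}) + (mset (rest4 t3) + {#z#}) + mset E + mset (concat (concat (map gblocks qs)))"
  by (simp add: gb bm ac_simps del: blk.simps gblocks.simps)
  have Rm: "mset R = mset R' + {#v1#} + {#v2#} + {#v3#}" unfolding R by simp
  show "count (mset (map fst gs') + mset (concat (nb @ bb))) a = count (mset (map fst gs) + mset (concat (concat (map gblocks (q # qs)))) + mset R) a"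
  unfolding nbm gm Rm mE count_union
  using arg_cong[OF r1(8), of "%M. count M a"] arg_cong[OF r2(8), of "%M. count M a"] arg_cong[OF r3(8), of "%M. count M a"]
  arg_cong[OF IH(4), of "%M. count M a"] unfolding count_union by linarith
  qed
  ultimately show ?thesis using IH(1,2) r1(4) r2(4) r3(4) by metis
 qed
qed

text \<open>The order of choices makes the pieces fit. Connectors avoid the reserved paths in the
  tiles, the tile paths are stretched over what the connectors leave, and only then is the leftover
  \<open>R\<close> known. Absorbing it changes blocks between fixed ends, so all connectors remain
  valid.\<close>

lemma assemble:
 assumes \<delta>: "0 < \<delta>" "144 * \<delta> <= \<gamma> * (s0/20)^3 / 1000" "144 * \<delta> <= e / 2" and K: "3 < \<delta> * real K"
  and rt: "\<forall>\<tau> v j. set (rest4 \<tau>) \<subseteq> V --> v \<in> V --> j < J --> \<theta> <= pr3 V (%u b c. ygrow \<theta> (%u. Wt u \<tau>) j u & L u b c & L v b c) -->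
  M < length (filter (%(u, \<sigma>). ygrow \<theta> (%u. Wt u \<tau>) j u & Wt v \<sigma>) gs0)"
  and ex: "\<forall>\<tau> v. rich \<tau> --> v \<in> V --> ygrow \<theta> (%u. Wt u \<tau>) J v"
  and gs0: "\<forall>(u, \<sigma>)\<in>set gs0. Wt u \<sigma>" and qs: "\<forall>q\<in>set qs. gadget q"
  and bs1: "bs1 = map blk gs0 @ concat (map gblocks qs)" "bs1 = xs @ [bl]" "distinct (concat bs1)" "set (concat bs1) \<subseteq> V"
  and us1: "length us1 = length xs" "woven h xs us1 (take 2 bl)" "distinct (concat us1)" "set (concat us1) \<subseteq> V - set (concat bs1)"
  and F0: "F0 = set (concat bs1) \<union> set (concat us1)" and til: "tiling t T' (V - F0) ts" and t: "2 <= t"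
  and sz: "real (card F0 + 6 * length ts + (length ts + 1) * (2 * K + 2) + 2 * K + 10) < \<delta> * card V"
  and left: "real (card V) <= real (card F0 + 3 * t * length ts) + Lf" "Lf + 2 * real ((length ts + 1) * (2 * K + 2)) <= 3 * real (length qs)"
  and M: "3 * length qs * J <= M"
 shows "EX c. distinct c & set c = V & tpath h (c @ take 2 c) & 3 <= length c"
proof -
 have gsV: "\<forall>(u, \<sigma>)\<in>set gs0. u \<in> V"
 proof
  fix g assume g: "g \<in> set gs0"
  have "fst g \<in> set (blk g)" using set_blk[of "fst g" "snd g"] by simp
  then have "fst g \<in> set (concat bs1)" using g unfolding bs1(1) by auto
  then show "case g of (u, \<sigma>) => u \<in> V" using bs1(4) by (auto simp: split_def)
 qed
 have ok1: "okb b" if "b \<in> set bs1" for b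
 proof -
  have "b \<in> blk ` set gs0 | b \<in> (\<Union>q\<in>set qs. set (gblocks q))" using that unfolding bs1(1) by simp
  then show ?thesis
  proof
  assume "b \<in> blk ` set gs0"
  then obtain g where g: "b = blk g" "g \<in> set gs0" by (rule imageE)
  then have "Wt (fst g) (snd g)" using gs0 by (auto simp: split_def)
  then show ?thesis using blk_okb[of "fst g" "snd g"] g(1) by simp
  next
  assume "b \<in> (\<Union>q\<in>set qs. set (gblocks q))"
  then obtain q where q2: "q \<in> set qs" "b \<in> set (gblocks q)" by (rule UN_E)
  obtain x t1 y t2 z t3 E where q: "q = ((x, t1), (y, t2), (z, t3), E)" by (metis surj_pair)
  have "gadget q" using q2 qs by blast
  then have "Wt x t1" "Wt y t2" "Wt z t3" "okb E" unfolding q by auto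
  then show ?thesis using q2(2) blk_okb[of x t1] blk_okb[of y t2] blk_okb[of z t3] unfolding q by (auto simp del: blk.simps)
  qed
 qed
 have "\<forall>\<tau>\<in>set ts. EX E. length E = 6 & distinct E & set E \<subseteq> supp \<tau> & okb E &
  (ALL Z. finite Z --> set E \<inter> Z = {} --> (EX b. same_ends E b & tpath h b & distinct b & set b \<subseteq> supp \<tau> - Z
  & length b mod 3 = 0 & 3 * t <= length b + 3 * card (Z \<inter> supp \<tau>)))"
 proof
  fix \<tau> assume "\<tau> \<in> set ts"
  then have "is_tile t T' \<tau>" by (rule tile_mem[OF til])
  then show "EX E. length E = 6 & distinct E & set E \<subseteq> supp \<tau> & okb E &
  (ALL Z. finite Z --> set E \<inter> Z = {} --> (EX b. same_ends E b & tpath h b & distinct b & set b \<subseteq> supp \<tau> - Z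
  & length b mod 3 = 0 & 3 * t <= length b + 3 * card (Z \<inter> supp \<tau>)))" by (rule tile_block[OF _ t])
 qed
 from bchoice[OF this] obtain Ef where Ef0: "\<forall>\<tau>\<in>set ts. length (Ef \<tau>) = 6 & distinct (Ef \<tau>) & set (Ef \<tau>) \<subseteq> supp \<tau> & okb (Ef \<tau>) &
  (ALL Z. finite Z --> set (Ef \<tau>) \<inter> Z = {} --> (EX b. same_ends (Ef \<tau>) b & tpath h b & distinct b & set b \<subseteq> supp \<tau> - Z
  & length b mod 3 = 0 & 3 * t <= length b + 3 * card (Z \<inter> supp \<tau>)))" by (rule exE)
 note Ef = Ef0[rule_format]
 define Es where "Es = map Ef ts"
 have EsV: "set (concat Es) \<subseteq> V - F0" using tiling_blocks[OF til, of Ef] Ef unfolding Es_def by blast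
 have lenEs: "length (concat Es) = 6 * length ts"
 proof -
  have "\<forall>\<tau>\<in>set ts. length (Ef \<tau>) = 6" using Ef by blast
  then show ?thesis unfolding Es_def by (induction ts) auto
 qed
 have hd1: "bs1 ~= []" using bs1(2) by simp
 have hdm: "hd bs1 \<in> set bs1" using hd1 by simp
 \<comment> \<open>The pair after the last connector is the beginning of the first block, which
   closes the cycle.\<close>
 define E where "E = take 2 (hd bs1)"
 have E: "E = [hd bs1 ! 0, hd bs1 ! 1]" "G (hd bs1 ! 0) (hd bs1 ! 1)"
  using two_ends[of "hd bs1"] ok1[OF hdm] unfolding E_def okb_def by auto
 have hs: "set (hd bs1) \<subseteq> F0" using hdm unfolding F0 by auto
 have blm: "bl \<in> set bs1" unfolding bs1(2) by simp
 define F where "F = F0 \<union> set (concat Es)"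
 have fF0: "finite F0" unfolding F0 by simp
 have fF: "finite F" "card F <= card F0 + 6 * length ts"
  unfolding F_def using fF0 card_Un_le[of F0 "set (concat Es)"] card_length[of "concat Es"] lenEs by (simp, linarith)
 \<comment> \<open>This is |V| - |F0| modulo 3. Since the tile paths have lengths divisible by 3, it
   makes the number of leftover vertices divisible by 3.\<close>
 define r where "r = (card V + 2 * card F0) mod 3"
 have "EX us. length us = length (bl # Es) & woven h (bl # Es) us E & distinct (concat us) & set (concat us) \<subseteq> V - F
  & length (concat us) <= length (bl # Es) * (2 * K + 2) & (bl # Es ~= [] --> length (concat us) mod 3 = r)"
 proof (rule connect_blocks[OF \<delta> K E _ fF(1)])
  show "{hd bs1 ! 0, hd bs1 ! 1} \<subseteq> F"
  proof -
  have "set E \<subseteq> set (hd bs1)" unfolding E_def by (rule set_take_subset)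
  then show ?thesis using hs E(1) unfolding F_def by auto
  qed
  show "\<forall>b\<in>set (bl # Es). okb b & set (take 2 b) \<subseteq> F & set (last2 b) \<subseteq> F"
  proof
  fix b assume b: "b \<in> set (bl # Es)"
  have "okb b" using b ok1[OF blm] Ef unfolding Es_def by auto
  moreover have "set b \<subseteq> F" using b blm unfolding F_def F0 by auto
  moreover have "set (take 2 b) \<subseteq> set b" "set (last2 b) \<subseteq> set b" unfolding last2_def by (rule set_take_subset set_drop_subset)+
  ultimately show "okb b & set (take 2 b) \<subseteq> F & set (last2 b) \<subseteq> F" by blast
  qed
  show "r < 3" unfolding r_def by simp
  have "card F + length (bl # Es) * (2 * K + 2) + 2 * K + 10 <= card F0 + 6 * length ts + (length ts + 1) * (2 * K + 2) + 2 * K + 10"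
  using fF(2) unfolding Es_def by simp
  then have "real (card F + length (bl # Es) * (2 * K + 2) + 2 * K + 10) <= real (card F0 + 6 * length ts + (length ts + 1) * (2 * K + 2) + 2 * K + 10)"
  by (rule of_nat_mono)
  then show "real (card F + length (bl # Es) * (2 * K + 2) + 2 * K + 10) < \<delta> * card V" using sz by linarith
 qed
 then obtain us2 where us2: "length us2 = length (bl # Es)" "woven h (bl # Es) us2 E" "distinct (concat us2)" "set (concat us2) \<subseteq> V - F"
  "length (concat us2) <= length (bl # Es) * (2 * K + 2)" "length (concat us2) mod 3 = r" by blast
 define Z where "Z = set (concat us2)"
 have fZ: "finite Z" unfolding Z_def by simp
 have cZ: "card Z = length (concat us2)" unfolding Z_def by (rule distinct_card[OF us2(3)])
 have "\<forall>\<tau>\<in>set ts. EX b. same_ends (Ef \<tau>) b & tpath h b & distinct b & set b \<subseteq> supp \<tau> - Z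
  & length b mod 3 = 0 & 3 * t <= length b + 3 * card (Z \<inter> supp \<tau>)"
 proof
  fix \<tau> assume tau: "\<tau> \<in> set ts"
  have "set (Ef \<tau>) \<inter> Z = {}" using us2(4) tau unfolding Z_def F_def Es_def by auto
  then show "EX b. same_ends (Ef \<tau>) b & tpath h b & distinct b & set b \<subseteq> supp \<tau> - Z
  & length b mod 3 = 0 & 3 * t <= length b + 3 * card (Z \<inter> supp \<tau>)" using Ef[OF tau] fZ by blast
 qed
 from bchoice[OF this] obtain Lo where Lo: "\<forall>\<tau>\<in>set ts. same_ends (Ef \<tau>) (Lo \<tau>) & tpath h (Lo \<tau>) & distinct (Lo \<tau>) & set (Lo \<tau>) \<subseteq> supp \<tau> - Z
  & length (Lo \<tau>) mod 3 = 0 & 3 * t <= length (Lo \<tau>) + 3 * card (Z \<inter> supp \<tau>)" by (rule exE)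
 define Ls where "Ls = map Lo ts"
 have "\<forall>\<tau>\<in>set ts. distinct (Lo \<tau>) & set (Lo \<tau>) \<subseteq> supp \<tau>" using Lo by blast
 from tiling_blocks[OF til this] have Ls1: "distinct (concat Ls)" "set (concat Ls) \<subseteq> V - F0" unfolding Ls_def by auto
 have Ls2: "set (concat Ls) \<inter> Z = {}" unfolding Ls_def using Lo by auto
 have Ls3: "length (concat Ls) mod 3 = 0"
 proof -
  have "\<forall>\<tau>\<in>set ts. length (Lo \<tau>) mod 3 = 0" using Lo by blast
  then show ?thesis unfolding Ls_def by (induction ts) (auto simp: mod_eq_0_iff_dvd)
 qed
 have "\<forall>\<tau>\<in>set ts. 3 * t <= length (Lo \<tau>) + 3 * card (Z \<inter> supp \<tau>)" using Lo by blast
 from tiling_cover[OF fZ til this] have "3 * t * length ts <= length (concat Ls) + 3 * card (Z \<inter> (V - F0))" unfolding Ls_def .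
 moreover have "card (Z \<inter> (V - F0)) <= card Z" using fZ by (intro card_mono) auto
 ultimately have Ls4: "3 * t * length ts <= length (concat Ls) + 3 * card Z" by linarith
 define U where "U = F0 \<union> Z \<union> set (concat Ls)"
 have UV: "U \<subseteq> V" unfolding U_def F0 Z_def using bs1(4) us1(4) us2(4) Ls1(2) by blast
 obtain R where R: "set R = V - U" "distinct R" using finite_distinct_list[of "V - U"] fin by auto
 have F0Z: "F0 \<inter> Z = {}" using us2(4) unfolding Z_def F_def by blast
 have cU: "card U = card F0 + card Z + length (concat Ls)"
 proof -
  have "card U = card (F0 \<union> Z) + card (set (concat Ls))"
  unfolding U_def by (rule card_Un_disjoint) (use fF0 fZ Ls1 Ls2 in auto)
  also have "card (F0 \<union> Z) = card F0 + card Z" by (rule card_Un_disjoint[OF fF0 fZ F0Z])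
  finally show ?thesis using distinct_card[OF Ls1(1)] by simp
 qed
 have cV: "card V = card F0 + card Z + length (concat Ls) + length R"
 proof -
  have "card V = card U + card (V - U)" using card_Diff_subset[of U V] card_mono[OF fin UV] UV fin finite_subset[OF UV fin] by simp
  then show ?thesis using cU distinct_card[OF R(2)] R(1) by simp
 qed
 have "card Z mod 3 = (card V + 2 * card F0) mod 3" using us2(6) unfolding cZ r_def .
 then have "length R mod 3 = 0" using cV Ls3 by presburger
 then obtain k where k: "length R = 3 * k" by auto
 \<comment> \<open>A connector vertex costs at most three tile vertices including itself, so it adds
   at most two to the leftover; this is the factor 2 in \<open>left\<close>.\<close>
 have kq: "k <= length qs"
 proof -
  have "real (card V) = real (card F0 + card Z + length (concat Ls) + length R)" using cV by simp
  moreover have "real (3 * t * length ts) <= real (length (concat Ls) + 3 * card Z)" using Ls4 by (rule of_nat_mono)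
  moreover have "real (card Z) <= real ((length ts + 1) * (2 * K + 2))" using us2(5) unfolding cZ Es_def by (intro of_nat_mono) simp
  ultimately have "real (length R) <= 3 * real (length qs)" using left by simp
  then show ?thesis using k by simp
 qed
 have "3 * k * J <= 3 * length qs * J" using kq by simp
 then have "3 * k * J <= M" using M by (rule order_trans)
 then have kM: "card ({} :: nat set) + 3 * k * J <= M" unfolding card.empty add_0_left .
 have "EX gs' bb. map snd gs' = map snd gs0 & (\<forall>(u, \<sigma>)\<in>set gs'. Wt u \<sigma>)
  & list_all2 (%b b'. same_ends b b' & tpath h b') (concat (map gblocks qs)) bb
  & mset (map fst gs') + mset (concat bb) = mset (map fst gs0) + mset (concat (concat (map gblocks qs))) + mset R"
  by (rule absorb[OF gsV rt ex qs k kq _ finite.emptyI kM _ gs0]) (use R(1) in \<open>auto simp: compat_def\<close>)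
 then obtain gs' bb where ab: "map snd gs' = map snd gs0" "\<forall>(u, \<sigma>)\<in>set gs'. Wt u \<sigma>"
  "list_all2 (%b b'. same_ends b b' & tpath h b') (concat (map gblocks qs)) bb"
  "mset (map fst gs') + mset (concat bb) = mset (map fst gs0) + mset (concat (concat (map gblocks qs))) + mset R"
  by (elim exE conjE) (rule that)
 define bs' where "bs' = map blk gs' @ bb @ Ls"
 have m1: "list_all2 (%b b'. same_ends b b' & tpath h b') (map blk gs0) (map blk gs')"
  unfolding list_all2_conv_all_nth
 proof (rule conjI)
  show "length (map blk gs0) = length (map blk gs')" using arg_cong[OF ab(1), of length] by simp
  show "\<forall>i<length (map blk gs0). same_ends (map blk gs0 ! i) (map blk gs' ! i) & tpath h (map blk gs' ! i)"
  proof (intro allI impI)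
  fix i assume i: "i < length (map blk gs0)"
  then have i2: "i < length gs0" "i < length gs'" using arg_cong[OF ab(1), of length] by auto
  have s: "snd (gs' ! i) = snd (gs0 ! i)" using arg_cong[OF ab(1), of "%l. l ! i"] i2 by simp
  have "Wt (fst (gs' ! i)) (snd (gs' ! i))" using ab(2) nth_mem[OF i2(2)] by (auto simp: split_def)
  then have "okb (blk (gs' ! i))" using blk_okb[of "fst (gs' ! i)" "snd (gs' ! i)"] by simp
  moreover have "same_ends (blk (gs0 ! i)) (blk (gs' ! i))"
  using blk_same[of "fst (gs0 ! i)" "snd (gs0 ! i)" "fst (gs' ! i)"] s by (metis prod.collapse)
  ultimately show "same_ends (map blk gs0 ! i) (map blk gs' ! i) & tpath h (map blk gs' ! i)"
  using i2 okb_self by simp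
  qed
 qed
 have m2: "list_all2 (%b b'. same_ends b b' & tpath h b') Es Ls"
  unfolding Es_def Ls_def list_all2_conv_all_nth using Lo by simp
 have sw: "list_all2 (%b b'. same_ends b b' & tpath h b') (bs1 @ Es) bs'"
  unfolding bs1(1) bs'_def append_assoc by (intro list_all2_appendI ab(3) m1 m2)
 define us where "us = us1 @ us2"
 have "woven h (xs @ (bl # Es)) (us1 @ us2) E" by (rule woven_append[OF us1(2) us2(2)])
 then have "woven h (bs1 @ Es) us E" unfolding bs1(2) us_def by simp
 then have w': "woven h bs' us E" by (rule woven_swap[OF _ sw])
 define c where "c = weave bs' us"
 have E2: "length E = 2" using E by simp
 note wt = woven_tpath[OF w' E2, folded c_def]
 have bs'ne: "bs' ~= []" using sw hd1 by auto
 then obtain b1 bs'' where b1: "bs' = b1 # bs''" by (cases bs') auto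
 have tE: "take 2 (c @ E) = E"
 proof -
  have "same_ends (hd bs1) b1" using sw hd1 unfolding b1 by (cases bs1) auto
  then have "take 2 b1 = E" unfolding same_ends_def E_def by simp
  then show ?thesis using wt unfolding b1 by simp
 qed
 have lus: "length bs' = length us"
  using list_all2_lengthD[OF sw] us1(1) us2(1) unfolding us_def bs1(2) by simp
 have mc: "mset c = mset (concat bs1 @ R @ concat Ls @ concat us1 @ concat us2)"
 proof -
  have "mset c = mset (concat bs') + mset (concat us)" unfolding c_def by (rule mset_weave[OF lus])
  also have "mset (concat bs') = mset (concat (map rest4 (map snd gs'))) + (mset (map fst gs') + mset (concat bb)) + mset (concat Ls)"
  unfolding bs'_def concat_append mset_append mset_blks by (simp only: ac_simps)
  also have "... = mset (concat (map rest4 (map snd gs0))) + (mset (map fst gs0) + mset (concat (concat (map gblocks qs))) + mset R) + mset (concat Ls)"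
  unfolding ab(1,4) ..
  also have "... = mset (concat bs1) + mset R + mset (concat Ls)"
  unfolding bs1(1) concat_append mset_append mset_blks by (simp only: ac_simps)
  finally show ?thesis unfolding us_def by (simp add: ac_simps)
 qed
 have sc: "set c = V"
 proof -
  have "set c = set (concat bs1 @ R @ concat Ls @ concat us1 @ concat us2)" by (rule mset_eq_setD[OF mc])
  also have "... = U \<union> set R" unfolding U_def F0 Z_def by auto
  also have "... = V" using UV R(1) by blast
  finally show ?thesis .
 qed
 have lc: "length c = card V"
 proof -
  have "card F0 = length (concat bs1) + length (concat us1)"
  unfolding F0 using card_Un_disjoint[of "set (concat bs1)" "set (concat us1)"] us1(4) distinct_card[OF bs1(3)] distinct_card[OF us1(3)] by auto
  moreover have "length c = length (concat bs1 @ R @ concat Ls @ concat us1 @ concat us2)" by (rule mset_eq_length[OF mc])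
  ultimately show ?thesis using cV cZ by simp
 qed
 have "distinct c" using lc sc card_distinct by metis
 have c4: "4 <= length c"
 proof -
  have "4 <= length (hd bs1)" using ok1[OF hdm] unfolding okb_def by simp
  also have "length (hd bs1) <= length (concat bs1)" using hd1 by (cases bs1) auto
  also have "... <= length c" using mset_eq_length[OF mc] by simp
  finally show ?thesis .
 qed
 then have "take 2 c = E" using tE by simp
 then show ?thesis using wt \<open>distinct c\<close> sc c4 by (intro exI[of _ c]) simp
qed

end

section \<open>The upper bound\<close>

lemma avg_sub:
 assumes "finite V" "U \<subseteq> V" "U ~= {}"
 shows "avg U f = (real (card V) / card U) * avg V (%x. of_bool (x \<in> U) * f x)"
proof -
 have "finite U" using assms finite_subset by blast
 then have c: "0 < card U" using assms by (simp add: card_gt_0_iff)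
 then have "0 < card V" using card_mono[OF assms(1,2)] by linarith
 have "(\<Sum>x\<in>V. of_bool (x \<in> U) * f x) = (\<Sum>x\<in>U. of_bool (x \<in> U) * f x)"
  by (rule sum.mono_neutral_right) (use assms in auto)
 also have "... = (\<Sum>x\<in>U. f x)" by (rule sum.cong) auto
 finally show ?thesis unfolding avg_def using c \<open>0 < card V\<close> by simp
qed

lemma pr_sub:
 assumes V: "finite V" "U \<subseteq> V" "U ~= {}"
 defines "\<rho> \<equiv> real (card V) / card U"
 shows "pr U P = \<rho> * pr V (%x. x \<in> U & P x)"
  "pr2 U Q = \<rho>^2 * pr2 V (%x y. x \<in> U & y \<in> U & Q x y)"
  "pr3 U R = \<rho>^3 * pr3 V (%x y z. x \<in> U & y \<in> U & z \<in> U & R x y z)"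
proof -
 have 1: "pr U P = \<rho> * pr V (%x. x \<in> U & P x)" for P
  unfolding pr_def avg_sub[OF V] \<rho>_def[symmetric] of_bool_conj ..
 have 2: "pr2 U Q = \<rho>^2 * pr2 V (%x y. x \<in> U & y \<in> U & Q x y)" for Q
 proof -
  have "pr2 U Q = \<rho> * avg V (%x. of_bool (x \<in> U) * (\<rho> * pr V (%y. y \<in> U & Q x y)))"
  unfolding pr2_def avg_sub[OF V] \<rho>_def[symmetric] 1 ..
  also have "... = \<rho> * avg V (%x. \<rho> * (of_bool (x \<in> U) * pr V (%y. y \<in> U & Q x y)))" by (simp only: mult.left_commute)
  also have "... = \<rho>^2 * avg V (%x. of_bool (x \<in> U) * pr V (%y. y \<in> U & Q x y))" unfolding avg_cmult by (simp add: power2_eq_square)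
  finally show ?thesis unfolding pr2_conj .
 qed
 have 3: "pr3 U R = \<rho>^3 * pr3 V (%x y z. x \<in> U & y \<in> U & z \<in> U & R x y z)"
 proof -
  have "pr3 U R = \<rho> * avg V (%x. of_bool (x \<in> U) * (\<rho>^2 * pr2 V (%y z. y \<in> U & z \<in> U & R x y z)))"
  unfolding pr3_def avg_sub[OF V] \<rho>_def[symmetric] 2 ..
  also have "... = \<rho> * avg V (%x. \<rho>^2 * (of_bool (x \<in> U) * pr2 V (%y z. y \<in> U & z \<in> U & R x y z)))" by (simp only: mult.left_commute)
  also have "... = \<rho>^3 * avg V (%x. of_bool (x \<in> U) * pr2 V (%y z. y \<in> U & z \<in> U & R x y z))" unfolding avg_cmult by (simp add: power3_eq_cube power2_eq_square)
  finally show ?thesis unfolding pr3_conj .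
 qed
 show "pr U P = \<rho> * pr V (%x. x \<in> U & P x)" "pr2 U Q = \<rho>^2 * pr2 V (%x y. x \<in> U & y \<in> U & Q x y)"
  "pr3 U R = \<rho>^3 * pr3 V (%x y z. x \<in> U & y \<in> U & z \<in> U & R x y z)" by (rule 1 2 3)+
qed

lemma pr_sub_bounds:
 assumes V: "finite V" "U \<subseteq> V" "U ~= {}" and half: "card V <= 2 * card U"
 shows "pr U P <= 2 * pr V (%x. x \<in> U & P x)" "pr2 U Q <= 4 * pr2 V (%x y. x \<in> U & y \<in> U & Q x y)"
  "pr3 U R <= 8 * pr3 V (%x y z. x \<in> U & y \<in> U & z \<in> U & R x y z)" "pr V (%x. x \<in> U & P x) <= pr U P" "real (card V) / card U <= 2"
proof -
 define \<rho> where "\<rho> = real (card V) / card U"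
 have "finite U" using V finite_subset by blast
 then have c: "0 < card U" using V by (simp add: card_gt_0_iff)
 have "real (card V) <= 2 * real (card U)" using half by linarith
 then have r2: "\<rho> <= 2" unfolding \<rho>_def using c by (simp add: divide_le_eq)
 have r1: "1 <= \<rho>" unfolding \<rho>_def using c card_mono[OF V(1,2)] by (simp add: le_divide_eq)
 note s = pr_sub[OF V, folded \<rho>_def]
 have p: "\<rho>^2 <= 2^2" "\<rho>^3 <= 2^3" using r1 r2 by (intro power_mono; simp)+
 show "pr U P <= 2 * pr V (%x. x \<in> U & P x)" unfolding s(1) using r2 by (intro mult_right_mono) auto
 show "pr2 U Q <= 4 * pr2 V (%x y. x \<in> U & y \<in> U & Q x y)" unfolding s(2) using p by (intro mult_right_mono) auto
 show "pr3 U R <= 8 * pr3 V (%x y z. x \<in> U & y \<in> U & z \<in> U & R x y z)" unfolding s(3) using p by (intro mult_right_mono) auto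
 have "1 * pr V (%x. x \<in> U & P x) <= \<rho> * pr V (%x. x \<in> U & P x)" using r1 by (intro mult_right_mono) auto
 then show "pr V (%x. x \<in> U & P x) <= pr U P" unfolding s(1) by simp
 show "real (card V) / card U <= 2" using r2 unfolding \<rho>_def .
qed

text \<open>Keeping at least half of the vertices multiplies densities of triples by at most 8,
  while degrees fall by at most the removed proportion \<open>d\<close>.\<close>

lemma (in trip) fm_restrict:
 fixes d g \<nu> \<nu>2 :: real
 assumes hyp: "fm_hyp D T g \<nu>" and U: "U \<subseteq> V" "U ~= {}" and half: "card V <= 2 * card U" and d: "real (card V) - card U <= d * card V" and n0: "0 <= \<nu>" and \<nu>2: "8 * \<nu> <= \<nu>2"
 shows "trip U h" "trip.fm_hyp U h D T (g - d) \<nu>2"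
proof -
 have fU: "finite U" using fin U finite_subset by blast
 show tU: "trip U h" by unfold_locales (use fU U h12 h23 h_neq in blast)+
 note b = pr_sub_bounds[OF fin U half]
 define \<rho> where "\<rho> = real (card V) / card U"
 note s = pr_sub[OF fin U, folded \<rho>_def]
 have \<rho>: "0 <= \<rho>" "\<rho> <= 2" using b(5) unfolding \<rho>_def by auto
 have out: "pr V (%x. x \<notin> U) <= d"
 proof -
  have "{x \<in> V. x \<notin> U} = V - U" by blast
  then have "pr V (%x. x \<notin> U) = real (card (V - U)) / card V" unfolding pr_eq_card[OF fin] by simp
  also have "real (card (V - U)) = real (card V) - card U"
  using card_Diff_subset[OF fU U(1)] card_mono[OF fin U(1)] by (simp add: of_nat_diff)
  also have "(real (card V) - card U) / card V <= d" using d card_pos by (simp add: divide_le_eq)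
  finally show ?thesis .
 qed
 have low: "pr V P - d <= pr U P" for P
 proof -
  have "pr V P - pr V (%x. x \<notin> U) <= pr V (%x. x \<in> U & P x)" by (rule pr_diff_ge) auto
  then show ?thesis using out b(4)[of P] by linarith
 qed
 have H: "grel D" "ALL x y z. T x y z --> h x y z & D x y & T x z y" "pr V (%x. pr V (D x) < 1/3 + g) <= \<nu>"
  "pr2 V (%x y. D x y & pr V (T x y) < 1/3 + g) <= \<nu>" "cut D <= \<nu>"
  "ALL X Y Z. 1/4 * pr V X * pr V Y * pr V Z - \<nu> <= pr3 V (%x y z. X x & Y y & Z z & h x y z)"
  using hyp unfolding fm_hyp_def by auto
 show "trip.fm_hyp U h D T (g - d) \<nu>2"
  unfolding trip.fm_hyp_def[OF tU]
 proof (intro conjI allI)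
  show "grel D" by (rule H(1))
  show "T x y z --> h x y z & D x y & T x z y" for x y z using H(2) by blast
  have "pr U (%x. pr U (D x) < 1/3 + (g - d)) <= 2 * pr V (%x. x \<in> U & pr U (D x) < 1/3 + (g - d))" by (rule b(1))
  also have "pr V (%x. x \<in> U & pr U (D x) < 1/3 + (g - d)) <= pr V (%x. pr V (D x) < 1/3 + g)"
  proof (rule pr_mono)
  fix x assume "x \<in> U & pr U (D x) < 1/3 + (g - d)"
  then show "pr V (D x) < 1/3 + g" using low[of "D x"] by linarith
  qed
  finally show "pr U (%x. pr U (D x) < 1/3 + (g - d)) <= \<nu>2" using H(3) \<nu>2 n0 by linarith
  have "pr2 U (%x y. D x y & pr U (T x y) < 1/3 + (g - d)) <= 4 * pr2 V (%x y. x \<in> U & y \<in> U & D x y & pr U (T x y) < 1/3 + (g - d))" by (rule b(2))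
  also have "pr2 V (%x y. x \<in> U & y \<in> U & D x y & pr U (T x y) < 1/3 + (g - d)) <= pr2 V (%x y. D x y & pr V (T x y) < 1/3 + g)"
  proof (rule pr2_mono)
  fix x y assume "x \<in> U & y \<in> U & D x y & pr U (T x y) < 1/3 + (g - d)"
  then show "D x y & pr V (T x y) < 1/3 + g" using low[of "T x y"] by auto
  qed
  finally show "pr2 U (%x y. D x y & pr U (T x y) < 1/3 + (g - d)) <= \<nu>2" using H(4) \<nu>2 n0 by linarith
  have "trip.cut U h D <= 8 * pr3 V (%x y z. x \<in> U & y \<in> U & z \<in> U & (h x y z & D x y & ~ D x z))"
  unfolding trip.cut_def[OF tU] by (rule b(3))
  also have "pr3 V (%x y z. x \<in> U & y \<in> U & z \<in> U & (h x y z & D x y & ~ D x z)) <= cut D"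
  unfolding cut_def by (rule pr3_mono) auto
  finally show "trip.cut U h D <= \<nu>2" using H(5) \<nu>2 by linarith
  fix X Y Z
  have "1/4 * pr V (%x. x \<in> U & X x) * pr V (%x. x \<in> U & Y x) * pr V (%x. x \<in> U & Z x) - \<nu>
  <= pr3 V (%x y z. (x \<in> U & X x) & (y \<in> U & Y y) & (z \<in> U & Z z) & h x y z)"
  by (rule H(6)[rule_format])
  also have "... = pr3 V (%x y z. x \<in> U & y \<in> U & z \<in> U & (X x & Y y & Z z & h x y z))"
  by (rule pr3_cong) auto
  finally have "\<rho>^3 * (1/4 * pr V (%x. x \<in> U & X x) * pr V (%x. x \<in> U & Y x) * pr V (%x. x \<in> U & Z x) - \<nu>) <= pr3 U (%x y z. X x & Y y & Z z & h x y z)"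
  unfolding s(3) using \<rho> by (intro mult_left_mono) auto
  moreover have "\<rho>^3 * (1/4 * pr V (%x. x \<in> U & X x) * pr V (%x. x \<in> U & Y x) * pr V (%x. x \<in> U & Z x) - \<nu>)
  = 1/4 * pr U X * pr U Y * pr U Z - \<rho>^3 * \<nu>" unfolding s(1) by (simp add: power3_eq_cube algebra_simps)
  moreover have "\<rho>^3 * \<nu> <= 2^3 * \<nu>" using \<rho> n0 by (intro mult_right_mono power_mono) auto
  ultimately show "1/4 * pr U X * pr U Y * pr U Z - \<nu>2 <= pr3 U (%x y z. X x & Y y & Z z & h x y z)"
  using \<nu>2 by simp
 qed
qed

text \<open>Degree 6 is one more than the exponent in the number |V|^5 times \<open>J\<close> of
  indices of \<open>slot_family\<close>.\<close>

lemma exp_ge_power6: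
 fixes y :: real
 assumes "0 <= y"
 shows "(y/6)^6 <= exp y"
proof -
 have "y/6 <= exp (y/6)" using exp_ge_add_one_self[of "y/6"] by linarith
 then have "(y/6)^6 <= exp (y/6)^6" using assms by (intro power_mono) auto
 also have "... = exp y" by (simp add: exp_of_nat_mult[symmetric])
 finally show ?thesis .
qed

text \<open>Appending the first two vertices turns the cyclic condition into a linear one.\<close>

lemma tight_cycle_of_path:
 assumes c: "distinct c" "set c = verts H" "3 <= length c" and p: "tpath (%x y z. {x, y, z} \<in> edges H) (c @ take 2 c)"
 shows "tight_hamilton_cycle H c"
proof -
 have nx: "(c @ take 2 c) ! k = c ! (k mod length c)" if "k < length c + 2" for k
 proof (cases "k < length c")
  case False
  then have k: "k - length c < 2" "length c <= k" using that by auto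
  have "k mod length c = k - length c" using k c(3) by (simp add: mod_if)
  then show ?thesis using k by (simp add: nth_append)
 qed (simp add: nth_append)
 have "tight_cycle_edges c \<subseteq> edges H"
 proof
  fix E assume "E \<in> tight_cycle_edges c"
  then obtain i where i: "i < length c" "E = {c ! i, c ! ((i + 1) mod length c), c ! ((i + 2) mod length c)}"
  unfolding tight_cycle_edges_def by blast
  have "i + 2 < length (c @ take 2 c)" using i(1) c(3) by simp
  from tpath_nth[OF p this] show "E \<in> edges H"
  unfolding i(2) using nx[of i] nx[of "i + 1"] nx[of "i + 2"] i(1) by simp
 qed
 then show ?thesis unfolding tight_hamilton_cycle_def tight_cycle_def using c by simp
qed

text \<open>The sizes are nested. Slots and gadgets with their connectors use at most \<delta>/8 of
  the vertices; tiles are so large that their connectors are few against both \<delta> and \<xi>;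
  and \<omega> is so small that the uncovered part is within the capacity of about \<xi> |V|
  gadgets.\<close>

lemma (in comp2) finish:
 fixes \<theta> \<delta> \<omega> \<nu>r \<zeta> \<xi> :: real
 assumes \<delta>: "0 < \<delta>" "144 * \<delta> <= \<gamma> * (s0/20)^3 / 1000" "144 * \<delta> <= e / 2" "\<delta> <= \<gamma>" and K: "3 < \<delta> * real K"
  and \<theta>: "0 < \<theta>" "\<theta> <= l0^5 / 10^12" "100 * \<theta> <= e" "100 * \<theta> <= s0" "\<theta> <= 1" and J: "1 < \<theta> * real J"
  and ctri: "\<forall>A B C (T :: 'a => 'a => 'a => bool). finite A --> finite B --> finite C -->
  m0 <= card A --> m0 <= card B --> m0 <= card C -->
  1/50 * card A * card B * card C <= card {(a, b, c). a \<in> A & b \<in> B & c \<in> C & T a b c} -->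
  (\<exists>A'\<subseteq>A. \<exists>B'\<subseteq>B. \<exists>C'\<subseteq>C. card A' = 3 & card B' = 3 & card C' = 3 & (\<forall>a\<in>A'. \<forall>b\<in>B'. \<forall>c\<in>C'. T a b c))"
  and til: "\<forall>(V :: 'a set) T. good_for \<omega> \<nu>r n1 V T --> (EX ts. tiling t T V ts & (1 - 30 * \<omega>) * card V <= 3 * real t * length ts)"
  and cov: "\<forall>V h D T \<nu> (c :: 'a => real). trip V h --> trip.fm_hyp V h D T (\<gamma>/4) \<nu> --> 0 < \<nu> --> \<nu> <= \<nu>0c -->
  (\<forall>x\<in>V. 0 <= c x) --> pr3 V (%x y z. T x y z & c x + c y + c z < 1) <= \<nu> --> (1 - \<omega>^3/2) / 3 <= avg V c"
  and \<nu>c: "0 < \<nu>0c" "\<nu>r + 8 * (264 * \<nu> / \<gamma>) <= \<nu>0c" "8 * (4 * \<nu> / \<gamma>) <= \<nu>0c"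
  and t: "2 <= t" "2 * (2 * real K + 8) <= \<delta> * real t" "2 * (2 * real K + 8) <= \<xi> * real t"
  and \<omega>: "0 < \<omega>" "60 * \<omega> <= \<xi>"
  and \<zeta>: "0 < \<zeta>" "40 * \<zeta> <= \<theta>" "30000 * \<zeta> <= l0" "8 * (10 * real K + 36) * \<zeta> <= \<delta>"
  and \<xi>: "0 < \<xi>" "\<xi> <= \<zeta>"
  and N: "N = nat \<lfloor>\<zeta> * card V\<rfloor>" and k: "k = nat \<lfloor>\<xi> * card V\<rfloor>"
  and MW: "real (card V)^5 * real J * (1 - \<theta>^4/2^15)^N < (1/2)^(3 * k * J)"
  and n: "3 / card V <= \<theta>^3 / 4096" "3 / card V <= (l0/4)^3 / 4096" "30000 <= l0 * card V" "2 * real m0 <= card V" "2 * real n1 <= card V"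
  "16 * real K + 80 <= \<delta> * card V" "8 * real K + 24 < \<xi> * card V"
 shows "EX c. distinct c & set c = V & tpath h (c @ take 2 c) & 3 <= length c"
proof -
 define nn where "nn = real (card V)"
 have nn0: "0 < nn" unfolding nn_def by (rule card_pos)
 have z: "0 <= \<zeta> * nn" "0 <= \<xi> * nn" using \<zeta> \<xi> nn0 by auto
 have Nb: "real N <= \<zeta> * nn" using z unfolding N nn_def[symmetric] by simp
 have kb: "real k <= \<xi> * nn" "\<xi> * nn - 1 <= real k" using z unfolding k nn_def[symmetric] by linarith+
 have xz: "\<xi> * nn <= \<zeta> * nn" using \<xi> nn0 by (intro mult_right_mono) auto
 have zs: "40 * (\<zeta> * nn) <= \<theta> * nn" "30000 * (\<zeta> * nn) <= l0 * nn" "8 * (10 * real K + 36) * (\<zeta> * nn) <= \<delta> * nn"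
  using \<zeta>(2-4) nn0 by (simp_all add: mult.assoc[symmetric] mult_right_mono)
 have l0n: "l0 * nn <= 1/25 * nn" using l0 nn0 by (intro mult_right_mono) auto
 have ns: "30000 <= l0 * nn" "2 * real m0 <= nn" "2 * real n1 <= nn" "16 * real K + 80 <= \<delta> * nn" "8 * real K + 24 < \<xi> * nn"
  using n(3-7) unfolding nn_def by auto
 have F0: "8 * (real (card ({} :: 'a set)) + 5 * real N) <= \<theta> * card V" using Nb zs unfolding nn_def[symmetric] by simp
 from slot_family[OF \<theta>(1,5) finite.emptyI F0 n(1) MW]
 obtain gs0 where gs0: "length gs0 <= N" "distinct (concat (map blk gs0))" "set (concat (map blk gs0)) \<subseteq> V - {}" "\<forall>(u, \<tau>)\<in>set gs0. Wt u \<tau>"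
  and rt0: "\<forall>\<tau> v j. fst \<tau> \<in> V & fst (snd \<tau>) \<in> V & fst (snd (snd \<tau>)) \<in> V & snd (snd (snd \<tau>)) \<in> V --> v \<in> V --> j < J -->
  \<theta> <= pr3 V (%u b c. ygrow \<theta> (%u. Wt u \<tau>) j u & L u b c & L v b c) -->
  3 * k * J < length (filter (%(u, \<sigma>). ygrow \<theta> (%u. Wt u \<tau>) j u & Wt v \<sigma>) gs0)"
  by (elim exE conjE) (rule that)
 have rt: "\<forall>\<tau> v j. set (rest4 \<tau>) \<subseteq> V --> v \<in> V --> j < J --> \<theta> <= pr3 V (%u b c. ygrow \<theta> (%u. Wt u \<tau>) j u & L u b c & L v b c) -->
  3 * k * J < length (filter (%(u, \<sigma>). ygrow \<theta> (%u. Wt u \<tau>) j u & Wt v \<sigma>) gs0)"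
 proof (intro allI impI)
  fix \<tau> v j
  assume a: "set (rest4 \<tau>) \<subseteq> V" "v \<in> V" "j < J" "\<theta> <= pr3 V (%u b c. ygrow \<theta> (%u. Wt u \<tau>) j u & L u b c & L v b c)"
  have "fst \<tau> \<in> V & fst (snd \<tau>) \<in> V & fst (snd (snd \<tau>)) \<in> V & snd (snd (snd \<tau>)) \<in> V" using a(1) by (cases \<tau>) simp
  then show "3 * k * J < length (filter (%(u, \<sigma>). ygrow \<theta> (%u. Wt u \<tau>) j u & Wt v \<sigma>) gs0)"
  by (rule rt0[rule_format, OF _ a(2-4)])
 qed
 have ex: "\<forall>\<tau> v. rich \<tau> --> v \<in> V --> ygrow \<theta> (%u. Wt u \<tau>) J v"
  using exchange_all[OF \<theta>(1-4) J] unfolding rich_def by blast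
 define A where "A = set (concat (map blk gs0))"
 have lenb: "length (concat (map blk gs)) = 5 * length gs" for gs :: "('a \<times> 'a \<times> 'a \<times> 'a \<times> 'a) list" by (induction gs) auto
 have cA: "finite A" "card A <= 5 * N" unfolding A_def using card_length[of "concat (map blk gs0)"] gs0(1) unfolding lenb by (simp, linarith)
 have cAr: "real (card A) <= 5 * real N" using cA(2) by linarith
 have g1: "400 * real (card A + 21 * k + 40) <= l0 * card V" "real (m0 + card A + 21 * k) <= real (card V)"
 proof -
  have "400 * real (card A + 21 * k + 40) = 400 * real (card A) + 8400 * real k + 16000" "real (m0 + card A + 21 * k) = real m0 + real (card A) + 21 * real k"
  by simp_all
  then show "400 * real (card A + 21 * k + 40) <= l0 * card V" "real (m0 + card A + 21 * k) <= real (card V)"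
  using cAr Nb kb(1) xz zs(2) l0n ns(1,2) unfolding nn_def[symmetric] by linarith+
 qed
 obtain qs where qs: "length qs = k" "\<forall>q\<in>set qs. gadget q" "distinct (concat (concat (map gblocks qs)))" "set (concat (concat (map gblocks qs))) \<subseteq> V - A"
  "length (concat (concat (map gblocks qs))) = 21 * k" "length (concat (map gblocks qs)) = 4 * k"
  using gadgets_exist[OF ctri cA(1) n(2) g1(1) g1(2)[unfolded of_nat_le_iff]] by (elim exE conjE) (rule that)
 define bs1 where "bs1 = map blk gs0 @ concat (map gblocks qs)"
 have k1: "1 <= k" using kb ns by simp
 have bne: "bs1 ~= []" using qs(6) k1 unfolding bs1_def by (metis append_is_Nil_conv list.size(3) mult_is_0 not_one_le_zero zero_neq_numeral)
 define xs bl where "xs = butlast bs1" and "bl = last bs1"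
 have bx: "bs1 = xs @ [bl]" unfolding xs_def bl_def using bne by simp
 have cb: "concat bs1 = concat (map blk gs0) @ concat (concat (map gblocks qs))" unfolding bs1_def by (rule concat_append)
 have dis: "set (concat (map blk gs0)) \<inter> set (concat (concat (map gblocks qs))) = {}" using qs(4) unfolding A_def by blast
 have dbs: "distinct (concat bs1)" "set (concat bs1) \<subseteq> V"
  unfolding cb distinct_append set_append by (intro conjI gs0(2) qs(3) dis) (use gs0(3) qs(4) in blast)
 have lbs: "length (concat bs1) <= 5 * N + 21 * k" "length bs1 <= N + 4 * k"
  unfolding bs1_def concat_append length_append lenb using qs(5,6) gs0(1) by auto
 have ok1: "okb b" if "b \<in> set bs1" for b
 proof -
  have "b \<in> blk ` set gs0 | b \<in> (\<Union>q\<in>set qs. set (gblocks q))" using that unfolding bs1_def by simp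
  then show ?thesis
  proof
  assume "b \<in> blk ` set gs0"
  then obtain g where g: "b = blk g" "g \<in> set gs0" by (rule imageE)
  then have "Wt (fst g) (snd g)" using gs0(4) by (auto simp: split_def)
  then show ?thesis using blk_okb[of "fst g" "snd g"] g(1) by simp
  next
  assume "b \<in> (\<Union>q\<in>set qs. set (gblocks q))"
  then obtain q where q2: "q \<in> set qs" "b \<in> set (gblocks q)" by (rule UN_E)
  obtain x t1 y t2 z t3 E where q: "q = ((x, t1), (y, t2), (z, t3), E)" by (metis surj_pair)
  have "gadget q" using q2 qs by blast
  then have "Wt x t1" "Wt y t2" "Wt z t3" "okb E" unfolding q by auto
  then show ?thesis using q2(2) blk_okb[of x t1] blk_okb[of y t2] blk_okb[of z t3] unfolding q by (auto simp del: blk.simps)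
  qed
 qed
 have blm: "bl \<in> set bs1" unfolding bx by simp
 define F where "F = set (concat bs1)"
 have cF: "finite F" "card F <= 5 * N + 21 * k" unfolding F_def using card_length[of "concat bs1"] lbs(1) by (simp, linarith)
 have bF: "set b \<subseteq> F" if "b \<in> set bs1" for b using that unfolding F_def by auto
 have E: "take 2 bl = [bl ! 0, bl ! 1]" "G (bl ! 0) (bl ! 1)" using two_ends[of bl] ok1[OF blm] unfolding okb_def by auto
 have lx: "length xs <= N + 4 * k" using lbs(2) unfolding bx by simp
 have tot: "real (5 * N + 21 * k + (N + 4 * k) * (2 * K + 2)) <= \<delta> * nn / 8"
 proof -
  have kz: "real k <= \<zeta> * nn" using kb xz by linarith
  have "real (5 * N + 21 * k + (N + 4 * k) * (2 * K + 2)) = (2 * real K + 7) * real N + (8 * real K + 29) * real k"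
  by (simp add: algebra_simps)
  also have "... <= (2 * real K + 7) * (\<zeta> * nn) + (8 * real K + 29) * (\<zeta> * nn)"
  using Nb kz by (intro add_mono mult_left_mono) auto
  also have "... = (10 * real K + 36) * (\<zeta> * nn)" by (simp add: algebra_simps)
  finally have t1: "real (5 * N + 21 * k + (N + 4 * k) * (2 * K + 2)) <= (10 * real K + 36) * (\<zeta> * nn)" .
  have "8 * ((10 * real K + 36) * (\<zeta> * nn)) <= \<delta> * nn" using zs(3) unfolding mult.assoc .
  then show ?thesis using t1 by linarith
 qed
 have "EX us. length us = length xs & woven h xs us (take 2 bl) & distinct (concat us) & set (concat us) \<subseteq> V - F
  & length (concat us) <= length xs * (2 * K + 2) & (xs ~= [] --> length (concat us) mod 3 = 0)"
 proof (rule connect_blocks[OF \<delta>(1-3) K E _ cF(1)])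
  have "set (take 2 bl) \<subseteq> F" using bF[OF blm] set_take_subset[of 2 bl] by blast
  then show "{bl ! 0, bl ! 1} \<subseteq> F" unfolding E(1) by simp
  show "\<forall>b\<in>set xs. okb b & set (take 2 b) \<subseteq> F & set (last2 b) \<subseteq> F"
  proof
  fix b assume "b \<in> set xs"
  then have b: "b \<in> set bs1" unfolding bx by simp
  have "set (take 2 b) \<subseteq> set b" "set (last2 b) \<subseteq> set b" unfolding last2_def by (rule set_take_subset set_drop_subset)+
  then show "okb b & set (take 2 b) \<subseteq> F & set (last2 b) \<subseteq> F" using ok1[OF b] bF[OF b] by blast
  qed
  have "length xs * (2 * K + 2) <= (N + 4 * k) * (2 * K + 2)" using lx by (rule mult_le_mono1)
  then have "card F + length xs * (2 * K + 2) + 2 * K + 10 <= 5 * N + 21 * k + (N + 4 * k) * (2 * K + 2) + 2 * K + 10"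
  using cF(2) by linarith
  then have "real (card F + length xs * (2 * K + 2) + 2 * K + 10) <= real (5 * N + 21 * k + (N + 4 * k) * (2 * K + 2) + 2 * K + 10)"
  by (rule of_nat_mono)
  also have "... = real (5 * N + 21 * k + (N + 4 * k) * (2 * K + 2)) + 2 * real K + 10" by simp
  also have "... < \<delta> * nn" using tot ns(4) by linarith
  finally show "real (card F + length xs * (2 * K + 2) + 2 * K + 10) < \<delta> * real (card V)" unfolding nn_def .
 qed simp
 then obtain us1 where us1: "length us1 = length xs" "woven h xs us1 (take 2 bl)" "distinct (concat us1)" "set (concat us1) \<subseteq> V - F"
  "length (concat us1) <= length xs * (2 * K + 2)" by blast
 define F0 where "F0 = set (concat bs1) \<union> set (concat us1)"
 have F0V: "F0 \<subseteq> V" "finite F0" unfolding F0_def using dbs us1(4) by auto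
 have cF0: "real (card F0) <= \<delta> * nn / 8"
 proof -
  have "card F0 <= card F + length (concat us1)" unfolding F0_def F_def using card_Un_le card_length by (meson add_left_mono order_trans)
  moreover have "length xs * (2 * K + 2) <= (N + 4 * k) * (2 * K + 2)" using lx by (rule mult_le_mono1)
  ultimately have "card F0 <= 5 * N + 21 * k + (N + 4 * k) * (2 * K + 2)" using cF(2) us1(5) by linarith
  then have "real (card F0) <= real (5 * N + 21 * k + (N + 4 * k) * (2 * K + 2))" by (rule of_nat_mono)
  then show ?thesis using tot by linarith
 qed
 define U where "U = V - F0"
 have dg: "\<delta> * nn <= \<gamma> * nn" "\<gamma> * nn <= 1 * nn" using \<delta>(4) \<gamma> nn0 by (intro mult_right_mono; simp)+
 have cU: "real (card U) = nn - card F0"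
  unfolding U_def nn_def using card_Diff_subset[OF F0V(2,1)] card_mono[OF fin F0V(1)] by (simp add: of_nat_diff)
 have Uh: "nn / 2 <= real (card U)" using cU cF0 dg nn0 by linarith
 have U: "U \<subseteq> V" "U ~= {}"
 proof -
  show "U \<subseteq> V" unfolding U_def by blast
  show "U ~= {}"
  proof
  assume "U = {}"
  then have "real (card U) = 0" by simp
  then show False using Uh nn0 by linarith
  qed
 qed
 have fU: "finite U" using fin unfolding U_def by simp
 have half: "card V <= 2 * card U" using Uh unfolding nn_def by linarith
 have "real (card V) - card U <= \<gamma>/4 * card V" using cU cF0 dg unfolding nn_def by linarith
 moreover have n4: "0 <= 4 * \<nu> / \<gamma>" using \<nu>0 \<gamma> by simp
 ultimately have fr: "trip U h" "trip.fm_hyp U h D T (\<gamma>/2 - \<gamma>/4) \<nu>0c"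
  using fm_restrict[OF fm_hyp_T U half _ _ \<nu>c(3), of "\<gamma>/4"] by blast+
 have fmU: "trip U h" "trip.fm_hyp U h D T (\<gamma>/4) \<nu>0c"
 proof -
  have e4: "\<gamma>/2 - \<gamma>/4 = \<gamma>/4" by linarith
  show "trip U h" by (rule fr(1))
  show "trip.fm_hyp U h D T (\<gamma>/4) \<nu>0c" using fr(2) unfolding e4 .
 qed
 \<comment> \<open>The cover bound for \<open>T\<close> carries over to \<open>T'\<close>, because
   few triples of \<open>T\<close> have a pair outside \<open>G\<close>.\<close>
 have "robust_cover U T' (\<omega>^3/2) \<nu>r"
  unfolding robust_cover_def
 proof (intro allI impI)
  fix c :: "'a => real" assume c: "\<forall>x\<in>U. 0 <= c x" "avg U c < (1 - \<omega>^3/2) / 3"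
  show "\<nu>r < pr3 U (%x y z. T' x y z & c x + c y + c z < 1)"
  proof (rule ccontr)
  assume neg: "~ ?thesis"
  have "pr3 U (%x y z. T x y z & c x + c y + c z < 1) <= pr3 U (%x y z. T' x y z & c x + c y + c z < 1) + pr3 U (%x y z. T x y z & ~ T' x y z)"
  by (rule pr3_union) auto
  moreover have "pr3 U (%x y z. T x y z & ~ T' x y z) <= 8 * pr3 V (%x y z. x \<in> U & y \<in> U & z \<in> U & T x y z & ~ T' x y z)"
  by (rule pr_sub_bounds(3)[OF fin U half])
  moreover have "pr3 V (%x y z. x \<in> U & y \<in> U & z \<in> U & T x y z & ~ T' x y z) <= pr3 V (%x y z. T x y z & ~ T' x y z)"
  by (rule pr3_mono) auto
  ultimately have "pr3 U (%x y z. T x y z & c x + c y + c z < 1) <= \<nu>0c" using neg nonT' \<nu>c(2) by linarith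
  then have le: "pr3 U (%x y z. T x y z & c x + c y + c z < 1) <= \<nu>0c" .
  have "(1 - \<omega>^3/2) / 3 <= avg U c"
  proof (rule cov[rule_format, OF fmU \<nu>c(1) order_refl])
  show "0 <= c x" if "x \<in> U" for x using c(1) that by blast
  qed (rule le)
  then show False using c(2) by linarith
  qed
 qed
 moreover have "n1 <= card U" using Uh ns(3) by linarith
 moreover have "finite U" using fin unfolding U_def by simp
 ultimately have "good_for \<omega> \<nu>r n1 U T'" unfolding good_for_def by simp
 then obtain ts where ts: "tiling t T' U ts" "(1 - 30 * \<omega>) * card U <= 3 * real t * length ts" using til by blast
 have tsn: "3 * real t * length ts <= nn"
 proof -
  have "card (supps ts) <= card U" by (rule card_mono[OF fU tiling_supps[OF ts(1)]])
  then have "3 * t * length ts <= card U" using conjunct2[OF card_supps[OF ts(1)]] by linarith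
  then have "real (3 * t * length ts) <= real (card U)" by (rule of_nat_mono)
  moreover have "real (3 * t * length ts) = 3 * real t * length ts" by simp
  moreover have "0 <= real (card F0)" by simp
  ultimately show ?thesis using cU by linarith
 qed
 have tsd: "(2 * real K + 8) * length ts <= \<delta> * nn / 6" "(2 * real K + 8) * length ts <= \<xi> * nn / 6"
 proof -
  have "2 * (2 * real K + 8) * real (length ts) <= \<delta> * real t * real (length ts)" by (rule mult_right_mono[OF t(2)]) simp
  moreover have "2 * (2 * real K + 8) * real (length ts) <= \<xi> * real t * real (length ts)" by (rule mult_right_mono[OF t(3)]) simp
  moreover have "\<delta> * (3 * real t * length ts) <= \<delta> * nn" by (rule mult_left_mono[OF tsn]) (use \<delta>(1) in simp)
  moreover have "\<xi> * (3 * real t * length ts) <= \<xi> * nn" by (rule mult_left_mono[OF tsn]) (use \<xi>(1) in simp)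
  moreover have "\<delta> * (3 * real t * length ts) = 3 * (\<delta> * real t * length ts)" "\<xi> * (3 * real t * length ts) = 3 * (\<xi> * real t * length ts)" by simp_all
  ultimately show "(2 * real K + 8) * length ts <= \<delta> * nn / 6" "(2 * real K + 8) * length ts <= \<xi> * nn / 6" by linarith+
 qed
 show ?thesis
 proof (rule assemble[where Lf = "30 * (\<omega> * nn)", OF \<delta>(1-3) K rt ex gs0(4) qs(2) bs1_def bx dbs us1(1-3) us1(4)[unfolded F_def] F0_def ts(1)[unfolded U_def] t(1)])
  have "real (card F0 + 6 * length ts + (length ts + 1) * (2 * K + 2) + 2 * K + 10) = real (card F0) + (2 * real K + 8) * length ts + 4 * real K + 12"
  by (simp add: algebra_simps)
  also have "... < \<delta> * nn" using cF0 tsd(1) ns(4) by linarith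
  finally show "real (card F0 + 6 * length ts + (length ts + 1) * (2 * K + 2) + 2 * K + 10) < \<delta> * real (card V)" unfolding nn_def .
  have on: "\<omega> * card U <= \<omega> * nn" using cU \<omega>(1) by (intro mult_left_mono) auto
  have "(1 - 30 * \<omega>) * card U = card U - 30 * (\<omega> * card U)" by (simp add: algebra_simps)
  then have "nn <= real (card F0) + 3 * real t * length ts + 30 * (\<omega> * nn)" using ts(2) cU on by linarith
  then show "real (card V) <= real (card F0 + 3 * t * length ts) + 30 * (\<omega> * nn)" unfolding nn_def by simp
  have "60 * (\<omega> * nn) <= \<xi> * nn" using \<omega>(2) nn0 by (simp add: mult.assoc[symmetric] mult_right_mono)
  moreover have "2 * real ((length ts + 1) * (2 * K + 2)) <= 2 * ((2 * real K + 8) * length ts) + 4 * real K + 4" by (simp add: algebra_simps)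
  ultimately show "30 * (\<omega> * nn) + 2 * real ((length ts + 1) * (2 * K + 2)) <= 3 * real (length qs)"
  using tsd(2) kb(2) ns(5) unfolding qs(1) by linarith
  show "3 * length qs * J <= 3 * k * J" unfolding qs(1) by simp
 qed
qed

text \<open>The family decreases the total weight by a factor of about exp (- y) with y = b \<zeta>
  n. An eighth of the exponent pays for the 3kJ required slots, since \<xi> is small against b
  \<zeta> / J; the rest beats the polynomial number of indices.\<close>

lemma mw_numeric:
 fixes b \<zeta> \<xi> n :: real
 assumes b: "0 < b" "b <= 1" and \<zeta>: "0 < \<zeta>" and \<xi>: "0 <= \<xi>" "24 * \<xi> * real J <= b * \<zeta>" and n: "0 < n" "3 * real J / (b * \<zeta> / 12)^6 < n"
 shows "n^5 * real J * (1 - b)^nat \<lfloor>\<zeta> * n\<rfloor> < (1/2)^(3 * nat \<lfloor>\<xi> * n\<rfloor> * J)"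
proof -
 define N where "N = nat \<lfloor>\<zeta> * n\<rfloor>"
 define k where "k = nat \<lfloor>\<xi> * n\<rfloor>"
 define y where "y = b * \<zeta> * n"
 have z: "0 <= \<zeta> * n" "0 <= \<xi> * n" using \<zeta> \<xi> n by auto
 have Nb: "\<zeta> * n - 1 <= real N" using z unfolding N_def by linarith
 have kb: "real k <= \<xi> * n" using z unfolding k_def by simp
 have y0: "0 < y" unfolding y_def using b \<zeta> n by simp
 have "1 - b <= exp (- b)" using exp_ge_add_one_self[of "- b"] by simp
 then have "(1 - b)^N <= exp (- b)^N" using b by (intro power_mono) auto
 also have "... = exp (- (b * N))" by (simp add: exp_of_nat_mult[symmetric] mult.commute)
 also have "... <= exp (1 - y)"
 proof -
  have "b * (\<zeta> * n - 1) <= b * real N" using Nb b by (intro mult_left_mono) auto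
  then have "y - b <= b * real N" unfolding y_def by (simp add: algebra_simps)
  then show ?thesis using b by simp
 qed
 also have "... = exp 1 * exp (- y)" by (simp add: exp_add[symmetric])
 also have "... <= 3 * exp (- y)" using exp_le by (intro mult_right_mono) auto
 finally have 1: "(1 - b)^N <= 3 * exp (- y)" .
 have "exp (- (y/8)) <= exp (- real (3 * k * J))"
 proof -
  have "3 * real k * real J <= 3 * (\<xi> * n) * real J" using kb by (intro mult_right_mono mult_left_mono) auto
  moreover have "24 * \<xi> * real J * n <= b * \<zeta> * n" using \<xi>(2) n by (intro mult_right_mono) auto
  moreover have "real (3 * k * J) = 3 * real k * real J" "3 * (\<xi> * n) * real J = 3 * (\<xi> * n * real J)"
  "24 * \<xi> * real J * n = 24 * (\<xi> * n * real J)" by simp_all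
  ultimately have "real (3 * k * J) <= y/8" unfolding y_def by linarith
  then show ?thesis by simp
 qed
 also have "... = exp (-1)^(3 * k * J)" by (simp add: exp_of_nat_mult[symmetric])
 also have "... <= (1/2)^(3 * k * J)"
 proof (rule power_mono)
  have "2 <= exp (1::real)" using exp_ge_add_one_self[of "1::real"] by simp
  then show "exp (-1::real) <= 1/2" by (simp add: exp_minus field_simps)
 qed simp
 finally have 2: "exp (- (y/8)) <= (1/2)^(3 * k * J)" .
 have "n^5 * (3 * real J) < n^5 * (n * (b * \<zeta> / 12)^6)"
 proof (rule mult_strict_left_mono)
  show "3 * real J < n * (b * \<zeta> / 12)^6" using n(2) b \<zeta> by (simp add: divide_less_eq)
 qed (use n in simp)
 also have "... = (y/2/6)^6" unfolding y_def by (simp add: power_mult_distrib power_divide power_eq_if)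
 also have "... <= exp (y/2)" using y0 by (intro exp_ge_power6) simp
 also have "... <= exp (y - y/8)" using y0 by simp
 finally have 3: "n^5 * (3 * real J) < exp (y - y/8)" .
 have "n^5 * real J * (1 - b)^N <= n^5 * real J * (3 * exp (- y))" using 1 n by (intro mult_left_mono) auto
 also have "... = n^5 * (3 * real J) * exp (- y)" by simp
 also have "... < exp (y - y/8) * exp (- y)" using 3 by (intro mult_strict_right_mono) auto
 also have "... = exp (- (y/8))" by (simp add: exp_add[symmetric])
 finally show ?thesis using 2 unfolding N_def k_def by linarith
qed

text \<open>Everything depending on the quality \<open>x\<close> of the expansion is fixed after
  \<open>x\<close>: the growth parameters, the proportions for slots, gadgets and uncovered
  vertices, the tile size, and finally \<nu> and \<open>n0\<close>.\<close>

lemma stage: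
 fixes g s0 \<kappa> x :: real
 assumes g: "0 < g" "g <= 1" and s0: "0 < s0" "s0 <= 1" and x: "0 < x"
 shows "\<exists>\<nu>>0. EX n0. \<forall>(V :: 'a set) h D \<nu>'. comp2 V h D g \<nu>' s0 \<kappa> x --> \<nu>' <= \<nu> --> n0 <= card V -->
  (EX c. distinct c & set c = V & tpath h (c @ take 2 c) & 3 <= length c)"
proof -
 define l where "l = g/25"
 define \<delta> where "\<delta> = min (g * (s0/20)^3 / 1000) (x/2) / 144"
 define \<theta> where "\<theta> = min (l^5/10^12) (min (x/100) (min (s0/100) 1))"
 define K where "K = nat \<lceil>3/\<delta>\<rceil> + 1"
 define J where "J = nat \<lceil>1/\<theta>\<rceil> + 1"
 define b where "b = \<theta>^4/2^15"
 define \<zeta> where "\<zeta> = min (\<theta>/40) (min (l/30000) (\<delta> / (8 * (10 * real K + 36))))"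
 define \<xi> where "\<xi> = min \<zeta> (b * \<zeta> / (24 * real J))"
 define \<omega> where "\<omega> = min (1/30) (\<xi>/60)"
 have l: "0 < l" unfolding l_def using g by simp
 have d0: "0 < \<delta>" unfolding \<delta>_def using g s0 x by simp
 have d1: "144 * \<delta> <= g * (s0/20)^3 / 1000" "144 * \<delta> <= x / 2" unfolding \<delta>_def by simp_all
 have "(s0/20)^3 <= 1" using s0 by (intro power_le_one) auto
 then have "g * (s0/20)^3 <= g * 1" using g by (intro mult_left_mono) auto
 then have d2: "\<delta> <= g" using d1(1) d0 g by linarith
 have K: "3 < \<delta> * real K"
 proof -
  have "3/\<delta> < real K" unfolding K_def by linarith
  then show ?thesis using d0 by (simp add: divide_less_eq mult.commute)
 qed
 have th: "0 < \<theta>" "\<theta> <= l^5/10^12" "100 * \<theta> <= x" "100 * \<theta> <= s0" "\<theta> <= 1"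
 proof -
  show "0 < \<theta>" unfolding \<theta>_def using l x s0 by simp
  have "\<theta> <= x/100" "\<theta> <= s0/100" unfolding \<theta>_def by (simp_all add: min_le_iff_disj)
  then show "100 * \<theta> <= x" "100 * \<theta> <= s0" by simp_all
 qed (simp_all add: \<theta>_def min_le_iff_disj)
 have J: "1 < \<theta> * real J"
 proof -
  have "1/\<theta> < real J" unfolding J_def by linarith
  then show ?thesis using th(1) by (simp add: divide_less_eq mult.commute)
 qed
 have J0: "0 < real J" unfolding J_def by simp
 have b: "0 < b" "b <= 1" unfolding b_def using th power_le_one[of \<theta> 4] by (auto simp: divide_le_eq)
 have K36: "0 < 8 * (10 * real K + 36)" by simp
 have ze: "0 < \<zeta>" "40 * \<zeta> <= \<theta>" "30000 * \<zeta> <= l" "8 * (10 * real K + 36) * \<zeta> <= \<delta>"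
 proof -
  show "0 < \<zeta>" unfolding \<zeta>_def using th l d0 K36 by simp
  have "\<zeta> <= \<theta>/40" "\<zeta> <= l/30000" and z3: "\<zeta> <= \<delta> / (8 * (10 * real K + 36))" unfolding \<zeta>_def by (simp_all only: min_le_iff_disj order_refl simp_thms)
  then show "40 * \<zeta> <= \<theta>" "30000 * \<zeta> <= l" by simp_all
  have "\<zeta> * (8 * (10 * real K + 36)) <= \<delta>" by (rule pos_le_divide_eq[THEN iffD1, OF K36 z3])
  then show "8 * (10 * real K + 36) * \<zeta> <= \<delta>" by (simp only: mult.commute)
 qed
 have xi: "0 < \<xi>" "\<xi> <= \<zeta>" unfolding \<xi>_def using ze b J0 by simp_all
 have xi2: "24 * \<xi> * real J <= b * \<zeta>"
 proof -
  have "\<xi> <= b * \<zeta> / (24 * real J)" unfolding \<xi>_def by simp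
  then have "\<xi> * (24 * real J) <= b * \<zeta>" by (rule pos_le_divide_eq[THEN iffD1, rotated]) (use J0 in simp)
  then show ?thesis by (simp add: mult.commute mult.left_commute)
 qed
 have om: "0 < \<omega>" "60 * \<omega> <= \<xi>" "\<omega> <= 1/30" unfolding \<omega>_def using xi by simp_all
 have om3: "0 < \<omega>^3/2" "\<omega>^3/2 <= 1" using om power_le_one[of \<omega> 3] by auto
 have "EX m0. \<forall>A B C (T :: 'a => 'a => 'a => bool). finite A --> finite B --> finite C -->
  m0 <= card A --> m0 <= card B --> m0 <= card C -->
  1/50 * card A * card B * card C <= card {(a, b, c). a \<in> A & b \<in> B & c \<in> C & T a b c} -->
  (\<exists>A'\<subseteq>A. \<exists>B'\<subseteq>B. \<exists>C'\<subseteq>C. card A' = 3 & card B' = 3 & card C' = 3 & (\<forall>a\<in>A'. \<forall>b\<in>B'. \<forall>c\<in>C'. T a b c))"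
  by (rule complete_tripartite) auto
 then obtain m0 where m0: "\<forall>A B C (T :: 'a => 'a => 'a => bool). finite A --> finite B --> finite C -->
  m0 <= card A --> m0 <= card B --> m0 <= card C -->
  1/50 * card A * card B * card C <= card {(a, b, c). a \<in> A & b \<in> B & c \<in> C & T a b c} -->
  (\<exists>A'\<subseteq>A. \<exists>B'\<subseteq>B. \<exists>C'\<subseteq>C. card A' = 3 & card B' = 3 & card C' = 3 & (\<forall>a\<in>A'. \<forall>b\<in>B'. \<forall>c\<in>C'. T a b c))" by (elim exE)
 have "\<exists>\<nu>0>0. \<forall>V h D T \<nu> (c :: 'a => real). trip V h --> trip.fm_hyp V h D T (g/4) \<nu> --> 0 < \<nu> --> \<nu> <= \<nu>0 -->
  (\<forall>x\<in>V. 0 <= c x) --> pr3 V (%x y z. T x y z & c x + c y + c z < 1) <= \<nu> --> (1 - \<omega>^3/2) / 3 <= avg V c"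
  by (rule fractional_cover_bound) (use g om3 in auto)
 then obtain \<nu>0c where n0c: "0 < \<nu>0c" and cov: "\<forall>V h D T \<nu> (c :: 'a => real). trip V h --> trip.fm_hyp V h D T (g/4) \<nu> --> 0 < \<nu> --> \<nu> <= \<nu>0c -->
  (\<forall>x\<in>V. 0 <= c x) --> pr3 V (%x y z. T x y z & c x + c y + c z < 1) <= \<nu> --> (1 - \<omega>^3/2) / 3 <= avg V c" by (elim exE conjE)
 define \<nu>r where "\<nu>r = min 1 (\<nu>0c/2)"
 have nr: "0 < \<nu>r" "\<nu>r <= 1" "\<nu>r <= \<nu>0c/2" unfolding \<nu>r_def using n0c by simp_all
 define t where "t = 2 + nat \<lceil>2 * (2 * real K + 8) / \<delta>\<rceil> + nat \<lceil>2 * (2 * real K + 8) / \<xi>\<rceil>"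
 have t: "2 <= t" "2 * (2 * real K + 8) <= \<delta> * real t" "2 * (2 * real K + 8) <= \<xi> * real t"
 proof -
  show "2 <= t" unfolding t_def by simp
  have "2 * (2 * real K + 8) / \<delta> <= real t" "2 * (2 * real K + 8) / \<xi> <= real t" unfolding t_def by linarith+
  then show "2 * (2 * real K + 8) <= \<delta> * real t" "2 * (2 * real K + 8) <= \<xi> * real t"
  using d0 xi(1) by (simp_all only: pos_divide_le_eq mult.commute)
 qed
 have "0 < t" using t(1) by simp
 from almost_tiling[OF om(1,3) nr(1,2) this]
 obtain n1 where til: "\<forall>(V :: 'a set) T. good_for \<omega> \<nu>r n1 V T --> (EX ts. tiling t T V ts & (1 - 30 * \<omega>) * card V <= 3 * real t * length ts)" by (elim exE)
 define Q where "Q = 3 * 4096/\<theta>^3 + 3 * 4096/(l/4)^3 + 30000/l + 2 * real m0 + 2 * real n1 + (16 * real K + 80)/\<delta> + (8 * real K + 24)/\<xi> + 3 * real J/(b * \<zeta>/12)^6 + 1"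
 have pos: "0 <= 3 * 4096/\<theta>^3" "0 <= 3 * 4096/(l/4)^3" "0 <= 30000/l" "0 <= (16 * real K + 80)/\<delta>" "0 <= (8 * real K + 24)/\<xi>" "0 <= 3 * real J/(b * \<zeta>/12)^6"
  using th(1) l d0 xi(1) b(1) ze(1) by simp_all
 show ?thesis
 \<comment> \<open>As 5000 exceeds 2 * 8 * 264, passing from \<open>T\<close> to \<open>T'\<close>
   on the subset spends at most half of \<open>\<nu>0c\<close>.\<close>
 proof (intro exI[of _ "g * \<nu>0c / 5000"] conjI exI[of _ "nat \<lceil>Q\<rceil>"] allI impI)
  show "0 < g * \<nu>0c / 5000" using g n0c by simp
  fix V :: "'a set" and h D \<nu>'
  assume C: "comp2 V h D g \<nu>' s0 \<kappa> x" and nu: "\<nu>' <= g * \<nu>0c / 5000" and nV: "nat \<lceil>Q\<rceil> <= card V"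
  interpret C: comp2 V h D g \<nu>' s0 \<kappa> x by (rule C)
  have l0: "C.l0 = l" unfolding C.l0_def l_def ..
  have QV: "Q <= real (card V)" using nV by linarith
  have V0: "0 < real (card V)" by (rule C.card_pos)
  have q: "3 * 4096/\<theta>^3 <= card V" "3 * 4096/(l/4)^3 <= card V" "30000/l <= card V" "2 * real m0 <= card V" "2 * real n1 <= card V"
  "(16 * real K + 80)/\<delta> <= card V" "(8 * real K + 24)/\<xi> < card V" "3 * real J/(b * \<zeta>/12)^6 < card V"
  using QV pos unfolding Q_def by linarith+
  have th': "\<theta> <= C.l0^5/10^12" using th(2) unfolding l0 .
  have ze': "30000 * \<zeta> <= C.l0" using ze(3) unfolding l0 .
  have c1: "3 / real (card V) <= \<theta>^3/4096" using q(1) th(1) V0 by (simp add: field_simps)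
  have c2: "3 / real (card V) <= (C.l0/4)^3/4096" using q(2) l V0 unfolding l0 by (simp add: field_simps)
  have c3: "30000 <= C.l0 * real (card V)" using q(3) l unfolding l0 by (simp only: pos_divide_le_eq mult.commute)
  have c6: "16 * real K + 80 <= \<delta> * real (card V)" using q(6) d0 by (simp only: pos_divide_le_eq mult.commute)
  have c7: "8 * real K + 24 < \<xi> * real (card V)" using q(7) xi(1) by (simp only: pos_divide_less_eq mult.commute)
  have mw: "real (card V)^5 * real J * (1 - \<theta>^4/2^15)^nat \<lfloor>\<zeta> * card V\<rfloor> < (1/2)^(3 * nat \<lfloor>\<xi> * card V\<rfloor> * J)"
  unfolding b_def[symmetric] by (rule mw_numeric[OF b ze(1) less_imp_le[OF xi(1)] xi2 V0 q(8)])
  have ng: "\<nu>' / g <= \<nu>0c / 5000" using nu g by (simp add: pos_divide_le_eq mult.commute)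
  have e1: "\<nu>r + 8 * (264 * \<nu>' / g) <= \<nu>0c" using ng nr(3) n0c by simp
  have e2: "8 * (4 * \<nu>' / g) <= \<nu>0c" using ng n0c by simp
  show "EX c. distinct c & set c = V & tpath h (c @ take 2 c) & 3 <= length c"
  by (rule C.finish[OF d0 d1 d2 K th(1) th' th(3-5) J m0 til cov n0c e1 e2 t om(1,2) ze(1,2) ze' ze(4) xi refl refl mw c1 c2 c3 q(4,5) c6 c7])
 qed
qed

lemma dense_trip_of_graph:
 fixes H :: "'a graph3" and \<alpha> \<gamma> \<mu> :: real
 assumes g: "is_graph3 H" and dn: "pmu_dense (1/4) \<mu> H" and cod: "\<alpha> * real (num_verts H) <= real (min_codegree H)"
  and \<gamma>: "0 < \<gamma>" "\<gamma> <= 1" "1/3 + \<gamma> <= \<alpha>" and n: "0 < num_verts H" "1 / real (num_verts H) <= \<mu>"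
 shows "dense_trip (verts H) (%x y z. {x, y, z} \<in> edges H) \<gamma> \<mu>"
proof -
 define V where "V = verts H"
 define h where "h x y z \<longleftrightarrow> {x, y, z} \<in> edges H" for x y z
 have fV: "finite V" using g unfolding is_graph3_def V_def by blast
 have nV: "0 < card V" using n(1) unfolding num_verts_def V_def .
 have neV: "V ~= {}" using nV by auto
 have perm: "{x, y, z} = {y, x, z}" "{x, y, z} = {x, z, y}" for x y z :: 'a by auto
 have tr: "trip V h"
 proof unfold_locales
  show "finite V" "V ~= {}" by (rule fV neV)+
  show "h y x z" if "h x y z" for x y z using that unfolding h_def by (subst perm(1))
  show "h x z y" if "h x y z" for x y z using that unfolding h_def by (subst perm(2))
  show "x ~= y" if "h x y z" for x y z
  proof
  assume "x = y"
  then have "{x, y, z} = {x, z}" by auto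
  moreover have "card {x, y, z} = 3" using that g unfolding h_def is_graph3_def by blast
  moreover have "card {x, z} <= 2" by (cases "x = z") auto
  ultimately show False by simp
  qed
 qed
 have "dense_trip V h \<gamma> \<mu>"
 proof (rule dense_trip.intro[OF tr], unfold_locales)
  show "0 < \<gamma>" "\<gamma> <= 1" by (rule \<gamma>)+
  show "1 / real (card V) <= \<mu>" using n(2) unfolding num_verts_def V_def .
  show "1/3 + \<gamma> <= pr V (h x y)" if xy: "x \<in> V" "y \<in> V" "x ~= y" for x y
  proof -
  define C where "C = {codegree H x y | x y. x \<in> verts H & y \<in> verts H & x ~= y}"
  have "C \<subseteq> (%(x, y). codegree H x y) ` (V \<times> V)" unfolding C_def V_def by auto
  then have fC: "finite C" by (rule finite_subset) (use fV in simp)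
  have "codegree H x y \<in> C" using xy unfolding C_def V_def by blast
  then have "min_codegree H <= codegree H x y" unfolding min_codegree_def C_def[symmetric] using fC by simp
  then have "real (min_codegree H) <= real (codegree H x y)" by (rule of_nat_mono)
  then have 1: "\<alpha> * real (card V) <= real (card {z \<in> V. h x y z})"
  using cod unfolding num_verts_def codegree_def V_def h_def by linarith
  have "(1/3 + \<gamma>) * real (card V) <= \<alpha> * real (card V)" using \<gamma>(3) by (intro mult_right_mono) auto
  then have 2: "(1/3 + \<gamma>) * real (card V) <= real (card {z \<in> V. h x y z})" using 1 by linarith
  have "0 < real (card V)" using nV by simp
  from pos_le_divide_eq[OF this, THEN iffD2, OF 2] show ?thesis unfolding pr_eq_card[OF fV] .
  qed
  show "1/4 * pr V X * pr V Y * pr V Z - \<mu> <= pr3 V (%x y z. X x & Y y & Z z & h x y z)" for X Y Z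
  proof -
  define n where "n = real (card V)"
  have n0: "0 < n" using nV unfolding n_def by simp
  define a b c where "a = real (card {x \<in> V. X x})" and "b = real (card {x \<in> V. Y x})" and "c = real (card {x \<in> V. Z x})"
  have "1/4 * a * b * c - \<mu> * n^3 <= real (edge_count H {x \<in> V. X x} {x \<in> V. Y x} {x \<in> V. Z x})"
  using dn unfolding pmu_dense_def num_verts_def V_def a_def b_def c_def n_def by simp
  also have "{(x, y, z). x \<in> {x \<in> V. X x} & y \<in> {x \<in> V. Y x} & z \<in> {x \<in> V. Z x} & {x, y, z} \<in> edges H}
  = {(x, y, z). x \<in> V & y \<in> V & z \<in> V & X x & Y y & Z z & h x y z}" unfolding h_def by auto
  then have "real (edge_count H {x \<in> V. X x} {x \<in> V. Y x} {x \<in> V. Z x}) = pr3 V (%x y z. X x & Y y & Z z & h x y z) * n^3"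
  unfolding edge_count_def n_def pr3_card[OF fV] by (simp only:)
  finally have 1: "1/4 * a * b * c - \<mu> * n^3 <= pr3 V (%x y z. X x & Y y & Z z & h x y z) * n^3" .
  have "1/4 * (a/n) * (b/n) * (c/n) - \<mu> = (1/4 * a * b * c - \<mu> * n^3) / n^3"
  using n0 by (simp add: power3_eq_cube field_simps)
  also have "... <= pr3 V (%x y z. X x & Y y & Z z & h x y z)" using 1 n0 by (simp add: pos_divide_le_eq)
  finally show ?thesis unfolding pr_eq_card[OF fV] a_def b_def c_def n_def .
  qed
 qed
 then show ?thesis unfolding V_def h_def .
qed

text \<open>The level at which splitting stops, and with it the parameter \<open>eps k\<close>, is
  not known beforehand. The tolerances from \<open>stage\<close> are therefore collected as
  functions of that parameter, the sequence \<open>eps\<close> is defined through them, and \<mu> is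
  a minimum over the finitely many levels up to \<open>M\<close>.\<close>

lemma upper_bound:
 fixes \<alpha> :: real
 assumes \<alpha>: "1/3 < \<alpha>"
 shows "\<exists>\<mu>>0. EX n0. \<forall>H::'a graph3. is_graph3 H --> n0 <= num_verts H --> pmu_dense (1/4) \<mu> H -->
  \<alpha> * real (num_verts H) <= real (min_codegree H) --> (EX c. tight_hamilton_cycle H c)"
proof -
 define \<gamma> where "\<gamma> = min (\<alpha> - 1/3) 1"
 \<comment> \<open>Half of the excess is given up, because degrees inside the component miss 1/3 +
   \<gamma> by the error of \<open>big_deg\<close>.\<close>
 define g where "g = \<gamma>/2"
 have \<gamma>: "0 < \<gamma>" "\<gamma> <= 1" "1/3 + \<gamma> <= \<alpha>" unfolding \<gamma>_def using \<alpha> by auto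
 have g: "0 < g" "g <= 1" unfolding g_def using \<gamma> by auto
 obtain s0 where s0: "0 < s0" "s0 <= g/1000" and ns: "\<forall>(V::'a set) h D \<nu> Y. comp0 V h D g \<nu> --> 4 * \<nu> / g <= s0 -->
  s0 < pr3 V (%x y z. comp0.T h D x y z & ~ comp0.one Y x y z)"
  using no_split[OF g, where ?'a = 'a] by (elim exE conjE)
 have s01: "s0 <= 1" using s0 g by linarith
 define \<kappa> where "\<kappa> = min (g * (s0/20)^3 / 1000) ((g/25)^5 / 10^12)"
 have \<kappa>: "0 < \<kappa>" "\<kappa> <= g * (s0/20)^3 / 1000" "\<kappa> <= (g/25)^5 / 10^12" unfolding \<kappa>_def using g s0 by simp_all
 define M where "M = nat \<lceil>1/\<kappa>\<rceil> + 1"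
 have M: "1 < \<kappa> * real M"
 proof -
  have "1/\<kappa> < real M" unfolding M_def by linarith
  then show ?thesis using \<kappa>(1) by (simp add: divide_less_eq mult.commute)
 qed
 define st where "st x \<nu> n0 \<longleftrightarrow> (\<forall>(V :: 'a set) h D \<nu>'. comp2 V h D g \<nu>' s0 \<kappa> x --> \<nu>' <= \<nu> --> n0 <= card V -->
  (EX c. distinct c & set c = V & tpath h (c @ take 2 c) & 3 <= length c))" for x \<nu> n0
 have "ALL x. EX p. 0 < x --> 0 < fst p & st x (fst p) (snd p)"
 proof
  fix x :: real
  show "EX p. 0 < x --> 0 < fst p & st x (fst p) (snd p)"
  proof (cases "0 < x")
  case True
  obtain \<nu> n0 where "0 < \<nu>" "st x \<nu> n0" using stage[OF g s0(1) s01 True, of \<kappa>, where ?'a = 'a] unfolding st_def by blast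
  then show ?thesis by (intro exI[of _ "(\<nu>, n0)"]) simp
  qed simp
 qed
 from choice[OF this] obtain f where f: "!!x. 0 < x ==> 0 < fst (f x)" "!!x. 0 < x ==> st x (fst (f x)) (snd (f x))" by blast
 define nu where "nu x = min (fst (f x)) (min (g * (s0/20)^3 / 1000) (min (x/4) (min (g * (g/25)^5 / 10^14) (min (g * x / 1000) (min (g/1000) (s0 * g/4))))))" for x
 have nu: "0 < nu x" "nu x <= fst (f x)" "nu x <= g * (s0/20)^3 / 1000" "nu x <= x/4" "nu x <= g * (g/25)^5 / 10^14" "nu x <= g * x / 1000"
  "nu x <= g/1000" "nu x <= s0 * g/4" if "0 < x" for x
 proof -
  have "0 < g * (s0/20)^3 / 1000" "0 < x/4" "0 < g * (g/25)^5 / 10^14" "0 < g * x / 1000" "0 < g/1000" "0 < s0 * g/4"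
  using that g(1) s0(1) by simp_all
  then show "0 < nu x" unfolding nu_def min_less_iff_conj using f(1)[OF that] by blast
  show "nu x <= fst (f x)" "nu x <= g * (s0/20)^3 / 1000" "nu x <= x/4" "nu x <= g * (g/25)^5 / 10^14" "nu x <= g * x / 1000"
  "nu x <= g/1000" "nu x <= s0 * g/4" unfolding nu_def by (simp_all only: min_le_iff_disj order_refl simp_thms)
 qed
 define e1 where "e1 x = min (\<gamma>/100) (\<gamma> * nu x / 14)" for x
 have e1: "0 < e1 x" "e1 x <= \<gamma>/100" "e1 x <= \<gamma> * nu x / 14" "e1 x <= nu x" "14 * e1 x / \<gamma> <= nu x" "e1 x ^3 <= e1 x" if "0 < x" for x
 proof -
  show 1: "0 < e1 x" "e1 x <= \<gamma>/100" "e1 x <= \<gamma> * nu x / 14" unfolding e1_def using nu(1)[OF that] \<gamma> by simp_all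
  have "\<gamma> * nu x <= 1 * nu x" using \<gamma> nu(1)[OF that] by (intro mult_right_mono) auto
  then show "e1 x <= nu x" using 1(3) nu(1)[OF that] by linarith
  show "14 * e1 x / \<gamma> <= nu x" using 1(3) \<gamma> by (simp add: pos_divide_le_eq mult.commute)
  have "e1 x ^3 <= e1 x ^1" using 1 \<gamma> by (intro power_decreasing) auto
  then show "e1 x ^3 <= e1 x" by simp
 qed
 \<comment> \<open>The cube is the boundary for which \<open>big_deg\<close> and
   \<open>big_pure\<close> work with error \<open>e1 x\<close>.\<close>
 define phi where "phi x = min x (e1 x ^3)" for x
 define eps where "eps = rec_nat ((\<gamma>^3/10000)^3) (%_ y. min y (phi y) / 2)"
 have eps0: "eps 0 = (\<gamma>^3/10000)^3" and epsS: "eps (Suc k) = min (eps k) (phi (eps k)) / 2" for k unfolding eps_def by simp_all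
 have ep: "0 < eps k" for k
 proof (induction k)
  case 0
  show ?case unfolding eps0 using \<gamma> by simp
 next
  case (Suc k)
  then show ?case unfolding epsS phi_def using e1(1)[OF Suc] by simp
 qed
 define S where "S = insert (\<gamma>^3/10000) ((%k. min (e1 (eps k)) (nu (eps k))) ` {..M})"
 define \<mu> where "\<mu> = Min S"
 have S: "finite S" "S ~= {}" "\<forall>x\<in>S. 0 < x" unfolding S_def using \<gamma> e1(1)[OF ep] nu(1)[OF ep] by auto
 have \<mu>0: "0 < \<mu>" unfolding \<mu>_def using S by simp
 have \<mu>1: "\<mu> <= \<gamma>^3/10000" unfolding \<mu>_def using S(1) by (intro Min_le) (auto simp: S_def)
 have \<mu>2: "\<mu> <= e1 (eps k)" "\<mu> <= nu (eps k)" if "k <= M" for k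
 proof -
  have "\<mu> <= min (e1 (eps k)) (nu (eps k))" unfolding \<mu>_def using S(1) that by (intro Min_le) (auto simp: S_def)
  then show "\<mu> <= e1 (eps k)" "\<mu> <= nu (eps k)" by simp_all
 qed
 define n0 where "n0 = Max ((%k. snd (f (eps k))) ` {..M}) + nat \<lceil>1/\<mu>\<rceil> + 1"
 show ?thesis
 proof (intro exI[of _ \<mu>] conjI exI[of _ n0] allI impI)
  show "0 < \<mu>" by (rule \<mu>0)
  fix H :: "'a graph3"
  assume H: "is_graph3 H" "n0 <= num_verts H" "pmu_dense (1/4) \<mu> H" "\<alpha> * real (num_verts H) <= real (min_codegree H)"
  define V where "V = verts H"
  define h where "h = (%x y z. {x, y, z} \<in> edges H)"
  have nV: "0 < num_verts H" "1/\<mu> <= real (num_verts H)" using H(2) unfolding n0_def by linarith+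
  have nm: "1 / real (num_verts H) <= \<mu>" using nV \<mu>0 by (simp add: pos_divide_le_eq mult.commute)
  have "dense_trip V h \<gamma> \<mu>" unfolding V_def h_def by (rule dense_trip_of_graph[OF H(1,3,4) \<gamma> nV(1) nm])
  then interpret dt: dense_trip V h \<gamma> \<mu> .
  have cV: "card V = num_verts H" unfolding num_verts_def V_def ..
  have "\<exists>k\<le>M. EX D. grel D & dt.big D & dt.cut D <= phi (eps k) &
  (ALL Q. grel Q --> (ALL x y. Q x y --> D x y) --> dt.cut Q <= eps k --> pr2 V Q <= \<kappa> | pr2 V (%x y. D x y & ~ Q x y) <= \<kappa>)"
  proof (rule dt.exists_component[OF \<kappa>(1) M ep _ _ _ _ _ \<mu>1])
  show "2 * eps (Suc k) <= eps k" "2 * eps (Suc k) <= phi (eps k)" for k unfolding epsS by simp_all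
  show "0 <= phi (eps k)" "phi (eps k) <= eps k" for k unfolding phi_def using ep[of k] e1(1)[OF ep, of k] by simp_all
  show "eps 0 <= (\<gamma>^3/10000)^3" unfolding eps0 ..
  qed
  then obtain k D where k: "k <= M" and D: "grel D" "dt.big D" "dt.cut D <= phi (eps k)"
  and exp: "ALL Q. grel Q --> (ALL x y. Q x y --> D x y) --> dt.cut Q <= eps k --> pr2 V Q <= \<kappa> | pr2 V (%x y. D x y & ~ Q x y) <= \<kappa>"
  by (elim exE conjE) (rule that)
  define x where "x = eps k"
  have x: "0 < x" unfolding x_def by (rule ep)
  note nux = nu[OF x] and e1x = e1[OF x]
  have mux: "\<mu> <= e1 x" "\<mu> <= nu x" using \<mu>2[OF k] unfolding x_def by auto
  have cut: "dt.cut D <= e1 x ^3" using D(3) unfolding phi_def x_def by simp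
  have C0: "comp0 V h D g (nu x)"
  proof (unfold_locales)
  show "0 < g" "g <= 1" by (rule g)+
  show "0 < nu x" "nu x <= g / 1000" by (rule nux(1) nux(7))+
  show "grel D" by (rule D(1))
  have "pr V (%y. pr V (D y) < 1/3 + g) <= pr V (%y. pr V (D y) < 1/3 + \<gamma> - e1 x)"
  by (rule pr_mono) (use e1x(2) \<gamma> in \<open>auto simp: g_def\<close>)
  also have "... <= 14 * e1 x / \<gamma>" by (rule dt.big_deg[OF D(1) cut e1x(1,2) mux(1) D(2)])
  finally show "pr V (%y. pr V (D y) < 1/3 + g) <= nu x" using e1x(5) by linarith
  show "dt.cut D <= nu x" using cut e1x(4,6) by linarith
  show "1/3 + g <= pr V (h a b)" if "a \<in> V" "b \<in> V" "a ~= b" for a b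
  using dt.codeg[OF that] \<gamma> unfolding g_def by linarith
  show "1/4 * pr V X * pr V Y * pr V Z - nu x <= pr3 V (%x y z. X x & Y y & Z z & h x y z)" for X Y Z
  using dt.dens[of X Y Z] mux(2) by linarith
  qed
  have n4: "4 * nu x / g <= s0" using nux(8) g by (simp add: pos_divide_le_eq)
  have C1: "comp1 V h D g (nu x) s0 \<kappa> x"
  proof (rule comp1.intro[OF C0], unfold_locales)
  show "s0 < pr3 V (%x y z. comp0.T h D x y z & ~ comp0.one Y x y z)" for Y
  by (rule ns[rule_format, OF C0 n4])
  show "pr2 V Q <= \<kappa> | pr2 V (%x y. D x y & ~ Q x y) <= \<kappa>" if "grel Q" "!!x y. Q x y ==> D x y" "dt.cut Q <= x" for Q
  by (rule exp[rule_format]) (use that in \<open>auto simp: x_def\<close>)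
  qed (use s0 \<kappa> nux x in auto)
  have "comp2 V h D g (nu x) s0 \<kappa> x"
  proof (rule comp2.intro[OF C1], unfold_locales)
  have "\<gamma>/4 <= pr V (%y. pr V (cpl D y) <= e1 x)" by (rule dt.big_pure[OF D(1) cut e1x(1,2) D(2)])
  also have "... <= pr V (%y. pr V (cpl D y) <= 1/10)" by (rule pr_mono) (use e1x(2) \<gamma> in auto)
  finally show "g/4 <= pr V (%y. pr V (cpl D y) <= 1/10)" using \<gamma> unfolding g_def by linarith
  show "1 / real (card V) <= nu x" using nm mux(2) unfolding cV by linarith
  qed (use \<kappa> nux in auto)
  moreover have "snd (f x) <= card V"
  proof -
  have "snd (f x) <= Max ((%k. snd (f (eps k))) ` {..M})" unfolding x_def using k by (intro Max_ge) auto
  then show ?thesis using H(2) unfolding cV n0_def by linarith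
  qed
  ultimately obtain c where c: "distinct c" "set c = V" "tpath h (c @ take 2 c)" "3 <= length c"
  using f(2)[OF x] nux(2) unfolding st_def by blast
  show "EX c. tight_hamilton_cycle H c"
  by (intro exI[of _ c] tight_cycle_of_path) (use c in \<open>auto simp: V_def h_def\<close>)
 qed
qed

section \<open>The lower bound\<close>

text \<open>Walsh characters: subsets are vectors over the field with two elements, and the exponent
  is their inner product.\<close>

definition sg :: "nat set => nat set => real" where
 "sg x u = (-1)^card (x \<inter> u)"

lemma sg_abs: "\<bar>sg x u\<bar> = 1"
 unfolding sg_def by (simp add: power_abs)

lemma sg_flip:
 assumes "finite x"
 shows "sg (if i \<in> x then x - {i} else insert i x) u = (if i \<in> u then - sg x u else sg x u)"
proof (cases "i \<in> u")
 case True
 have fin: "finite (x \<inter> u)" using assms by simp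
 show ?thesis
 proof (cases "i \<in> x")
  case i: True
  have "card (x \<inter> u) = Suc (card (x \<inter> u - {i}))" by (rule card.remove[OF fin]) (use i True in simp)
  moreover have "x \<inter> u - {i} = (x - {i}) \<inter> u" by auto
  ultimately have c: "card (x \<inter> u) = Suc (card ((x - {i}) \<inter> u))" by (simp only:)
  have "sg (x - {i}) u = - sg x u" unfolding sg_def c by simp
  then show ?thesis using i True by simp
 next
  case i: False
  have "insert i x \<inter> u = insert i (x \<inter> u)" using True by auto
  moreover have "card (insert i (x \<inter> u)) = Suc (card (x \<inter> u))" using fin i by simp
  ultimately show ?thesis using i True unfolding sg_def by simp
 qed
next
 case False
 then have "(if i \<in> x then x - {i} else insert i x) \<inter> u = x \<inter> u" by auto
 then show ?thesis using False unfolding sg_def by simp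
qed

text \<open>Toggling an element in which \<open>u\<close> and \<open>v\<close> differ flips exactly
  one of the two signs.\<close>

lemma sg_orth:
 assumes S: "finite S" "u \<subseteq> S" "v \<subseteq> S" "u ~= v"
 shows "(\<Sum>x\<in>Pow S. sg x u * sg x v) = 0"
proof -
 obtain i where i: "i \<in> S" "(i \<in> u) ~= (i \<in> v)" using S by blast
 define f where "f x = (if i \<in> x then x - {i} else insert i x)" for x
 have inv: "f (f x) = x" for x unfolding f_def by auto
 have fS: "f x \<in> Pow S" if "x \<in> Pow S" for x using that i(1) unfolding f_def by auto
 have neg: "sg (f x) u * sg (f x) v = - (sg x u * sg x v)" if "x \<in> Pow S" for x
 proof -
  have "finite x" using that S(1) finite_subset by blast
  then show ?thesis unfolding f_def sg_flip[OF \<open>finite x\<close>] using i(2) by auto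
 qed
 have "(\<Sum>x\<in>Pow S. sg x u * sg x v) = (\<Sum>x\<in>Pow S. - (sg x u * sg x v))"
  by (rule sum.reindex_bij_witness[of _ f f]) (use inv fS neg in auto)
 then show ?thesis by (simp add: sum_negf)
qed

text \<open>The sum equals \<open>2^card S\<close> unless \<open>u\<close> is empty, when it
  vanishes. So exceptional vertices only have smaller degrees, and the degree bound of the
  quasirandom graph is exact.\<close>

lemma sg_half:
 assumes "finite S" "u \<subseteq> S"
 shows "0 <= (\<Sum>x\<in>Pow S. 1 - sg x u)" "(\<Sum>x\<in>Pow S. 1 - sg x u) <= 2^card S"
proof -
 have "1 - sg x u >= 0" for x using sg_abs[of x u] by linarith
 then show "0 <= (\<Sum>x\<in>Pow S. 1 - sg x u)" by (intro sum_nonneg) auto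
 show "(\<Sum>x\<in>Pow S. 1 - sg x u) <= 2^card S"
 proof (cases "u = {}")
  case True
  then show ?thesis unfolding sg_def by simp
 next
  case False
  have "(\<Sum>x\<in>Pow S. sg x u) = 0" using sg_orth[of S u "{}"] assms False unfolding sg_def by simp
  then show ?thesis using assms by (simp add: sum_subtractf card_Pow)
 qed
qed

lemma cs_sum: "(\<Sum>i\<in>I. f i)\<^sup>2 <= real (card I) * (\<Sum>i\<in>I. (f i)\<^sup>2)"
proof (cases "finite I")
 case True
 have "0 <= (\<Sum>i\<in>I. \<Sum>j\<in>I. (f i - f j)\<^sup>2)" by (intro sum_nonneg) auto
 also have "... = (\<Sum>i\<in>I. \<Sum>j\<in>I. (f i)\<^sup>2 + (f j)\<^sup>2 - 2 * (f i * f j))" by (simp add: power2_diff mult.assoc)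
 also have "... = 2 * (real (card I) * (\<Sum>i\<in>I. (f i)\<^sup>2)) - 2 * (\<Sum>i\<in>I. \<Sum>j\<in>I. f i * f j)"
  by (simp add: sum.distrib sum_subtractf sum_distrib_left[symmetric])
 also have "(\<Sum>i\<in>I. \<Sum>j\<in>I. f i * f j) = (\<Sum>i\<in>I. f i)\<^sup>2" by (simp add: power2_eq_square sum_product)
 finally show ?thesis by linarith
qed simp

text \<open>Lindsey's inequality: after Cauchy-Schwarz in \<open>x\<close>, orthogonality removes
  all pairs of columns except those in a common fibre of \<open>p\<close>. Fibres enter because a
  character of one coordinate does not separate all vertices.\<close>

lemma lindsey:
 fixes \<chi> :: "'b => 'b => real"
 assumes B: "finite B" and orth: "!!y z. y \<in> B ==> z \<in> B ==> p y ~= p z ==> (\<Sum>x\<in>B. \<chi> x y * \<chi> x z) = 0"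
  and bnd: "!!x y. \<bar>\<chi> x y\<bar> = 1" and fib: "!!y. y \<in> B ==> card {z \<in> B. p y = p z} <= F" and XY: "X \<subseteq> B" "Y \<subseteq> B"
 shows "(\<Sum>x\<in>X. \<Sum>y\<in>Y. \<chi> x y)\<^sup>2 <= real (card B)^3 * real F"
proof -
 have fY: "finite Y" using B XY finite_subset by blast
 have b1: "\<chi> x y * \<chi> x z <= 1" for x y z using bnd[of x y] bnd[of x z] by (metis abs_ge_self abs_mult mult_1)
 have "(\<Sum>x\<in>X. \<Sum>y\<in>Y. \<chi> x y)\<^sup>2 <= real (card X) * (\<Sum>x\<in>X. (\<Sum>y\<in>Y. \<chi> x y)\<^sup>2)" by (rule cs_sum)
 also have "... <= real (card B) * (\<Sum>x\<in>B. (\<Sum>y\<in>Y. \<chi> x y)\<^sup>2)"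
  by (intro mult_mono sum_mono2 of_nat_mono card_mono B XY sum_nonneg) auto
 finally have 1: "(\<Sum>x\<in>X. \<Sum>y\<in>Y. \<chi> x y)\<^sup>2 <= real (card B) * (\<Sum>x\<in>B. (\<Sum>y\<in>Y. \<chi> x y)\<^sup>2)" .
 have "(\<Sum>x\<in>B. (\<Sum>y\<in>Y. \<chi> x y)\<^sup>2) = (\<Sum>x\<in>B. \<Sum>y\<in>Y. \<Sum>z\<in>Y. \<chi> x y * \<chi> x z)"
  by (simp add: power2_eq_square sum_product)
 also have "... = (\<Sum>y\<in>Y. \<Sum>x\<in>B. \<Sum>z\<in>Y. \<chi> x y * \<chi> x z)" by (rule sum.swap)
 also have "... = (\<Sum>y\<in>Y. \<Sum>z\<in>Y. \<Sum>x\<in>B. \<chi> x y * \<chi> x z)" by (rule sum.cong[OF refl], rule sum.swap)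
 also have "... <= (\<Sum>y\<in>Y. \<Sum>z\<in>Y. of_bool (p y = p z) * real (card B))"
 proof (rule sum_mono, rule sum_mono)
  fix y z assume yz: "y \<in> Y" "z \<in> Y"
  have yB: "y \<in> B" "z \<in> B" using yz XY by blast+
  have "(\<Sum>x\<in>B. \<chi> x y * \<chi> x z) <= (\<Sum>x\<in>B. 1)" by (intro sum_mono b1)
  then show "(\<Sum>x\<in>B. \<chi> x y * \<chi> x z) <= of_bool (p y = p z) * real (card B)"
  using orth[OF yB] by (cases "p y = p z") auto
 qed
 also have "... = (\<Sum>y\<in>Y. real (card {z \<in> Y. p y = p z}) * real (card B))"
  using fY by (simp add: sum_distrib_right[symmetric] sum_of_bool_eq Int_def)
 also have "... <= (\<Sum>y\<in>Y. real F * real (card B))"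
 proof (rule sum_mono)
  fix y assume y: "y \<in> Y"
  have "card {z \<in> Y. p y = p z} <= card {z \<in> B. p y = p z}" using B XY by (intro card_mono) auto
  also have "... <= F" using fib y XY by blast
  finally show "real (card {z \<in> Y. p y = p z}) * real (card B) <= real F * real (card B)" by (intro mult_right_mono) auto
 qed
 also have "... = real (card Y) * (real F * real (card B))" by simp
 also have "... <= real (card B) * (real F * real (card B))"
  using XY B by (intro mult_right_mono of_nat_mono card_mono) auto
 finally have "real (card B) * (\<Sum>x\<in>B. (\<Sum>y\<in>Y. \<chi> x y)\<^sup>2) <= real (card B) * (real (card B) * (real F * real (card B)))"
  by (rule mult_left_mono) simp
 moreover have "real (card B) * (real (card B) * (real F * real (card B))) = real (card B)^3 * real F"
  by (simp add: power3_eq_cube)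
 ultimately show ?thesis using 1 by linarith
qed

text \<open>Vertices are pairs of subsets, joined if both inner products are odd: two quasirandom
  graphs of density 1/2 on separate coordinates, intersected. With the two signs s and s', the
  indicator minus 1/4 is (s s' - s - s') / 4, and each term has small discrepancy.\<close>

lemma quasirandom_quarter:
 assumes \<eta>: "0 < (\<eta>::real)"
 shows "\<exists>m (bl :: nat => nat => bool). N <= m & even m & (ALL x y. bl x y = bl y x)
  & (\<forall>x<m. 4 * card {y. y < m & bl x y} <= m)
  & (ALL X Y. X \<subseteq> {..<m} --> Y \<subseteq> {..<m} --> \<bar>\<Sum>x\<in>X. \<Sum>y\<in>Y. of_bool (bl x y) - 1/4\<bar> <= \<eta> * real m^2)"
proof -
 obtain k0 where k0: "(1/2::real)^k0 < \<eta>\<^sup>2" using real_arch_pow_inv[of "\<eta>\<^sup>2" "1/2"] \<eta> by auto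
 define k where "k = k0 + N + 1"
 define S where "S = {..<k}"
 define B where "B = Pow S \<times> Pow S"
 define m where "m = card B"
 have fS: "finite S" "card S = k" unfolding S_def by auto
 have fB: "finite B" unfolding B_def S_def by simp
 have m: "m = 2^k * 2^k" unfolding m_def B_def using fS by (simp add: card_cartesian_product card_Pow)
 have kN: "N <= m"
 proof -
  have "k < 2^k" by (rule less_exp)
  moreover have "(2::nat)^k * 1 <= 2^k * 2^k" by (intro mult_le_mono2) simp
  ultimately show ?thesis unfolding m k_def by linarith
 qed
 have ev: "even m" unfolding m k_def by simp
 obtain f where f: "bij_betw f {..<m} B" using ex_bij_betw_nat_finite[OF fB] unfolding m_def by (auto simp: lessThan_atLeast0)
 have fB': "f x \<in> B" if "x < m" for x using f that unfolding bij_betw_def by auto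
 define bb where "bb p q \<longleftrightarrow> odd (card (fst p \<inter> fst q)) & odd (card (snd p \<inter> snd q))" for p q :: "nat set \<times> nat set"
 define bl where "bl x y = bb (f x) (f y)" for x y
 have sgo: "sg x u = (if odd (card (x \<inter> u)) then -1 else 1)" for x u unfolding sg_def by simp
 have bbs: "of_bool (bb p q) = (1 - sg (fst p) (fst q)) * (1 - sg (snd p) (snd q)) / (4::real)" for p q
  unfolding bb_def sgo by simp
 have sym: "bl x y = bl y x" for x y unfolding bl_def bb_def by (simp add: Int_commute)
 have deg: "4 * card {y. y < m & bl x y} <= m" if x: "x < m" for x
 proof -
  obtain u v where uv: "f x = (u, v)" "u \<subseteq> S" "v \<subseteq> S" using fB'[OF x] unfolding B_def by auto
  have "inj_on f {y. y < m & bl x y}" using f unfolding bij_betw_def by (auto intro: inj_on_subset)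
  then have "card {y. y < m & bl x y} = card (f ` {y. y < m & bl x y})" by (rule card_image[symmetric])
  also have "... <= card {q \<in> B. bb (u, v) q}" using fB' fB uv unfolding bl_def by (intro card_mono) auto
  finally have "4 * real (card {y. y < m & bl x y}) <= 4 * real (card {q \<in> B. bb (u, v) q})" by simp
  also have "... = 4 * (\<Sum>q\<in>B. of_bool (bb (u, v) q))" using fB by (simp add: sum_of_bool_eq Int_def)
  also have "... = (\<Sum>q\<in>B. (1 - sg (fst q) u) * (1 - sg (snd q) v))"
  unfolding bbs sum_distrib_left by (rule sum.cong) (auto simp: sg_def Int_commute)
  also have "... = (\<Sum>x\<in>Pow S. \<Sum>y\<in>Pow S. (1 - sg x u) * (1 - sg y v))"
  unfolding B_def sum.cartesian_product by (simp add: split_def)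
  also have "... = (\<Sum>x\<in>Pow S. 1 - sg x u) * (\<Sum>x\<in>Pow S. 1 - sg x v)" by (rule sum_product[symmetric])
  also have "... <= 2^card S * 2^card S" using sg_half[OF fS(1)] uv by (intro mult_mono) auto
  also have "... = real m" unfolding m fS by simp
  finally show ?thesis by linarith
 qed
 have disc: "\<bar>\<Sum>x\<in>X. \<Sum>y\<in>Y. \<chi> x y\<bar> <= \<eta> * real m^2"
  if XY: "X \<subseteq> B" "Y \<subseteq> B" and \<chi>: "\<chi> = (%p q. sg (fst p) (fst q)) | \<chi> = (%p q. sg (snd p) (snd q)) | \<chi> = (%p q. sg (fst p) (fst q) * sg (snd p) (snd q))" for X Y \<chi>
 proof -
  have o1: "(\<Sum>x\<in>Pow S. sg x (fst y) * sg x (fst z)) = 0" if "y \<in> B" "z \<in> B" "fst y ~= fst z" for y z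
  by (rule sg_orth) (use that fS in \<open>auto simp: B_def\<close>)
  have o2: "(\<Sum>x\<in>Pow S. sg x (snd y) * sg x (snd z)) = 0" if "y \<in> B" "z \<in> B" "snd y ~= snd z" for y z
  by (rule sg_orth) (use that fS in \<open>auto simp: B_def\<close>)
  have split: "(\<Sum>x\<in>B. g (fst x) * h (snd x)) = (\<Sum>x\<in>Pow S. g x) * (\<Sum>x\<in>Pow S. h x)" for g h :: "nat set => real"
  unfolding B_def sum_product sum.cartesian_product by (simp add: split_def)
  have cP: "card (Pow S) = 2^k" using fS by (simp add: card_Pow)
  have f1: "card {z \<in> B. fst y = fst z} <= 2^k" for y
  proof -
  have "card {z \<in> B. fst y = fst z} <= card ({fst y} \<times> Pow S)" using fS by (intro card_mono) (auto simp: B_def)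
  then show ?thesis using cP by (simp add: card_cartesian_product)
  qed
  have f2: "card {z \<in> B. snd y = snd z} <= 2^k" for y
  proof -
  have "card {z \<in> B. snd y = snd z} <= card (Pow S \<times> {snd y})" using fS by (intro card_mono) (auto simp: B_def)
  then show ?thesis using cP by (simp add: card_cartesian_product)
  qed
  have "(\<Sum>x\<in>X. \<Sum>y\<in>Y. \<chi> x y)\<^sup>2 <= real (card B)^3 * real (2^k)"
  using \<chi>
  proof (elim disjE)
  assume c: "\<chi> = (%p q. sg (fst p) (fst q))"
  show ?thesis
  proof (rule lindsey[OF fB _ _ f1 XY])
  fix y z assume "y \<in> B" "z \<in> B" "fst y ~= fst z"
  then show "(\<Sum>x\<in>B. \<chi> x y * \<chi> x z) = 0"
  using split[of "%x. sg x (fst y) * sg x (fst z)" "%x. 1"] o1[of y z] unfolding c by simp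
  qed (simp add: c sg_abs)
  next
  assume c: "\<chi> = (%p q. sg (snd p) (snd q))"
  show ?thesis
  proof (rule lindsey[OF fB _ _ f2 XY])
  fix y z assume "y \<in> B" "z \<in> B" "snd y ~= snd z"
  then show "(\<Sum>x\<in>B. \<chi> x y * \<chi> x z) = 0"
  using split[of "%x. 1" "%x. sg x (snd y) * sg x (snd z)"] o2[of y z] unfolding c by simp
  qed (simp add: c sg_abs)
  next
  assume c: "\<chi> = (%p q. sg (fst p) (fst q) * sg (snd p) (snd q))"
  show ?thesis
  proof (rule lindsey[OF fB _ _ f1 XY])
  fix y z assume yz: "y \<in> B" "z \<in> B" "fst y ~= fst z"
  have "(\<Sum>x\<in>B. \<chi> x y * \<chi> x z) = (\<Sum>x\<in>B. (sg (fst x) (fst y) * sg (fst x) (fst z)) * (sg (snd x) (snd y) * sg (snd x) (snd z)))"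
  unfolding c by (simp add: ac_simps)
  also have "... = 0" unfolding split[of "%x. sg x (fst y) * sg x (fst z)" "%x. sg x (snd y) * sg x (snd z)"] using o1[OF yz] by simp
  finally show "(\<Sum>x\<in>B. \<chi> x y * \<chi> x z) = 0" .
  qed (simp add: c sg_abs abs_mult)
  qed
  also have "... <= (\<eta> * real m^2)\<^sup>2"
  proof -
  have "(1/2::real)^k <= (1/2)^k0" unfolding k_def by (intro power_decreasing) auto
  then have "(1/2::real)^k <= \<eta>\<^sup>2" using k0 by linarith
  then have "(1/2::real)^k * real m^4 <= \<eta>\<^sup>2 * real m^4" by (intro mult_right_mono) auto
  moreover have "(1/2::real)^k * real m^4 = real m^3 * 2^k"
  unfolding m by (simp add: power_mult_distrib power_one_over field_simps power_add[symmetric] power_mult[symmetric])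
  ultimately show ?thesis unfolding m_def[symmetric] by (simp add: power_mult_distrib power_mult[symmetric])
  qed
  finally show ?thesis using abs_le_square_iff[of "\<Sum>x\<in>X. \<Sum>y\<in>Y. \<chi> x y" "\<eta> * real m^2"] \<eta> by simp
 qed
 have "\<bar>\<Sum>x\<in>X. \<Sum>y\<in>Y. of_bool (bl x y) - 1/4\<bar> <= \<eta> * real m^2" if XY: "X \<subseteq> {..<m}" "Y \<subseteq> {..<m}" for X Y
 proof -
  have inj: "inj_on f X" "inj_on f Y" using f XY inj_on_subset unfolding bij_betw_def by blast+
  have im: "f ` X \<subseteq> B" "f ` Y \<subseteq> B" using f XY unfolding bij_betw_def by blast+
  define s where "s \<chi> = (\<Sum>p\<in>f ` X. \<Sum>q\<in>f ` Y. \<chi> p q :: real)" for \<chi>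
  have "(\<Sum>x\<in>X. \<Sum>y\<in>Y. of_bool (bl x y) - 1/4) = (\<Sum>p\<in>f ` X. \<Sum>q\<in>f ` Y. of_bool (bb p q) - 1/4)"
  using inj by (simp add: sum.reindex bl_def)
  also have "... = (\<Sum>p\<in>f ` X. \<Sum>q\<in>f ` Y. 1/4 * (sg (fst p) (fst q) * sg (snd p) (snd q)) - 1/4 * sg (fst p) (fst q) - 1/4 * sg (snd p) (snd q))"
  unfolding bbs by (intro sum.cong refl) (simp add: field_simps)
  also have "... = 1/4 * s (%p q. sg (fst p) (fst q) * sg (snd p) (snd q)) - 1/4 * s (%p q. sg (fst p) (fst q)) - 1/4 * s (%p q. sg (snd p) (snd q))"
  unfolding s_def by (simp only: sum_subtractf sum_distrib_left[symmetric])
  finally have eq: "(\<Sum>x\<in>X. \<Sum>y\<in>Y. of_bool (bl x y) - 1/4) = 1/4 * s (%p q. sg (fst p) (fst q) * sg (snd p) (snd q)) - 1/4 * s (%p q. sg (fst p) (fst q)) - 1/4 * s (%p q. sg (snd p) (snd q))" .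
  have "\<bar>s (%p q. sg (fst p) (fst q) * sg (snd p) (snd q))\<bar> <= \<eta> * real m^2"
  "\<bar>s (%p q. sg (fst p) (fst q))\<bar> <= \<eta> * real m^2" "\<bar>s (%p q. sg (snd p) (snd q))\<bar> <= \<eta> * real m^2"
  unfolding s_def by (rule disc[OF im]; simp)+
  moreover have "0 <= \<eta> * real m^2" using \<eta> by simp
  ultimately show ?thesis unfolding eq by linarith
 qed
 then show ?thesis using kN ev sym deg by blast
qed

section \<open>Hypergraphs without a tight Hamilton cycle\<close>

lemma sym3_mem:
 assumes S: "!!x y z. S x y z ==> x ~= y & x ~= z & y ~= z & S y x z & S x z y"
 shows "{x, y, z} \<in> {{a, b, c} | a b c. S a b c} \<longleftrightarrow> S x y z"
proof
 assume "{x, y, z} \<in> {{a, b, c} | a b c. S a b c}"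
 then obtain a b c where abc: "{x, y, z} = {a, b, c}" "S a b c" by blast
 have d: "a ~= b" "a ~= c" "b ~= c" using S[OF abc(2)] by auto
 have p: "S b a c" "S a c b" "S b c a" "S c a b" "S c b a"
  using S[OF abc(2)] S[of b a c] S[of a c b] S[of c a b] by blast+
 have "card {x, y, z} = 3" unfolding abc(1) using d by simp
 then have e: "x ~= y" "x ~= z" "y ~= z" by (auto simp: card_insert_if split: if_splits)
 have "x \<in> {a, b, c}" "y \<in> {a, b, c}" "z \<in> {a, b, c}" using abc(1) by blast+
 then show "S x y z" using e p abc(2) by auto
qed blast

lemma periodic_sum:
 fixes g :: "nat => real"
 assumes "!!i. g (i + n) = g i"
 shows "(\<Sum>i<n. g (i + d)) = (\<Sum>i<n. g i)"
proof (induction d)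
 case (Suc d)
 have "(\<Sum>i<N. g (i + Suc d)) + g d = (\<Sum>i<N. g (i + d)) + g (N + d)" for N
  by (induction N) auto
 from this[of n] show ?case using Suc assms[of d] by (simp add: add.commute)
qed simp

lemma card_triples:
 assumes "finite X" "finite Y" "finite Z"
 shows "real (card {(x, y, z). x \<in> X & y \<in> Y & z \<in> Z & Q x y z}) = (\<Sum>x\<in>X. \<Sum>y\<in>Y. \<Sum>z\<in>Z. of_bool (Q x y z))"
proof -
 have "(\<Sum>x\<in>X. \<Sum>y\<in>Y. \<Sum>z\<in>Z. of_bool (Q x y z) :: real) = (\<Sum>p\<in>X \<times> Y \<times> Z. of_bool (Q (fst p) (fst (snd p)) (snd (snd p))))"
  by (simp add: sum.cartesian_product split_def)
 also have "... = real (card {p \<in> X \<times> Y \<times> Z. Q (fst p) (fst (snd p)) (snd (snd p))})"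
  using assms by (simp add: sum_of_bool_eq Int_def)
 also have "{p \<in> X \<times> Y \<times> Z. Q (fst p) (fst (snd p)) (snd (snd p))} = {(x, y, z). x \<in> X & y \<in> Y & z \<in> Z & Q x y z}"
  by auto
 finally show ?thesis by simp
qed

text \<open>Let A be {m..<n}, with p - 1 vertices, next to m = 2p others carrying \<open>bl\<close>.
  Edges have at least two vertices in A, or one and a \<open>bl\<close>-pair, or none and no
  \<open>bl\<close>-pair. A tight walk with three consecutive vertices outside A sees no
  \<open>bl\<close>-pair there and can never enter A. So every three consecutive vertices of a tight
  Hamilton cycle would meet A, but 3(p - 1) is less than n = 3p - 1.\<close>

lemma lower_bound:
 assumes \<epsilon>: "0 < (\<epsilon>::real)" and \<mu>: "0 < (\<mu>::real)"
 shows "\<exists>H::nat graph3. is_graph3 H & num_verts H >= N & pmu_dense (1/4) \<mu> H &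
  real (min_codegree H) >= (1/3 - \<epsilon>) * real (num_verts H) & ~ (EX c. tight_hamilton_cycle H c)"
proof -
 obtain m bl where Nm: "N + 8 + nat \<lceil>24/\<mu>\<rceil> + nat \<lceil>4/\<epsilon>\<rceil> <= m" and ev: "even m" and sym: "ALL x y. bl x y = bl y x"
  and deg: "\<forall>x<m. 4 * card {y. y < m & bl x y} <= m"
  and disc: "ALL X Y. X \<subseteq> {..<m} --> Y \<subseteq> {..<m} --> \<bar>\<Sum>x\<in>X. \<Sum>y\<in>Y. of_bool (bl x y) - 1/4\<bar> <= \<mu>/6 * real m^2"
  using quasirandom_quarter[of "\<mu>/6" "N + 8 + nat \<lceil>24/\<mu>\<rceil> + nat \<lceil>4/\<epsilon>\<rceil>"] \<mu> by auto
 obtain p where p: "m = 2 * p" using ev by blast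
 define n where "n = 3 * p - 1"
 have big: "8 <= m" "N <= m" "24/\<mu> <= real m" "4/\<epsilon> <= real m" using Nm by linarith+
 have pn: "4 <= p" "m < n" "n = m + (p - 1)" using big p unfolding n_def by auto
 define P where "P x y z \<longleftrightarrow> (m <= x & m <= y) | (m <= x & m <= z) | (m <= y & m <= z)
  | (m <= x & y < m & z < m & bl y z) | (m <= y & x < m & z < m & bl x z) | (m <= z & x < m & y < m & bl x y)
  | (x < m & y < m & z < m & ~ bl x y & ~ bl y z & ~ bl x z)" for x y z
 define S where "S x y z \<longleftrightarrow> x < n & y < n & z < n & x ~= y & x ~= z & y ~= z & P x y z" for x y z
 define H where "H = ({..<n}, {{a, b, c} | a b c. S a b c})"
 have Sp: "x ~= y & x ~= z & y ~= z & S y x z & S x z y" if "S x y z" for x y z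
  using that sym[rule_format, of x y] sym[rule_format, of x z] sym[rule_format, of y z] unfolding S_def P_def by auto
 have mem: "{x, y, z} \<in> edges H \<longleftrightarrow> S x y z" for x y z
  unfolding H_def snd_conv by (rule sym3_mem) (rule Sp)
 have vH: "verts H = {..<n}" "num_verts H = n" unfolding H_def num_verts_def by auto
 have g3: "is_graph3 H"
  unfolding is_graph3_def H_def S_def by auto
 have red: "p - 2 <= card {z \<in> {..<n}. S x y z}" if "x < n" "y < n" "x ~= y" for x y
 proof -
  have aux: "p - 2 <= card {z \<in> {..<n}. S x y z}" if "finite Z" "Z \<subseteq> {z \<in> {..<n}. S x y z}" "p - 2 <= card Z" for Z
  using card_mono[OF _ that(2)] that(3) by simp
  consider "m <= x" "m <= y" | "m <= x" "y < m" | "x < m" "m <= y" | "x < m" "y < m" "bl x y" | "x < m" "y < m" "~ bl x y" by linarith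
  then show ?thesis
  proof cases
  case 1
  have "card {..<n} <= card ({..<n} - {x, y}) + card {x, y}" using diff_card_le_card_Diff[of "{x, y}" "{..<n}"] by simp
  moreover have "card {x, y} = 2" using that by simp
  ultimately have "p - 2 <= card ({..<n} - {x, y})" using p pn(2) unfolding card_lessThan by linarith
  moreover have "{..<n} - {x, y} \<subseteq> {z \<in> {..<n}. S x y z}" using 1 that by (auto simp: S_def P_def)
  ultimately show ?thesis by (intro aux) auto
  next
  case 2
  have "card {m..<n} <= card ({m..<n} - {x}) + card {x}" using diff_card_le_card_Diff[of "{x}" "{m..<n}"] by simp
  then show ?thesis using 2 that pn by (intro aux[of "{m..<n} - {x}"]) (auto simp: S_def P_def)
  next
  case 3
  have "card {m..<n} <= card ({m..<n} - {y}) + card {y}" using diff_card_le_card_Diff[of "{y}" "{m..<n}"] by simp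
  then show ?thesis using 3 that pn by (intro aux[of "{m..<n} - {y}"]) (auto simp: S_def P_def)
  next
  case 4
  then show ?thesis using that pn by (intro aux[of "{m..<n}"]) (auto simp: S_def P_def)
  next
  \<comment> \<open>The two \<open>bl\<close>-neighbourhoods take at most a quarter of the 2p
    vertices each, so up to the pair itself \<open>p\<close> common non-neighbours remain.\<close>
  case 5
  define X where "X = {x, y} \<union> ({z. z < m & bl x z} \<union> {z. z < m & bl y z})"
  have "card X <= card {x, y} + (card {z. z < m & bl x z} + card {z. z < m & bl y z})"
  unfolding X_def using card_Un_le[of "{x, y}" "{z. z < m & bl x z} \<union> {z. z < m & bl y z}"]
  card_Un_le[of "{z. z < m & bl x z}" "{z. z < m & bl y z}"] by linarith
  moreover have "4 * card {z. z < m & bl x z} <= m" "4 * card {z. z < m & bl y z} <= m" using deg 5 by blast+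
  moreover have "card {x, y} = 2" using that by simp
  moreover have "card {..<m} <= card ({..<m} - X) + card X"
  using diff_card_le_card_Diff[of X "{..<m}"] unfolding X_def by simp
  ultimately have "p - 2 <= card ({..<m} - X)" using p by simp
  then show ?thesis using 5 that pn by (intro aux[of "{..<m} - X"]) (auto simp: S_def P_def X_def)
  qed
 qed
 have cod: "(1/3 - \<epsilon>) * real (num_verts H) <= real (min_codegree H)"
 proof -
  define C where "C = {codegree H x y | x y. x \<in> verts H & y \<in> verts H & x ~= y}"
  have "C \<subseteq> (%(x, y). codegree H x y) ` ({..<n} \<times> {..<n})" unfolding C_def vH by auto
  then have fC: "finite C" by (rule finite_subset) simp
  have "codegree H 0 1 \<in> C" unfolding C_def vH using pn by (intro CollectI exI[of _ 0] exI[of _ 1]) auto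
  then have neC: "C ~= {}" by blast
  have "p - 2 <= c" if "c \<in> C" for c
  using that red unfolding C_def codegree_def mem vH by auto
  then have "p - 2 <= Min C" using Min_ge_iff[OF fC neC] by blast
  then have mc: "real p - 2 <= real (min_codegree H)" unfolding min_codegree_def C_def[symmetric] using pn by linarith
  have "real n = 3 * real p - 1" unfolding n_def using pn by (simp add: of_nat_diff)
  moreover have "4 <= \<epsilon> * real m" using big(4) \<epsilon> by (simp add: field_simps)
  moreover have "\<epsilon> * real m <= \<epsilon> * real n" using \<epsilon> pn by (intro mult_left_mono) auto
  moreover have "(1/3 - \<epsilon>) * real n = real n / 3 - \<epsilon> * real n" by (simp add: algebra_simps)
  ultimately show ?thesis using mc unfolding vH by linarith
 qed
 have dense: "pmu_dense (1/4) \<mu> H"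
  unfolding pmu_dense_def
 proof (intro allI impI)
  fix X Y Z assume XYZ: "X \<subseteq> verts H" "Y \<subseteq> verts H" "Z \<subseteq> verts H"
  then have sub: "X \<subseteq> {..<n}" "Y \<subseteq> {..<n}" "Z \<subseteq> {..<n}" unfolding vH by auto
  have fin: "finite X" "finite Y" "finite Z" using sub finite_subset by blast+
  have crd: "card X <= n" "card Y <= n" "card Z <= n" using sub card_mono[of "{..<n}"] by fastforce+
  define f where "f x y = (if x < m & y < m then of_bool (bl x y) - 1/4 else 0::real)" for x y
  define \<sigma> where "\<sigma> z = (if m <= z then 1 else -1::real)" for z :: nat
  define dg where "dg x y z = (of_bool (x = y) + of_bool (x = z) + of_bool (y = z) :: real)" for x y z :: nat
  \<comment> \<open>Reduces the density to the discrepancy of \<open>bl\<close>. With exactly one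
    vertex at least \<open>m\<close> this is an equality. With none, the sum without
    \<open>dg\<close> is 3/4 if there is no \<open>bl\<close>-pair, and -1/4 or less otherwise,
    because \<sigma> is then negative. The term \<open>dg\<close> pays for triples with repeated
    vertices.\<close>
  have pw: "\<sigma> z * f x y + \<sigma> x * f y z + \<sigma> y * f x z - 4 * dg x y z <= of_bool (S x y z) - 1/4"
  if "x \<in> X" "y \<in> Y" "z \<in> Z" for x y z
  proof (cases "x ~= y & x ~= z & y ~= z")
  case True
  have lt: "x < n" "y < n" "z < n" using that sub by auto
  have SP: "S x y z = P x y z" using True lt unfolding S_def by simp
  show ?thesis
  by (cases "x < m"; cases "y < m"; cases "z < m"; cases "bl x y"; cases "bl y z"; cases "bl x z";
  simp add: SP P_def f_def \<sigma>_def dg_def True)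
  next
  case False
  have fb: "\<bar>\<sigma> a * f b c\<bar> <= 1" for a b c unfolding \<sigma>_def f_def by auto
  have "1 <= dg x y z" using False unfolding dg_def by auto
  moreover have "(0::real) <= of_bool (S x y z)" by simp
  ultimately show ?thesis using fb[of z x y] fb[of x y z] fb[of y x z] by linarith
  qed
  define F where "F X Y = (\<Sum>x\<in>X. \<Sum>y\<in>Y. f x y)" for X Y
  have Fb: "\<bar>F U W\<bar> <= \<mu>/6 * real n^2" if "finite U" "finite W" for U W
  proof -
  have "F U W = (\<Sum>x\<in>U \<inter> {..<m}. \<Sum>y\<in>W \<inter> {..<m}. f x y)"
  proof -
  have "(\<Sum>y\<in>W. f x y) = (\<Sum>y\<in>W \<inter> {..<m}. f x y)" for x
  by (rule sum.mono_neutral_right) (use that in \<open>auto simp: f_def\<close>)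
  moreover have "(\<Sum>x\<in>U. \<Sum>y\<in>W \<inter> {..<m}. f x y) = (\<Sum>x\<in>U \<inter> {..<m}. \<Sum>y\<in>W \<inter> {..<m}. f x y)"
  by (rule sum.mono_neutral_right) (use that in \<open>auto simp: f_def\<close>)
  ultimately show ?thesis unfolding F_def by simp
  qed
  also have "... = (\<Sum>x\<in>U \<inter> {..<m}. \<Sum>y\<in>W \<inter> {..<m}. of_bool (bl x y) - 1/4)"
  by (intro sum.cong refl) (auto simp: f_def)
  finally have "\<bar>F U W\<bar> <= \<mu>/6 * real m^2" using disc[rule_format, of "U \<inter> {..<m}" "W \<inter> {..<m}"] by simp
  also have "... <= \<mu>/6 * real n^2" using \<mu> pn by (intro mult_left_mono power_mono) auto
  finally show ?thesis .
  qed
  have sF: "\<bar>\<Sum>z\<in>U. \<sigma> z * c\<bar> <= real n * (\<mu>/6 * real n^2)" if "finite U" "card U <= n" "\<bar>c\<bar> <= \<mu>/6 * real n^2" for U c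
  proof -
  have "\<bar>\<Sum>z\<in>U. \<sigma> z * c\<bar> <= (\<Sum>z\<in>U. \<bar>\<sigma> z * c\<bar>)" by (rule sum_abs)
  also have "... = real (card U) * \<bar>c\<bar>"
  proof -
  have "\<bar>\<sigma> z * c\<bar> = \<bar>c\<bar>" for z unfolding \<sigma>_def by simp
  then show ?thesis by simp
  qed
  also have "... <= real n * (\<mu>/6 * real n^2)" using that by (intro mult_mono) auto
  finally show ?thesis .
  qed
  have one: "(\<Sum>a\<in>U. of_bool (a = b) :: real) <= 1" "(\<Sum>a\<in>U. of_bool (b = a) :: real) <= 1" if "finite U" for U and b :: nat
  proof -
  have "U \<inter> {a. a = b} \<subseteq> {b}" "U \<inter> {a. b = a} \<subseteq> {b}" by auto
  then have "card (U \<inter> {a. a = b}) <= card {b}" "card (U \<inter> {a. b = a}) <= card {b}" by (intro card_mono; simp)+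
  then show "(\<Sum>a\<in>U. of_bool (a = b) :: real) <= 1" "(\<Sum>a\<in>U. of_bool (b = a) :: real) <= 1"
  using that by (simp_all add: sum_of_bool_eq)
  qed
  have nn: "real (card U) * real (card W) <= real n^2" if "card U <= n" "card W <= n" for U W :: "nat set"
  unfolding power2_eq_square using that by (intro mult_mono) auto
  have D: "(\<Sum>x\<in>X. \<Sum>y\<in>Y. \<Sum>z\<in>Z. dg x y z) <= 3 * real n^2"
  proof -
  have "(\<Sum>x\<in>X. \<Sum>y\<in>Y. \<Sum>z\<in>Z. (of_bool (x = y) :: real)) = real (card Z) * (\<Sum>x\<in>X. \<Sum>y\<in>Y. of_bool (x = y))"
  by (simp add: sum_distrib_left)
  also have "... <= real (card Z) * (\<Sum>x\<in>X. 1)" by (intro mult_left_mono sum_mono one fin) auto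
  finally have 1: "(\<Sum>x\<in>X. \<Sum>y\<in>Y. \<Sum>z\<in>Z. (of_bool (x = y) :: real)) <= real n^2" using nn[OF crd(3,1)] by simp
  have "(\<Sum>x\<in>X. \<Sum>y\<in>Y. \<Sum>z\<in>Z. (of_bool (x = z) :: real)) <= (\<Sum>x\<in>X. \<Sum>y\<in>Y. 1)" by (intro sum_mono one fin)
  then have 2: "(\<Sum>x\<in>X. \<Sum>y\<in>Y. \<Sum>z\<in>Z. (of_bool (x = z) :: real)) <= real n^2" using nn[OF crd(1,2)] by simp
  have "(\<Sum>x\<in>X. \<Sum>y\<in>Y. \<Sum>z\<in>Z. (of_bool (y = z) :: real)) <= (\<Sum>x\<in>X. \<Sum>y\<in>Y. 1)" by (intro sum_mono one fin)
  then have 3: "(\<Sum>x\<in>X. \<Sum>y\<in>Y. \<Sum>z\<in>Z. (of_bool (y = z) :: real)) <= real n^2" using nn[OF crd(1,2)] by simp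
  show ?thesis unfolding dg_def sum.distrib using 1 2 3 by linarith
  qed
  have t1: "(\<Sum>x\<in>X. \<Sum>y\<in>Y. \<Sum>z\<in>Z. \<sigma> z * f x y) = (\<Sum>z\<in>Z. \<sigma> z * F X Y)"
  proof -
  have "(\<Sum>x\<in>X. \<Sum>y\<in>Y. \<Sum>z\<in>Z. \<sigma> z * f x y) = (\<Sum>x\<in>X. \<Sum>y\<in>Y. sum \<sigma> Z * f x y)" by (simp only: sum_distrib_right)
  also have "... = sum \<sigma> Z * F X Y" unfolding F_def by (simp only: sum_distrib_left)
  finally show ?thesis by (simp only: sum_distrib_right)
  qed
  have t2: "(\<Sum>x\<in>X. \<Sum>y\<in>Y. \<Sum>z\<in>Z. \<sigma> x * f y z) = (\<Sum>x\<in>X. \<sigma> x * F Y Z)"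
  unfolding F_def by (simp only: sum_distrib_left)
  have t3: "(\<Sum>x\<in>X. \<Sum>y\<in>Y. \<Sum>z\<in>Z. \<sigma> y * f x z) = (\<Sum>y\<in>Y. \<sigma> y * F X Z)"
  proof -
  have "(\<Sum>x\<in>X. \<Sum>y\<in>Y. \<Sum>z\<in>Z. \<sigma> y * f x z) = (\<Sum>y\<in>Y. \<Sum>x\<in>X. \<Sum>z\<in>Z. \<sigma> y * f x z)" by (rule sum.swap)
  then show ?thesis unfolding F_def by (simp only: sum_distrib_left)
  qed
  have "(\<Sum>x\<in>X. \<Sum>y\<in>Y. \<Sum>z\<in>Z. \<sigma> z * f x y + \<sigma> x * f y z + \<sigma> y * f x z - 4 * dg x y z)
  <= (\<Sum>x\<in>X. \<Sum>y\<in>Y. \<Sum>z\<in>Z. of_bool (S x y z) - 1/4)"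
  by (intro sum_mono pw)
  moreover have "(\<Sum>x\<in>X. \<Sum>y\<in>Y. \<Sum>z\<in>Z. \<sigma> z * f x y + \<sigma> x * f y z + \<sigma> y * f x z - 4 * dg x y z)
  = (\<Sum>z\<in>Z. \<sigma> z * F X Y) + (\<Sum>x\<in>X. \<sigma> x * F Y Z) + (\<Sum>y\<in>Y. \<sigma> y * F X Z) - 4 * (\<Sum>x\<in>X. \<Sum>y\<in>Y. \<Sum>z\<in>Z. dg x y z)"
  unfolding t1[symmetric] t2[symmetric] t3[symmetric] by (simp only: sum.distrib sum_subtractf sum_distrib_left[symmetric])
  moreover have "(\<Sum>x\<in>X. \<Sum>y\<in>Y. \<Sum>z\<in>Z. of_bool (S x y z) - 1/4)
  = (\<Sum>x\<in>X. \<Sum>y\<in>Y. \<Sum>z\<in>Z. of_bool (S x y z)) - 1/4 * real (card X) * real (card Y) * real (card Z)"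
  by (simp add: sum_subtractf)
  moreover have "(\<Sum>x\<in>X. \<Sum>y\<in>Y. \<Sum>z\<in>Z. of_bool (S x y z)) = real (edge_count H X Y Z)"
  unfolding edge_count_def mem by (rule card_triples[OF fin, symmetric])
  moreover have "\<bar>\<Sum>z\<in>Z. \<sigma> z * F X Y\<bar> <= real n * (\<mu>/6 * real n^2)" "\<bar>\<Sum>x\<in>X. \<sigma> x * F Y Z\<bar> <= real n * (\<mu>/6 * real n^2)"
  "\<bar>\<Sum>y\<in>Y. \<sigma> y * F X Z\<bar> <= real n * (\<mu>/6 * real n^2)"
  by (intro sF Fb fin crd)+
  moreover have "12 * real n^2 <= \<mu>/2 * (real n * real n^2)"
  proof -
  have "24 <= \<mu> * real m" using big(3) \<mu> by (simp add: field_simps)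
  also have "... <= \<mu> * real n" using \<mu> pn by (intro mult_left_mono) auto
  finally have "24 * real n^2 <= \<mu> * real n * real n^2" by (intro mult_right_mono) auto
  then show ?thesis by simp
  qed
  moreover have "real n * (\<mu>/6 * real n^2) = 1/6 * (\<mu> * (real n * real n^2))" "\<mu>/2 * (real n * real n^2) = 1/2 * (\<mu> * (real n * real n^2))"
  "\<mu> * real n^3 = \<mu> * (real n * real n^2)" by (simp_all add: power3_eq_cube power2_eq_square)
  ultimately show "1/4 * real (card X) * real (card Y) * real (card Z) - \<mu> * real (num_verts H)^3 <= real (edge_count H X Y Z)"
  unfolding vH using D by linarith
 qed
 have noc: "~ tight_hamilton_cycle H c" for c
 proof
  assume thc: "tight_hamilton_cycle H c"
  then have c: "distinct c" "set c = {..<n}" "tight_cycle_edges c \<subseteq> edges H"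
  unfolding tight_hamilton_cycle_def tight_cycle_def vH by auto
  have len: "length c = n" using distinct_card[OF c(1)] c(2) by simp
  define s where "s i = c ! (i mod n)" for i
  have win: "S (s i) (s (i + 1)) (s (i + 2))" for i
  proof -
  have "i mod n < length c" using len pn by simp
  then have "{c ! (i mod n), c ! ((i mod n + 1) mod length c), c ! ((i mod n + 2) mod length c)} \<in> tight_cycle_edges c"
  unfolding tight_cycle_edges_def by blast
  then have "{c ! (i mod n), c ! ((i mod n + 1) mod length c), c ! ((i mod n + 2) mod length c)} \<in> edges H" using c(3) by (rule subsetD[rotated])
  then show ?thesis unfolding mem s_def len by (simp add: mod_simps)
  qed
  \<comment> \<open>Three consecutive vertices below \<open>m\<close> span no
    \<open>bl\<close>-pair, so the next vertex is below \<open>m\<close> too, and the cycle would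
    miss \<open>m\<close> altogether.\<close>
  have hit: "m <= s i | m <= s (i + 1) | m <= s (i + 2)" for i
  proof (rule ccontr)
  assume neg: "~ ?thesis"
  have low: "s (i + j) < m & s (i + j + 1) < m & s (i + j + 2) < m" for j
  proof (induction j)
  case 0
  then show ?case using neg by simp
  next
  case (Suc j)
  have "~ bl (s (i + j + 1)) (s (i + j + 2))" using win[of "i + j"] Suc unfolding S_def P_def by auto
  then have "s (i + j + 3) < m" using win[of "i + j + 1"] Suc unfolding S_def P_def by (auto simp: numeral_3_eq_3)
  then show ?case using Suc by (simp add: numeral_eq_Suc)
  qed
  have "m \<in> set c" using c(2) pn by simp
  then obtain k where k: "k < n" "c ! k = m" unfolding in_set_conv_nth len by blast
  have "i <= n * i" using pn by simp
  then have e: "i + (n * i + k - i) = k + n * i" by linarith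
  have "s (i + (n * i + k - i)) = m" unfolding s_def e using k by simp
  then show False using low[of "n * i + k - i"] by simp
  qed
  define g where "g i = (of_bool (m <= s i) :: real)" for i
  have per: "g (i + n) = g i" for i unfolding g_def s_def by simp
  have "real n = (\<Sum>i<n. 1)" by simp
  also have "... <= (\<Sum>i<n. g (i + 0) + g (i + 1) + g (i + 2))"
  by (rule sum_mono) (use hit in \<open>auto simp: g_def\<close>)
  also have "... = 3 * (\<Sum>i<n. g i)" unfolding sum.distrib periodic_sum[of g, OF per] by simp
  also have "(\<Sum>i<n. g i) = (\<Sum>i<n. of_bool (m <= c ! i))" unfolding g_def s_def by simp
  also have "... = (\<Sum>x\<in>set c. of_bool (m <= x))"
  by (rule sum.reindex_bij_betw) (rule bij_betw_nth[OF c(1)], auto simp: len)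
  also have "... = real (card {m..<n})"
  proof -
  have "{..<n} \<inter> {x. m <= x} = {m..<n}" by auto
  then show ?thesis unfolding c(2) by (simp add: sum_of_bool_eq)
  qed
  finally show False using pn p unfolding n_def by simp
 qed
 show ?thesis using g3 vH big(2) pn dense cod noc by (intro exI[of _ H]) auto
qed

theorem corollary1p4:
  shows "(\<forall>\<alpha>::real. \<alpha> > 1/3 \<longrightarrow>
            (\<exists>\<mu>::real. \<mu> > 0 \<and> (\<exists>n0::nat. \<forall>H::'a graph3.
               is_graph3 H \<longrightarrow> num_verts H \<ge> n0 \<longrightarrow> pmu_dense (1/4) \<mu> H \<longrightarrow>
               real (min_codegree H) \<ge> \<alpha> * real (num_verts H) \<longrightarrow>
               (\<exists>c. tight_hamilton_cycle H c))))
       \<and> (\<forall>\<epsilon> \<mu> :: real. \<epsilon> > 0 \<longrightarrow> \<mu> > 0 \<longrightarrow>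
            (\<forall>N::nat. \<exists>H::nat graph3.
               is_graph3 H \<and> num_verts H \<ge> N \<and> pmu_dense (1/4) \<mu> H \<and>
               real (min_codegree H) \<ge> (1/3 - \<epsilon>) * real (num_verts H) \<and>
               \<not> (\<exists>c. tight_hamilton_cycle H c)))"
  using upper_bound[where ?'a = 'a] lower_bound by auto

end
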